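(* For every real $\eta$ with $0<\eta<\frac14$, there exist $\delta=\delta(\eta)>0$ and a constant $C(\eta)>0$, both depending only on $\eta$, such that for every real $X>1$, every prime number $q$ with $X^{\eta}\leq q\leq X^{\frac{1}{2}-\eta}$, and every integer $a$ with $(a,q)=1$, $$ |E(X,q,a)| \leq C(\eta) \left(\frac{X}{q}\right)^{\frac{1}{2}-\delta}. $$
   Context: Let $\mu$ be the Möbius function, so $\mu^2$ is the indicator function of squarefree positive integers, and let $\varphi$ be Euler's totient function. For real $X>0$, an integer $q\geq 1$ and an integer $a$ coprime to $q$, define $$ E(X,q,a):=\sum_{\substack{n\leq X\\ n\equiv a \pmod q}}\mu^2(n)-\frac{1}{\varphi(q)}\sum_{\substack{n\leq X\\ (n,q)=1}}\mu^2(n), $$ where $n$ runs over positive integers. *)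

theory Defs
  imports Complex_Main "HOL-Computational_Algebra.Squarefree" "HOL-Number_Theory.Number_Theory"
begin

definition moebius :: "nat \<Rightarrow> int" where
  "moebius n = (if squarefree n then (- 1) ^ card (prime_factors n) else 0)"

lemma moebius_square: "(moebius n)\<^sup>2 = (if squarefree n then 1 else 0)"
  by (simp add: moebius_def flip: power_mult)

definition squarefree_error :: "real \<Rightarrow> nat \<Rightarrow> int \<Rightarrow> real" where
  "squarefree_error X q a =
     (\<Sum>n | n > 0 \<and> real n \<le> X \<and> [int n = a] (mod int q). real_of_int ((moebius n)\<^sup>2))
     - (1 / real (totient q)) *
       (\<Sum>n | n > 0 \<and> real n \<le> X \<and> coprime n q. real_of_int ((moebius n)\<^sup>2))"

end

theory Submission
  imports
    Defs
    "HOL-Algebra.Algebraic_Closure_Type"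
    "Berlekamp_Zassenhaus.Finite_Field"
    "HOL-Real_Asymp.Real_Asymp"
    "HOL-Library.FuncSet"
    "HOL-Analysis.Convex"
    "HOL-Analysis.Harmonic_Numbers"
    "HOL-Number_Theory.Number_Theory"
begin

hide_const (open) Divisibility.prime Module.smult Complex_Transcendental.moebius
no_notation Polynomials.var (\<open>X\<index>\<close>)

text \<open>
  Writing \<open>\<mu>\<^sup>2(n)\<close> as the sum of \<open>\<mu>(d)\<close> over \<open>d\<^sup>2\<close> dividing \<open>n\<close> turns the error term into a sum over \<open>d \<le> sqrt X\<close> of
  \<open>\<mu>(d)\<close> times the discrepancy of the residue class \<open>a d^(-2)\<close> modulo \<open>q\<close> among the integers up to \<open>X / d\<^sup>2\<close>.
  Put \<open>D = sqrt (X / q)\<close>. Each discrepancy is at most 1 in absolute value, so \<open>d \<le> D q^(-\<gamma>)\<close> is harmless. For \<open>d \<ge> D q^\<gamma>\<close>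
  one drops \<open>\<mu>\<close> and counts solutions of \<open>m d\<^sup>2 = a\<close> modulo \<open>q\<close> with the Weil bound for incomplete sums of
  \<open>e(h d^(-2) / q)\<close>. In the critical range \<open>d\<close> is of size \<open>D\<close>, possibly only slightly above \<open>q^(1/2)\<close>, and one needs
  a power saving for sums of \<open>\<mu>(d) e(h d^(-2) / q)\<close> over \<open>d \<le> N\<close> with \<open>N \<ge> q^(1/2 + \<kappa>)\<close>. Vaughan's identity
  reduces this to Weil sums and to bilinear sums over \<open>e(h m^(-2) n^(-2) / q)\<close>. Hoelder's inequality bounds the latter by the
  number of frequencies \<open>h\<close> at which short sums of \<open>e(h n^(-2) / q)\<close> are large, and that number is small by the shift
  \<open>n \<mapsto> n + a b\<close> together with moments over complete residue systems.
\<close>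

section \<open>Additive characters and monic polynomials\<close>

text \<open>Since X = D^2 q, the upper bound on q says D \<ge> q^(1/2 + 2 \<eta>), and X^\<eta>
  \<le> q makes any saving q^(-\<gamma>) over the trivial bound D a power saving in X / q. The
  obstacle is that both variables of the bilinear sums may be shorter than q^(1/2), where
  Cauchy-Schwarz followed by completion gains nothing; only the product of the lengths beats
  q^(1/2). This forces moments of an order that grows as \<eta> shrinks. A second obstacle is that
  the range X / d^2 of the cofactor moves with d; near D, d is therefore cut into intervals of
  length D q^(-6 \<gamma>), on which this range is nearly constant. The Weil bound is proved from
  scratch, for the phases h / x^2 + k x only: the L-function is a polynomial of degree at most 3,
  and Stepanov's method bounds point counts from above over the fields with p^(2 m) elements. The
  bounds become two-sided because the counts for all trace values have a known total, and their
  growth in m confines the inverse roots to absolute value at most p^(1/2).\<close>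

definition ee :: "nat \<Rightarrow> int \<Rightarrow> complex" where
  "ee q n = cis (2 * pi * real_of_int n / real q)"

lemma ee_0 [simp]: "ee q 0 = 1"
  by (simp add: ee_def)

lemma norm_ee [simp]: "norm (ee q n) = 1"
  by (simp add: ee_def)

lemma ee_add: "ee q (m + n) = ee q m * ee q n"
  by (simp add: ee_def cis_mult add_divide_distrib distrib_left)

lemma ee_minus: "ee q (- n) = cnj (ee q n)"
  by (simp add: ee_def cis_cnj)

lemma ee_diff: "ee q (m - n) = ee q m * cnj (ee q n)"
  using ee_add[of q m "- n"] by (simp add: ee_minus)

lemma ee_sum: "ee q (sum g A) = (\<Prod>x\<in>A. ee q (g x))"
  by (induction A rule: infinite_finite_induct) (auto simp: ee_add)

lemma ee_mult_nat: "ee q (int k * n) = ee q n ^ k"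
  by (induction k) (auto simp: ee_add algebra_simps)

lemma ee_eq_1_iff:
  assumes "q > 0"
  shows "ee q n = 1 \<longleftrightarrow> int q dvd n"
proof
  assume "ee q n = 1"
  hence "cos (2 * pi * real_of_int n / real q) = 1"
    by (auto simp: ee_def complex_eq_iff)
  then obtain m :: int where "2 * pi * real_of_int n / real q = real_of_int m * 2 * pi"
    using cos_one_2pi_int by blast
  hence "real_of_int n = real_of_int (m * int q)"
    using assms by (simp add: field_simps)
  hence "n = m * int q"
    by linarith
  thus "int q dvd n" by simp
next
  assume "int q dvd n"
  then obtain m where "n = int q * m" by blast
  hence "ee q n = cis (2 * pi * real_of_int m)"
    using assms by (simp add: ee_def field_simps)
  thus "ee q n = 1"
    by simp
qed

lemma ee_cong:
  assumes "[m = n] (mod int q)"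
  shows "ee q m = ee q n"
proof (cases "q = 0")
  case True
  thus ?thesis using assms by (auto simp: cong_def)
next
  case False
  have "int q dvd m - n"
    using assms by (simp add: cong_iff_dvd_diff)
  hence "ee q (m - n) = 1"
    using False ee_eq_1_iff by simp
  moreover have "ee q m = ee q (m - n) * ee q n"
    by (simp flip: ee_add)
  ultimately show ?thesis by simp
qed

lemma sum_ee:
  assumes "q > 0"
  shows "(\<Sum>x\<in>{0..<int q}. ee q (n * x)) = (if int q dvd n then of_nat q else 0)"
proof -
  have eq: "(\<Sum>x\<in>{0..<int q}. ee q (n * x)) = (\<Sum>k<q. ee q n ^ k)"
    by (rule sum.reindex_bij_witness[of _ int nat]) (auto simp flip: ee_mult_nat simp: mult.commute)
  show ?thesis
  proof (cases "int q dvd n")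
    case True
    hence "ee q n = 1" using ee_eq_1_iff[OF assms] by simp
    thus ?thesis unfolding eq using True by simp
  next
    case False
    hence "ee q n \<noteq> 1" using ee_eq_1_iff[OF assms] by simp
    moreover have "ee q n ^ q = 1"
      using ee_eq_1_iff[OF assms, of "int q * n"] by (simp add: ee_mult_nat)
    ultimately show ?thesis
      unfolding eq using False by (simp add: sum_gp_strict)
  qed
qed

section \<open>Monic polynomials as multisets of roots\<close>

lemma finite_multisets_size:
  assumes "finite S"
  shows "finite {A. size A = n \<and> set_mset A \<subseteq> S}"
proof (rule finite_subset)
  show "{A. size A = n \<and> set_mset A \<subseteq> S} \<subseteq> mset ` {xs. set xs \<subseteq> S \<and> length xs = n}"
  proof safe
    fix A assume "set_mset A \<subseteq> S"
    moreover obtain xs where "mset xs = A" using ex_mset by blast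
    ultimately show "A \<in> mset ` {xs. set xs \<subseteq> S \<and> length xs = size A}"
      by (intro image_eqI[of _ _ xs]) auto
  qed
  show "finite (mset ` {xs. set xs \<subseteq> S \<and> length xs = n})"
    using finite_lists_length_eq[OF assms] by simp
qed

definition poly_of_roots :: "'a::comm_ring_1 multiset \<Rightarrow> 'a poly" where
  "poly_of_roots A = (\<Prod>x\<in>#A. [:-x, 1:])"

lemma poly_of_roots_empty [simp]: "poly_of_roots {#} = 1"
  by (simp add: poly_of_roots_def)

lemma poly_of_roots_add_mset [simp]: "poly_of_roots (add_mset x A) = [:-x, 1:] * poly_of_roots A"
  by (simp add: poly_of_roots_def)

lemma coeff_linear_mult:
  fixes x :: "'a::comm_ring_1"
  shows "coeff ([:-x, 1:] * g) 0 = - (x * coeff g 0)"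
  "coeff ([:-x, 1:] * g) (Suc n) = coeff g n - x * coeff g (Suc n)"
  by (simp_all add: coeff_pCons algebra_simps)

lemma monic_poly_of_roots:
  fixes A :: "'a::idom multiset"
  shows "lead_coeff (poly_of_roots A) = 1 \<and> degree (poly_of_roots A) = size A"
proof (induction A)
  case (add x A)
  hence nz: "poly_of_roots A \<noteq> 0" by auto
  have "lead_coeff ([:-x, 1:] * poly_of_roots A) = lead_coeff [:-x, 1:] * lead_coeff (poly_of_roots A)"
    by (rule lead_coeff_mult)
  moreover have "degree ([:-x, 1:] * poly_of_roots A) = Suc (degree (poly_of_roots A))"
    using nz by (subst degree_mult_eq) auto
  ultimately show ?case
    using add.IH by (auto simp del: mult_pCons_left)
qed auto

lemma proots_poly_of_roots [simp]: "proots (poly_of_roots (A :: 'a::idom multiset)) = A"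
proof (induction A)
  case (add x A)
  have "poly_of_roots A \<noteq> 0"
    using monic_poly_of_roots[of A] by auto
  with add show ?case
    by (simp add: proots_mult del: mult_pCons_left)
qed auto

lemma poly_of_roots_proots:
  fixes g :: "'a::alg_closed_field poly"
  assumes "lead_coeff g = 1"
  shows "poly_of_roots (proots g) = g"
proof -
  have "g \<noteq> 0" using assms by auto
  then obtain A where "g = smult (lead_coeff g) (\<Prod>x\<in>#A. [:-x, 1:])"
    using alg_closed_imp_factorization by blast
  hence "g = poly_of_roots A" using assms by (simp add: poly_of_roots_def)
  thus ?thesis by simp
qed

lemma coeff_poly_of_roots_subleading:
  fixes A :: "'a::idom multiset"
  shows "size A = Suc n \<Longrightarrow> coeff (poly_of_roots A) n = - (\<Sum>x\<in>#A. x)"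
proof (induction A arbitrary: n)
  case (add x A)
  show ?case
  proof (cases n)
    case 0
    with add.prems show ?thesis by auto
  next
    case (Suc m)
    have "coeff (poly_of_roots A) (Suc m) = 1"
      using monic_poly_of_roots[of A] add.prems Suc by auto
    thus ?thesis
      using add Suc by (simp add: coeff_linear_mult del: mult_pCons_left)
  qed
qed auto

text \<open>Newton's identities for the reciprocals of the roots. Through them the sum of h / x^2
  over the roots depends only on the three lowest coefficients. The last identity is not divided by
  2, so it stays valid in characteristic 2, where it says that the sum of 1 / x^2 is the square of
  the sum of 1 / x.\<close>

lemma coeff_poly_of_roots_low:
  fixes A :: "'a::field multiset"
  assumes "0 \<notin># A"
  shows "coeff (poly_of_roots A) 0 \<noteq> 0"
    and "coeff (poly_of_roots A) 1 = - coeff (poly_of_roots A) 0 * (\<Sum>x\<in>#A. 1 / x)"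
    and "2 * coeff (poly_of_roots A) 2 =
      coeff (poly_of_roots A) 0 * ((\<Sum>x\<in>#A. 1 / x)\<^sup>2 - (\<Sum>x\<in>#A. 1 / x\<^sup>2))"
proof -
  let ?P = "\<lambda>A. coeff (poly_of_roots A) 0 \<noteq> 0 \<and>
    coeff (poly_of_roots A) 1 = - coeff (poly_of_roots A) 0 * (\<Sum>x\<in>#A. 1 / x) \<and>
    2 * coeff (poly_of_roots A) 2 =
      coeff (poly_of_roots A) 0 * ((\<Sum>x\<in>#A. 1 / x)\<^sup>2 - (\<Sum>x\<in>#A. 1 / x\<^sup>2))"
  have "?P A"
    using assms
  proof (induction A)
    case (add x A)
    define c where "c = coeff (poly_of_roots A)"
    define s where "s = (\<Sum>x\<in>#A. 1 / x)"
    define t where "t = (\<Sum>x\<in>#A. 1 / x\<^sup>2)"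
    have x: "x \<noteq> 0" and c0: "c 0 \<noteq> 0" and c1: "c 1 = - c 0 * s" and c2: "2 * c 2 = c 0 * (s\<^sup>2 - t)"
      using add by (auto simp: c_def s_def t_def)
    have d0: "coeff (poly_of_roots (add_mset x A)) 0 = - (x * c 0)"
      and d1: "coeff (poly_of_roots (add_mset x A)) 1 = c 0 - x * c 1"
      and d2: "coeff (poly_of_roots (add_mset x A)) 2 = c 1 - x * c 2"
      by (simp_all add: coeff_linear_mult c_def numeral_2_eq_2 del: mult_pCons_left)
    have "2 * (c 1 - x * c 2) = 2 * c 1 - x * (2 * c 2)"
      by (simp add: algebra_simps)
    also have "\<dots> = - (x * c 0) * ((1 / x + s)\<^sup>2 - (1 / x\<^sup>2 + t))"
      unfolding c2 c1 using x by (simp add: field_simps power2_eq_square)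
    finally have q2: "2 * (c 1 - x * c 2) = - (x * c 0) * ((1 / x + s)\<^sup>2 - (1 / x\<^sup>2 + t))" .
    have q1: "c 0 - x * c 1 = - (- (x * c 0)) * (1 / x + s)"
      unfolding c1 using x by (simp add: field_simps)
    have sums: "(\<Sum>y\<in>#add_mset x A. 1 / y) = 1 / x + s" "(\<Sum>y\<in>#add_mset x A. 1 / y\<^sup>2) = 1 / x\<^sup>2 + t"
      by (simp_all add: s_def t_def)
    show ?case
      unfolding d0 d1 d2 sums using x c0 q1 q2 by simp
  qed auto
  thus "coeff (poly_of_roots A) 0 \<noteq> 0"
    and "coeff (poly_of_roots A) 1 = - coeff (poly_of_roots A) 0 * (\<Sum>x\<in>#A. 1 / x)"
    and "2 * coeff (poly_of_roots A) 2 =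
      coeff (poly_of_roots A) 0 * ((\<Sum>x\<in>#A. 1 / x)\<^sup>2 - (\<Sum>x\<in>#A. 1 / x\<^sup>2))"
    by blast+
qed


section \<open>Frobenius, finite subfields and the character of the prime field\<close>

context
  fixes p :: nat
  assumes p_char: "p = CHAR('k::{alg_closed_field, field_prime_char})"
begin

lemma p_prime: "prime p"
  using p_char by simp

lemma p_gt_1: "p > 1"
  using p_prime prime_gt_1_nat by blast

lemma frob_add: "(x + y :: 'k) ^ (p ^ n) = x ^ (p ^ n) + y ^ (p ^ n)"
  by (rule freshmans_dream'[of _ n]) (simp_all add: p_char)

lemma frob_sum: "(sum g A :: 'k) ^ (p ^ n) = (\<Sum>x\<in>A. g x ^ (p ^ n))"
  by (rule freshmans_dream_sum'[of _ n]) (simp_all add: p_char)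

lemma frob_minus: "(- x :: 'k) ^ (p ^ n) = - (x ^ (p ^ n))"
proof -
  have "x ^ (p ^ n) + (- x) ^ (p ^ n) = 0"
    using frob_add[of x "- x" n] p_gt_1 by (simp add: zero_power)
  thus ?thesis by (simp add: add_eq_0_iff)
qed

lemma frob_diff: "(x - y :: 'k) ^ (p ^ n) = x ^ (p ^ n) - y ^ (p ^ n)"
  using frob_add[of x "- y" n] by (simp add: frob_minus)

lemma frob_inj: "x ^ (p ^ n) = y ^ (p ^ n) \<Longrightarrow> x = (y :: 'k)"
  using frob_diff[of x y n] by simp

lemma inj_frob: "inj (\<lambda>x::'k. x ^ p)"
  using frob_inj[of _ 1] by (auto intro!: injI)

lemma frob_frob: "((x :: 'k) ^ (p ^ i)) ^ (p ^ j) = x ^ (p ^ (i + j))"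
  by (simp add: power_add flip: power_mult)

text \<open>For \<open>n > 0\<close> this is the field with \<open>p ^ n\<close> elements, kept as a
  subset of one algebraically closed type so that all extensions are available at once;
  \<open>fixn 1\<close> is the prime field.\<close>

definition fixn :: "nat \<Rightarrow> 'k set" where
  "fixn n = {x. x ^ (p ^ n) = x}"

lemma fixn_poly:
  assumes "n > 0"
  shows "fixn n = {x. poly (monom 1 (p ^ n) - monom 1 1) x = 0}"
    and "degree (monom 1 (p ^ n) - monom 1 1 :: 'k poly) = p ^ n"
proof -
  show "fixn n = {x. poly (monom 1 (p ^ n) - monom 1 1) x = 0}"
    by (auto simp: fixn_def poly_monom)
  have "1 < p ^ n" using p_gt_1 assms one_less_power by blast
  hence "degree (monom 1 (p ^ n) + - monom 1 1 :: 'k poly) = degree (monom 1 (p ^ n) :: 'k poly)"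
    by (intro degree_add_eq_left) (simp add: degree_monom_eq)
  thus "degree (monom 1 (p ^ n) - monom 1 1 :: 'k poly) = p ^ n"
    by (simp add: degree_monom_eq)
qed

lemma finite_fixn: "n > 0 \<Longrightarrow> finite (fixn n)"
proof -
  assume n: "n > 0"
  have "monom 1 (p ^ n) - monom 1 1 \<noteq> (0 :: 'k poly)"
    using fixn_poly(2)[OF n] p_gt_1 by (metis degree_0 less_numeral_extra(3) not_one_less_zero power_eq_0_iff)
  thus ?thesis
    unfolding fixn_poly(1)[OF n] by (rule poly_roots_finite)
qed

text \<open>The polynomial X^(p^n) - X has derivative -1, so all its roots are simple and their
  number is the degree.\<close>

lemma card_fixn:
  assumes "n > 0"
  shows "card (fixn n) = p ^ n"
proof -
  define P :: "'k poly" where "P = monom 1 (p ^ n) - monom 1 1"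
  have deg: "degree P = p ^ n" and roots: "fixn n = {x. poly P x = 0}"
    using fixn_poly[OF assms] by (simp_all add: P_def)
  have [simp]: "P \<noteq> 0" using deg p_gt_1 by auto
  have "of_nat (p ^ n) = (0 :: 'k)"
    using assms by (simp add: p_char)
  hence der: "pderiv P = - 1"
    by (simp add: P_def pderiv_diff pderiv_monom one_pCons monom_0 del: of_nat_power)
  have "order x P \<le> 1" for x
  proof (rule ccontr)
    assume "\<not> order x P \<le> 1"
    hence "[:-x, 1:] ^ 2 dvd P"
      by (simp add: order_divides)
    then obtain r where r: "P = [:-x, 1:] ^ 2 * r" by blast
    have "poly (pderiv P) x = 0"
      unfolding r by (simp add: pderiv_mult power2_eq_square del: mult_pCons_left mult_pCons_right)
    thus False by (simp add: der)
  qed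
  hence cnt: "count (proots P) x = (if x \<in> set_mset (proots P) then 1 else 0)" for x
    by (metis count_greater_zero_iff count_proots \<open>P \<noteq> 0\<close> le_antisym not_gr_zero
        One_nat_def Suc_leI not_in_iff)
  have "size (proots P) = (\<Sum>x\<in>set_mset (proots P). count (proots P) x)"
    by (simp add: size_multiset_overloaded_eq)
  also have "\<dots> = card (set_mset (proots P))"
    using cnt by simp
  finally have "size (proots P) = card (fixn n)"
    by (simp add: roots)
  moreover obtain A where A: "size A = degree P" "P = smult (lead_coeff P) (\<Prod>x\<in>#A. [:-x, 1:])"
    using alg_closed_imp_factorization[of P] by auto
  have "proots P = A"
    using A(2) by (metis \<open>P \<noteq> 0\<close> leading_coeff_0_iff proots_smult proots_poly_of_roots poly_of_roots_def)
  ultimately show ?thesis using A deg by simp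
qed

text \<open>Additivity of Frobenius makes all integers fixed points, and the p distinct classes
  already exhaust a set of p elements.\<close>

lemma fixn_1_eq: "fixn 1 = of_int ` {0..<int p}"
proof -
  have inj: "inj_on (of_int :: int \<Rightarrow> 'k) {0..<int p}"
    by (rule inj_onI) (auto simp: of_int_eq_iff_cong_CHAR simp flip: p_char intro: cong_less_imp_eq_int)
  have "(of_int i :: 'k) ^ p = of_int i" for i
  proof (induction i)
    case (nonneg n)
    show ?case
      by (induction n) (use frob_add[of 1 _ 1] p_gt_1 in \<open>auto simp: zero_power\<close>)
  next
    case (neg n)
    have "(of_int (int n) :: 'k) ^ p = of_int (int n)" for n
      by (induction n) (use frob_add[of 1 _ 1] p_gt_1 in \<open>auto simp: zero_power\<close>)
    from this[of "Suc n"] show ?case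
      using frob_minus[of "of_int (int (Suc n))" 1] by simp
  qed
  hence sub: "of_int ` {0..<int p} \<subseteq> (fixn 1 :: 'k set)"
    by (auto simp: fixn_def)
  have "card (of_int ` {0..<int p} :: 'k set) = p"
    by (subst card_image[OF inj]) simp
  thus ?thesis
    using sub finite_fixn[of 1] card_fixn[of 1] by (intro sym[OF card_subset_eq]) auto
qed

text \<open>The additive character of the prime field. The choice of a representing integer is
  harmless because \<open>ee p\<close> is periodic modulo p; outside \<open>fixn 1\<close> the value
  has no meaning, which is why arguments must be shown to lie there.\<close>

definition psi :: "'k \<Rightarrow> complex" where
  "psi x = ee p (SOME i. of_int i = x)"

lemma psi_of_int: "psi (of_int i) = ee p i"
proof -
  have "of_int (SOME j. of_int j = (of_int i :: 'k)) = (of_int i :: 'k)"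
    by (rule someI[of _ i]) simp
  thus ?thesis
    unfolding psi_def by (intro ee_cong) (simp add: of_int_eq_iff_cong_CHAR p_char)
qed

lemma norm_psi [simp]: "norm (psi x) = 1"
  by (simp add: psi_def)

lemma psi_0 [simp]: "psi 0 = 1"
  using psi_of_int[of 0] by simp

lemma psi_1: "psi 1 \<noteq> 1"
  using psi_of_int[of 1] ee_eq_1_iff[of p 1] p_gt_1 by simp

lemma fixn_1_E:
  assumes "x \<in> fixn 1"
  obtains i where "x = of_int i"
  using assms fixn_1_eq by auto

lemma psi_add:
  assumes "x \<in> fixn 1" "y \<in> fixn 1"
  shows "psi (x + y) = psi x * psi y"
proof -
  obtain i j where "x = of_int i" "y = of_int j"
    using assms by (blast elim: fixn_1_E)
  thus ?thesis
    using psi_of_int[of "i + j"] by (simp add: psi_of_int ee_add)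
qed

lemma sum_psi: "(\<Sum>c\<in>fixn 1. psi c) = 0"
proof -
  have "inj_on (of_int :: int \<Rightarrow> 'k) {0..<int p}"
    by (rule inj_onI) (auto simp: of_int_eq_iff_cong_CHAR simp flip: p_char intro: cong_less_imp_eq_int)
  hence "(\<Sum>c\<in>fixn 1. psi c) = (\<Sum>i\<in>{0..<int p}. ee p i)"
    unfolding fixn_1_eq by (simp add: sum.reindex psi_of_int)
  also have "\<dots> = 0"
    using sum_ee[of p 1] p_gt_1 by simp
  finally show ?thesis .
qed

lemma fixn_add: "x \<in> fixn n \<Longrightarrow> y \<in> fixn n \<Longrightarrow> x + y \<in> fixn n"
  by (simp add: fixn_def frob_add)

end

context
  fixes p :: nat and \<kappa> h :: "'k::{alg_closed_field, field_prime_char}"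
  assumes p_char: "p = CHAR('k)"
    and kappa: "\<kappa> \<in> fixn p 1" and h: "h \<in> fixn p 1"
begin

section \<open>The L-function\<close>

text \<open>A monic polynomial over the prime field with nonzero constant term is encoded by the multiset of its
  roots, so that \<open>stab d\<close> corresponds to these polynomials of degree \<open>d\<close>. Then \<open>lam\<close> is a multiplicative character
  and \<open>Lsum d\<close> is the coefficient of degree \<open>d\<close> of the L-function whose logarithmic derivative has the
  coefficients \<open>Ssum n\<close>.\<close>

definition ratf :: "'k \<Rightarrow> 'k" where "ratf x = \<kappa> * x + h / x\<^sup>2"

definition trace :: "nat \<Rightarrow> 'k \<Rightarrow> 'k" where "trace n x = (\<Sum>i<n. x ^ (p ^ i))"

definition stab :: "nat \<Rightarrow> 'k multiset set" where
  "stab d = {A. size A = d \<and> 0 \<notin># A \<and> image_mset (\<lambda>x. x ^ p) A = A}"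

definition lam :: "'k multiset \<Rightarrow> complex" where
  "lam A = psi p (\<Sum>x\<in>#A. ratf x)"

definition Lsum :: "nat \<Rightarrow> complex" where "Lsum d = (\<Sum>A\<in>stab d. lam A)"

definition Ssum :: "nat \<Rightarrow> complex" where
  "Ssum n = (\<Sum>x\<in>fixn p n - {0}. psi p (trace n (ratf x)))"

text \<open>For \<open>a\<close> in \<open>fixn p j\<close> these are the roots of the
  characteristic polynomial of \<open>a\<close> over the prime field: the Frobenius orbit of
  \<open>a\<close>, repeated j / e times when \<open>a\<close> has degree e.\<close>

definition orb :: "nat \<Rightarrow> 'k \<Rightarrow> 'k multiset" where
  "orb j a = image_mset (\<lambda>i. a ^ (p ^ i)) (mset_set {..<j})"

lemmas p_gt_1' = p_gt_1[OF p_char]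

lemma ratf_frob: "ratf x ^ (p ^ n) = ratf (x ^ (p ^ n))"
proof (induction n)
  case (Suc n)
  have 1: "ratf y ^ p = ratf (y ^ p)" for y
    using frob_add[OF p_char, of "\<kappa> * y" "h / y\<^sup>2" 1] kappa h
    by (simp add: ratf_def fixn_def[OF p_char] power_mult_distrib power_divide power_mult[symmetric] mult.commute)
  have "ratf x ^ p ^ Suc n = (ratf x ^ p ^ n) ^ p"
    by (simp add: power_mult[symmetric] mult.commute)
  also have "\<dots> = ratf ((x ^ p ^ n) ^ p)"
    by (simp add: Suc 1)
  finally show ?case
    by (simp add: power_mult[symmetric] mult.commute)
qed auto

lemma sum_mset_frob: "(\<Sum>x\<in>#A. g x :: 'k) ^ p = (\<Sum>x\<in>#A. g x ^ p)"
proof (induction A)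
  case empty
  show ?case using p_gt_1' by (simp add: zero_power)
next
  case (add x A)
  thus ?case using frob_add[OF p_char, of "g x" "\<Sum>x\<in>#A. g x" 1] by simp
qed

lemma sum_ratf_fixn:
  assumes "A \<in> stab d"
  shows "(\<Sum>x\<in>#A. ratf x) \<in> fixn p 1"
proof -
  have "(\<Sum>x\<in>#A. ratf x) ^ p = (\<Sum>x\<in>#A. ratf (x ^ p))"
    using sum_mset_frob[of ratf A] ratf_frob[of _ 1] by simp
  also have "\<dots> = (\<Sum>x\<in>#image_mset (\<lambda>x. x ^ p) A. ratf x)"
    by (simp add: image_mset.compositionality comp_def)
  also have "\<dots> = (\<Sum>x\<in>#A. ratf x)"
    using assms by (simp add: stab_def)
  finally show ?thesis by (simp add: fixn_def[OF p_char])
qed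

lemma lam_union:
  assumes "A \<in> stab d" "B \<in> stab e"
  shows "lam (A + B) = lam A * lam B"
  using psi_add[OF p_char sum_ratf_fixn[OF assms(1)] sum_ratf_fixn[OF assms(2)]]
  by (simp add: lam_def)

lemma stab_union: "A \<in> stab d \<Longrightarrow> B \<in> stab e \<Longrightarrow> A + B \<in> stab (d + e)"
  by (auto simp: stab_def)

lemma stab_diff:
  assumes "A \<in> stab d" "B \<in> stab e" "B \<subseteq># A"
  shows "A - B \<in> stab (d - e)"
proof -
  have "image_mset (\<lambda>x. x ^ p) (A - B) = image_mset (\<lambda>x. x ^ p) A - image_mset (\<lambda>x. x ^ p) B"
    using assms(3) by (rule image_mset_Diff)
  thus ?thesis
    using assms by (auto simp: stab_def size_Diff_submset dest: in_diffD)
qed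

lemma stab_0: "stab 0 = {{#}}"
  by (auto simp: stab_def)

lemma Lsum_0: "Lsum 0 = 1"
  by (simp add: Lsum_def stab_0 lam_def psi_0[OF p_char])

lemma count_frob: "A \<in> stab d \<Longrightarrow> count A (x ^ (p ^ n)) = count A x"
proof (induction n)
  case (Suc n)
  have 1: "count A (y ^ p) = count A y" for y
  proof -
    have "image_mset (\<lambda>x. x ^ p) A = A" using Suc.prems by (simp add: stab_def)
    moreover have "count (image_mset (\<lambda>x. x ^ p) B) (y ^ p) = count B y" for B
      by (induction B) (use inj_frob[OF p_char] in \<open>auto dest: injD\<close>)
    ultimately show ?thesis by metis
  qed
  have "x ^ p ^ Suc n = (x ^ p ^ n) ^ p"
    by (simp add: power_mult[symmetric] mult.commute)
  thus ?case using Suc 1 by simp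
qed auto

lemma frob_period_aux:
  assumes "i < j" "(a :: 'k) ^ (p ^ i) = a ^ (p ^ j)"
  shows "a \<in> fixn p (j - i)"
proof -
  have "(a ^ (p ^ (j - i))) ^ (p ^ i) = a ^ (p ^ i)"
    using assms by (simp add: frob_frob[OF p_char])
  hence "a ^ (p ^ (j - i)) = a"
    by (rule frob_inj[OF p_char])
  thus ?thesis by (simp add: fixn_def[OF p_char])
qed

text \<open>Pigeonhole: the d + 1 iterates a, a^p, ..., a^(p^d) all lie in a multiset of size d, and
  a coincidence between two of them can be pulled back to \<open>a\<close> because Frobenius is
  injective.\<close>

lemma stab_mem_fixn:
  assumes A: "A \<in> stab d" and a: "a \<in># A"
  shows "\<exists>j. 1 \<le> j \<and> j \<le> d \<and> a \<in> fixn p j"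
proof -
  have sub: "(\<lambda>i. a ^ (p ^ i)) ` {..d} \<subseteq> set_mset A"
  proof safe
    fix i
    have "count A (a ^ (p ^ i)) > 0"
      using count_frob[OF A, of a i] a by simp
    thus "a ^ (p ^ i) \<in># A" by simp
  qed
  have "card ((\<lambda>i. a ^ (p ^ i)) ` {..d}) \<le> card (set_mset A)"
    by (rule card_mono) (use sub in auto)
  also have "\<dots> \<le> size A"
    using size_mset_mono[OF mset_set_set_mset_msubset[of A]] by simp
  also have "\<dots> = d" using A by (simp add: stab_def)
  finally have "card ((\<lambda>i. a ^ (p ^ i)) ` {..d}) < card {..d}"
    by simp
  hence "\<not> inj_on (\<lambda>i. a ^ (p ^ i)) {..d}"
    by (rule pigeonhole)
  then obtain u v where uv: "u \<le> d" "v \<le> d" "u \<noteq> v" "a ^ (p ^ u) = a ^ (p ^ v)"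
    by (auto simp: inj_on_def)
  define i where "i = min u v"
  define j where "j = max u v"
  have "i < j" "j \<le> d" "a ^ (p ^ i) = a ^ (p ^ j)"
    using uv by (auto simp: i_def j_def min_def max_def)
  thus ?thesis using frob_period_aux[of i j a] by (intro exI[of _ "j - i"]) auto
qed

lemma finite_stab: "finite (stab d)"
proof (rule finite_subset)
  show "stab d \<subseteq> {A. size A = d \<and> set_mset A \<subseteq> (\<Union>j\<in>{1..d}. fixn p j)}"
  proof safe
    fix A assume A: "A \<in> stab d"
    thus "size A = d" by (simp add: stab_def)
    fix a assume "a \<in># A"
    thus "a \<in> (\<Union>j\<in>{1..d}. fixn p j)" using stab_mem_fixn[OF A, of a] by fastforce
  qed
  show "finite {A. size A = d \<and> set_mset A \<subseteq> (\<Union>j\<in>{1..d}. fixn p j :: 'k set)}"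
    by (rule finite_multisets_size) (auto intro!: finite_fixn[OF p_char])
qed

lemma size_orb [simp]: "size (orb j a) = j"
  by (simp add: orb_def)

lemma orb_stab:
  assumes "j > 0" "a \<in> fixn p j" "a \<noteq> 0"
  shows "orb j a \<in> stab j"
proof -
  define g where "g = (\<lambda>i. a ^ (p ^ i))"
  obtain j' where j: "j = Suc j'" using assms(1) by (cases j) auto
  have gj: "g j = g 0" using assms(2) by (simp add: g_def fixn_def[OF p_char])
  have "image_mset (\<lambda>x. x ^ p) (orb j a) = image_mset g (image_mset Suc (mset_set {..<j}))"
    unfolding orb_def image_mset.compositionality comp_def g_def
    by (intro image_mset_cong) (simp add: power_mult[symmetric] mult.commute)
  also have "image_mset Suc (mset_set {..<j}) = mset_set (insert j {1..<j})"
  proof -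
    have "Suc ` {..<j} = insert j {1..<j}"
      unfolding j by (auto simp: image_iff) (metis Suc_le_D lessThan_iff not_less_eq less_Suc_eq Suc_le_eq)
    thus ?thesis by (simp add: image_mset_mset_set)
  qed
  also have "image_mset g (mset_set (insert j {1..<j})) = image_mset g (mset_set (insert 0 {1..<j}))"
    by (simp add: gj)
  also have "insert 0 {1..<j} = {..<j}"
    using assms(1) by auto
  finally have "image_mset (\<lambda>x. x ^ p) (orb j a) = orb j a"
    by (simp add: orb_def g_def)
  thus ?thesis
    using assms(3) by (auto simp: stab_def orb_def)
qed

lemma lam_orb: "lam (orb j a) = psi p (trace j (ratf a))"
  by (simp add: lam_def orb_def trace_def ratf_frob image_mset.compositionality comp_def sum_unfold_sum_mset)

text \<open>If \<open>a\<close> has degree e, then \<open>a\<close> lies in \<open>fixn p j\<close>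
  exactly for the multiples j = r e, and \<open>orb j a\<close> is r copies of its orbit. As
  \<open>A\<close> has constant multiplicity along the orbit, inclusion means r \<le>
  \<open>count A a\<close>.\<close>

lemma card_orb_sub:
  assumes A: "A \<in> stab d" and a: "a \<in># A"
  shows "card {j. 1 \<le> j \<and> j \<le> d \<and> a \<in> fixn p j \<and> orb j a \<subseteq># A} = count A a"
proof -
  define e where "e = (LEAST e. e > 0 \<and> a \<in> fixn p e)"
  have ex: "\<exists>e. e > 0 \<and> a \<in> fixn p e"
    using stab_mem_fixn[OF A a] by (metis less_le_trans zero_less_one)
  have e: "e > 0" "a \<in> fixn p e"
    using LeastI_ex[OF ex] by (simp_all add: e_def)
  have min: "\<not> (0 < j \<and> j < e \<and> a \<in> fixn p j)" for j
    using not_less_Least[of j "\<lambda>e. e > 0 \<and> a \<in> fixn p e"] by (auto simp: e_def)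
  have ae: "a ^ (p ^ (e * r)) = a" for r
  proof (induction r)
    case (Suc r)
    have "a ^ (p ^ (e * Suc r)) = (a ^ (p ^ (e * r))) ^ (p ^ e)"
      by (simp add: frob_frob[OF p_char] add.commute)
    thus ?case using Suc e(2) by (simp add: fixn_def[OF p_char])
  qed auto
  have amod: "a ^ (p ^ i) = a ^ (p ^ (i mod e))" for i
  proof -
    have "a ^ (p ^ i) = (a ^ (p ^ (e * (i div e)))) ^ (p ^ (i mod e))"
      unfolding frob_frob[OF p_char] by simp
    thus ?thesis by (simp add: ae)
  qed
  have dvd: "a \<in> fixn p j \<longleftrightarrow> e dvd j" for j
  proof
    assume "a \<in> fixn p j"
    hence "a \<in> fixn p (j mod e)" using amod[of j] by (simp add: fixn_def[OF p_char])
    hence "j mod e = 0" using min[of "j mod e"] e(1) by auto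
    thus "e dvd j" by auto
  next
    assume "e dvd j"
    thus "a \<in> fixn p j" using ae by (auto simp: fixn_def[OF p_char])
  qed
  have inj: "inj_on (\<lambda>i. a ^ (p ^ i)) {..<e}"
  proof (rule inj_onI, rule ccontr)
    fix i j assume ij: "i \<in> {..<e}" "j \<in> {..<e}" "a ^ (p ^ i) = a ^ (p ^ j)" "i \<noteq> j"
    have "\<exists>l. 0 < l \<and> l < e \<and> a \<in> fixn p l"
    proof (cases "i < j")
      case True
      thus ?thesis using frob_period_aux[of i j a] ij by (intro exI[of _ "j - i"]) auto
    next
      case False
      thus ?thesis using frob_period_aux[of j i a] ij by (intro exI[of _ "i - j"]) auto
    qed
    thus False using min by blast
  qed
  have cnt_e: "count (orb e a) x = (if x \<in> (\<lambda>i. a ^ (p ^ i)) ` {..<e} then 1 else 0)" for x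
    using inj by (simp add: orb_def image_mset_mset_set count_mset_set')
  have orb_mult: "orb (r * e) a = repeat_mset r (orb e a)" for r
  proof (induction r)
    case (Suc r)
    have "{..<Suc r * e} = {..<r * e} \<union> {r * e..<Suc r * e}" by auto
    moreover have "{..<r * e} \<inter> {r * e..<Suc r * e} = {}" by auto
    ultimately have "orb (Suc r * e) a = orb (r * e) a + image_mset (\<lambda>i. a ^ (p ^ i)) (mset_set {r * e..<Suc r * e})"
      by (simp add: orb_def mset_set_Union ivl_disj_int del: mult_Suc mult_Suc_right)
    also have "mset_set {r * e..<Suc r * e} = image_mset (\<lambda>i. i + r * e) (mset_set {..<e})"
    proof -
      have "(\<lambda>i. i + r * e) ` {..<e} = {r * e..<Suc r * e}"
        using image_add_atLeastLessThan'[of "r * e" 0 e] by (simp add: lessThan_atLeast0 add.commute)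
      thus ?thesis by (subst image_mset_mset_set) (auto simp: inj_on_def)
    qed
    also have "image_mset (\<lambda>i. a ^ (p ^ i)) (image_mset (\<lambda>i. i + r * e) (mset_set {..<e})) = orb e a"
      unfolding orb_def image_mset.compositionality comp_def
      by (intro image_mset_cong) (subst amod, simp add: amod[symmetric])
    finally show ?case using Suc by simp
  qed (simp add: orb_def)
  have sub: "orb (r * e) a \<subseteq># A \<longleftrightarrow> r \<le> count A a" for r
  proof
    assume "orb (r * e) a \<subseteq># A"
    hence "count (orb (r * e) a) a \<le> count A a"
      by (rule mset_subset_eq_count)
    moreover have "count (orb e a) a = 1"
      unfolding cnt_e using e(1) by (auto intro!: image_eqI[of _ _ 0])
    ultimately show "r \<le> count A a" by (simp add: orb_mult)
  next
    assume r: "r \<le> count A a"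
    show "orb (r * e) a \<subseteq># A"
    proof (rule mset_subset_eqI)
      fix x
      show "count (orb (r * e) a) x \<le> count A x"
        using r count_frob[OF A, of a] by (auto simp: orb_mult cnt_e)
    qed
  qed
  have "{j. 1 \<le> j \<and> j \<le> d \<and> a \<in> fixn p j \<and> orb j a \<subseteq># A} = (\<lambda>r. r * e) ` {1..count A a}"
  proof (intro equalityI subsetI)
    fix j assume "j \<in> {j. 1 \<le> j \<and> j \<le> d \<and> a \<in> fixn p j \<and> orb j a \<subseteq># A}"
    hence j: "1 \<le> j" "e dvd j" "orb j a \<subseteq># A" by (auto simp: dvd)
    then obtain r where r: "j = r * e" by (metis dvd_def mult.commute)
    thus "j \<in> (\<lambda>r. r * e) ` {1..count A a}"
      using j sub[of r] by (auto intro!: image_eqI[of _ _ r] simp: Suc_le_eq)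
  next
    fix j assume "j \<in> (\<lambda>r. r * e) ` {1..count A a}"
    then obtain r where "j = r * e" "r \<in> {1..count A a}" by (elim imageE)
    hence r: "j = r * e" "1 \<le> r" "r \<le> count A a" by auto
    have s: "orb j a \<subseteq># A" using sub r by simp
    hence "j \<le> d" using size_mset_mono[OF s] A by (simp add: stab_def)
    thus "j \<in> {j. 1 \<le> j \<and> j \<le> d \<and> a \<in> fixn p j \<and> orb j a \<subseteq># A}"
      using r s e(1) by (auto simp: dvd)
  qed
  also have "card \<dots> = count A a"
    using e(1) by (subst card_image) (auto simp: inj_on_def)
  finally show ?thesis .
qed

text \<open>The coefficientwise form of T L'(T) = S(T) L(T). It is a double count of the pairs
  formed by \<open>A\<close> in \<open>stab d\<close> and (j, a) with \<open>orb j a\<close>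
  contained in \<open>A\<close>: each \<open>A\<close> occurs d times by
  \<open>card_orb_sub\<close>, while removing \<open>orb j a\<close> from \<open>A\<close> factors
  \<open>lam A\<close>.\<close>

lemma newton_identity: "of_nat d * Lsum d = (\<Sum>j=1..d. Ssum j * Lsum (d - j))"
proof -
  define I where "I = (SIGMA j:{1..d}. fixn p j - {0::'k})"
  have finI: "finite I" unfolding I_def
    by (rule finite_SigmaI) (auto intro!: finite_fixn[OF p_char])
  have card: "card {ja\<in>I. orb (fst ja) (snd ja) \<subseteq># A} = d" if A: "A \<in> stab d" for A
  proof -
    have "{ja\<in>I. orb (fst ja) (snd ja) \<subseteq># A} =
      (\<lambda>(a, j). (j, a)) ` (SIGMA a:set_mset A. {j. 1 \<le> j \<and> j \<le> d \<and> a \<in> fixn p j \<and> orb j a \<subseteq># A})"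
      (is "?L = ?f ` ?R")
    proof (intro equalityI subsetI)
      fix z assume "z \<in> ?L"
      then obtain j a where z: "z = (j, a)" "1 \<le> j" "j \<le> d" "a \<in> fixn p j" "orb j a \<subseteq># A"
        by (auto simp: I_def)
      have "a \<in># orb j a"
        using z(2) by (auto simp: orb_def intro!: image_eqI[of _ _ 0])
      hence "a \<in># A" using z(5) by (meson mset_subset_eqD)
      thus "z \<in> ?f ` ?R" using z by (auto intro!: image_eqI[of _ _ "(a, j)"])
    next
      fix z assume "z \<in> ?f ` ?R"
      thus "z \<in> ?L" using A by (auto simp: I_def stab_def)
    qed
    hence "card ?L = card ?R"
      by (simp add: card_image inj_on_def)
    also have "\<dots> = (\<Sum>a\<in>set_mset A. count A a)"
      using card_orb_sub[OF A] by (subst card_SigmaI) (auto intro: finite_subset[of _ "{..d}"])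
    also have "\<dots> = d" using A by (simp add: stab_def size_multiset_overloaded_eq)
    finally show ?thesis .
  qed
  have "of_nat d * Lsum d = (\<Sum>A\<in>stab d. \<Sum>ja\<in>{ja\<in>I. orb (fst ja) (snd ja) \<subseteq># A}. lam A)"
    by (simp add: Lsum_def sum_distrib_left card)
  also have "\<dots> = (\<Sum>ja\<in>I. \<Sum>A\<in>{A\<in>stab d. orb (fst ja) (snd ja) \<subseteq># A}. lam A)"
    by (rule sum.swap_restrict[OF finite_stab finI])
  also have "\<dots> = (\<Sum>ja\<in>I. psi p (trace (fst ja) (ratf (snd ja))) * Lsum (d - fst ja))"
  proof (rule sum.cong[OF refl])
    fix ja assume "ja \<in> I"
    moreover obtain j a where ja1: "ja = (j, a)" by (cases ja)
    ultimately have ja: "ja = (j, a)" "1 \<le> j" "j \<le> d" "a \<in> fixn p j" "a \<noteq> 0"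
      by (auto simp: I_def)
    have st: "orb j a \<in> stab j" using ja by (intro orb_stab) auto
    have "(\<Sum>A\<in>{A\<in>stab d. orb j a \<subseteq># A}. lam A) = (\<Sum>B\<in>stab (d - j). lam (orb j a + B))"
    proof (rule sum.reindex_bij_witness[of _ "\<lambda>B. orb j a + B" "\<lambda>A. A - orb j a"])
      fix A assume "A \<in> {A\<in>stab d. orb j a \<subseteq># A}"
      thus "orb j a + (A - orb j a) = A" "A - orb j a \<in> stab (d - j)" "lam (orb j a + (A - orb j a)) = lam A"
        using stab_diff st by auto
    next
      fix B assume "B \<in> stab (d - j)"
      thus "orb j a + B - orb j a = B" "orb j a + B \<in> {A\<in>stab d. orb j a \<subseteq># A}"
        using stab_union[OF st, of B "d - j"] ja by auto
    qed
    also have "\<dots> = lam (orb j a) * Lsum (d - j)"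
      by (simp add: Lsum_def sum_distrib_left lam_union[OF st] cong: sum.cong)
    finally show "(\<Sum>A\<in>{A\<in>stab d. orb (fst ja) (snd ja) \<subseteq># A}. lam A) =
        psi p (trace (fst ja) (ratf (snd ja))) * Lsum (d - fst ja)"
      by (simp add: ja lam_orb)
  qed
  also have "\<dots> = (\<Sum>j=1..d. \<Sum>a\<in>fixn p j - {0}. psi p (trace j (ratf a)) * Lsum (d - j))"
    unfolding I_def by (subst sum.Sigma) (auto intro!: finite_fixn[OF p_char] simp: case_prod_unfold)
  also have "\<dots> = (\<Sum>j=1..d. Ssum j * Lsum (d - j))"
    by (simp add: Ssum_def sum_distrib_right)
  finally show ?thesis .
qed


section \<open>Vanishing of the higher coefficients of the L-function\<close>

lemma coeff_poly_of_roots_frob: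
  "coeff (poly_of_roots (image_mset (\<lambda>x. x ^ p) A)) i = coeff (poly_of_roots (A :: 'k multiset)) i ^ p"
proof (induction A arbitrary: i)
  case empty
  show ?case using p_gt_1' by (simp add: coeff_1 zero_power)
next
  case (add x A)
  have fd: "(u - v :: 'k) ^ p = u ^ p - v ^ p" and fm: "(- u :: 'k) ^ p = - (u ^ p)" for u v
    using frob_diff[OF p_char, of u v 1] frob_minus[OF p_char, of u 1] by simp_all
  show ?case
    using add by (cases i) (simp_all add: coeff_linear_mult fd fm power_mult_distrib del: mult_pCons_left)
qed

text \<open>Frobenius acts on the coefficients as it acts on the roots, and a monic polynomial
  determines its roots. This form allows a single coefficient to be changed without leaving
  \<open>stab d\<close>.\<close>

lemma stab_iff_coeff:
  "A \<in> stab d \<longleftrightarrow> size A = d \<and> 0 \<notin># A \<and> (\<forall>i. coeff (poly_of_roots A) i \<in> fixn p 1)"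
proof -
  have "(\<forall>i. coeff (poly_of_roots A) i \<in> fixn p 1) \<longleftrightarrow>
      poly_of_roots (image_mset (\<lambda>x. x ^ p) A) = poly_of_roots A"
    by (auto simp: poly_eq_iff coeff_poly_of_roots_frob fixn_def[OF p_char])
  also have "\<dots> \<longleftrightarrow> image_mset (\<lambda>x. x ^ p) A = A"
    by (metis proots_poly_of_roots)
  finally show ?thesis by (auto simp: stab_def)
qed

text \<open>Moving the subleading coefficient permutes \<open>stab d\<close> and, for \<open>d \<ge> 4\<close>, multiplies \<open>lam\<close> by a nontrivial
  constant; hence \<open>Lsum d = 0\<close>.\<close>

definition shift :: "'k \<Rightarrow> 'k multiset \<Rightarrow> 'k multiset" where
  "shift t A = proots (poly_of_roots A + monom t (size A - 1))"

lemma poly_of_roots_shift: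
  assumes "size A \<ge> 1"
  shows "poly_of_roots (shift t A) = poly_of_roots A + monom t (size A - 1)"
    and "size (shift t A) = size A"
proof -
  let ?g = "poly_of_roots A + monom t (size A - 1)"
  have m: "lead_coeff (poly_of_roots A) = 1" "degree (poly_of_roots A) = size A"
    using monic_poly_of_roots[of A] by auto
  have "degree (monom t (size A - 1)) < degree (poly_of_roots A)"
    using assms m degree_monom_le[of t "size A - 1"] by linarith
  hence d: "degree ?g = size A" and "lead_coeff ?g = 1"
    using m degree_add_eq_left[of "monom t (size A - 1)" "poly_of_roots A"] assms
    by (simp_all add: coeff_monom)
  thus *: "poly_of_roots (shift t A) = ?g"
    unfolding shift_def by (intro poly_of_roots_proots)
  show "size (shift t A) = size A"
    using monic_poly_of_roots[of "shift t A"] d * by simp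
qed

text \<open>For d \<ge> 4 the modified coefficient, of index d - 1 \<ge> 3, is none of the three
  that determine the sums of 1 / x and 1 / x^2. Only the sum of the roots changes, by - t. The
  constant coefficient also survives, so 0 does not become a root.\<close>

lemma shift_stab:
  assumes A: "A \<in> stab d" and d: "d \<ge> 4" and t: "t \<in> fixn p 1"
  shows "shift t A \<in> stab d" and "(\<Sum>x\<in>#shift t A. ratf x) = (\<Sum>x\<in>#A. ratf x) - \<kappa> * t"
proof -
  have sz: "size A = d" and 0: "0 \<notin># A" using A by (auto simp: stab_def)
  have *: "poly_of_roots (shift t A) = poly_of_roots A + monom t (d - 1)" "size (shift t A) = d"
    using poly_of_roots_shift[of A t] sz d by simp_all
  have low: "coeff (poly_of_roots (shift t A)) i = coeff (poly_of_roots A) i" if "i \<le> 2" for i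
    unfolding * using that d by simp
  have "coeff (poly_of_roots (shift t A)) 0 \<noteq> 0"
    using low[of 0] coeff_poly_of_roots_low(1)[OF 0] by simp
  hence "poly (poly_of_roots (shift t A)) 0 \<noteq> 0"
    by (simp add: poly_0_coeff_0)
  hence nz': "0 \<notin># shift t A"
    by (auto simp: poly_of_roots_def dest!: multi_member_split)
  have c0: "(0 :: 'k) \<in> fixn p 1" using p_gt_1' by (simp add: fixn_def[OF p_char] zero_power)
  show "shift t A \<in> stab d"
    using A t nz' c0 * unfolding stab_iff_coeff by (auto intro!: fixn_add[OF p_char])
  obtain d' where d': "d = Suc d'" using d by (cases d) auto
  have s1: "(\<Sum>x\<in>#shift t A. x) = (\<Sum>x\<in>#A. x) - t"
  proof -
    have "- (\<Sum>x\<in>#shift t A. x) = - (\<Sum>x\<in>#A. x) + t"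
      using coeff_poly_of_roots_subleading[of A d'] coeff_poly_of_roots_subleading[of "shift t A" d'] sz *(2) d'
      by (simp add: *(1))
    hence "- (- (\<Sum>x\<in>#shift t A. x)) = - (- (\<Sum>x\<in>#A. x) + t)" by (rule arg_cong)
    thus ?thesis by (simp only: minus_minus minus_add_distrib diff_conv_add_uminus)
  qed
  let ?c = "coeff (poly_of_roots A)" and ?c' = "coeff (poly_of_roots (shift t A))"
  have l: "?c' 0 = ?c 0" "?c' 1 = ?c 1" "?c' 2 = ?c 2"
    using low by auto
  have ne: "?c 0 \<noteq> 0" by (rule coeff_poly_of_roots_low(1)[OF 0])
  have "- ?c 0 * (\<Sum>x\<in>#shift t A. 1 / x) = - ?c 0 * (\<Sum>x\<in>#A. 1 / x)"
    by (rule trans[OF sym[OF coeff_poly_of_roots_low(2)[OF nz', unfolded l]] coeff_poly_of_roots_low(2)[OF 0]])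
  hence inv: "(\<Sum>x\<in>#shift t A. 1 / x) = (\<Sum>x\<in>#A. 1 / x)"
    by (rule mult_left_cancel[THEN iffD1, rotated]) (use ne in simp)
  have "?c 0 * ((\<Sum>x\<in>#A. 1 / x)\<^sup>2 - (\<Sum>x\<in>#shift t A. 1 / x\<^sup>2)) =
      ?c 0 * ((\<Sum>x\<in>#A. 1 / x)\<^sup>2 - (\<Sum>x\<in>#A. 1 / x\<^sup>2))"
    by (rule trans[OF sym[OF coeff_poly_of_roots_low(3)[OF nz', unfolded l inv]] coeff_poly_of_roots_low(3)[OF 0]])
  hence "(\<Sum>x\<in>#A. 1 / x)\<^sup>2 - (\<Sum>x\<in>#shift t A. 1 / x\<^sup>2) = (\<Sum>x\<in>#A. 1 / x)\<^sup>2 - (\<Sum>x\<in>#A. 1 / x\<^sup>2)"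
    by (rule mult_left_cancel[THEN iffD1, rotated]) (use ne in simp)
  hence s2: "(\<Sum>x\<in>#shift t A. 1 / x\<^sup>2) = (\<Sum>x\<in>#A. 1 / x\<^sup>2)"
    by (simp only: diff_conv_add_uminus add_left_cancel neg_equal_iff_equal)
  have rat: "(\<Sum>x\<in>#B. ratf x) = \<kappa> * (\<Sum>x\<in>#B. x) + h * (\<Sum>x\<in>#B. 1 / x\<^sup>2)" for B
    by (induction B) (auto simp: ratf_def algebra_simps)
  show "(\<Sum>x\<in>#shift t A. ratf x) = (\<Sum>x\<in>#A. ratf x) - \<kappa> * t"
    unfolding rat s1 s2 by (simp only: right_diff_distrib diff_add_eq)
qed

lemma shift_shift: "A \<in> stab d \<Longrightarrow> d \<ge> 1 \<Longrightarrow> shift (- t) (shift t A) = A"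
proof -
  assume A: "A \<in> stab d" "d \<ge> 1"
  hence "poly_of_roots (shift t A) + monom (- t) (size (shift t A) - 1) =
      poly_of_roots A + (monom t (d - 1) + monom (- t) (d - 1))"
    using poly_of_roots_shift[of A t] by (simp add: stab_def add.assoc)
  also have "\<dots> = poly_of_roots A"
    by (simp only: add_monom) simp
  finally show ?thesis by (simp add: shift_def[of "- t"])
qed

lemma Lsum_eq_0:
  assumes "\<kappa> \<noteq> 0" "d \<ge> 4"
  shows "Lsum d = 0"
proof -
  \<comment> \<open>With this \<open>t\<close> the sum of \<open>ratf\<close> grows by exactly 1, so
    the bijection \<open>shift t\<close> multiplies every \<open>lam A\<close> by the same constant
    \<open>psi p 1\<close>, which is not 1.\<close>
  define t where "t = - inverse \<kappa>"
  have inv: "inverse x \<in> fixn p 1" "- x \<in> fixn p 1" if "x \<in> fixn p 1" for x :: 'k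
    using that frob_minus[OF p_char, of x 1] by (simp_all add: fixn_def[OF p_char] power_inverse)
  have t: "t \<in> fixn p 1" "- t \<in> fixn p 1"
    using kappa inv by (auto simp: t_def)
  have one: "(1 :: 'k) \<in> fixn p 1" by (simp add: fixn_def[OF p_char])
  have "Lsum d = (\<Sum>A\<in>stab d. lam (shift t A))"
    unfolding Lsum_def
    by (rule sum.reindex_bij_witness[of _ "shift t" "shift (- t)"])
       (use shift_stab[OF _ assms(2)] t shift_shift[of _ d t] shift_shift[of _ d "- t"] assms(2) in auto)
  also have "\<dots> = (\<Sum>A\<in>stab d. lam A * psi p (1 :: 'k))"
  proof (rule sum.cong[OF refl])
    fix A assume A: "A \<in> stab d"
    show "lam (shift t A) = lam A * psi p (1 :: 'k)"
      using shift_stab(2)[OF A assms(2) t(1)] assms(1) psi_add[OF p_char sum_ratf_fixn[OF A] one]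
      by (simp add: lam_def t_def)
  qed
  also have "\<dots> = Lsum d * psi p (1 :: 'k)"
    by (simp add: Lsum_def sum_distrib_right)
  finally have "Lsum d * (1 - psi p (1::'k)) = 0"
    by (simp add: algebra_simps)
  thus ?thesis using psi_1[OF p_char] by simp
qed

end

section \<open>Point counts by Stepanov's method\<close>

text \<open>Gaussian elimination: if some unknown \<open>w\<close> occurs in the equation
  \<open>e\<close>, it is eliminated from the remaining equations and its value is recovered from
  \<open>e\<close> afterwards.\<close>

lemma nontrivial_kernel:
  fixes v :: "'i \<Rightarrow> 'e \<Rightarrow> 'a::field"
  assumes "finite E" "finite U" "card E < card U"
  shows "\<exists>c. (\<exists>u\<in>U. c u \<noteq> 0) \<and> (\<forall>e\<in>E. (\<Sum>u\<in>U. c u * v u e) = 0)"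
  using assms
proof (induction E arbitrary: U v rule: finite_induct)
  case empty
  hence "U \<noteq> {}" by auto
  thus ?case by (intro exI[of _ "\<lambda>_. 1"]) auto
next
  case (insert e E)
  show ?case
  proof (cases "\<forall>u\<in>U. v u e = 0")
    case True
    have "card E < card U" using insert by simp
    then obtain c where "\<exists>u\<in>U. c u \<noteq> 0" "\<forall>e\<in>E. (\<Sum>u\<in>U. c u * v u e) = 0"
      using insert.IH[OF insert.prems(1), of v] by blast
    thus ?thesis using True by (intro exI[of _ c]) auto
  next
    case False
    then obtain w where w: "w \<in> U" "v w e \<noteq> 0" by blast
    define U' where "U' = U - {w}"
    define v' where "v' = (\<lambda>u e'. v u e' - v u e / v w e * v w e')"
    have U': "finite U'" "card E < card U'" "U = insert w U'" "w \<notin> U'"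
      using insert w by (auto simp: U'_def)
    then obtain c where c: "\<exists>u\<in>U'. c u \<noteq> 0" "\<forall>e\<in>E. (\<Sum>u\<in>U'. c u * v' u e) = 0"
      using insert.IH[of U' v'] by blast
    define d where "d = (\<lambda>u. if u = w then - (\<Sum>u\<in>U'. c u * v u e / v w e) else c u)"
    have sum_d: "(\<Sum>u\<in>U. d u * v u e') = (\<Sum>u\<in>U'. c u * v' u e')" for e'
    proof -
      have "(\<Sum>u\<in>U'. d u * v u e') = (\<Sum>u\<in>U'. c u * v u e')"
        using U'(4) by (intro sum.cong) (auto simp: d_def)
      hence "(\<Sum>u\<in>U. d u * v u e') = - (\<Sum>u\<in>U'. c u * v u e / v w e) * v w e' + (\<Sum>u\<in>U'. c u * v u e')"
        unfolding U'(3) using U'(1,4) by (simp add: d_def)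
      also have "\<dots> = (\<Sum>u\<in>U'. c u * v' u e')"
        by (simp add: v'_def sum_distrib_right sum_subtractf right_diff_distrib mult.assoc)
      finally show ?thesis .
    qed
    have "(\<Sum>u\<in>U. d u * v u e) = 0"
      unfolding sum_d using w by (simp add: v'_def)
    moreover have "\<exists>u\<in>U. d u \<noteq> 0" using c(1) U' by (auto simp: d_def)
    ultimately show ?thesis using c(2) sum_d by (intro exI[of _ d]) auto
  qed
qed

text \<open>The term of largest degree with nonzero coefficient cannot cancel. With degrees read as
  pole orders, this shows that Stepanov's auxiliary function is not identically zero.\<close>

lemma degree_sum_distinct:
  fixes b :: "'i \<Rightarrow> 'a::field poly"
  assumes "finite U" "inj_on (\<lambda>u. degree (b u)) U" "\<forall>u\<in>U. b u \<noteq> 0" "\<exists>u\<in>U. c u \<noteq> 0"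
  shows "(\<Sum>u\<in>U. smult (c u) (b u)) \<noteq> 0"
proof
  assume 0: "(\<Sum>u\<in>U. smult (c u) (b u)) = 0"
  define V where "V = {u\<in>U. c u \<noteq> 0}"
  have V: "finite V" "V \<noteq> {}" using assms by (auto simp: V_def)
  obtain w where w: "w \<in> V" "\<And>u. u \<in> V \<Longrightarrow> degree (b u) \<le> degree (b w)"
    using obtains_MAX[OF V, of "\<lambda>u. degree (b u)"] V(1) by (metis Max_ge finite_imageI imageI)
  have "coeff (\<Sum>u\<in>U. smult (c u) (b u)) (degree (b w)) = (\<Sum>u\<in>U. c u * coeff (b u) (degree (b w)))"
    by (simp add: coeff_sum)
  also have "\<dots> = (\<Sum>u\<in>{w}. c u * coeff (b u) (degree (b w)))"
  proof (rule sum.mono_neutral_right)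
    show "\<forall>u\<in>U - {w}. c u * coeff (b u) (degree (b w)) = 0"
    proof
      fix u assume u: "u \<in> U - {w}"
      show "c u * coeff (b u) (degree (b w)) = 0"
      proof (cases "c u = 0")
        case False
        hence "u \<in> V" using u by (simp add: V_def)
        hence "degree (b u) \<le> degree (b w)" using w by simp
        moreover have "degree (b u) \<noteq> degree (b w)"
          using assms(2) u w(1) by (auto simp: inj_on_def V_def)
        ultimately show ?thesis by (simp add: coeff_eq_0)
      qed simp
    qed
  qed (use assms w in \<open>auto simp: V_def\<close>)
  also have "\<dots> \<noteq> 0" using w(1) assms(3) by (auto simp: V_def)
  finally show False by (simp add: 0)
qed

section \<open>Functions on an Artin-Schreier curve graded by pole order\<close>

context
  fixes p :: nat and \<kappa> h \<gamma> :: "'k::{alg_closed_field, field_prime_char}"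
  assumes p_char: "p = CHAR('k)"
    and kappa: "\<kappa> \<noteq> 0"
begin

text \<open>The parameter \<gamma> selects a trace value: iterating the equation n times gives
  y^(p^n) - y = tr(\<kappa> x + h / x^2) - tr(\<gamma>), where tr adds the first n Frobenius
  iterates. Hence all points above an x of trace tr(\<gamma>) are rational.\<close>

definition curve :: "('k \<times> 'k) set" where
  "curve = {(x, y). x \<noteq> 0 \<and> y ^ p = y + \<kappa> * x + h / x\<^sup>2 - \<gamma>}"

text \<open>A polynomial stands for the function on the curve in which the monomial of degree \<open>u\<close> is
  replaced by \<open>x ^ (u div p) * y ^ (u mod p)\<close>; degrees then are pole orders at infinity.\<close>

definition ev :: "'k poly \<Rightarrow> 'k \<Rightarrow> 'k \<Rightarrow> 'k" where
  "ev b x y = (\<Sum>u\<le>degree b. coeff b u * (x ^ (u div p) * y ^ (u mod p)))"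

lemma ev_eq: "degree b \<le> n \<Longrightarrow> ev b x y = (\<Sum>u\<le>n. coeff b u * (x ^ (u div p) * y ^ (u mod p)))"
  unfolding ev_def by (rule sum.mono_neutral_left) (auto simp: coeff_eq_0)

lemma ev_0 [simp]: "ev 0 x y = 0"
  by (simp add: ev_def)

lemma ev_add: "ev (b + c) x y = ev b x y + ev c x y"
proof -
  define n where "n = max (degree b) (degree c)"
  have "degree (b + c) \<le> n" "degree b \<le> n" "degree c \<le> n"
    by (auto simp: n_def degree_add_le_max)
  thus ?thesis by (simp add: ev_eq[of _ n] distrib_right sum.distrib)
qed

lemma ev_smult: "ev (smult a b) x y = a * ev b x y"
  using ev_eq[of "smult a b" "degree b"] by (simp add: degree_smult_le ev_def sum_distrib_left mult.assoc)

lemma ev_sum: "ev (\<Sum>u\<in>U. g u) x y = (\<Sum>u\<in>U. ev (g u) x y)"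
  by (induction U rule: infinite_finite_induct) (auto simp: ev_add)

lemma ev_monom: "ev (monom a u) x y = a * (x ^ (u div p) * y ^ (u mod p))"
proof -
  have "ev (monom a u) x y = (\<Sum>v\<le>u. coeff (monom a u) v * (x ^ (v div p) * y ^ (v mod p)))"
    by (rule ev_eq) (simp add: degree_monom_le)
  also have "\<dots> = (\<Sum>v\<in>{u}. coeff (monom a u) v * (x ^ (v div p) * y ^ (v mod p)))"
    by (rule sum.mono_neutral_right) auto
  finally show ?thesis by simp
qed

lemmas p_gt_1'' = p_gt_1[OF p_char]

lemma ev_monom_mult: "ev (monom 1 (p * i) * b) x y = x ^ i * ev b x y"
proof -
  have "monom 1 (p * i) * b = (\<Sum>u\<le>degree b. monom (coeff b u) (p * i + u))"
    by (subst (1) poly_as_sum_of_monoms[of b, symmetric]) (simp add: sum_distrib_left mult_monom)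
  moreover have "ev b x y = (\<Sum>u\<le>degree b. coeff b u * (x ^ (u div p) * y ^ (u mod p)))"
    by (rule ev_def)
  ultimately show ?thesis
    using p_gt_1'' by (simp only: ev_sum ev_monom) (simp add: sum_distrib_left power_add mult_ac)
qed

lemma ev_pcompose_mult: "ev (pcompose g (monom 1 p) * b) x y = poly g x * ev b x y"
proof (induction g)
  case (pCons a g)
  have "pcompose (pCons a g) (monom 1 p) * b = smult a b + monom 1 (p * 1) * (pcompose g (monom 1 p) * b)"
    by (simp add: pcompose_pCons algebra_simps)
  thus ?case
    by (simp only: ev_add ev_smult ev_monom_mult pCons.IH) (simp add: algebra_simps)
qed simp

lemma degree_pcompose_monom: "degree (pcompose g (monom (1::'k) p)) = p * degree g"
  by (simp add: degree_monom_eq)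

text \<open>At infinity x has pole order p and y has pole order 1, so multiplication by x^2 y must
  raise the degree by 2 p + 1. Only the overflow of the exponent of y at
  \<open>u mod p = p - 1\<close> needs the curve equation; the factor x^2 clears the denominator of
  h / x^2.\<close>

lemma ev_mult_y_monom:
  "\<exists>b. degree b = u + 2 * p + 1 \<and> (\<forall>(x, y)\<in>curve. ev b x y = x\<^sup>2 * y * ev (monom 1 u) x y)"
proof (cases "u mod p = p - 1")
  case False
  hence "u mod p < p - 1"
    using p_gt_1'' mod_less_divisor[of p u] by linarith
  hence sm: "Suc u mod p = Suc (u mod p)"
    by (simp add: mod_Suc)
  hence sd: "Suc u div p = u div p"
    by (simp add: div_Suc)
  show ?thesis
  proof (intro exI[of _ "monom 1 (p * 2) * monom 1 (Suc u)"] conjI)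
    show "degree (monom 1 (p * 2) * monom 1 (Suc u) :: 'k poly) = u + 2 * p + 1"
      by (simp add: mult_monom degree_monom_eq)
    show "\<forall>(x, y)\<in>curve. ev (monom 1 (p * 2) * monom 1 (Suc u)) x y = x\<^sup>2 * y * ev (monom 1 u) x y"
      by (simp only: ev_monom_mult ev_monom sm sd) (simp add: algebra_simps)
  qed
next
  case True
  define i where "i = u div p"
  have u: "u = p * i + (p - 1)"
    using True by (metis i_def mult_div_mod_eq)
  \<comment> \<open>The expansion of x^(i + 2) y^p by the curve equation. The term \<kappa> x^(i +
    3) has the largest pole order, and \<kappa> \<noteq> 0 makes the degree exact.\<close>
  define b where "b = monom \<kappa> (p * (i + 3)) + (monom 1 (p * (i + 2) + 1) - monom \<gamma> (p * (i + 2)) + monom h (p * i))"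
  have "degree (monom 1 (p * (i + 2) + 1) - monom \<gamma> (p * (i + 2)) + monom h (p * i)) \<le> p * (i + 2) + 1"
    by (intro degree_add_le degree_diff_le order_trans[OF degree_monom_le]) auto
  also have "p * (i + 2) + 1 < p * (i + 3)"
    using p_gt_1'' by (simp add: algebra_simps)
  finally have "degree b = p * (i + 3)"
    unfolding b_def using kappa by (subst degree_add_eq_left) (auto simp: degree_monom_eq)
  also have "\<dots> = u + 2 * p + 1"
    unfolding u using p_gt_1'' by (simp add: algebra_simps)
  finally have "degree b = u + 2 * p + 1" .
  moreover have "ev b x y = x\<^sup>2 * y * ev (monom 1 u) x y" if "(x, y) \<in> curve" for x y
  proof -
    have x: "x \<noteq> 0" and y: "y ^ p = y + \<kappa> * x + h / x\<^sup>2 - \<gamma>"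
      using that by (auto simp: curve_def)
    have m: "(p * (i + 2) + 1) mod p = 1" "(p * (i + 2) + 1) div p = i + 2"
      "(p * j) mod p = 0" "(p * j) div p = j" for j
    proof -
      show "(p * (i + 2) + 1) mod p = 1"
        using p_gt_1'' mod_mult_self4[of p "i + 2" 1] by (simp only: mod_less)
      show "(p * (i + 2) + 1) div p = i + 2"
        using p_gt_1'' div_mult_self4[of p "i + 2" 1] by (simp only: div_less)
    qed (use p_gt_1'' in auto)
    have evd: "ev (c - d) x y = ev c x y - ev d x y" for c d
      using ev_add[of c "- d" x y] ev_smult[of "- 1" d x y] by simp
    have "ev b x y = \<kappa> * x ^ (i + 3) + (x ^ (i + 2) * y - \<gamma> * x ^ (i + 2) + h * x ^ i)"
      unfolding b_def ev_add evd ev_monom m by simp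
    also have "\<dots> = x ^ (i + 2) * (y + \<kappa> * x + h / x\<^sup>2 - \<gamma>)"
      using x by (simp add: field_simps power_add power2_eq_square power3_eq_cube)
    also have "\<dots> = x ^ (i + 2) * y ^ p" by (simp add: y)
    also have "\<dots> = x\<^sup>2 * y * (x ^ i * y ^ (p - 1))"
      using p_gt_1'' by (simp add: power_add power2_eq_square power_eq_if)
    also have "x ^ i * y ^ (p - 1) = ev (monom 1 u) x y"
      using True by (simp add: ev_monom i_def)
    finally show ?thesis .
  qed
  ultimately show ?thesis by blast
qed

lemma ev_mult_y:
  assumes "b \<noteq> 0"
  shows "\<exists>b'. degree b' = degree b + 2 * p + 1 \<and> (\<forall>(x, y)\<in>curve. ev b' x y = x\<^sup>2 * y * ev b x y)"
proof -
  obtain Y where Y: "\<And>u. degree (Y u) = u + 2 * p + 1"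
      "\<And>u x y. (x, y) \<in> curve \<Longrightarrow> ev (Y u) x y = x\<^sup>2 * y * ev (monom 1 u) x y"
  proof -
    have "\<forall>u. \<exists>b. degree b = u + 2 * p + 1 \<and> (\<forall>z\<in>curve. ev b (fst z) (snd z) = (fst z)\<^sup>2 * snd z * ev (monom 1 u) (fst z) (snd z))"
      using ev_mult_y_monom by (simp add: case_prod_unfold)
    then obtain Y where "\<forall>u. degree (Y u) = u + 2 * p + 1 \<and>
        (\<forall>z\<in>curve. ev (Y u) (fst z) (snd z) = (fst z)\<^sup>2 * snd z * ev (monom 1 u) (fst z) (snd z))"
      by (elim choice[THEN exE]) blast
    hence "degree (Y u) = u + 2 * p + 1" "(x, y) \<in> curve \<Longrightarrow> ev (Y u) x y = x\<^sup>2 * y * ev (monom 1 u) x y" for u x y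
      by (auto dest!: spec[of _ u] bspec[of _ _ "(x, y)"])
    thus ?thesis by (rule that)
  qed
  define b' where "b' = (\<Sum>u\<le>degree b. smult (coeff b u) (Y u))"
  define N where "N = degree b + 2 * p + 1"
  have "degree b' \<le> N"
    unfolding b'_def N_def by (intro degree_sum_le order_trans[OF degree_smult_le]) (auto simp: Y)
  moreover have "coeff b' N = lead_coeff b * coeff (Y (degree b)) N"
  proof -
    have "coeff b' N = (\<Sum>u\<le>degree b. coeff b u * coeff (Y u) N)"
      by (simp add: b'_def coeff_sum)
    also have "\<dots> = (\<Sum>u\<in>{degree b}. coeff b u * coeff (Y u) N)"
      by (rule sum.mono_neutral_right) (auto simp: Y N_def coeff_eq_0)
    finally show ?thesis by simp
  qed
  moreover have "coeff (Y (degree b)) N \<noteq> 0"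
    using Y(1)[of "degree b"] by (metis N_def add_is_0 degree_0 leading_coeff_0_iff one_neq_zero)
  ultimately have "degree b' = N"
    using assms by (metis le_antisym le_degree leading_coeff_0_iff mult_eq_0_iff)
  moreover have "ev b' x y = x\<^sup>2 * y * ev b x y" if "(x, y) \<in> curve" for x y
  proof -
    have "ev b' x y = (\<Sum>u\<le>degree b. coeff b u * (x\<^sup>2 * y * (x ^ (u div p) * y ^ (u mod p))))"
      unfolding b'_def ev_sum ev_smult Y(2)[OF that] ev_monom by simp
    also have "\<dots> = x\<^sup>2 * y * (\<Sum>u\<le>degree b. coeff b u * (x ^ (u div p) * y ^ (u mod p)))"
      unfolding sum_distrib_left by (intro sum.cong refl) (simp only: mult_ac)
    finally show ?thesis by (simp only: ev_def)
  qed
  ultimately show ?thesis unfolding N_def by blast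
qed

lemma ev_mult_y_pow:
  assumes "b \<noteq> 0"
  shows "\<exists>b'. b' \<noteq> 0 \<and> degree b' = degree b + j * (2 * p + 1) \<and>
    (\<forall>(x, y)\<in>curve. ev b' x y = (x\<^sup>2 * y) ^ j * ev b x y)"
proof (induction j)
  case 0
  show ?case using assms by (intro exI[of _ b]) auto
next
  case (Suc j)
  then obtain c where c: "c \<noteq> 0" "degree c = degree b + j * (2 * p + 1)"
    "\<forall>(x, y)\<in>curve. ev c x y = (x\<^sup>2 * y) ^ j * ev b x y" by blast
  then obtain d where d: "degree d = degree c + 2 * p + 1" "\<forall>(x, y)\<in>curve. ev d x y = x\<^sup>2 * y * ev c x y"
    using ev_mult_y by blast
  show ?case
  proof (intro exI[of _ d] conjI ballI)
    fix z assume z: "z \<in> curve"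
    obtain x y where [simp]: "z = (x, y)" by fastforce
    have "ev d x y = x\<^sup>2 * y * ev c x y" "ev c x y = (x\<^sup>2 * y) ^ j * ev b x y"
      using z c(3) d(2) by auto
    thus "case z of (x, y) \<Rightarrow> ev d x y = (x\<^sup>2 * y) ^ Suc j * ev b x y"
      by (simp add: mult_ac)
  qed (use c d in auto)
qed


text \<open>This is y^(p^m) - y for a point (x, y) of the curve, a function of x alone.\<close>

definition frobsum :: "nat \<Rightarrow> 'k \<Rightarrow> 'k" where
  "frobsum m x = (\<Sum>l<m. (\<kappa> * x + h / x\<^sup>2 - \<gamma>) ^ (p ^ l))"

lemma curve_frob: "(x, y) \<in> curve \<Longrightarrow> y ^ (p ^ m) = y + frobsum m x"
proof (induction m)
  case (Suc m)
  have "y ^ (p ^ Suc m) = (y ^ p) ^ (p ^ m)"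
    by (simp add: power_mult[symmetric] mult.commute)
  also have "y ^ p = y + (\<kappa> * x + h / x\<^sup>2 - \<gamma>)"
    using Suc.prems by (simp add: curve_def)
  also have "\<dots> ^ (p ^ m) = y ^ (p ^ m) + (\<kappa> * x + h / x\<^sup>2 - \<gamma>) ^ (p ^ m)"
    by (rule frob_add[OF p_char])
  finally show ?case using Suc by (simp add: frobsum_def)
qed (simp add: frobsum_def)

text \<open>On the curve y^(p^m) is y plus a rational function of x, so its multiplication costs
  only a polynomial in x once x^(2 p^(m - 1)), the largest denominator, is cleared. The pole order 2
  p^m + p^m adds up as expected.\<close>

lemma ev_mult_yM:
  assumes "b \<noteq> 0" and m: "m = Suc m'"
  shows "\<exists>b'. degree b' = degree b + 3 * p ^ m \<and>
    (\<forall>(x, y)\<in>curve. ev b' x y = x ^ (2 * p ^ m') * y ^ (p ^ m) * ev b x y)"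
proof -
  define M' where "M' = p ^ m'"
  have M': "M' \<ge> 1" "p * M' = p ^ m" using p_gt_1'' by (simp_all add: M'_def m)
  have mono: "p ^ l \<le> M'" if "l \<le> m'" for l
    using that p_gt_1'' by (simp add: M'_def)
  \<comment> \<open>The numerator x^2 (\<kappa> x + h / x^2 - \<gamma>). Below, \<open>T l\<close>
    is the term of index l of \<open>frobsum\<close> after multiplication by x^(2 M'), and the term
    with l = m' dominates the degree.\<close>
  define U where "U = [:h, 0, -\<gamma>, \<kappa>:]"
  have degU: "degree U = 3" using kappa by (simp add: U_def)
  define T where "T = (\<lambda>l. U ^ (p ^ l) * monom 1 (2 * (M' - p ^ l)))"
  have degT: "degree (T l) = 2 * M' + p ^ l" if "l \<le> m'" for l
  proof -
    have "U \<noteq> 0" using degU by auto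
    hence "degree (T l) = 3 * p ^ l + 2 * (M' - p ^ l)"
      unfolding T_def by (subst degree_mult_eq) (auto simp: degree_power_eq degU degree_monom_eq)
    thus ?thesis using mono[OF that] by simp
  qed
  have evT: "poly (T l) x = x ^ (2 * M') * (\<kappa> * x + h / x\<^sup>2 - \<gamma>) ^ (p ^ l)" if "l \<le> m'" "x \<noteq> 0" for l x
  proof -
    have "poly U x = x ^ 2 * (\<kappa> * x + h / x\<^sup>2 - \<gamma>)"
      using that(2) by (simp add: U_def field_simps power2_eq_square)
    hence "poly (T l) x = (x ^ 2) ^ (p ^ l) * x ^ (2 * (M' - p ^ l)) * (\<kappa> * x + h / x\<^sup>2 - \<gamma>) ^ (p ^ l)"
      by (simp add: T_def poly_monom power_mult_distrib)
    also have "(x ^ 2) ^ (p ^ l) * x ^ (2 * (M' - p ^ l)) = x ^ (2 * M')"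
      using mono[OF that(1)] by (simp add: power_mult[symmetric] power_add[symmetric] flip: distrib_left)
    finally show ?thesis .
  qed
  define G where "G = (\<Sum>l<m. T l)"
  have "G = T m' + (\<Sum>l<m'. T l)" by (simp add: G_def m add.commute)
  moreover have "degree (\<Sum>l<m'. T l) < degree (T m')"
  proof -
    have "degree (T l) < 3 * M'" if "l < m'" for l
    proof -
      have "p ^ l < M'" unfolding M'_def using that p_gt_1'' by (intro power_strict_increasing) auto
      thus ?thesis using degT[of l] that by simp
    qed
    hence "degree (\<Sum>l<m'. T l) < 3 * M'"
      using M'(1) by (cases "m' = 0") (auto intro!: degree_sum_less)
    thus ?thesis using degT[of m'] by (simp add: M'_def)
  qed
  ultimately have degG: "degree G = 3 * M'"
    using degT[of m'] by (simp add: degree_add_eq_left M'_def)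
  have evG: "poly G x = x ^ (2 * M') * frobsum m x" if "x \<noteq> 0" for x
    unfolding G_def frobsum_def poly_sum sum_distrib_left
    by (intro sum.cong refl evT) (use that m in auto)
  obtain c where c: "degree c = degree b + 2 * p + 1" "\<forall>(x, y)\<in>curve. ev c x y = x\<^sup>2 * y * ev b x y"
    using ev_mult_y[OF assms(1)] by blast
  define b' where "b' = pcompose G (monom 1 p) * b + monom 1 (p * (2 * M' - 2)) * c"
  have "c \<noteq> 0" using c(1) by auto
  hence d1: "degree (monom 1 (p * (2 * M' - 2)) * c) = p * (2 * M' - 2) + (degree b + 2 * p + 1)"
    by (subst degree_mult_eq) (auto simp: degree_monom_eq c(1))
  have "p * (2 * M' - 2) + 2 * p = 2 * (p * M')"
    using M'(1) by (simp add: algebra_simps diff_mult_distrib2)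
  hence d1': "degree (monom 1 (p * (2 * M' - 2)) * c) = degree b + 2 * (p * M') + 1"
    using d1 by simp
  have "pcompose G (monom 1 p) \<noteq> 0"
    using degree_pcompose_monom[of G] degG M'(1) p_gt_1'' by (metis degree_0 mult_is_0 not_one_le_zero zero_neq_numeral less_zeroE)
  hence d2: "degree (pcompose G (monom 1 p) * b) = degree b + 3 * (p * M')"
    using assms(1) by (subst degree_mult_eq) (auto simp: degree_pcompose_monom degG simp del: degree_pcompose)
  have "1 < p * M'" using M'(1) p_gt_1'' by (metis One_nat_def less_le_trans mult.right_neutral mult_le_mono2)
  hence "degree b' = degree b + 3 * p ^ m"
    unfolding b'_def using d1' d2 M'(2) by (subst degree_add_eq_left) auto
  moreover have "ev b' x y = x ^ (2 * p ^ m') * y ^ (p ^ m) * ev b x y" if "(x, y) \<in> curve" for x y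
  proof -
    have x: "x \<noteq> 0" using that by (simp add: curve_def)
    have "ev b' x y = x ^ (2 * M') * frobsum m x * ev b x y + x ^ (2 * M' - 2) * (x\<^sup>2 * y * ev b x y)"
      unfolding b'_def ev_add ev_pcompose_mult ev_monom_mult evG[OF x] using c(2) that by auto
    also have "x ^ (2 * M' - 2) * (x\<^sup>2 * y * ev b x y) = x ^ (2 * M' - 2 + 2) * y * ev b x y"
      by (simp only: power_add mult.assoc)
    also have "2 * M' - 2 + 2 = 2 * M'" using M'(1) by simp
    finally show ?thesis
      using curve_frob[OF that, of m] by (simp add: algebra_simps M'_def)
  qed
  ultimately show ?thesis by blast
qed

lemma ev_mult_yM_pow:
  assumes "b \<noteq> 0" and m: "m = Suc m'"
  shows "\<exists>b'. b' \<noteq> 0 \<and> degree b' = degree b + j * (3 * p ^ m) \<and>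
    (\<forall>(x, y)\<in>curve. ev b' x y = (x ^ (2 * p ^ m') * y ^ (p ^ m)) ^ j * ev b x y)"
proof (induction j)
  case 0
  show ?case using assms by (intro exI[of _ b]) auto
next
  case (Suc j)
  then obtain c where c: "c \<noteq> 0" "degree c = degree b + j * (3 * p ^ m)"
    "\<forall>(x, y)\<in>curve. ev c x y = (x ^ (2 * p ^ m') * y ^ (p ^ m)) ^ j * ev b x y" by blast
  then obtain d where d: "degree d = degree c + 3 * p ^ m"
    "\<forall>(x, y)\<in>curve. ev d x y = x ^ (2 * p ^ m') * y ^ (p ^ m) * ev c x y"
    using ev_mult_yM[OF _ m] by blast
  show ?case
  proof (intro exI[of _ d] conjI ballI)
    fix z assume z: "z \<in> curve"
    obtain x y where [simp]: "z = (x, y)" by fastforce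
    have "ev d x y = x ^ (2 * p ^ m') * y ^ (p ^ m) * ev c x y"
      "ev c x y = (x ^ (2 * p ^ m') * y ^ (p ^ m)) ^ j * ev b x y"
      using z c(3) d(2) by auto
    thus "case z of (x, y) \<Rightarrow> ev d x y = (x ^ (2 * p ^ m') * y ^ (p ^ m)) ^ Suc j * ev b x y"
      by (simp only: \<open>z = (x, y)\<close> prod.case power_Suc mult.assoc)
  next
    show "d \<noteq> 0" using d(1) p_gt_1'' by auto
  qed (use c d in auto)
qed

definition mon :: "nat \<Rightarrow> 'k \<Rightarrow> 'k \<Rightarrow> 'k" where
  "mon u x y = x ^ (u div p) * y ^ (u mod p)"

text \<open>A factor y^j needs x^(2 j), and the j'-th power of y^(p^m) needs x^(2 p^(m - 1) j').
  \<open>N\<close> pays for the worst case j = j' = p - 1, so the same power of x serves all u and v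
  and the degree is affine in u and v.\<close>

lemma ev_mon_mon:
  assumes m: "m = Suc m'" and N: "N = 2 * (p - 1) + 2 * p ^ m' * (p - 1)"
  shows "\<exists>b. degree b = p * N + u + p ^ m * v \<and>
    (\<forall>(x, y)\<in>curve. ev b x y = x ^ N * mon u x y * mon v x y ^ (p ^ m))"
proof -
  define M' where "M' = p ^ m'"
  define i j i' j' where "i = u div p" and "j = u mod p" and "i' = v div p" and "j' = v mod p"
  have uv: "u = p * i + j" "v = p * i' + j'" and jl: "j \<le> p - 1" "j' \<le> p - 1"
  proof -
    have "u mod p < p" "v mod p < p" using p_gt_1'' by auto
    thus "j \<le> p - 1" "j' \<le> p - 1" unfolding j_def j'_def by linarith+
  qed (simp_all add: i_def j_def i'_def j'_def)
  \<comment> \<open>The part of x^N that these particular exponents leave over; it is multiplied in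
    without any denominator to clear.\<close>
  define K where "K = N - 2 * j - 2 * M' * j'"
  have "2 * j \<le> 2 * (p - 1)" "2 * M' * j' \<le> 2 * M' * (p - 1)"
    using jl by (auto intro!: mult_le_mono2)
  moreover have "N = 2 * (p - 1) + 2 * M' * (p - 1)" by (simp add: N M'_def)
  ultimately have NK: "N = K + 2 * j + 2 * M' * j'" unfolding K_def by linarith
  define b0 where "b0 = monom (1::'k) (p * (i + i' * p ^ m + K))"
  have b0: "b0 \<noteq> 0" "degree b0 = p * (i + i' * p ^ m + K)" by (simp_all add: b0_def degree_monom_eq)
  obtain b1 where b1: "b1 \<noteq> 0" "degree b1 = degree b0 + j * (2 * p + 1)"
      "\<forall>(x, y)\<in>curve. ev b1 x y = (x\<^sup>2 * y) ^ j * ev b0 x y"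
    using ev_mult_y_pow[OF b0(1), of j] by blast
  obtain b2 where b2: "b2 \<noteq> 0" "degree b2 = degree b1 + j' * (3 * p ^ m)"
      "\<forall>(x, y)\<in>curve. ev b2 x y = (x ^ (2 * p ^ m') * y ^ (p ^ m)) ^ j' * ev b1 x y"
    using ev_mult_yM_pow[OF b1(1) m, of j'] by blast
  have pm: "p ^ m = p * M'" by (simp add: m M'_def)
  show ?thesis
  proof (intro exI[of _ b2] conjI ballI)
    show "degree b2 = p * N + u + p ^ m * v"
      unfolding b2 b1 b0 NK uv pm by (simp add: algebra_simps)
  next
    fix z assume z: "z \<in> curve"
    obtain x y where [simp]: "z = (x, y)" by fastforce
    have "ev b2 x y = (x ^ (2 * M') * y ^ (p ^ m)) ^ j' * ev b1 x y" "ev b1 x y = (x\<^sup>2 * y) ^ j * ev b0 x y"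
      using z b1(3) b2(3) by (auto simp: M'_def)
    hence "ev b2 x y = (x ^ (2 * M') * y ^ (p ^ m)) ^ j' * ((x\<^sup>2 * y) ^ j * ev b0 x y)" by simp
    also have "ev b0 x y = x ^ (i + i' * p ^ m + K)"
      using p_gt_1'' by (simp add: b0_def ev_monom)
    also have "(x ^ (2 * M') * y ^ (p ^ m)) ^ j' * ((x\<^sup>2 * y) ^ j * x ^ (i + i' * p ^ m + K)) =
        x ^ N * (x ^ i * y ^ j) * (x ^ i' * y ^ j') ^ (p ^ m)"
      by (simp add: NK power_mult_distrib power_add power_mult[symmetric] mult_ac)
    finally show "case z of (x, y) \<Rightarrow> ev b2 x y = x ^ N * mon u x y * mon v x y ^ (p ^ m)"
      by (simp add: mon_def i_def j_def i'_def j'_def)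
  qed
qed

text \<open>The coefficient of y^l, as a polynomial in x, of the function represented by
  \<open>b\<close>.\<close>

definition comp :: "'k poly \<Rightarrow> nat \<Rightarrow> 'k poly" where
  "comp b l = (\<Sum>i\<le>degree b div p. monom (coeff b (i * p + l)) i)"

lemma ev_comp: "ev b x y = (\<Sum>l<p. poly (comp b l) x * y ^ l)"
proof -
  define K where "K = Suc (degree b div p)"
  have "degree b < K * p" using p_gt_1'' by (simp add: K_def dividend_less_div_times)
  hence "ev b x y = (\<Sum>u<K * p. coeff b u * (x ^ (u div p) * y ^ (u mod p)))"
    unfolding ev_def by (intro sum.mono_neutral_left) (auto simp: coeff_eq_0)
  also have "\<dots> = (\<Sum>i<K. \<Sum>u\<in>{i * p..<i * p + p}. coeff b u * (x ^ (u div p) * y ^ (u mod p)))"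
    by (rule sum.nat_group[symmetric])
  also have "\<dots> = (\<Sum>i<K. \<Sum>l<p. coeff b (i * p + l) * (x ^ i * y ^ l))"
  proof (rule sum.cong[OF refl])
    fix i
    show "(\<Sum>u\<in>{i * p..<i * p + p}. coeff b u * (x ^ (u div p) * y ^ (u mod p))) =
        (\<Sum>l<p. coeff b (i * p + l) * (x ^ i * y ^ l))"
    proof (rule sum.reindex_bij_witness[of _ "\<lambda>l. i * p + l" "\<lambda>u. u - i * p"])
      fix u assume u: "u \<in> {i * p..<i * p + p}"
      then obtain l where l: "u = i * p + l" by (metis atLeastLessThan_iff le_Suc_ex)
      hence "l < p" using u by simp
      thus "i * p + (u - i * p) = u" "u - i * p \<in> {..<p}"
        "coeff b (i * p + (u - i * p)) * (x ^ i * y ^ (u - i * p)) = coeff b u * (x ^ (u div p) * y ^ (u mod p))"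
        by (simp_all add: l)
    qed auto
  qed
  also have "\<dots> = (\<Sum>l<p. \<Sum>i<K. coeff b (i * p + l) * (x ^ i * y ^ l))"
    by (rule sum.swap)
  also have "\<dots> = (\<Sum>l<p. poly (comp b l) x * y ^ l)"
    by (simp add: comp_def poly_sum poly_monom sum_distrib_right K_def lessThan_Suc_atMost mult.assoc)
  finally show ?thesis .
qed

lemma degree_comp: "degree (comp b l) \<le> degree b div p"
  unfolding comp_def by (intro degree_sum_le order_trans[OF degree_monom_le]) auto

lemma comp_nonzero:
  assumes "b \<noteq> 0"
  shows "\<exists>l<p. comp b l \<noteq> 0"
proof (intro exI conjI)
  show "degree b mod p < p" using p_gt_1'' by simp
  have "coeff (comp b (degree b mod p)) (degree b div p) = lead_coeff b"
    by (simp add: comp_def coeff_sum)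
  thus "comp b (degree b mod p) \<noteq> 0" using assms by auto
qed


text \<open>With M = p^m the field has M^2 elements. Linear algebra yields a nontrivial relation
  \<Sum> c' mon_u mon_v^M = 0 valid on the whole curve. Taking M-th roots of the coefficients and
  exchanging u and v yields a function whose M-th power agrees with that relation at rational
  points, since there the map z \<mapsto> z^(M^2) is the identity. It vanishes at all these points
  but not identically, and its pole order bounds the number of its zeros.\<close>

lemma stepanov:
  assumes m: "m \<ge> 2"
    and Z: "\<And>x. x \<in> Z \<Longrightarrow> x \<noteq> 0 \<and> x ^ (p ^ (2 * m)) = x \<and>
      (\<forall>y. (x, y) \<in> curve \<longrightarrow> y ^ (p ^ (2 * m)) = y)"
  shows "finite Z \<and> card Z \<le> p ^ (2 * m - 1) + 9 * p ^ m"
proof -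
  define M where "M = p ^ m"
  obtain m' where m': "m = Suc m'" using m by (cases m) auto
  define M' where "M' = p ^ m'"
  have MM': "M = p * M'" by (simp add: M_def M'_def m')
  have Q: "p ^ (2 * m) = M * M" by (simp add: M_def mult_2 power_add)
  have "p ^ 1 < p ^ m" using m p_gt_1'' by (intro power_strict_increasing) auto
  hence pM: "p < M" by (simp add: M_def)
  define N where "N = 2 * (p - 1) + 2 * M' * (p - 1)"
  have N: "N = 2 * (p - 1) + 2 * p ^ m' * (p - 1)" by (simp add: N_def M'_def)
  have "p * N = 2 * (p - 1) * (p + M)" by (cases p) (simp_all add: N_def MM' algebra_simps)
  also have "\<dots> \<le> 2 * (p - 1) * (2 * M)" using pM by (intro mult_left_mono) auto
  finally have pN: "p * N \<le> 4 * (p - 1) * M" by simp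
  \<comment> \<open>R * M unknowns must outnumber the D + 1 equations. The surplus 4 p over M pays
    for p N \<le> 4 (p - 1) M; the strict inequality then rests on p < M, that is, on m \<ge>
    2.\<close>
  define R where "R = M + 4 * p"
  obtain B where B: "\<And>u v. degree (B u v) = p * N + u + M * v"
      "\<And>u v x y. (x, y) \<in> curve \<Longrightarrow> ev (B u v) x y = x ^ N * mon u x y * mon v x y ^ M"
  proof -
    have "\<forall>u v. \<exists>b. degree b = p * N + u + M * v \<and>
        (\<forall>z\<in>curve. ev b (fst z) (snd z) = fst z ^ N * mon u (fst z) (snd z) * mon v (fst z) (snd z) ^ M)"
      using ev_mon_mon[OF m' N] by (simp add: case_prod_unfold M_def)
    then obtain B where B: "\<forall>u v. degree (B u v) = p * N + u + M * v \<and>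
        (\<forall>z\<in>curve. ev (B u v) (fst z) (snd z) = fst z ^ N * mon u (fst z) (snd z) * mon v (fst z) (snd z) ^ M)"
      by metis
    have "degree (B u v) = p * N + u + M * v"
      "(x, y) \<in> curve \<Longrightarrow> ev (B u v) x y = x ^ N * mon u x y * mon v x y ^ M" for u v x y
      using conjunct1[OF spec[OF spec[OF B, of u], of v]]
        bspec[OF conjunct2[OF spec[OF spec[OF B, of u], of v]], of "(x, y)"] by simp_all
    thus ?thesis by (rule that)
  qed
  define I where "I = {..<R} \<times> {..<M}"
  define D where "D = p * N + (R - 1) + M * (M - 1)"
  have card: "card {..D} < card I"
  proof -
    have "D + 1 = p * N + R + M * (M - 1)" using p_gt_1'' by (simp add: D_def R_def)
    also have "\<dots> \<le> 4 * (p - 1) * M + (M + 4 * p) + M * (M - 1)" using pN by (simp add: R_def)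
    also have "\<dots> = 4 * p * M - 4 * M + 4 * p + M * M"
    proof -
      have "M + M * (M - 1) = M * M" using pM by (cases M) auto
      moreover have "4 * (p - 1) * M = 4 * p * M - 4 * M" by (simp add: algebra_simps diff_mult_distrib2)
      ultimately show ?thesis by simp
    qed
    also have "\<dots> < R * M"
    proof -
      have "4 * M \<le> 4 * p * M" using p_gt_1'' by simp
      moreover have "R * M = M * M + 4 * p * M" by (simp add: R_def algebra_simps)
      ultimately show ?thesis using pM by linarith
    qed
    finally show ?thesis by (simp add: I_def)
  qed
  obtain c' where c': "\<exists>w\<in>I. c' w \<noteq> 0"
      "\<forall>e\<in>{..D}. (\<Sum>w\<in>I. c' w * coeff (B (fst w) (snd w)) e) = 0"
    using nontrivial_kernel[OF _ _ card, of "\<lambda>w e. coeff (B (fst w) (snd w)) e"] by (auto simp: I_def)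
  have "(\<Sum>w\<in>I. smult (c' w) (B (fst w) (snd w))) = 0"
  proof (rule poly_eqI)
    fix e
    show "coeff (\<Sum>w\<in>I. smult (c' w) (B (fst w) (snd w))) e = coeff 0 e"
    proof (cases "e \<le> D")
      case False
      have "degree (B (fst w) (snd w)) < e" if "w \<in> I" for w
      proof -
        have "fst w \<le> R - 1" "M * snd w \<le> M * (M - 1)" using that by (auto simp: I_def)
        thus ?thesis using False unfolding B D_def by linarith
      qed
      thus ?thesis by (simp add: coeff_sum coeff_eq_0)
    qed (use c'(2) in \<open>simp add: coeff_sum\<close>)
  qed
  note zero = this
  have ev0: "(\<Sum>w\<in>I. c' w * (x ^ N * mon (fst w) x y * mon (snd w) x y ^ M)) = 0" if "(x, y) \<in> curve" for x y
  proof -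
    have "(\<Sum>w\<in>I. c' w * ev (B (fst w) (snd w)) x y) = ev (\<Sum>w\<in>I. smult (c' w) (B (fst w) (snd w))) x y"
      by (simp only: ev_sum ev_smult)
    also have "\<dots> = 0" by (simp only: zero ev_0)
    finally show ?thesis by (simp only: B(2)[OF that])
  qed
  have "\<exists>z. z ^ M = c' w" for w using nth_root_exists[of M "c' w"] pM by auto
  then obtain c where c: "\<And>w. c w ^ M = c' w" by metis
  \<comment> \<open>The roles of the two indices are exchanged: now the index raised to the M-th
    power ranges below R and the other one below M. The degrees p N + snd w + M fst w are therefore
    distinct, as for digits in base M, which makes \<open>b\<close> nonzero.\<close>
  define b where "b = (\<Sum>w\<in>I. smult (c w) (B (snd w) (fst w)))"
  have "b \<noteq> 0"
    unfolding b_def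
  proof (rule degree_sum_distinct)
    show "inj_on (\<lambda>w. degree (B (snd w) (fst w))) I"
    proof (rule inj_onI)
      fix w w' assume w: "w \<in> I" "w' \<in> I" "degree (B (snd w) (fst w)) = degree (B (snd w') (fst w'))"
      hence lt: "snd w < M" "snd w' < M" and eq: "snd w + M * fst w = snd w' + M * fst w'"
        by (auto simp: I_def B)
      have "snd w = snd w'" using arg_cong[OF eq, of "\<lambda>n. n mod M"] lt by simp
      thus "w = w'" using eq pM by (auto simp: prod_eq_iff)
    qed
    show "\<forall>w\<in>I. B (snd w) (fst w) \<noteq> 0"
    proof
      fix w assume "w \<in> I"
      have "p * N > 0" using p_gt_1'' by (auto simp: N_def)
      thus "B (snd w) (fst w) \<noteq> 0" using B(1)[of "snd w" "fst w"] by (metis add_is_0 degree_0 less_not_refl)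
    qed
    show "\<exists>w\<in>I. c w \<noteq> 0" using c'(1) c pM by (metis power_0_left less_nat_zero_code)
  qed (auto simp: I_def)
  have evb: "ev b x y = 0" if "(x, y) \<in> curve" "x ^ (M * M) = x" "y ^ (M * M) = y" for x y
  proof -
    have pw: "(mon u x y ^ M) ^ M = mon u x y" for u
      using that(2,3) by (simp add: mon_def power_mult_distrib power_mult[symmetric] mult.commute[of _ "M * M"] mult.assoc)
         (simp add: power_mult)
    define G where "G = (\<Sum>w\<in>I. c w * (mon (snd w) x y * mon (fst w) x y ^ M))"
    have "G ^ M = (\<Sum>w\<in>I. (c w * (mon (snd w) x y * mon (fst w) x y ^ M)) ^ M)"
      unfolding G_def M_def by (rule frob_sum[OF p_char])
    also have "\<dots> = (\<Sum>w\<in>I. c' w * (mon (fst w) x y * mon (snd w) x y ^ M))"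
      by (simp add: power_mult_distrib c pw mult_ac)
    finally have "x ^ N * G ^ M = (\<Sum>w\<in>I. c' w * (x ^ N * mon (fst w) x y * mon (snd w) x y ^ M))"
      by (simp add: sum_distrib_left mult_ac)
    also have "\<dots> = 0" by (rule ev0[OF that(1)])
    finally have "G = 0" using that(1) by (auto simp: curve_def)
    moreover have "ev b x y = x ^ N * G"
      by (simp add: b_def ev_sum ev_smult B(2)[OF that(1)] sum_distrib_left mult_ac G_def)
    ultimately show ?thesis by simp
  qed
  obtain l where l: "l < p" "comp b l \<noteq> 0" using comp_nonzero[OF \<open>b \<noteq> 0\<close>] by blast
  \<comment> \<open>All p points (x, y0 + i) above an x in Z are rational. Hence \<open>b\<close>, a
    polynomial in y of degree below p for fixed x, has p zeros there, and each of its coefficients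
    \<open>comp b l\<close> vanishes at x. This gains a factor p over counting zeros point by
    point.\<close>
  have "Z \<subseteq> {x. poly (comp b l) x = 0}"
  proof
    fix x assume x: "x \<in> Z"
    define u where "u = \<kappa> * x + h / x\<^sup>2 - \<gamma>"
    have "degree (monom 1 p - monom 1 1 - [:u:]) > 0" for u :: 'k
    proof -
      have "degree (monom 1 p + (- monom 1 1 - [:u:])) = degree (monom (1::'k) p)"
        using p_gt_1'' by (intro degree_add_eq_left)
          (auto simp: degree_monom_eq intro!: le_less_trans[OF degree_diff_le[of _ 1]])
      also have "\<dots> = p" by (simp add: degree_monom_eq)
      finally have "degree (monom 1 p + (- monom 1 1 - [:u:])) > 0" using p_gt_1'' by simp
      moreover have "monom 1 p - monom 1 1 - [:u:] = monom 1 p + (- monom 1 1 - [:u:])" by simp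
      ultimately show ?thesis by metis
    qed
    then obtain y0 where "poly (monom 1 p - monom 1 1 - [:u:]) y0 = 0"
      using alg_closed_imp_poly_has_root by blast
    hence y0: "y0 ^ p = y0 + u" by (simp add: poly_monom algebra_simps)
    define P where "P = (\<Sum>j<p. monom (poly (comp b j) x) j)"
    have "poly P y = 0" if y: "y \<in> (\<lambda>i. y0 + i) ` fixn p 1" for y
    proof -
      obtain i where i: "y = y0 + i" "i ^ p = i" using y by (auto simp: fixn_def[OF p_char])
      have "y ^ p = y + u" using frob_add[OF p_char, of y0 i 1] i y0 by simp
      hence cur: "(x, y) \<in> curve" using Z[OF x] by (simp add: curve_def u_def)
      have "ev b x y = 0" using evb[OF cur] Z[OF x] cur Q by simp
      thus ?thesis by (simp add: ev_comp P_def poly_sum poly_monom)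
    qed
    hence sub: "(\<lambda>i. y0 + i) ` fixn p 1 \<subseteq> {y. poly P y = 0}" by auto
    have "P = 0"
    proof (rule ccontr)
      assume P: "P \<noteq> 0"
      have "card ((\<lambda>i. y0 + i) ` fixn p 1) = p"
        using card_fixn[OF p_char, of 1] by (subst card_image) auto
      hence "p \<le> card {y. poly P y = 0}"
        using card_mono[OF poly_roots_finite[OF P] sub] by simp
      also have "\<dots> \<le> degree P" by (rule poly_roots_degree[OF P])
      also have "\<dots> \<le> p - 1"
        unfolding P_def by (intro degree_sum_le order_trans[OF degree_monom_le]) auto
      finally show False using p_gt_1'' by simp
    qed
    hence "coeff P l = 0" by simp
    thus "x \<in> {x. poly (comp b l) x = 0}" using l(1) by (simp add: P_def coeff_sum)
  qed
  hence fin: "finite Z" and "card Z \<le> degree (comp b l)"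
    using l(2) poly_roots_finite[OF l(2)] card_mono poly_roots_degree[OF l(2)]
    by (auto intro: finite_subset order_trans)
  hence "card Z \<le> degree b div p" using degree_comp order_trans by blast
  hence "card Z * p \<le> degree b" using p_gt_1'' by (simp add: less_eq_div_iff_mult_less_eq)
  also have "degree b \<le> p * N + (M - 1) + M * (R - 1)"
    unfolding b_def
  proof (intro degree_sum_le order_trans[OF degree_smult_le])
    fix w assume "w \<in> I"
    hence "snd w \<le> M - 1" "M * fst w \<le> M * (R - 1)" by (auto simp: I_def)
    thus "degree (B (snd w) (fst w)) \<le> p * N + (M - 1) + M * (R - 1)" unfolding B by linarith
  qed (auto simp: I_def)
  also have "\<dots> \<le> 4 * (p - 1) * M + M * R"
  proof -
    have "(M - 1) + M * (R - 1) \<le> M * R"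
      using p_gt_1'' by (cases R) (auto simp: R_def)
    thus ?thesis using pN by simp
  qed
  also have "\<dots> \<le> (p ^ (2 * m - 1) + 9 * M) * p"
  proof -
    have "p ^ (2 * m - 1) * p = M * M"
      using Q m by (metis One_nat_def Suc_pred mult.commute nat_0_less_mult_iff not_numeral_le_zero power_Suc zero_less_numeral gr0I)
    moreover have "4 * (p - 1) * M \<le> 5 * (p * M)" by (simp add: algebra_simps diff_mult_distrib2)
    ultimately show ?thesis by (simp add: R_def algebra_simps)
  qed
  finally show ?thesis using fin p_gt_1'' by (simp add: M_def)
qed

end

section \<open>The Weil bound\<close>

text \<open>Applied to the exponents m, 2 m and 3 m, the hypothesis bounds the elementary symmetric
  functions of u^m, v^m, w^m. So u^m is a root of a cubic with controlled coefficients, norm u^m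
  \<le> K \<rho>^m with K independent of m, and m tends to infinity.\<close>

lemma three_power_sums_bound:
  fixes u v w :: complex and C \<rho> :: real
  assumes C: "C \<ge> 0" and \<rho>: "\<rho> > 0" and bd: "\<And>m. m \<ge> 2 \<Longrightarrow> norm (u ^ m + v ^ m + w ^ m) \<le> C * \<rho> ^ m"
  shows "norm u \<le> \<rho>"
proof (rule ccontr)
  assume "\<not> norm u \<le> \<rho>"
  hence gt: "norm u / \<rho> > 1" using \<rho> by (simp add: field_simps)
  define K where "K = 1 + C + (C\<^sup>2 + C) + (C ^ 3 + 3 * C\<^sup>2 + 2 * C)"
  have K: "norm u ^ m \<le> K * \<rho> ^ m" if m: "m \<ge> 2" for m
  proof -
    define R where "R = \<rho> ^ m"
    have R: "R > 0" using \<rho> by (simp add: R_def)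
    define x y z where "x = u ^ m" and "y = v ^ m" and "z = w ^ m"
    define s1 s2 s3 where "s1 = x + y + z" and "s2 = x ^ 2 + y ^ 2 + z ^ 2" and "s3 = x ^ 3 + y ^ 3 + z ^ 3"
    have s: "norm s1 \<le> C * R" "norm s2 \<le> C * R\<^sup>2" "norm s3 \<le> C * R ^ 3"
      using bd[of m] bd[of "m * 2"] bd[of "m * 3"] m
      by (simp_all add: s1_def s2_def s3_def x_def y_def z_def R_def power_mult)
    \<comment> \<open>Twice the second and six times the third elementary symmetric function of x,
      y, z.\<close>
    define e2 e3 where "e2 = s1\<^sup>2 - s2" and "e3 = s1 ^ 3 - 3 * s1 * s2 + 2 * s3"
    have "norm (s1\<^sup>2) \<le> (C * R)\<^sup>2"
      unfolding norm_power by (intro power_mono s) auto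
    hence e2: "norm e2 \<le> (C\<^sup>2 + C) * R\<^sup>2"
      using norm_triangle_ineq4[of "s1\<^sup>2" s2] s(2) by (simp add: e2_def power_mult_distrib algebra_simps)
    have "norm (s1 ^ 3) \<le> (C * R) ^ 3"
      unfolding norm_power by (intro power_mono s) auto
    moreover have "norm (3 * s1 * s2) \<le> 3 * (C * R) * (C * R\<^sup>2)"
      using s R C unfolding norm_mult by (intro mult_mono) auto
    moreover have "norm (2 * s3) \<le> 2 * (C * R ^ 3)"
      using s by (simp add: norm_mult)
    moreover have "norm e3 \<le> norm (s1 ^ 3) + norm (3 * s1 * s2) + norm (2 * s3)"
      unfolding e3_def by (intro order_trans[OF norm_triangle_ineq] add_mono norm_triangle_ineq4) auto
    ultimately have e3: "norm e3 \<le> (C ^ 3 + 3 * C\<^sup>2 + 2 * C) * R ^ 3"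
      by (simp add: power_mult_distrib algebra_simps power2_eq_square power3_eq_cube)
    have eq: "6 * x ^ 3 = 6 * s1 * x\<^sup>2 - 3 * e2 * x + e3"
      unfolding e2_def e3_def s1_def s2_def s3_def
      by (simp add: power2_eq_square power3_eq_cube algebra_simps)
    have "norm (6 * x ^ 3) \<le> norm (6 * s1 * x\<^sup>2 - 3 * e2 * x) + norm e3"
      unfolding eq by (rule norm_triangle_ineq)
    also have "\<dots> \<le> norm (6 * s1 * x\<^sup>2) + norm (3 * e2 * x) + norm e3"
      by (intro add_right_mono norm_triangle_ineq4)
    finally have "norm (6 * x ^ 3) \<le> norm (6 * s1 * x\<^sup>2) + norm (3 * e2 * x) + norm e3" .
    hence ineq: "6 * norm x ^ 3 \<le> 6 * norm s1 * (norm x)\<^sup>2 + 3 * norm e2 * norm x + norm e3"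
      by (simp add: norm_mult norm_power)
    show ?thesis
    proof (rule ccontr)
      assume "\<not> ?thesis"
      hence big: "norm x > K * R" by (simp add: x_def norm_power R_def)
      define t where "t = norm x"
      have K1: "K \<ge> 1" using C by (simp add: K_def)
      have "1 * R \<le> K * R" using K1 R by (intro mult_right_mono) auto
      hence tR: "t \<ge> R" using big by (simp add: t_def)
      have t0: "t > 0" using tR R by linarith
      have a1: "6 * norm s1 * t\<^sup>2 \<le> 6 * (C * R) * t\<^sup>2"
        using s by (intro mult_right_mono) auto
      have "R * t \<le> t * t" using tR t0 by (intro mult_right_mono) auto
      hence rr: "R\<^sup>2 * t \<le> R * t\<^sup>2" using R by (simp add: power2_eq_square mult_left_mono mult.assoc)
      have "3 * norm e2 * t \<le> 3 * ((C\<^sup>2 + C) * R\<^sup>2) * t"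
        using e2 t0 by (intro mult_right_mono) auto
      also have "\<dots> = 3 * (C\<^sup>2 + C) * (R\<^sup>2 * t)" by simp
      also have "\<dots> \<le> 3 * (C\<^sup>2 + C) * (R * t\<^sup>2)" using C rr by (intro mult_left_mono) auto
      finally have a2: "3 * norm e2 * t \<le> 3 * (C\<^sup>2 + C) * (R * t\<^sup>2)" .
      have "R\<^sup>2 \<le> t\<^sup>2" using tR R by (intro power_mono) auto
      hence "R ^ 3 \<le> R * t\<^sup>2" using R by (simp add: power3_eq_cube power2_eq_square mult_left_mono)
      hence "(C ^ 3 + 3 * C\<^sup>2 + 2 * C) * R ^ 3 \<le> (C ^ 3 + 3 * C\<^sup>2 + 2 * C) * (R * t\<^sup>2)"
        using C by (intro mult_left_mono) auto
      hence a3: "norm e3 \<le> (C ^ 3 + 3 * C\<^sup>2 + 2 * C) * (R * t\<^sup>2)" using e3 by linarith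
      have "6 * t ^ 3 \<le> (6 * C + 3 * (C\<^sup>2 + C) + (C ^ 3 + 3 * C\<^sup>2 + 2 * C)) * (R * t\<^sup>2)"
        using ineq a1 a2 a3 by (simp add: t_def algebra_simps)
      also have "\<dots> \<le> 6 * K * (R * t\<^sup>2)"
        using C R t0 by (intro mult_right_mono) (auto simp: K_def)
      also have "\<dots> = 6 * (K * R) * t\<^sup>2" by simp
      also have "\<dots> < 6 * t * t\<^sup>2" using big t0 by (intro mult_strict_right_mono) (auto simp: t_def)
      finally show False by (simp add: power2_eq_square power3_eq_cube)
    qed
  qed
  obtain n where n: "K < (norm u / \<rho>) ^ n" using real_arch_pow[OF gt] by blast
  also have "\<dots> \<le> (norm u / \<rho>) ^ (n + 2)" using gt by (intro power_increasing) auto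
  also have "\<dots> \<le> K" using K[of "n + 2"] \<rho> by (simp add: power_divide field_simps)
  finally show False by simp
qed

context
  fixes p :: nat and \<kappa> h :: "'k::{alg_closed_field, field_prime_char}"
  assumes p_char: "p = CHAR('k)"
    and kappa: "\<kappa> \<in> fixn p 1" and h: "h \<in> fixn p 1" and kappa0: "\<kappa> \<noteq> 0"
begin

text \<open>Stepanov's bound for the number of x with a given trace is only an upper bound. The p
  counts however add up to p^(2 m) - 1, so no count can lie far below its mean either. The loss of a
  factor p is harmless, since only the growth in m is used.\<close>

lemma Ssum_even_bound:
  assumes m: "m \<ge> 2"
  shows "norm (Ssum p \<kappa> h (2 * m)) \<le> 19 * real p * real p ^ m"
proof -
  define n where "n = 2 * m"
  have n: "n > 0" using m by (simp add: n_def)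
  define F where "F = fixn p n - {0::'k}"
  have p1: "p > 1" by (rule p_gt_1[OF p_char])
  have finF: "finite F" using finite_fixn[OF p_char n] by (simp add: F_def)
  have "(0::'k) \<in> fixn p n" using p1 by (simp add: fixn_def[OF p_char] zero_power)
  hence cardF: "card F = p ^ n - 1"
    using card_fixn[OF p_char n] finite_fixn[OF p_char n] by (simp add: F_def)
  define r where "r = ratf \<kappa> h"
  have tr1: "trace p n (r x) \<in> fixn p 1" if "x \<in> F" for x
  proof -
    have "r x ^ (p ^ n) = r x"
      using that ratf_frob[OF p_char kappa h, of x n] by (simp add: r_def F_def fixn_def[OF p_char])
    hence "(\<Sum>i<Suc n. r x ^ (p ^ i)) = trace p n (r x) + r x"
      by (simp add: trace_def[OF p_char kappa h])
    moreover have "(\<Sum>i<Suc n. r x ^ (p ^ i)) = r x + (\<Sum>i<n. r x ^ (p ^ Suc i))"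
      by (subst sum.lessThan_Suc_shift) simp
    ultimately have "(\<Sum>i<n. r x ^ (p ^ Suc i)) = trace p n (r x)" by simp
    moreover have "trace p n (r x) ^ (p ^ 1) = (\<Sum>i<n. r x ^ (p ^ Suc i))"
      unfolding trace_def[OF p_char kappa h] frob_sum[OF p_char] frob_frob[OF p_char] by simp
    ultimately show ?thesis by (simp add: fixn_def[OF p_char])
  qed
  define Z where "Z = (\<lambda>c. {x\<in>F. trace p n (r x) = c})"
  have cardZ: "card (Z c) \<le> p ^ (n - 1) + 9 * p ^ m" for c
  proof -
    \<comment> \<open>A root \<gamma> of this polynomial has trace c, so that the fibre over c
      becomes the set of x above which the curve with parameter \<gamma> has rational
      points.\<close>
    define P where "P = (\<Sum>i<n. monom (1::'k) (p ^ i)) - [:c:]"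
    obtain n' where n': "n = Suc n'" "n' \<noteq> 0" using m by (cases n) (auto simp: n_def)
    have "degree ((\<Sum>i<n'. monom (1::'k) (p ^ i)) - [:c:]) < p ^ n'"
    proof (rule degree_diff_less)
      show "degree (\<Sum>i<n'. monom (1::'k) (p ^ i)) < p ^ n'"
        using p1 by (intro degree_sum_less) (auto simp: degree_monom_eq)
    qed (use p1 in auto)
    moreover have "P = monom 1 (p ^ n') + ((\<Sum>i<n'. monom (1::'k) (p ^ i)) - [:c:])"
      by (simp add: P_def n')
    ultimately have "degree P = p ^ n'" by (simp add: degree_add_eq_left degree_monom_eq)
    hence "degree P > 0" using p1 by simp
    then obtain \<gamma> where "poly P \<gamma> = 0" using alg_closed_imp_poly_has_root by blast
    hence \<gamma>: "(\<Sum>i<n. \<gamma> ^ (p ^ i)) = c" by (simp add: P_def poly_sum poly_monom)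
    have "finite (Z c) \<and> card (Z c) \<le> p ^ (2 * m - 1) + 9 * p ^ m"
    proof (rule stepanov[OF p_char kappa0 m, where h = h and \<gamma> = \<gamma>], intro conjI allI impI)
      fix x assume x: "x \<in> Z c"
      thus "x \<noteq> 0" by (simp add: Z_def F_def)
      show "x ^ (p ^ (2 * m)) = x" using x by (simp add: Z_def F_def n_def fixn_def[OF p_char])
      fix y assume "(x, y) \<in> curve p \<kappa> h \<gamma>"
      hence "y ^ (p ^ n) = y + frobsum p \<kappa> h \<gamma> n x" by (rule curve_frob[OF p_char kappa0])
      also have "frobsum p \<kappa> h \<gamma> n x = trace p n (r x) - (\<Sum>i<n. \<gamma> ^ (p ^ i))"
        by (simp add: frobsum_def[OF p_char kappa0] trace_def[OF p_char kappa h] r_def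
          ratf_def[OF p_char kappa h] frob_diff[OF p_char] sum_subtractf)
      also have "\<dots> = 0" using x \<gamma> by (simp add: Z_def)
      finally show "y ^ (p ^ (2 * m)) = y" by (simp add: n_def)
    qed
    thus ?thesis by (simp add: n_def)
  qed
  have fin1: "finite (fixn p 1 :: 'k set)" and card1: "card (fixn p 1 :: 'k set) = p"
    using finite_fixn[OF p_char, of 1] card_fixn[OF p_char, of 1] by auto
  have split: "(\<Sum>x\<in>F. g (trace p n (r x))) = (\<Sum>c\<in>fixn p 1. of_nat (card (Z c)) * g c)"
    for g :: "'k \<Rightarrow> complex"
  proof -
    have "(\<Sum>c\<in>fixn p 1. of_nat (card (Z c)) * g c) = (\<Sum>c\<in>fixn p 1. \<Sum>x\<in>Z c. g (trace p n (r x)))"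
      by (simp add: Z_def)
    also have "\<dots> = (\<Sum>x\<in>F. g (trace p n (r x)))"
      unfolding Z_def using tr1 by (intro sum.group finF fin1) auto
    finally show ?thesis by simp
  qed
  \<comment> \<open>Deviation from the mean. The mean may be subtracted freely in the character sum
    because \<open>psi\<close> sums to 0 over the prime field.\<close>
  define a where "a = (\<lambda>c. real (card (Z c)) - real p ^ (n - 1))"
  have "complex_of_real (\<Sum>c\<in>fixn p 1. real (card (Z c))) = of_nat (card F)"
    using split[of "\<lambda>_. 1"] by simp
  hence "(\<Sum>c\<in>fixn p 1. real (card (Z c))) = real (card F)"
    by (metis of_real_eq_iff of_real_of_nat_eq)
  also have "\<dots> = real p ^ n - 1" using cardF p1 by (simp add: of_nat_diff)
  also have "real p ^ n = real p * real p ^ (n - 1)" using n by (simp add: power_eq_if)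
  finally have suma: "(\<Sum>c\<in>fixn p 1. a c) = - 1"
    using card1 by (simp add: a_def sum_subtractf)
  have ub: "a c \<le> 9 * real p ^ m" for c
  proof -
    have "real (card (Z c)) \<le> real (p ^ (n - 1) + 9 * p ^ m)" using cardZ by (intro of_nat_mono)
    thus ?thesis by (simp add: a_def)
  qed
  have "Ssum p \<kappa> h n = (\<Sum>c\<in>fixn p 1. of_nat (card (Z c)) * psi p c)"
    using split[of "psi p"] by (simp add: Ssum_def[OF p_char kappa h] F_def r_def)
  also have "\<dots> = (\<Sum>c\<in>fixn p 1. of_real (a c) * psi p c)"
    using sum_psi[OF p_char] by (simp add: a_def left_diff_distrib sum_subtractf sum_distrib_left[symmetric])
  also have "norm \<dots> \<le> (\<Sum>c\<in>fixn p 1. \<bar>a c\<bar>)"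
    by (rule order_trans[OF norm_sum]) (simp add: norm_mult norm_psi[OF p_char])
  \<comment> \<open>This uses only a \<le> 9 p^m: for a \<ge> 0 it reads 2 a \<le> 18 p^m, and for a
    < 0 the term - a is \<bar>a\<bar> itself. The sum of the - a is then known.\<close>
  also have "\<dots> \<le> (\<Sum>c\<in>fixn p 1. 18 * real p ^ m - a c)"
  proof (intro sum_mono)
    fix c show "\<bar>a c\<bar> \<le> 18 * real p ^ m - a c"
      using ub[of c] zero_le_power[of "real p" m] by (auto simp: abs_if)
  qed
  also have "\<dots> = 18 * (real p * real p ^ m) + 1"
    using suma card1 by (simp add: sum_subtractf)
  also have "\<dots> \<le> 19 * real p * real p ^ m"
  proof -
    have "1 \<le> real p * real p ^ m" using p1 by (metis less_imp_le of_nat_1 of_nat_less_iff one_le_power power_Suc)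
    thus ?thesis by simp
  qed
  finally show ?thesis by (simp add: n_def)
qed

text \<open>The L-function is a cubic polynomial in T, and Newton's identity turns its inverse roots
  a, b, c into S_n = - (a^n + b^n + c^n). Even n suffice to bound the inverse roots; n = 1 is the
  sum wanted.\<close>

lemma Ssum_1_bound: "norm (Ssum p \<kappa> h 1) \<le> 3 * sqrt (real p)"
proof -
  define S where "S = Ssum p \<kappa> h"
  define L where "L = Lsum p \<kappa> h"
  have p1: "p > 1" by (rule p_gt_1[OF p_char])
  have newton: "of_nat d * L d = (\<Sum>j=1..d. S j * L (d - j))" for d
    unfolding L_def S_def by (rule newton_identity[OF p_char kappa h])
  have L0: "L 0 = 1" unfolding L_def by (rule Lsum_0[OF p_char kappa h])
  have L4: "L d = 0" if "d \<ge> 4" for d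
    unfolding L_def by (rule Lsum_eq_0[OF p_char kappa h kappa0 that])
  obtain a b c where abc: "L 1 = - (a + b + c)" "L 2 = a * b + b * c + c * a" "L 3 = - (a * b * c)"
  proof -
    \<comment> \<open>The reversed L-polynomial, so that its roots are the inverse roots a, b,
      c.\<close>
    define P where "P = [:L 3, L 2, L 1, 1:]"
    have "P \<noteq> 0" "degree P = 3" "lead_coeff P = 1" by (simp_all add: P_def)
    then obtain A where A: "size A = 3" "P = (\<Prod>x\<in>#A. [:-x, 1:])"
      using alg_closed_imp_factorization[of P] by auto
    obtain a A1 where A1: "A = add_mset a A1" using A(1) by (cases A) auto
    obtain b A2 where A2: "A1 = add_mset b A2" using A(1) A1 by (cases A1) auto
    obtain c A3 where A3: "A2 = add_mset c A3" using A(1) A1 A2 by (cases A2) auto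
    have "A = {#a, b, c#}" using A(1) A1 A2 A3 by simp
    hence "P = [:-a, 1:] * ([:-b, 1:] * [:-c, 1:])" using A(2) by simp
    hence "L 1 = - (a + b + c) \<and> L 2 = a * b + b * c + c * a \<and> L 3 = - (a * b * c)"
      by (simp add: P_def algebra_simps)
    thus ?thesis using that by blast
  qed
  have S: "S n = - (a ^ n + b ^ n + c ^ n)" if "n \<ge> 1" for n
    using that
  proof (induction n rule: less_induct)
    case (less n)
    have S1: "S 1 = - (a + b + c)"
      using newton[of 1] L0 abc by simp
    have S2: "S 2 = - (a ^ 2 + b ^ 2 + c ^ 2)"
    proof -
      have "2 * L 2 = S 1 * L 1 + S 2 * L 0"
        using newton[of 2] by (simp add: numeral_2_eq_2)
      hence eq: "S 2 = 2 * L 2 - S 1 * L 1" using L0 by (simp add: eq_diff_eq add.commute)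
      show ?thesis unfolding eq S1 abc by (simp add: power2_eq_square algebra_simps)
    qed
    have S3: "S 3 = - (a ^ 3 + b ^ 3 + c ^ 3)"
    proof -
      have "3 * L 3 = S 1 * L 2 + S 2 * L 1 + S 3 * L 0"
        using newton[of 3] by (simp add: numeral_3_eq_3 numeral_2_eq_2)
      hence eq: "S 3 = 3 * L 3 - S 1 * L 2 - S 2 * L 1" using L0 by (simp add: eq_diff_eq add.commute add.assoc)
      show ?thesis unfolding eq S1 S2 abc by (simp add: power2_eq_square power3_eq_cube algebra_simps)
    qed
    consider "n = 1" | "n = 2" | "n = 3" | "n \<ge> 4" using less.prems by linarith
    thus ?case
    proof cases
      case 4
      then obtain k where k: "n = k + 4" by (metis le_add_diff_inverse2)
      \<comment> \<open>From here on L_n = 0 and only L_0, ..., L_3 survive in Newton's identity,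
        leaving the linear recurrence whose characteristic roots are a, b, c.\<close>
      have "0 = (\<Sum>j=1..n. S j * L (n - j))" using newton[of n] L4[OF 4] by simp
      also have "\<dots> = (\<Sum>j\<in>{k + 1..k + 4}. S j * L (n - j))"
        by (rule sum.mono_neutral_right) (auto simp: k L4)
      also have "\<dots> = S (k + 1) * L 3 + S (k + 2) * L 2 + S (k + 3) * L 1 + S n * L 0"
        by (simp add: k numeral_eq_Suc sum.atLeast_Suc_atMost add.assoc)
      finally have Sn: "S n = - (S (k + 1) * L 3 + S (k + 2) * L 2 + S (k + 3) * L 1)"
        unfolding L0 by (simp only: eq_neg_iff_add_eq_0 mult_1_right) (simp only: add.commute)
      have i: "S (k + 1) = - (a ^ k * a + b ^ k * b + c ^ k * c)"
        "S (k + 2) = - (a ^ k * a\<^sup>2 + b ^ k * b\<^sup>2 + c ^ k * c\<^sup>2)"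
        "S (k + 3) = - (a ^ k * a ^ 3 + b ^ k * b ^ 3 + c ^ k * c ^ 3)"
        using less.IH[of "k + 1"] less.IH[of "k + 2"] less.IH[of "k + 3"] by (simp_all add: k power_add power2_eq_square power3_eq_cube mult_ac)
      have n: "z ^ n = z ^ k * z ^ 4" for z :: complex by (simp add: k power_add)
      show ?thesis
        unfolding Sn i abc n by (simp add: power2_eq_square power3_eq_cube power4_eq_xxxx algebra_simps)
    qed (use S1 S2 S3 in auto)
  qed
  \<comment> \<open>Point counts are available for even degrees only, so the growth lemma is applied
    to the squares of the inverse roots with \<rho> = p.\<close>
  have bd: "norm ((a\<^sup>2) ^ m + (b\<^sup>2) ^ m + (c\<^sup>2) ^ m) \<le> 19 * real p * real p ^ m" if "m \<ge> 2" for m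
  proof -
    have "norm (S (2 * m)) = norm (a ^ (2 * m) + b ^ (2 * m) + c ^ (2 * m))"
    proof -
      have "S (2 * m) = - (a ^ (2 * m) + b ^ (2 * m) + c ^ (2 * m))" using that by (intro S) auto
      thus ?thesis by (simp only: norm_minus_cancel)
    qed
    thus ?thesis
      using Ssum_even_bound[OF that] by (simp add: S_def power_mult)
  qed
  have rt: "norm z \<le> sqrt (real p)" if "norm (z\<^sup>2) \<le> real p" for z :: complex
    using that by (simp add: norm_power real_le_rsqrt)
  have 1: "norm a \<le> sqrt (real p)"
    using p1 by (intro rt three_power_sums_bound[OF _ _ bd]) auto
  have bd2: "norm ((b\<^sup>2) ^ m + (a\<^sup>2) ^ m + (c\<^sup>2) ^ m) \<le> 19 * real p * real p ^ m"
    and bd3: "norm ((c\<^sup>2) ^ m + (a\<^sup>2) ^ m + (b\<^sup>2) ^ m) \<le> 19 * real p * real p ^ m" if "m \<ge> 2" for m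
    using bd[OF that] by (simp_all only: add.commute add.left_commute)
  have 2: "norm b \<le> sqrt (real p)"
    using p1 by (intro rt three_power_sums_bound[OF _ _ bd2]) auto
  have 3: "norm c \<le> sqrt (real p)"
    using p1 by (intro rt three_power_sums_bound[OF _ _ bd3]) auto
  have "S 1 = - (a + b + c)" using S[of 1] by simp
  hence "norm (S 1) = norm (a + b + c)" by (simp only: norm_minus_cancel)
  also have "\<dots> \<le> norm a + norm b + norm c"
    by (intro order_trans[OF norm_triangle_ineq] add_mono norm_triangle_ineq) auto
  finally show ?thesis using 1 2 3 by (simp add: S_def)
qed

end

text \<open>By Fermat this is \<open>x^(-2)\<close> modulo a prime \<open>q\<close>, and \<open>0\<close> if \<open>q\<close> divides \<open>x\<close>.\<close>

definition invsq :: "nat \<Rightarrow> int \<Rightarrow> int" where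
  "invsq q x = x ^ (2 * (q - 2))"

text \<open>The case n = 1, where the trace is the identity: Fermat turns x^(2 (p - 2)) into 1 / x^2
  in the prime field, and p not dividing k is the condition that the linear coefficient is
  nonzero.\<close>

lemma weil_bound_type:
  fixes k h :: int
  assumes p: "p = CHAR('k::{alg_closed_field, field_prime_char})" and k: "\<not> int p dvd k"
  shows "norm (\<Sum>x\<in>{1..<int p}. ee p (h * invsq p x + k * x)) \<le> 3 * sqrt (real p)"
proof -
  have p1: "p > 1" by (rule p_gt_1[OF p])
  have of_int_fix: "(of_int i :: 'k) \<in> fixn p 1" for i
  proof -
    have "(of_int i :: 'k) = of_int (i mod int p)"
      by (simp add: of_int_eq_iff_cong_CHAR p cong_def)
    moreover have "i mod int p \<in> {0..<int p}" using p1 by simp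
    ultimately show ?thesis unfolding fixn_1_eq[OF p] by blast
  qed
  have k0: "(of_int k :: 'k) \<noteq> 0"
    using k by (simp add: of_int_eq_0_iff_char_dvd p)
  have inj: "inj_on (of_int :: int \<Rightarrow> 'k) {1..<int p}"
    by (rule inj_onI) (auto simp: of_int_eq_iff_cong_CHAR simp flip: p intro: cong_less_imp_eq_int)
  have img: "fixn p 1 - {0::'k} = of_int ` {1..<int p}"
  proof -
    have "{0..<int p} = insert 0 {1..<int p}" using p1 by auto
    moreover have "(of_int i :: 'k) \<noteq> 0" if "i \<in> {1..<int p}" for i
      using that by (auto simp: of_int_eq_0_iff_char_dvd zdvd_not_zless simp flip: p)
    ultimately show ?thesis unfolding fixn_1_eq[OF p] by auto
  qed
  have "psi p (trace p 1 (ratf (of_int k) (of_int h) (of_int x :: 'k))) = ee p (h * invsq p x + k * x)"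
    if x: "x \<in> {1..<int p}" for x
  proof -
    define z where "z = (of_int x :: 'k)"
    have z: "z \<noteq> 0" "z ^ p = z"
      using img x of_int_fix[of x] by (auto simp: z_def fixn_def[OF p])
    have "z ^ (p - 1) = 1"
      using z p1 by (metis mult_cancel_left1 power_eq_if not_one_less_zero)
    hence "z ^ (p - 2) * z = 1"
      using p1 by (metis Suc_diff_Suc numeral_2_eq_2 One_nat_def power_Suc2)
    hence "z ^ (p - 2) = 1 / z" using z by (simp add: field_simps)
    hence "(z ^ (p - 2))\<^sup>2 = 1 / z\<^sup>2" by (simp add: power_divide)
    hence "(of_int (h * invsq p x + k * x) :: 'k) = of_int h / z\<^sup>2 + of_int k * z"
      by (simp add: invsq_def z_def power_mult[symmetric] mult.commute[of 2] divide_inverse)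
    thus ?thesis
      unfolding trace_def[OF p of_int_fix of_int_fix] ratf_def[OF p of_int_fix of_int_fix]
      by (simp add: z_def psi_of_int[OF p, symmetric] add.commute)
  qed
  hence "(\<Sum>x\<in>{1..<int p}. ee p (h * invsq p x + k * x)) = Ssum p (of_int k :: 'k) (of_int h) 1"
    unfolding Ssum_def[OF p of_int_fix of_int_fix] img
    by (subst sum.reindex[OF inj]) simp
  thus ?thesis using Ssum_1_bound[OF p of_int_fix of_int_fix k0] by simp
qed

text \<open>HOL cannot quantify over types, so no type of characteristic \<open>p\<close> is available for a prime
  variable \<open>p\<close>. If the bound failed for some prime, a fixed such prime \<open>P0\<close> could be chosen, and for
  a constant \<open>P0\<close> the field with \<open>P0\<close> elements is a type.\<close>

definition weil_fails :: "nat \<Rightarrow> bool" where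
  "weil_fails p \<longleftrightarrow> prime p \<and> (\<exists>h k. \<not> int p dvd k \<and>
     norm (\<Sum>x\<in>{1..<int p}. ee p (h * invsq p x + k * x)) > 3 * sqrt (real p))"

definition P0 :: nat where
  "P0 = (if \<exists>p. weil_fails p then SOME p. weil_fails p else 2)"

lemma prime_P0: "prime P0"
proof (cases "\<exists>p. weil_fails p")
  case True
  hence "weil_fails P0" unfolding P0_def by (simp add: someI_ex)
  thus ?thesis by (simp add: weil_fails_def)
qed (simp add: P0_def two_is_prime_nat)

typedef residue = "{0..<P0}"
  using prime_gt_0_nat[OF prime_P0] by auto

lemma card_residue: "CARD(residue) = P0"
  using type_definition.card[OF type_definition_residue] by simp

instance residue :: prime_card
  by standard (simp add: card_residue prime_P0)

instance alg_closure :: (field_prime_char) field_prime_char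
  by (rule field_prime_charI') simp

theorem weil_bound:
  assumes "prime p" "\<not> int p dvd k"
  shows "norm (\<Sum>x\<in>{1..<int p}. ee p (h * invsq p x + k * x)) \<le> 3 * sqrt (real p)"
proof (rule ccontr)
  assume "\<not> ?thesis"
  hence "weil_fails p" using assms by (auto simp: weil_fails_def not_le)
  hence "\<exists>p. weil_fails p" by blast
  hence "weil_fails P0" unfolding P0_def by (simp add: someI_ex)
  then obtain h k where "\<not> int P0 dvd k"
    "norm (\<Sum>x\<in>{1..<int P0}. ee P0 (h * invsq P0 x + k * x)) > 3 * sqrt (real P0)"
    by (auto simp: weil_fails_def)
  moreover have P0: "P0 = CHAR(residue mod_ring alg_closure)"
    by (simp add: card_residue)
  ultimately show False
    using weil_bound_type[OF P0, of k h] by (meson not_less)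
qed

section \<open>Incomplete sums and equidistribution\<close>

lemma sum_residues_shift:
  fixes g :: "int \<Rightarrow> 'a::comm_monoid_add"
  assumes "q > 0" "\<And>x y. [x = y] (mod int q) \<Longrightarrow> g x = g y"
  shows "(\<Sum>x\<in>{0..<int q}. g (x + c)) = (\<Sum>x\<in>{0..<int q}. g x)"
proof (rule sum.reindex_bij_witness[of _ "\<lambda>x. (x - c) mod int q" "\<lambda>x. (x + c) mod int q"])
  fix x assume x: "x \<in> {0..<int q}"
  show "((x + c) mod int q - c) mod int q = x" "((x - c) mod int q + c) mod int q = x"
    using x by (simp_all add: mod_simps)
  show "(x + c) mod int q \<in> {0..<int q}" "(x - c) mod int q \<in> {0..<int q}"
    using assms(1) by simp_all
  show "g ((x + c) mod int q) = g (x + c)"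
    by (rule assms(2)) (simp add: unique_euclidean_semiring_class.cong_def)
qed

section \<open>Inverse squares and complete sums modulo q\<close>

context
  fixes q :: nat
  assumes q: "prime q" and q3: "q \<ge> 3"
begin

lemma q_dvd_mult_iff: "int q dvd x * y \<longleftrightarrow> int q dvd x \<or> int q dvd y"
  using q by (simp add: prime_dvd_mult_iff)

lemma inverse_cong:
  assumes "\<not> int q dvd x"
  shows "[x * x ^ (q - 2) = 1] (mod int q)"
proof -
  define y where "y = nat (x mod int q)"
  have y: "int y = x mod int q" using q3 by (simp add: y_def)
  have "\<not> q dvd y"
    using assms by (metis y int_dvd_int_iff dvd_mod_iff dvd_refl)
  hence "[y ^ (q - 1) = 1] (mod q)" by (rule fermat_theorem[OF q])
  hence "[int y ^ (q - 1) = 1] (mod int q)"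
    by (metis cong_int_iff of_nat_1 of_nat_power)
  moreover have "[x ^ (q - 1) = int y ^ (q - 1)] (mod int q)"
    by (intro cong_pow) (simp add: y)
  moreover have "q - 1 = Suc (q - 2)" using q3 by simp
  ultimately show ?thesis by (metis cong_trans power_Suc)
qed

lemma invsq_eq: "invsq q x = (x ^ (q - 2))\<^sup>2"
  by (simp add: invsq_def power_mult[symmetric] mult.commute)

lemma invsq_mult: "invsq q (x * y) = invsq q x * invsq q y"
  by (simp add: invsq_def power_mult_distrib)

lemma invsq_cong: "[x = y] (mod int q) \<Longrightarrow> [invsq q x = invsq q y] (mod int q)"
  unfolding invsq_def by (rule cong_pow)

lemma invsq_cong_1:
  assumes "\<not> int q dvd x"
  shows "[x\<^sup>2 * invsq q x = 1] (mod int q)"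
  using cong_pow[OF inverse_cong[OF assms], of 2] by (simp add: invsq_eq power_mult_distrib)

lemma dvd_invsq_iff: "int q dvd invsq q x \<longleftrightarrow> int q dvd x"
  using q q3 prime_dvd_power_iff[of "int q" "2 * (q - 2)" x] by (simp add: invsq_def)

text \<open>Substituting u = t + v in the squared modulus leaves a phase 2 h t v that is linear in
  v; as q is odd, only t = 0 survives. This supplies the frequency k = 0, at which the Weil bound
  above does not apply.\<close>

lemma quadratic_gauss_sum:
  assumes "\<not> int q dvd h"
  shows "norm (\<Sum>x\<in>{0..<int q}. ee q (h * x\<^sup>2)) = sqrt (real q)"
proof -
  let ?G = "\<Sum>x\<in>{0..<int q}. ee q (h * x\<^sup>2)"
  have q0: "q > 0" using q3 by simp
  have "?G * cnj ?G = (\<Sum>v\<in>{0..<int q}. \<Sum>u\<in>{0..<int q}. ee q (h * u\<^sup>2 - h * v\<^sup>2))"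
    unfolding cnj_sum sum_product by (subst sum.swap) (simp add: ee_diff)
  also have "\<dots> = (\<Sum>v\<in>{0..<int q}. \<Sum>t\<in>{0..<int q}. ee q (h * t\<^sup>2) * ee q ((2 * h * t) * v))"
  proof (rule sum.cong[OF refl])
    fix v
    have "(\<Sum>u\<in>{0..<int q}. ee q (h * u\<^sup>2 - h * v\<^sup>2)) = (\<Sum>t\<in>{0..<int q}. ee q (h * (t + v)\<^sup>2 - h * v\<^sup>2))"
      by (rule sum_residues_shift[OF q0, symmetric])
         (intro ee_cong cong_diff cong_mult cong_pow cong_refl)
    thus "(\<Sum>u\<in>{0..<int q}. ee q (h * u\<^sup>2 - h * v\<^sup>2)) = (\<Sum>t\<in>{0..<int q}. ee q (h * t\<^sup>2) * ee q ((2 * h * t) * v))"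
      by (simp add: ee_add[symmetric] power2_eq_square algebra_simps)
  qed
  also have "\<dots> = (\<Sum>t\<in>{0..<int q}. ee q (h * t\<^sup>2) * (\<Sum>v\<in>{0..<int q}. ee q ((2 * h * t) * v)))"
    by (subst sum.swap) (simp add: sum_distrib_left)
  also have "\<dots> = (\<Sum>t\<in>{0}. ee q (h * t\<^sup>2) * of_nat q)"
  proof (rule sum.mono_neutral_cong_right)
    have two: "\<not> int q dvd 2" using q3 by (auto dest: zdvd_imp_le)
    show "\<forall>t\<in>{0..<int q} - {0}. ee q (h * t\<^sup>2) * (\<Sum>v\<in>{0..<int q}. ee q ((2 * h * t) * v)) = 0"
    proof
      fix t assume t: "t \<in> {0..<int q} - {0}"
      hence "\<not> int q dvd t" by (auto simp: zdvd_not_zless)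
      hence "\<not> int q dvd 2 * h * t" using two assms by (simp add: q_dvd_mult_iff)
      thus "ee q (h * t\<^sup>2) * (\<Sum>v\<in>{0..<int q}. ee q ((2 * h * t) * v)) = 0"
        by (simp only: sum_ee[OF q0]) simp
    qed
    fix t assume "t \<in> {0::int}"
    thus "ee q (h * t\<^sup>2) * (\<Sum>v\<in>{0..<int q}. ee q ((2 * h * t) * v)) = ee q (h * t\<^sup>2) * of_nat q"
      by (simp only: sum_ee[OF q0]) simp
  qed (use q0 in auto)
  also have "\<dots> = of_nat q" by simp
  finally have "(norm ?G)\<^sup>2 = real q"
    by (metis complex_norm_square of_real_eq_iff of_real_of_nat_eq)
  thus ?thesis by (metis norm_ge_zero real_sqrt_unique)
qed

text \<open>x \<mapsto> x^(q - 2) is an involution of the residues modulo q. It inverts the nonzero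
  classes and fixes 0, so the term x = 0 matches as well.\<close>

lemma sum_invsq_eq_gauss: "(\<Sum>x\<in>{0..<int q}. ee q (h * invsq q x)) = (\<Sum>x\<in>{0..<int q}. ee q (h * x\<^sup>2))"
proof -
  define g where "g = (\<lambda>x. x ^ (q - 2) mod int q)"
  have q0: "int q > 0" using q3 by simp
  have gg: "g (g x) = x" if x: "x \<in> {0..<int q}" for x
  proof (cases "x = 0")
    case True
    thus ?thesis using q3 by (simp add: g_def zero_power)
  next
    case False
    hence nd: "\<not> int q dvd x" using x by (auto simp: zdvd_not_zless)
    define y where "y = x ^ (q - 2)"
    have xy: "[x * y = 1] (mod int q)" using inverse_cong[OF nd] by (simp add: y_def)
    hence "\<not> int q dvd y"
      by (metis cong_dvd_iff dvd_mult nd q_dvd_mult_iff one_dvd zdvd_not_zless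
          prime_nat_iff q cong_sym dvd_refl int_one_le_iff_zero_less not_prime_unit prime_nat_int_transfer)
    hence yz: "[y * y ^ (q - 2) = 1] (mod int q)" by (rule inverse_cong)
    have "[x * (y * y ^ (q - 2)) = x * 1] (mod int q)" using yz by (intro cong_mult cong_refl)
    moreover have "[(x * y) * y ^ (q - 2) = 1 * y ^ (q - 2)] (mod int q)" using xy by (intro cong_mult cong_refl)
    ultimately have "[y ^ (q - 2) = x] (mod int q)"
      by (simp add: mult.assoc) (metis cong_sym cong_trans)
    moreover have "[(y mod int q) ^ (q - 2) = y ^ (q - 2)] (mod int q)"
      by (intro cong_pow) (simp add: unique_euclidean_semiring_class.cong_def)
    ultimately have "[(y mod int q) ^ (q - 2) = x] (mod int q)" by (rule cong_trans[rotated])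
    hence "(y mod int q) ^ (q - 2) mod int q = x mod int q" by (simp only: unique_euclidean_semiring_class.cong_def)
    thus ?thesis using x by (simp only: g_def y_def) simp
  qed
  show ?thesis
  proof (rule sum.reindex_bij_witness[of _ g g])
    fix x assume x: "x \<in> {0..<int q}"
    show "g (g x) = x" "g (g x) = x" "g x \<in> {0..<int q}" "g x \<in> {0..<int q}"
      using gg[OF x] q0 by (simp_all add: g_def)
    have "[g x = x ^ (q - 2)] (mod int q)" by (simp add: g_def unique_euclidean_semiring_class.cong_def)
    thus "ee q (h * (g x)\<^sup>2) = ee q (h * invsq q x)"
      unfolding invsq_eq by (intro ee_cong cong_mult cong_refl cong_pow)
  qed
qed

lemma complete_sum_bound:
  assumes "\<not> int q dvd h \<or> \<not> int q dvd k"
  shows "norm (\<Sum>x\<in>{0..<int q}. ee q (h * invsq q x + k * x)) \<le> 4 * sqrt (real q)"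
proof (cases "int q dvd k")
  case True
  have "(\<Sum>x\<in>{0..<int q}. ee q (h * invsq q x + k * x)) = (\<Sum>x\<in>{0..<int q}. ee q (h * invsq q x))"
    using True by (intro sum.cong refl ee_cong) (auto simp: cong_iff_dvd_diff)
  thus ?thesis
    using quadratic_gauss_sum[of h] True assms by (simp add: sum_invsq_eq_gauss)
next
  case False
  \<comment> \<open>The class 0 contributes the term 1, which turns the constant 3 of the Weil bound
    into 4.\<close>
  have "{0..<int q} = insert 0 {1..<int q}" using q3 by auto
  hence "(\<Sum>x\<in>{0..<int q}. ee q (h * invsq q x + k * x)) =
      1 + (\<Sum>x\<in>{1..<int q}. ee q (h * invsq q x + k * x))"
    using q3 by (simp add: invsq_def zero_power)
  hence "norm (\<Sum>x\<in>{0..<int q}. ee q (h * invsq q x + k * x)) \<le> 1 + 3 * sqrt (real q)"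
    using norm_triangle_ineq[of 1 "\<Sum>x\<in>{1..<int q}. ee q (h * invsq q x + k * x)"] weil_bound[OF q False, of h]
    by simp
  moreover have "1 \<le> sqrt (real q)" using q3 by simp
  ultimately show ?thesis by linarith
qed

section \<open>Fourier coefficients of intervals\<close>

lemma norm_one_minus_ee: "norm (1 - ee q k) = 2 * \<bar>sin (pi * real_of_int k / real q)\<bar>"
proof -
  define t where "t = pi * real_of_int k / real q"
  have "ee q k = cis (2 * t)" by (simp add: ee_def t_def mult.assoc)
  hence "(norm (1 - ee q k))\<^sup>2 = (1 - cos (2 * t))\<^sup>2 + (sin (2 * t))\<^sup>2"
    by (simp add: cmod_power2)
  also have "\<dots> = 2 - 2 * cos (2 * t)"
    using sin_cos_squared_add[of "2 * t"] by (simp add: power2_eq_square algebra_simps)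
  also have "\<dots> = (2 * sin t)\<^sup>2"
    by (simp add: cos_double_sin power2_eq_square)
  finally have "(norm (1 - ee q k))\<^sup>2 = (2 * \<bar>sin t\<bar>)\<^sup>2" by (simp add: power_mult_distrib)
  hence "norm (1 - ee q k) = 2 * \<bar>sin t\<bar>" by (rule power2_eq_imp_eq) auto
  thus ?thesis by (simp add: t_def)
qed

text \<open>Adding the reciprocals of the distances of k to 0 and to q, instead of taking the larger
  one, makes the sum over k two harmonic sums. The crude inequality sin x \<ge> x / 3 on [0, 2]
  together with pi > 3 is enough.\<close>

lemma norm_one_minus_ee_ge:
  assumes "0 < k" "k < int q"
  shows "1 / norm (1 - ee q k) \<le> real q / 2 * (1 / real_of_int k + 1 / (real q - real_of_int k))"
proof -
  have sin_ge: "sin x \<ge> x / 3" if "0 \<le> x" "x \<le> 2" for x :: real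
  proof -
    have "\<bar>sin x - (\<Sum>m<3. sin_coeff m * x ^ m)\<bar> \<le> inverse (fact 3) * \<bar>x\<bar> ^ 3"
      by (rule Maclaurin_sin_bound)
    hence "\<bar>sin x - x\<bar> \<le> x ^ 3 / 6"
      using that by (simp add: numeral_3_eq_3 sin_coeff_def fact_numeral)
    moreover have "x ^ 3 \<le> x * 4"
      using that mult_mono[of x 2 x 2] by (simp add: power3_eq_cube mult_left_mono mult.assoc)
    ultimately show ?thesis by linarith
  qed
  have key: "2 * real_of_int j / real q \<le> norm (1 - ee q j)" if j: "0 < j" "2 * j \<le> int q" for j
  proof -
    have "real_of_int (2 * j) \<le> real q" using j by linarith
    hence "pi * real_of_int j / real q \<le> pi * (1 / 2)"
      using q3 pi_gt_zero by (simp add: field_simps)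
    hence "pi * real_of_int j / real q \<le> 2" using pi_less_4 by linarith
    hence "sin (pi * real_of_int j / real q) \<ge> pi * real_of_int j / real q / 3"
      using j pi_gt_zero by (intro sin_ge) auto
    moreover have "pi * real_of_int j / real q / 3 \<ge> real_of_int j / real q"
      using j pi_gt3 q3 by (simp add: field_simps)
    ultimately show ?thesis unfolding norm_one_minus_ee by simp
  qed
  have nz: "norm (1 - ee q k) > 0"
    using assms ee_eq_1_iff[of q k] q3 by (auto simp: zdvd_not_zless)
  have pos: "1 / real_of_int k > 0" "1 / (real q - real_of_int k) > 0" using assms by auto
  show ?thesis
  proof (cases "2 * k \<le> int q")
    case True
    have "1 / norm (1 - ee q k) \<le> 1 / (2 * real_of_int k / real q)"
      using key[OF assms(1) True] assms q3 nz by (intro divide_left_mono mult_pos_pos) simp_all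
    also have "\<dots> = real q / 2 * (1 / real_of_int k)" by simp
    also have "\<dots> \<le> real q / 2 * (1 / real_of_int k + 1 / (real q - real_of_int k))"
      using pos by (intro mult_left_mono) auto
    finally show ?thesis .
  next
    case False
    have "ee q k = cnj (ee q (int q - k))"
      unfolding ee_minus[symmetric] by (rule ee_cong) (simp add: cong_iff_dvd_diff)
    hence eq: "norm (1 - ee q k) = norm (1 - ee q (int q - k))"
      by (metis complex_cnj_diff complex_cnj_one complex_mod_cnj)
    have "1 / norm (1 - ee q k) \<le> 1 / (2 * real_of_int (int q - k) / real q)"
      using key[of "int q - k"] assms q3 False nz unfolding eq
      by (intro divide_left_mono mult_pos_pos) simp_all
    also have "\<dots> = real q / 2 * (1 / (real q - real_of_int k))" by simp
    also have "\<dots> \<le> real q / 2 * (1 / real_of_int k + 1 / (real q - real_of_int k))"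
      using pos by (intro mult_left_mono) auto
    finally show ?thesis .
  qed
qed

lemma norm_geometric_ee:
  assumes "0 < k" "k < int q"
  shows "norm (\<Sum>n\<in>{a..<a + int N}. ee q (k * n)) \<le> real q * (1 / real_of_int k + 1 / (real q - real_of_int k))"
proof -
  have ne: "ee q k \<noteq> 1"
    using assms ee_eq_1_iff[of q k] q3 by (auto simp: zdvd_not_zless)
  have "(\<Sum>n\<in>{a..<a + int N}. ee q (k * n)) = (\<Sum>i<N. ee q (k * a) * ee q k ^ i)"
    by (rule sum.reindex_bij_witness[of _ "\<lambda>i. a + int i" "\<lambda>n. nat (n - a)"])
       (auto simp: ee_add[symmetric] ee_mult_nat[symmetric] algebra_simps)
  also have "\<dots> = ee q (k * a) * ((1 - ee q k ^ N) / (1 - ee q k))"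
    using ne by (simp add: sum_distrib_left[symmetric] sum_gp_strict)
  also have "norm \<dots> = norm (1 - ee q k ^ N) * (1 / norm (1 - ee q k))"
    by (simp add: norm_mult norm_divide)
  also have "\<dots> \<le> 2 * (real q / 2 * (1 / real_of_int k + 1 / (real q - real_of_int k)))"
  proof (intro mult_mono norm_one_minus_ee_ge assms)
    show "norm (1 - ee q k ^ N) \<le> 2"
      using norm_triangle_ineq4[of 1 "ee q k ^ N"] by (simp add: norm_power)
  qed auto
  finally show ?thesis by simp
qed

lemma sum_norm_geometric_ee:
  "(\<Sum>k\<in>{1..<int q}. norm (\<Sum>n\<in>{a..<a + int N}. ee q (k * n))) \<le> 2 * real q * (1 + ln (real q))"
proof -
  have h1: "(\<Sum>k\<in>{1..<int q}. 1 / real_of_int k) \<le> 1 + ln (real q)"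
  proof -
    have "(\<Sum>k\<in>{1..<int q}. 1 / real_of_int k) = (\<Sum>k\<in>{1..q - 1}. inverse (real k))"
      by (rule sum.reindex_bij_witness[of _ int nat]) (auto simp: inverse_eq_divide)
    also have "\<dots> = harm (q - 1)" by (simp add: harm_def)
    also have "\<dots> \<le> harm q" unfolding harm_def by (intro sum_mono2) auto
    also have "\<dots> \<le> 1 + ln (real q)"
      using euler_mascheroni_sequence_decreasing[of 1 q] q3 by (simp add: harm_expand)
    finally show ?thesis .
  qed
  have h2: "(\<Sum>k\<in>{1..<int q}. 1 / (real q - real_of_int k)) = (\<Sum>k\<in>{1..<int q}. 1 / real_of_int k)"
    by (rule sum.reindex_bij_witness[of _ "\<lambda>k. int q - k" "\<lambda>k. int q - k"]) auto
  have "(\<Sum>k\<in>{1..<int q}. norm (\<Sum>n\<in>{a..<a + int N}. ee q (k * n))) \<le>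
      (\<Sum>k\<in>{1..<int q}. real q * (1 / real_of_int k + 1 / (real q - real_of_int k)))"
    by (intro sum_mono norm_geometric_ee) auto
  also have "\<dots> = real q * (2 * (\<Sum>k\<in>{1..<int q}. 1 / real_of_int k))"
    by (simp add: sum_distrib_left[symmetric] sum.distrib h2)
  also have "\<dots> \<le> real q * (2 * (1 + ln (real q)))"
    using h1 by (intro mult_left_mono) auto
  finally show ?thesis by (simp only: mult_ac)
qed

section \<open>Completion and equidistribution in windows\<close>

lemma card_cong_fourier:
  assumes "finite A"
  shows "of_nat (card {m\<in>A. [m = c] (mod int q)}) =
    (\<Sum>k\<in>{0..<int q}. (\<Sum>m\<in>A. ee q (k * m)) * ee q (- (k * c))) / of_nat q"
proof -
  have q0: "q > 0" using q3 by simp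
  have "(\<Sum>k\<in>{0..<int q}. (\<Sum>m\<in>A. ee q (k * m)) * ee q (- (k * c))) =
      (\<Sum>k\<in>{0..<int q}. \<Sum>m\<in>A. ee q ((m - c) * k))"
    unfolding sum_distrib_right ee_add[symmetric] by (simp add: algebra_simps)
  also have "\<dots> = (\<Sum>m\<in>A. \<Sum>k\<in>{0..<int q}. ee q ((m - c) * k))"
    by (rule sum.swap)
  also have "\<dots> = (\<Sum>m\<in>A. if [m = c] (mod int q) then of_nat q else 0)"
    by (simp only: sum_ee[OF q0] cong_iff_dvd_diff)
  also have "\<dots> = of_nat (card {m\<in>A. [m = c] (mod int q)}) * of_nat q"
    using assms by (simp add: sum.If_cases Int_def)
  finally show ?thesis using q0 by simp
qed

text \<open>Completion: the Fourier coefficients of the interval are summable up to a logarithm, and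
  each meets a complete sum of size at most 4 q^(1/2). The coefficient at frequency 0 causes the
  term N / q.\<close>

lemma incomplete_sum_bound:
  assumes h: "\<not> int q dvd h"
  shows "norm (\<Sum>n\<in>{a..<a + int N}. ee q (h * invsq q n)) \<le>
    8 * sqrt (real q) * (1 + ln (real q) + real N / real q)"
proof -
  let ?I = "{a..<a + int N}"
  let ?W = "\<lambda>k. \<Sum>x\<in>{0..<int q}. ee q (h * invsq q x + k * x)"
  let ?E = "\<lambda>k. \<Sum>n\<in>?I. ee q (k * n)"
  have q0: "q > 0" using q3 by simp
  have ln0: "ln (real q) \<ge> 0" using q3 by simp
  have "(\<Sum>n\<in>?I. ee q (h * invsq q n)) =
      (\<Sum>n\<in>?I. \<Sum>x\<in>{0..<int q}. if [n = x] (mod int q) then ee q (h * invsq q x) else 0)"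
  proof (rule sum.cong[OF refl])
    fix n
    have iff: "[n = x] (mod int q) \<longleftrightarrow> x = n mod int q" if "x \<in> {0..<int q}" for x
      using that by (metis atLeastLessThan_iff unique_euclidean_semiring_class.cong_def mod_mod_trivial mod_pos_pos_trivial)
    have "(\<Sum>x\<in>{0..<int q}. if [n = x] (mod int q) then ee q (h * invsq q x) else 0) =
        (\<Sum>x\<in>{0..<int q}. if x = n mod int q then ee q (h * invsq q x) else 0)"
      by (intro sum.cong refl) (simp only: iff)
    also have "\<dots> = (\<Sum>x\<in>{n mod int q}. ee q (h * invsq q x))"
      using q0 by simp
    also have "\<dots> = ee q (h * invsq q n)"
      by simp (intro ee_cong cong_mult cong_refl invsq_cong, simp add: unique_euclidean_semiring_class.cong_def)
    finally show "ee q (h * invsq q n) =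
        (\<Sum>x\<in>{0..<int q}. if [n = x] (mod int q) then ee q (h * invsq q x) else 0)" ..
  qed
  also have "\<dots> = (\<Sum>x\<in>{0..<int q}. of_nat (card {n\<in>?I. [n = x] (mod int q)}) * ee q (h * invsq q x))"
    by (subst sum.swap) (simp add: sum.If_cases Int_def)
  also have "\<dots> = (\<Sum>k\<in>{0..<int q}. ?E k * ?W (- k)) / of_nat q"
  proof -
    define E where "E = ?E"
    have E: "?E k = E k" for k by (simp add: E_def)
    have "(\<Sum>x\<in>{0..<int q}. of_nat (card {n\<in>?I. [n = x] (mod int q)}) * ee q (h * invsq q x)) =
        (\<Sum>x\<in>{0..<int q}. \<Sum>k\<in>{0..<int q}. E k * (ee q (- (k * x)) * ee q (h * invsq q x))) / of_nat q"
      unfolding card_cong_fourier[OF finite_atLeastLessThan_int] E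
      by (simp add: sum_distrib_right sum_divide_distrib mult.assoc)
    also have "(\<Sum>x\<in>{0..<int q}. \<Sum>k\<in>{0..<int q}. E k * (ee q (- (k * x)) * ee q (h * invsq q x))) =
        (\<Sum>k\<in>{0..<int q}. \<Sum>x\<in>{0..<int q}. E k * (ee q (- (k * x)) * ee q (h * invsq q x)))"
      by (rule sum.swap)
    also have "\<dots> = (\<Sum>k\<in>{0..<int q}. E k * ?W (- k))"
      by (simp add: sum_distrib_left ee_add[symmetric])
    finally show ?thesis by (simp only: E_def)
  qed
  finally have eq: "norm (\<Sum>n\<in>?I. ee q (h * invsq q n)) = norm (\<Sum>k\<in>{0..<int q}. ?E k * ?W (- k)) / real q"
    by (simp add: norm_divide)
  have "norm (\<Sum>k\<in>{0..<int q}. ?E k * ?W (- k)) \<le> (\<Sum>k\<in>{0..<int q}. norm (?E k) * (4 * sqrt (real q)))"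
    by (intro order_trans[OF norm_sum] sum_mono)
       (simp only: norm_mult, intro mult_left_mono complete_sum_bound, use h in auto)
  also have "\<dots> = (norm (?E 0) + (\<Sum>k\<in>{1..<int q}. norm (?E k))) * (4 * sqrt (real q))"
  proof -
    have "{0..<int q} = insert 0 {1..<int q}" using q3 by auto
    thus ?thesis by (simp add: sum_distrib_right distrib_right)
  qed
  also have "\<dots> \<le> (real N + 2 * real q * (1 + ln (real q))) * (4 * sqrt (real q))"
    using sum_norm_geometric_ee[of a N] by (intro mult_right_mono add_mono) auto
  finally have "norm (\<Sum>n\<in>?I. ee q (h * invsq q n)) \<le>
      (real N + 2 * real q * (1 + ln (real q))) * (4 * sqrt (real q)) / real q"
    unfolding eq by (intro divide_right_mono) auto
  also have "\<dots> = 4 * sqrt (real q) * (real N / real q + 2 * (1 + ln (real q)))"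
  proof -
    have "(u + 2 * v * l) * (4 * r) / v = 4 * r * (u / v + 2 * l)" if "v > 0" for u v l r :: real
      using that by (simp add: field_simps)
    thus ?thesis using q0 by simp
  qed
  also have "\<dots> \<le> 8 * sqrt (real q) * (1 + ln (real q) + real N / real q)"
  proof -
    have "4 * r * (u + 2 * (1 + l)) \<le> 8 * r * (1 + l + u)" if "r \<ge> 0" "u \<ge> 0" for u l r :: real
      using that by (simp add: algebra_simps)
    thus ?thesis by simp
  qed
  finally show ?thesis .
qed

text \<open>The subtracted main term is exactly the frequency 0. Every other frequency k produces
  the weighted sum at - k a, which is at most B. The bound involves neither the position nor the
  length of the window, so only the sums weighted by \<open>w\<close> matter; it is used with
  \<open>w\<close> equal to 1 and to the Moebius function.\<close>

lemma window_discrepancy: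
  fixes w :: "int \<Rightarrow> complex"
  assumes D: "finite D" and a: "\<not> int q dvd a"
    and B: "\<And>h. \<not> int q dvd h \<Longrightarrow> norm (\<Sum>d\<in>D. w d * ee q (h * invsq q d)) \<le> B"
  shows "norm ((\<Sum>d\<in>D. w d * of_nat (card {m\<in>{b..<b + int Z}. [m = a * invsq q d] (mod int q)}))
      - of_real (real Z / real q) * (\<Sum>d\<in>D. w d)) \<le> 2 * (1 + ln (real q)) * B"
proof -
  let ?E = "\<lambda>k. \<Sum>n\<in>{b..<b + int Z}. ee q (k * n)"
  let ?T = "\<lambda>k. \<Sum>d\<in>D. w d * ee q (k * invsq q d)"
  have q0: "q > 0" using q3 by simp
  have B0: "B \<ge> 0" using B[OF a] norm_ge_zero order_trans by blast
  have "(\<Sum>d\<in>D. w d * of_nat (card {m\<in>{b..<b + int Z}. [m = a * invsq q d] (mod int q)})) =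
      (\<Sum>k\<in>{0..<int q}. ?E k * ?T (- (k * a))) / of_nat q"
  proof -
    define E where "E = ?E"
    have E: "?E k = E k" for k by (simp add: E_def)
    have "(\<Sum>d\<in>D. w d * of_nat (card {m\<in>{b..<b + int Z}. [m = a * invsq q d] (mod int q)})) =
        (\<Sum>d\<in>D. \<Sum>k\<in>{0..<int q}. E k * (w d * ee q (- (k * a) * invsq q d))) / of_nat q"
      unfolding card_cong_fourier[OF finite_atLeastLessThan_int] E
      by (simp add: sum_distrib_left sum_divide_distrib mult_ac)
    also have "(\<Sum>d\<in>D. \<Sum>k\<in>{0..<int q}. E k * (w d * ee q (- (k * a) * invsq q d))) =
        (\<Sum>k\<in>{0..<int q}. \<Sum>d\<in>D. E k * (w d * ee q (- (k * a) * invsq q d)))"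
      by (rule sum.swap)
    finally show ?thesis by (simp only: E_def sum_distrib_left)
  qed
  also have "{0..<int q} = insert 0 {1..<int q}" using q3 by auto
  also have "(\<Sum>k\<in>insert 0 {1..<int q}. ?E k * ?T (- (k * a))) / of_nat q =
      of_real (real Z / real q) * (\<Sum>d\<in>D. w d) + (\<Sum>k\<in>{1..<int q}. ?E k * ?T (- (k * a))) / of_nat q"
    by (simp add: add_divide_distrib)
  finally have eq: "norm ((\<Sum>d\<in>D. w d * of_nat (card {m\<in>{b..<b + int Z}. [m = a * invsq q d] (mod int q)}))
      - of_real (real Z / real q) * (\<Sum>d\<in>D. w d)) = norm (\<Sum>k\<in>{1..<int q}. ?E k * ?T (- (k * a))) / real q"
    by (simp add: norm_divide)
  have "norm (\<Sum>k\<in>{1..<int q}. ?E k * ?T (- (k * a))) \<le> (\<Sum>k\<in>{1..<int q}. norm (?E k) * B)"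
  proof (intro order_trans[OF norm_sum] sum_mono)
    fix k assume "k \<in> {1..<int q}"
    hence "\<not> int q dvd - (k * a)" using a by (auto simp: q_dvd_mult_iff zdvd_not_zless)
    thus "norm (?E k * ?T (- (k * a))) \<le> norm (?E k) * B"
      unfolding norm_mult by (intro mult_left_mono B) auto
  qed
  also have "\<dots> \<le> (2 * real q * (1 + ln (real q))) * B"
    unfolding sum_distrib_right[symmetric] using sum_norm_geometric_ee[of b Z] B0 by (intro mult_right_mono)
  finally show ?thesis unfolding eq using q0 by (simp add: pos_divide_le_eq mult_ac)
qed

lemma count_bound:
  assumes a: "\<not> int q dvd a"
  shows "real (\<Sum>d\<in>{s..<s + int N}. card {m\<in>{b..<b + int Z}. [m = a * invsq q d] (mod int q)}) \<le>
    real N * real Z / real q + 16 * (1 + ln (real q))\<^sup>2 * (sqrt (real q) + real N / sqrt (real q))"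
proof -
  let ?S = "\<Sum>d\<in>{s..<s + int N}. card {m\<in>{b..<b + int Z}. [m = a * invsq q d] (mod int q)}"
  define l where "l = 1 + ln (real q)"
  have l: "l \<ge> 1" using q3 by (simp add: l_def)
  define B where "B = 8 * sqrt (real q) * (l + real N / real q)"
  have "norm ((\<Sum>d\<in>{s..<s + int N}. (1::complex) * of_nat (card {m\<in>{b..<b + int Z}. [m = a * invsq q d] (mod int q)}))
      - of_real (real Z / real q) * (\<Sum>d\<in>{s..<s + int N}. 1)) \<le> 2 * l * B"
    unfolding l_def using incomplete_sum_bound[of _ s N]
    by (intro window_discrepancy[where w = "\<lambda>_. 1"] a) (auto simp: B_def l_def)
  hence "norm (complex_of_real (real ?S - real Z / real q * real N)) \<le> 2 * l * B"
    by simp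
  hence "real ?S - real Z / real q * real N \<le> 2 * l * B"
    unfolding norm_of_real by linarith
  also have "2 * l * B = 16 * l * (l * sqrt (real q) + real N / sqrt (real q))"
  proof -
    have alg: "2 * l * (8 * r * (l + t)) = 16 * l * (l * r + r * t)" for r t :: real
      by (simp add: algebra_simps)
    have "2 * l * (8 * r * (l + u / (r * r))) = 16 * l * (l * r + u / r)" if "r > 0" for u r :: real
      unfolding alg using that by simp
    from this[of "sqrt (real q)" "real N"] show ?thesis using q3 by (simp add: B_def)
  qed
  also have "\<dots> \<le> 16 * l * (l * sqrt (real q) + l * (real N / sqrt (real q)))"
    using l mult_right_mono[OF l, of "real N / sqrt (real q)"] by (intro mult_left_mono add_left_mono) auto
  also have "\<dots> = 16 * l\<^sup>2 * (sqrt (real q) + real N / sqrt (real q))"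
    by (simp only: power2_eq_square distrib_left mult_ac)
  finally have "real ?S \<le> real Z / real q * real N + 16 * l\<^sup>2 * (sqrt (real q) + real N / sqrt (real q))" by linarith
  moreover have "real Z / real q * real N = real N * real Z / real q" by simp
  ultimately show ?thesis by (simp only: l_def)
qed

end

section \<open>Large values of short sums\<close>

lemma power_sum_le:
  fixes x :: "'a \<Rightarrow> real"
  assumes "\<And>i. i \<in> I \<Longrightarrow> x i \<ge> 0" "k \<ge> 1"
  shows "(\<Sum>i\<in>I. x i) ^ k \<le> real (card I) ^ (k - 1) * (\<Sum>i\<in>I. x i ^ k)"
proof (cases "finite I \<and> I \<noteq> {}")
  case True
  have conv: "convex_on {0::real..} (\<lambda>x. x ^ k)"
    using convex_power_even[of k] convex_power_odd[of k] by (cases "even k") (auto intro: convex_on_subset)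
  define c where "c = real (card I)"
  have c: "c > 0" using True by (auto simp: c_def card_gt_0_iff)
  have "(\<Sum>i\<in>I. (1 / c) *\<^sub>R x i) ^ k \<le> (\<Sum>i\<in>I. (1 / c) * x i ^ k)"
    using True assms(1) c by (intro convex_on_sum[OF _ _ conv]) (auto simp: c_def)
  hence "((\<Sum>i\<in>I. x i) / c) ^ k \<le> (\<Sum>i\<in>I. x i ^ k) / c"
    by (simp add: sum_divide_distrib)
  moreover have "c ^ k = c * c ^ (k - 1)" using assms(2) by (simp add: power_eq_if)
  ultimately show ?thesis
    using c by (simp add: power_divide c_def[symmetric] field_simps)
next
  case False
  thus ?thesis using assms(2) by (auto simp: zero_power)
qed

text \<open>Nonvanishing modulo q is expressed by a witness \<open>x0\<close>, which survives
  division by x - r. This spares the passage to polynomials over the residue field.\<close>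

lemma card_roots_mod_prime:
  fixes P :: "int poly"
  assumes q: "prime q" and "\<not> int q dvd poly P x0"
  shows "card {x\<in>{0..<int q}. int q dvd poly P x} \<le> degree P"
  using assms(2)
proof (induction "degree P" arbitrary: P rule: less_induct)
  case less
  show ?case
  proof (cases "\<exists>r\<in>{0..<int q}. int q dvd poly P r")
    case False
    hence "{x\<in>{0..<int q}. int q dvd poly P x} = {}" by auto
    thus ?thesis by (metis card.empty le0)
  next
    case True
    then obtain r where r: "r \<in> {0..<int q}" "int q dvd poly P r" by blast
    have "degree P \<noteq> 0"
    proof
      assume "degree P = 0"
      then obtain c where "P = [:c:]" by (rule degree_eq_zeroE)
      thus False using r less.prems by simp
    qed
    define Q where "Q = synthetic_div P r"
    have degQ: "degree Q = degree P - 1" by (simp add: Q_def degree_synthetic_div)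
    have PQ: "poly P x = poly P r + (x - r) * poly Q x" for x
    proof -
      have "P + smult r Q = pCons (poly P r) Q"
        unfolding Q_def by (rule synthetic_div_correct)
      hence "poly (P + smult r Q) x = poly (pCons (poly P r) Q) x" by simp
      thus ?thesis by (simp add: algebra_simps)
    qed
    have "\<not> int q dvd poly Q x0" using less.prems r(2) PQ[of x0] by auto
    hence IH: "card {x\<in>{0..<int q}. int q dvd poly Q x} \<le> degree Q"
      using less.hyps[of Q] degQ \<open>degree P \<noteq> 0\<close> by simp
    have "{x\<in>{0..<int q}. int q dvd poly P x} \<subseteq> insert r {x\<in>{0..<int q}. int q dvd poly Q x}"
    proof
      fix x assume x: "x \<in> {x\<in>{0..<int q}. int q dvd poly P x}"
      hence "int q dvd (x - r) * poly Q x"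
        using PQ[of x] r(2) by (simp add: dvd_add_right_iff)
      hence "int q dvd x - r \<or> int q dvd poly Q x"
        using q by (simp add: prime_dvd_mult_iff)
      moreover have "x = r" if "int q dvd x - r"
      proof (rule ccontr)
        assume "x \<noteq> r"
        hence "int q \<le> \<bar>x - r\<bar>" using that by (intro zdvd_imp_le) auto
        thus False using x r(1) by auto
      qed
      ultimately show "x \<in> insert r {x\<in>{0..<int q}. int q dvd poly Q x}" using x by auto
    qed
    moreover have fin: "finite {x\<in>{0..<int q}. int q dvd poly Q x}"
      by (rule finite_subset[of _ "{0..<int q}"]) auto
    ultimately have "card {x\<in>{0..<int q}. int q dvd poly P x} \<le> card (insert r {x\<in>{0..<int q}. int q dvd poly Q x})"
      by (intro card_mono) auto
    also have "\<dots> \<le> Suc (card {x\<in>{0..<int q}. int q dvd poly Q x})"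
      using fin by (simp only: card_insert_if) simp
    also have "\<dots> \<le> Suc (degree Q)" using IH by simp
    finally show ?thesis using degQ \<open>degree P \<noteq> 0\<close> by simp
  qed
qed

abbreviation tuples :: "nat \<Rightarrow> 'a set \<Rightarrow> (nat \<Rightarrow> 'a) set" where
  "tuples k V \<equiv> ({..<k} \<rightarrow>\<^sub>E V)"

lemma finite_tuples [simp]: "finite V \<Longrightarrow> finite (tuples k V)"
  by (intro finite_PiE) auto

lemma card_tuples: "card (tuples k V) = card V ^ k"
  by (simp add: card_PiE)

lemma norm_exp_sum_power:
  fixes \<beta> :: "'a \<Rightarrow> complex" and g :: "'a \<Rightarrow> int"
  assumes "finite V"
  shows "complex_of_real (norm (\<Sum>v\<in>V. \<beta> v * ee q (t * g v)) ^ (2 * k)) =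
    (\<Sum>(u, w)\<in>tuples k V \<times> tuples k V. (\<Prod>i<k. \<beta> (u i) * cnj (\<beta> (w i))) * ee q (t * (\<Sum>i<k. g (u i) - g (w i))))"
proof -
  define x where "x = (\<lambda>v. \<beta> v * ee q (t * g v))"
  define z where "z = (\<Sum>v\<in>V. x v)"
  have "complex_of_real (norm z ^ (2 * k)) = z ^ k * cnj z ^ k"
    using complex_norm_square[of z] by (simp add: power_mult power_mult_distrib)
  also have "z ^ k = (\<Prod>i<k. \<Sum>v\<in>V. x v)" by (simp add: z_def)
  also have "\<dots> = (\<Sum>u\<in>tuples k V. \<Prod>i<k. x (u i))"
    using assms by (intro prod_sum_PiE) auto
  also have "cnj z ^ k = (\<Prod>i<k. \<Sum>v\<in>V. cnj (x v))" by (simp add: z_def)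
  also have "\<dots> = (\<Sum>w\<in>tuples k V. \<Prod>i<k. cnj (x (w i)))"
    using assms by (intro prod_sum_PiE) auto
  also have "(\<Sum>u\<in>tuples k V. \<Prod>i<k. x (u i)) * (\<Sum>w\<in>tuples k V. \<Prod>i<k. cnj (x (w i))) =
      (\<Sum>(u, w)\<in>tuples k V \<times> tuples k V. (\<Prod>i<k. x (u i)) * (\<Prod>i<k. cnj (x (w i))))"
    by (simp add: sum_product sum.cartesian_product)
  also have "\<dots> = (\<Sum>(u, w)\<in>tuples k V \<times> tuples k V. (\<Prod>i<k. \<beta> (u i) * cnj (\<beta> (w i))) * ee q (t * (\<Sum>i<k. g (u i) - g (w i))))"
  proof (intro sum.cong refl, clarify)
    fix u w :: "nat \<Rightarrow> 'a"
    have "(\<Prod>i<k. x (u i)) * (\<Prod>i<k. cnj (x (w i))) =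
        (\<Prod>i<k. (\<beta> (u i) * cnj (\<beta> (w i))) * ee q (t * g (u i) - t * g (w i)))"
      unfolding prod.distrib[symmetric] by (intro prod.cong refl) (simp add: x_def ee_diff mult_ac)
    also have "\<dots> = (\<Prod>i<k. \<beta> (u i) * cnj (\<beta> (w i))) * ee q (\<Sum>i<k. t * g (u i) - t * g (w i))"
      by (simp only: prod.distrib ee_sum)
    also have "(\<Sum>i<k. t * g (u i) - t * g (w i)) = t * (\<Sum>i<k. g (u i) - g (w i))"
      by (simp add: sum_distrib_left right_diff_distrib)
    finally show "(\<Prod>i<k. x (u i)) * (\<Prod>i<k. cnj (x (w i))) =
        (\<Prod>i<k. \<beta> (u i) * cnj (\<beta> (w i))) * ee q (t * (\<Sum>i<k. g (u i) - g (w i)))" .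
  qed
  finally show ?thesis by (simp only: z_def x_def)
qed

lemma card_residue_class_interval:
  fixes d :: nat
  assumes "N \<subseteq> {s..<s + int L}" "d \<ge> 1" "\<And>x y. x \<in> N \<Longrightarrow> y \<in> N \<Longrightarrow> int d dvd x - y"
  shows "real (card N) \<le> real L / real d + 1"
proof (cases "L = 0")
  case True
  thus ?thesis using assms(1) by simp
next
  case False
  have "inj_on (\<lambda>x. (x - s) div int d) N"
  proof (rule inj_onI)
    fix x y assume xy: "x \<in> N" "y \<in> N" "(x - s) div int d = (y - s) div int d"
    have "(x - s) mod int d = (y - s) mod int d"
      using assms(3)[OF xy(1,2)] by (simp add: mod_eq_dvd_iff)
    thus "x = y" using xy(3) by (metis diff_add_cancel mult_div_mod_eq)
  qed
  moreover have "(\<lambda>x. (x - s) div int d) ` N \<subseteq> {0..int ((L - 1) div d)}"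
  proof
    fix z assume "z \<in> (\<lambda>x. (x - s) div int d) ` N"
    then obtain x where x: "x \<in> N" "z = (x - s) div int d" by blast
    hence "0 \<le> x - s" "x - s \<le> int (L - 1)" using assms(1) False by auto
    thus "z \<in> {0..int ((L - 1) div d)}"
      using x(2) assms(2) by (auto simp: zdiv_int intro!: zdiv_mono1 simp: pos_imp_zdiv_nonneg_iff)
  qed
  ultimately have "card N \<le> card {0..int ((L - 1) div d)}"
    by (intro card_inj_on_le) auto
  also have "\<dots> = (L - 1) div d + 1" by simp
  finally have "real (card N) \<le> real ((L - 1) div d) + 1" by linarith
  also have "real ((L - 1) div d) \<le> real (L - 1) / real d" by (rule of_nat_div_le_of_nat)
  also have "\<dots> \<le> real L / real d" by (intro divide_right_mono) auto
  finally show ?thesis by simp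
qed

lemma harm_le_ln: "n \<ge> 1 \<Longrightarrow> harm n \<le> 1 + ln (real n)"
  using euler_mascheroni_sequence_decreasing[of 1 n] by (simp add: harm_expand)

text \<open>gcd(a, b) is at most the sum of all common divisors g, after which the sums over a and b
  separate for each g.\<close>

lemma sum_gcd_div_le:
  fixes A :: nat
  assumes "A \<ge> 1"
  shows "(\<Sum>a\<in>{1..A}. \<Sum>b\<in>{1..A}. real (gcd a b) / real a) \<le> real A * (harm A)\<^sup>2"
proof -
  have "(\<Sum>a\<in>{1..A}. \<Sum>b\<in>{1..A}. real (gcd a b) / real a) \<le>
      (\<Sum>a\<in>{1..A}. \<Sum>b\<in>{1..A}. \<Sum>g\<in>{1..A}. (if g dvd a then real g / real a else 0) * (if g dvd b then 1 else 0))"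
  proof (intro sum_mono)
    fix a b assume ab: "a \<in> {1..A}" "b \<in> {1..A}"
    define F where "F = (\<lambda>g. (if g dvd a then real g / real a else 0) * (if g dvd b then 1 else (0::real)))"
    have "gcd a b \<in> {1..A}" using ab by (auto simp: Suc_le_eq intro: order_trans[OF gcd_le1_nat])
    hence "F (gcd a b) \<le> (\<Sum>g\<in>{1..A}. F g)"
      by (intro member_le_sum) (auto simp: F_def)
    thus "real (gcd a b) / real a \<le> (\<Sum>g\<in>{1..A}. F g)" by (simp add: F_def)
  qed
  also have "\<dots> = (\<Sum>g\<in>{1..A}. (\<Sum>a\<in>{1..A}. if g dvd a then real g / real a else 0) * (\<Sum>b\<in>{1..A}. if g dvd b then 1 else 0))"
    unfolding sum_product by (subst sum.swap[of _ "{1..A}" "{1..A}"], subst (2) sum.swap) (rule refl)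
  also have "\<dots> \<le> (\<Sum>g\<in>{1..A}. harm A * (real A / real g))"
  proof (intro sum_mono mult_mono)
    fix g assume g: "g \<in> {1..A}"
    have mult: "{a\<in>{1..A}. g dvd a} = (\<lambda>j. g * j) ` {1..A div g}"
    proof (intro equalityI subsetI)
      fix a assume "a \<in> {a\<in>{1..A}. g dvd a}"
      then obtain j where "a = g * j" "1 \<le> a" "a \<le> A" by auto
      thus "a \<in> (\<lambda>j. g * j) ` {1..A div g}"
        using g by (intro image_eqI[of _ _ j]) (auto simp: less_eq_div_iff_mult_less_eq mult.commute Suc_le_eq)
    next
      fix a assume "a \<in> (\<lambda>j. g * j) ` {1..A div g}"
      then obtain j where "a = g * j" "j \<in> {1..A div g}" by (elim imageE)
      hence "a = g * j" "1 \<le> j" "j \<le> A div g" by auto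
      thus "a \<in> {a\<in>{1..A}. g dvd a}"
        using g by (auto simp: less_eq_div_iff_mult_less_eq mult.commute Suc_le_eq)
    qed
    have inj: "inj_on (\<lambda>j. g * j) {1..A div g}" using g by (auto simp: inj_on_def)
    have "(\<Sum>a\<in>{1..A}. if g dvd a then real g / real a else 0) = (\<Sum>a\<in>{a\<in>{1..A}. g dvd a}. real g / real a)"
      by (simp add: sum.If_cases Int_def)
    also have "\<dots> = (\<Sum>j\<in>{1..A div g}. inverse (real j))"
      unfolding mult using g by (subst sum.reindex[OF inj]) (simp add: inverse_eq_divide)
    also have "\<dots> \<le> harm A" unfolding harm_def by (intro sum_mono2) auto
    finally show "(\<Sum>a\<in>{1..A}. if g dvd a then real g / real a else 0) \<le> harm A" .
    have "(\<Sum>b\<in>{1..A}. if g dvd b then 1 else 0) = real (card {a\<in>{1..A}. g dvd a})"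
      by (simp add: sum.If_cases Int_def)
    also have "\<dots> = real (A div g)" unfolding mult by (subst card_image[OF inj]) simp
    also have "\<dots> \<le> real A / real g" by (rule of_nat_div_le_of_nat)
    finally show "(\<Sum>b\<in>{1..A}. if g dvd b then 1 else 0) \<le> real A / real g" .
  qed (auto intro: sum_nonneg harm_nonneg)
  also have "\<dots> = real A * (harm A)\<^sup>2"
    by (simp add: harm_def sum_distrib_left power2_eq_square divide_inverse mult_ac)
  finally show ?thesis .
qed

text \<open>A unit shift of the interval exchanges only its two end terms.\<close>

lemma norm_sum_shift_diff:
  fixes F :: "int \<Rightarrow> complex"
  assumes F: "\<And>n. norm (F n) \<le> 1"
  shows "norm ((\<Sum>n\<in>{s..<s + int L}. F (n + int c)) - (\<Sum>n\<in>{s..<s + int L}. F n)) \<le> 2 * real c"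
proof (induction c)
  case (Suc c)
  let ?D = "\<lambda>c. \<Sum>n\<in>{s..<s + int L}. F (n + int c)"
  have "?D (Suc c) - ?D c = (\<Sum>n\<in>{s..<s + int L}. F (n + 1 + int c) - F (n + int c))"
    by (simp add: sum_subtractf add_ac)
  also have "\<dots> = (\<Sum>i<L. F (s + int (Suc i) + int c) - F (s + int i + int c))"
    by (rule sum.reindex_bij_witness[of _ "\<lambda>i. s + int i" "\<lambda>n. nat (n - s)"]) (auto simp: algebra_simps)
  also have "\<dots> = F (s + int L + int c) - F (s + int c)"
    using sum_lessThan_telescope[of "\<lambda>i. F (s + int i + int c)" L] by simp
  finally have "?D (Suc c) - ?D 0 = (?D c - ?D 0) + (F (s + int L + int c) - F (s + int c))"
    by (simp add: algebra_simps)
  hence "norm (?D (Suc c) - ?D 0) \<le> norm (?D c - ?D 0) + norm (F (s + int L + int c) - F (s + int c))"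
    by (metis norm_triangle_ineq)
  also have "norm (F (s + int L + int c) - F (s + int c)) \<le> 2"
    using F[of "s + int L + int c"] F[of "s + int c"] norm_triangle_ineq4[of "F (s + int L + int c)" "F (s + int c)"]
    by linarith
  finally show ?case using Suc by simp
qed simp

section \<open>Moments over complete residue systems\<close>

context
  fixes q :: nat
  assumes q: "prime q" and q3: "q \<ge> 3"
begin

text \<open>Clearing denominators turns the congruence into a polynomial congruence of degree at
  most 4 k. To these roots come the at most 2 k classes at which some summand has a pole, where
  \<open>invsq\<close> takes the value 0 and the cleared equation says nothing.\<close>

lemma card_collision_roots:
  fixes b b' :: "nat \<Rightarrow> int"
  assumes b: "b \<in> tuples k {1..int B}" "b' \<in> tuples k {1..int B}" and B: "B < q" and k: "k < q"
    and v0: "card {i\<in>{..<k}. b i = v0} \<noteq> card {i\<in>{..<k}. b' i = v0}"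
  shows "card {\<xi>\<in>{0..<int q}. int q dvd (\<Sum>i<k. invsq q (\<xi> + b i) - invsq q (\<xi> + b' i))} \<le> 6 * k"
proof -
  define V where "V = b ` {..<k} \<union> b' ` {..<k}"
  define c where "c = (\<lambda>v. int (card {i\<in>{..<k}. b i = v}) - int (card {i\<in>{..<k}. b' i = v}))"
  define P where "P = (\<Sum>v\<in>V. smult (c v) (\<Prod>w\<in>V - {v}. [:w, 1:] ^ 2))"
  have fin: "finite V" by (simp add: V_def)
  have cardV: "card V \<le> 2 * k"
    unfolding V_def by (intro order_trans[OF card_Un_le]) (use card_image_le[of "{..<k}" b] card_image_le[of "{..<k}" b'] in auto)
  have VB: "v \<in> {1..int B}" if "v \<in> V" for v using that b by (auto simp: V_def PiE_iff)
  have v0V: "v0 \<in> V"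
  proof (rule ccontr)
    assume "v0 \<notin> V"
    hence "{i\<in>{..<k}. b i = v0} = {}" "{i\<in>{..<k}. b' i = v0} = {}" by (auto simp: V_def)
    thus False using v0 by (simp only:)
  qed
  have grp: "(\<Sum>i<k. g (d i)) = (\<Sum>v\<in>V. int (card {i\<in>{..<k}. d i = v}) * g v)"
    if "d ` {..<k} \<subseteq> V" for g :: "int \<Rightarrow> int" and d
  proof -
    have "(\<Sum>v\<in>V. int (card {i\<in>{..<k}. d i = v}) * g v) = (\<Sum>v\<in>V. \<Sum>i\<in>{i\<in>{..<k}. d i = v}. g (d i))"
      by simp
    also have "\<dots> = (\<Sum>i<k. g (d i))" using that fin by (intro sum.group) auto
    finally show ?thesis ..
  qed
  have expr: "(\<Sum>i<k. invsq q (\<xi> + b i) - invsq q (\<xi> + b' i)) = (\<Sum>v\<in>V. c v * invsq q (\<xi> + v))" for \<xi>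
    using grp[of b "\<lambda>v. invsq q (\<xi> + v)"] grp[of b' "\<lambda>v. invsq q (\<xi> + v)"]
    by (simp add: V_def sum_subtractf c_def left_diff_distrib)
  have polyP: "poly P \<xi> = (\<Sum>v\<in>V. c v * (\<Prod>w\<in>V - {v}. (\<xi> + w)\<^sup>2))" for \<xi>
    by (simp add: P_def poly_sum poly_prod add.commute)
  have degP: "degree P \<le> 4 * k"
    unfolding P_def
  proof (intro degree_sum_le order_trans[OF degree_smult_le] fin)
    fix v assume "v \<in> V"
    have "degree (\<Prod>w\<in>V - {v}. [:w, 1:] ^ 2) \<le> (\<Sum>w\<in>V - {v}. degree ([:w, 1:] ^ 2))"
      using degree_prod_sum_le[of "V - {v}" "\<lambda>w. [:w, 1:] ^ 2"] fin by (simp add: comp_def)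
    also have "\<dots> = 2 * card (V - {v})" by (simp add: degree_power_eq)
    also have "\<dots> \<le> 4 * k" using cardV card_Diff1_le[of V v] by linarith
    finally show "degree (\<Prod>w\<in>V - {v}. [:w, 1:] ^ 2) \<le> 4 * k" .
  qed
  \<comment> \<open>At - v0 only the summand of \<open>v0\<close> survives. Its multiplicity
    difference is nonzero and at most k < q in absolute value, and the other values differ from
    \<open>v0\<close> by less than q.\<close>
  have "\<not> int q dvd poly P (- v0)"
  proof -
    have "poly P (- v0) = (\<Sum>v\<in>{v0}. c v * (\<Prod>w\<in>V - {v}. (- v0 + w)\<^sup>2))"
      unfolding polyP using fin v0V by (intro sum.mono_neutral_right) (auto simp: prod_zero_iff)
    moreover have "\<not> int q dvd (- v0 + w)\<^sup>2" if "w \<in> V - {v0}" for w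
    proof -
      have "\<not> int q dvd - v0 + w"
      proof
        assume "int q dvd - v0 + w"
        hence "int q \<le> \<bar>- v0 + w\<bar>" using that by (intro zdvd_imp_le) auto
        thus False using VB[of w] VB[OF v0V] that B by auto
      qed
      thus ?thesis using q by (simp add: prime_dvd_power_iff)
    qed
    moreover have "\<not> int q dvd c v0"
    proof -
      have "card {i\<in>{..<k}. b i = v0} \<le> card {..<k}" "card {i\<in>{..<k}. b' i = v0} \<le> card {..<k}"
        by (intro card_mono; auto)+
      hence "\<bar>c v0\<bar> < int q" "c v0 \<noteq> 0" using k v0 by (auto simp: c_def)
      thus ?thesis using zdvd_imp_le[of "int q" "\<bar>c v0\<bar>"] by auto
    qed
    ultimately show ?thesis
      using q fin by (simp add: prime_dvd_mult_iff prime_dvd_prod_iff)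
  qed
  hence roots: "card {x\<in>{0..<int q}. int q dvd poly P x} \<le> 4 * k"
    using card_roots_mod_prime[OF q] degP order_trans by blast
  let ?Z = "{\<xi>\<in>{0..<int q}. int q dvd (\<Sum>i<k. invsq q (\<xi> + b i) - invsq q (\<xi> + b' i))}"
  have "?Z \<subseteq> {x\<in>{0..<int q}. int q dvd poly P x} \<union> (\<lambda>v. (- v) mod int q) ` V"
  proof
    fix \<xi> assume \<xi>: "\<xi> \<in> ?Z"
    show "\<xi> \<in> {x\<in>{0..<int q}. int q dvd poly P x} \<union> (\<lambda>v. (- v) mod int q) ` V"
    proof (cases "\<exists>v\<in>V. int q dvd \<xi> + v")
      case True
      then obtain v where v: "v \<in> V" "int q dvd \<xi> + v" by blast
      hence "\<xi> mod int q = (- v) mod int q" by (simp add: mod_eq_dvd_iff)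
      hence "\<xi> = (- v) mod int q" using \<xi> by simp
      thus ?thesis using v by blast
    next
      case False
      define R where "R = (\<Prod>w\<in>V. (\<xi> + w)\<^sup>2)"
      have "[R * (\<Sum>v\<in>V. c v * invsq q (\<xi> + v)) = poly P \<xi>] (mod int q)"
        unfolding polyP sum_distrib_left
      proof (rule cong_sum)
        fix v assume v: "v \<in> V"
        have "R = (\<xi> + v)\<^sup>2 * (\<Prod>w\<in>V - {v}. (\<xi> + w)\<^sup>2)"
          unfolding R_def using fin v by (simp add: prod.remove)
        hence "R * (c v * invsq q (\<xi> + v)) =
            (\<xi> + v)\<^sup>2 * invsq q (\<xi> + v) * (c v * (\<Prod>w\<in>V - {v}. (\<xi> + w)\<^sup>2))" by (simp add: mult_ac)
        moreover have "[(\<xi> + v)\<^sup>2 * invsq q (\<xi> + v) * (c v * (\<Prod>w\<in>V - {v}. (\<xi> + w)\<^sup>2)) =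
            1 * (c v * (\<Prod>w\<in>V - {v}. (\<xi> + w)\<^sup>2))] (mod int q)"
          using False v by (intro cong_mult invsq_cong_1[OF q q3] cong_refl) auto
        ultimately show "[R * (c v * invsq q (\<xi> + v)) = c v * (\<Prod>w\<in>V - {v}. (\<xi> + w)\<^sup>2)] (mod int q)"
          by (simp only: mult_1)
      qed
      moreover have "int q dvd R * (\<Sum>v\<in>V. c v * invsq q (\<xi> + v))"
        using \<xi> expr[of \<xi>] by simp
      ultimately have "int q dvd poly P \<xi>" using cong_dvd_iff by blast
      thus ?thesis using \<xi> by simp
    qed
  qed
  moreover have "finite {x\<in>{0..<int q}. int q dvd poly P x}"
    by (rule finite_subset[of _ "{0..<int q}"]) auto
  ultimately have "card ?Z \<le> card ({x\<in>{0..<int q}. int q dvd poly P x} \<union> (\<lambda>v. (- v) mod int q) ` V)"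
    using fin by (intro card_mono) auto
  also have "\<dots> \<le> card {x\<in>{0..<int q}. int q dvd poly P x} + card ((\<lambda>v. (- v) mod int q) ` V)"
    by (rule card_Un_le)
  also have "\<dots> \<le> 4 * k + 2 * k" using roots card_image_le[OF fin] cardV by (intro add_mono) (auto intro: order_trans)
  finally show ?thesis by simp
qed

lemma sum_indicator_affine:
  fixes x y z :: real
  assumes "finite T" "E \<subseteq> T"
  shows "(\<Sum>t\<in>T. x * ((if t \<in> E then y else 0) + z)) = x * (y * real (card E) + z * real (card T))"
proof -
  have "(\<Sum>t\<in>T. if t \<in> E then y else 0) = (\<Sum>t\<in>E. y)"
    using assms by (intro sum.mono_neutral_cong_right) auto
  thus ?thesis by (simp add: sum_distrib_left[symmetric] sum.distrib mult.commute)
qed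

text \<open>Equal value counts make b' a rearrangement of b. It is enough that each entry of b'
  occurs in b, so b' = b \<circ> \<sigma> for some map \<sigma>; counting all maps gives
  k^k.\<close>

lemma card_same_counts:
  fixes V :: "'a set"
  assumes "finite V"
  shows "card {(b, b')\<in>tuples k V \<times> tuples k V. \<forall>v. card {i\<in>{..<k}. b i = v} = card {i\<in>{..<k}. b' i = v}}
    \<le> card V ^ k * k ^ k"
proof -
  let ?f = "\<lambda>(b, \<sigma>). (b, restrict (b \<circ> \<sigma>) {..<k})"
  have "{(b, b')\<in>tuples k V \<times> tuples k V. \<forall>v. card {i\<in>{..<k}. b i = v} = card {i\<in>{..<k}. b' i = v}}
      \<subseteq> ?f ` (tuples k V \<times> tuples k {..<k})"
  proof clarify
    fix b b' assume b: "b \<in> tuples k V" "b' \<in> tuples k V"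
      and eq: "\<forall>v. card {i\<in>{..<k}. b i = v} = card {i\<in>{..<k}. b' i = v}"
    have "\<exists>j<k. b j = b' i" if "i < k" for i
    proof -
      have "card {j\<in>{..<k}. b' j = b' i} > 0" using that by (auto simp: card_gt_0_iff)
      hence "card {j\<in>{..<k}. b j = b' i} > 0" using eq by simp
      thus ?thesis by (auto simp: card_gt_0_iff)
    qed
    then obtain \<sigma> where \<sigma>: "\<And>i. i < k \<Longrightarrow> \<sigma> i < k \<and> b (\<sigma> i) = b' i" by metis
    have "restrict \<sigma> {..<k} \<in> tuples k {..<k}" using \<sigma> by auto
    moreover have "b' = restrict (b \<circ> restrict \<sigma> {..<k}) {..<k}"
      using b(2) \<sigma> by (auto simp: fun_eq_iff restrict_def PiE_iff extensional_def)
    ultimately show "(b, b') \<in> ?f ` (tuples k V \<times> tuples k {..<k})"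
      using b(1) by (intro image_eqI[of _ _ "(b, restrict \<sigma> {..<k})"]) auto
  qed
  hence "card {(b, b')\<in>tuples k V \<times> tuples k V. \<forall>v. card {i\<in>{..<k}. b i = v} = card {i\<in>{..<k}. b' i = v}}
      \<le> card (?f ` (tuples k V \<times> tuples k {..<k}))"
    using assms by (intro card_mono finite_imageI finite_cartesian_product) auto
  also have "\<dots> \<le> card (tuples k V \<times> tuples k {..<k})"
    using assms by (intro card_image_le finite_cartesian_product) auto
  finally show ?thesis by (simp add: card_cartesian_product card_tuples)
qed

text \<open>Summation over t counts the \<xi> at which the sums of inverse squares along b and b'
  agree modulo q. The rearranged pairs may agree at all q points; every other pair agrees at no more
  than 6 k.\<close>

lemma moment_bound:
  assumes B: "B < q" and k: "k < q"
  shows "(\<Sum>t\<in>{0..<int q}. \<Sum>\<xi>\<in>{0..<int q}. norm (\<Sum>b\<in>{1..int B}. ee q (t * invsq q (\<xi> + b))) ^ (2 * k))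
    \<le> real q * (real q * real k ^ k * real B ^ k + 6 * real k * real B ^ (2 * k))" (is "?S \<le> _")
proof -
  let ?T = "tuples k {1..int B} \<times> tuples k {1..int B}"
  let ?N = "\<lambda>\<xi> b b'. \<Sum>i<k. invsq q (\<xi> + b i) - invsq q (\<xi> + b' i)"
  let ?Z = "\<lambda>b b'. {\<xi>\<in>{0..<int q}. int q dvd ?N \<xi> b b'}"
  define E where "E = {(b, b')\<in>?T. \<forall>v. card {i\<in>{..<k}. b i = v} = card {i\<in>{..<k}. b' i = v}}"
  have q0: "q > 0" using q3 by simp
  have finT: "finite ?T" by (intro finite_cartesian_product finite_tuples) auto
  have "complex_of_real ?S = (\<Sum>t\<in>{0..<int q}. \<Sum>\<xi>\<in>{0..<int q}. \<Sum>(b, b')\<in>?T. ee q (t * ?N \<xi> b b'))"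
    using norm_exp_sum_power[of "{1..int B}" "\<lambda>_. 1"] by (simp add: of_real_sum del: of_real_power)
  also have "\<dots> = (\<Sum>\<xi>\<in>{0..<int q}. \<Sum>(b, b')\<in>?T. \<Sum>t\<in>{0..<int q}. ee q (?N \<xi> b b' * t))"
    by (subst sum.swap, intro sum.cong refl, subst sum.swap) (simp add: case_prod_unfold mult.commute)
  also have "\<dots> = (\<Sum>\<xi>\<in>{0..<int q}. \<Sum>(b, b')\<in>?T. if int q dvd ?N \<xi> b b' then of_nat q else 0)"
    by (simp only: sum_ee[OF q0])
  also have "\<dots> = (\<Sum>(b, b')\<in>?T. \<Sum>\<xi>\<in>{0..<int q}. if int q dvd ?N \<xi> b b' then of_nat q else 0)"
    by (subst sum.swap) (simp add: case_prod_unfold)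
  also have "\<dots> = (\<Sum>(b, b')\<in>?T. complex_of_real (real q * real (card (?Z b b'))))"
    by (intro sum.cong refl) (simp add: sum.If_cases Int_def case_prod_unfold)
  finally have "?S = (\<Sum>(b, b')\<in>?T. real q * real (card (?Z b b')))"
    unfolding case_prod_unfold of_real_sum[symmetric] of_real_eq_iff .
  also have "\<dots> \<le> (\<Sum>z\<in>?T. real q * ((if z \<in> E then real q else 0) + 6 * real k))"
  proof (intro sum_mono, clarify)
    fix b b' assume b: "b \<in> tuples k {1..int B}" "b' \<in> tuples k {1..int B}"
    show "real q * real (card (?Z b b')) \<le> real q * ((if (b, b') \<in> E then real q else 0) + 6 * real k)"
    proof (cases "(b, b') \<in> E")
      case True
      have "card (?Z b b') \<le> card {0..<int q}" by (intro card_mono) auto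
      thus ?thesis using True by (intro mult_left_mono) auto
    next
      case False
      then obtain v0 where "card {i\<in>{..<k}. b i = v0} \<noteq> card {i\<in>{..<k}. b' i = v0}" using b by (auto simp: E_def)
      hence "card (?Z b b') \<le> 6 * k" by (rule card_collision_roots[OF b B k])
      hence "real (card (?Z b b')) \<le> real (6 * k)" by (intro of_nat_mono)
      thus ?thesis using False by (intro mult_left_mono) auto
    qed
  qed
  also have "\<dots> = real q * (real q * real (card E) + 6 * real k * real (card ?T))"
  proof (rule sum_indicator_affine[OF finT])
    show "E \<subseteq> ?T" by (auto simp: E_def)
  qed
  also have "\<dots> \<le> real q * (real q * (real B ^ k * real k ^ k) + 6 * real k * real B ^ (2 * k))"
  proof (intro mult_left_mono add_mono)
    have "card E \<le> B ^ k * k ^ k" using card_same_counts[of "{1..int B}" k] by (simp add: E_def)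
    thus "real (card E) \<le> real B ^ k * real k ^ k" by (metis of_nat_le_iff of_nat_mult of_nat_power)
    show "real (card ?T) \<le> real B ^ (2 * k)"
      by (simp add: card_cartesian_product card_tuples mult_2 power_add)
  qed auto
  finally show ?thesis by (simp add: mult_ac)
qed

end

section \<open>Coincidences of the points n / a and large values\<close>

context
  fixes q :: nat
  assumes q: "prime q" and q3: "q \<ge> 3"
begin

text \<open>The interval may lie far from 0, so a single congruence is not an equation. Differences
  of two solutions are small, however, and 2 L A < q makes (x - y) a' = (x' - y') a an equation in
  integers. Hence n determines n', and all n agree modulo a / gcd(a, a').\<close>

lemma card_proportional_pairs:
  fixes a a' :: nat
  assumes a: "1 \<le> a" "a \<le> A" "1 \<le> a'" "a' \<le> A" and LA: "2 * L * A < q"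
  shows "real (card {(n, n')\<in>{s..<s + int L} \<times> {s..<s + int L}. int q dvd n * int a' - n' * int a})
    \<le> real L * (real (gcd a a') / real a) + 1"
proof -
  let ?I = "{s..<s + int L}"
  define K where "K = {(n, n')\<in>?I \<times> ?I. int q dvd n * int a' - n' * int a}"
  have small: "\<bar>(x - y) * int c\<bar> \<le> int (L * A)" if "x \<in> ?I" "y \<in> ?I" "c \<le> A" for x y c
  proof -
    have "\<bar>x - y\<bar> \<le> int L" using that by auto
    hence "\<bar>x - y\<bar> * int c \<le> int L * int A" using that by (intro mult_mono) auto
    thus ?thesis by (simp add: abs_mult)
  qed
  have LA': "2 * int (L * A) < int q" using LA by (metis mult.assoc of_nat_less_iff of_nat_mult of_nat_numeral)
  have inj: "inj_on fst K"
  proof (rule inj_onI, clarify)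
    fix n n1 m n2 assume "(n, n1) \<in> K" "(m, n2) \<in> K" "fst (n, n1) = fst (m, n2)"
    hence n: "n1 \<in> ?I" "n2 \<in> ?I" "int q dvd n * int a' - n1 * int a" "int q dvd n * int a' - n2 * int a" "m = n"
      by (auto simp: K_def)
    have "int q dvd (n * int a' - n2 * int a) - (n * int a' - n1 * int a)" by (rule dvd_diff[OF n(4) n(3)])
    hence "int q dvd (n1 - n2) * int a" by (simp add: algebra_simps)
    moreover have "\<bar>(n1 - n2) * int a\<bar> < int q" using small[OF n(1,2) a(2)] LA' by linarith
    ultimately have "(n1 - n2) * int a = 0" using zdvd_imp_le[of "int q" "\<bar>(n1 - n2) * int a\<bar>"] by fastforce
    thus "n = m \<and> n1 = n2" using a n by simp
  qed
  define d where "d = a div gcd a a'"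
  have d1: "d \<ge> 1" using a by (simp add: d_def Suc_le_eq div_greater_zero_iff gcd_le1_nat)
  have "real (card (fst ` K)) \<le> real L / real d + 1"
  proof (rule card_residue_class_interval[OF _ d1])
    show "fst ` K \<subseteq> ?I" by (auto simp: K_def)
    fix x y assume "x \<in> fst ` K" "y \<in> fst ` K"
    then obtain x' y' where xy: "x \<in> ?I" "x' \<in> ?I" "y \<in> ?I" "y' \<in> ?I"
        "int q dvd x * int a' - x' * int a" "int q dvd y * int a' - y' * int a"
      by (auto simp: K_def)
    have "int q dvd (x * int a' - x' * int a) - (y * int a' - y' * int a)" by (rule dvd_diff[OF xy(5) xy(6)])
    hence "int q dvd (x - y) * int a' - (x' - y') * int a" by (simp add: algebra_simps)
    moreover have "\<bar>(x - y) * int a' - (x' - y') * int a\<bar> < int q"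
      using small[OF xy(1,3) a(4)] small[OF xy(2,4) a(2)] LA' by linarith
    ultimately have "(x - y) * int a' - (x' - y') * int a = 0"
      using zdvd_imp_le[of "int q" "\<bar>(x - y) * int a' - (x' - y') * int a\<bar>"] by fastforce
    hence "int a dvd (x - y) * int a'" by (intro dvdI[of _ _ "x' - y'"]) (simp add: algebra_simps)
    moreover obtain c where c: "a' = gcd a a' * c" by (meson dvdE gcd_dvd2)
    have ad: "a = gcd a a' * d" by (simp add: d_def)
    have cop: "coprime d c"
    proof -
      have "c = a' div gcd a a'" using c a by (metis gcd_eq_0_iff nonzero_mult_div_cancel_left not_one_le_zero)
      thus ?thesis unfolding d_def using a by (simp add: div_gcd_coprime)
    qed
    ultimately have "int (gcd a a') * int d dvd (x - y) * (int (gcd a a') * int c)"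
      using ad c by (metis of_nat_mult)
    hence "int (gcd a a') * int d dvd int (gcd a a') * ((x - y) * int c)" by (simp add: mult_ac)
    hence "int d dvd (x - y) * int c" using a by simp
    thus "int d dvd x - y" using cop by (simp add: coprime_dvd_mult_left_iff)
  qed
  also have "real L / real d = real L * (real (gcd a a') / real a)"
  proof -
    have "real d = real a / real (gcd a a')" unfolding d_def by (rule real_of_nat_div) simp
    thus ?thesis by simp
  qed
  finally show ?thesis using card_image[OF inj] by (simp add: K_def)
qed

text \<open>This counts the coincidences n / a = n' / a' modulo q. Since A \<le> L, the additive 1
  of each pair (a, a') is absorbed, which accounts for the factor 2.\<close>

lemma card_proportional:
  assumes A: "1 \<le> A" "A \<le> L" and LA: "2 * L * A < q"
  shows "real (card {w\<in>({1..int A} \<times> {s..<s + int L}) \<times> ({1..int A} \<times> {s..<s + int L}).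
      int q dvd snd (fst w) * fst (snd w) - snd (snd w) * fst (fst w)}) \<le> 2 * real A * real L * (1 + ln (real q))\<^sup>2"
    (is "real (card ?E) \<le> _")
proof -
  let ?I = "{s..<s + int L}"
  let ?K = "\<lambda>a a'. {(n, n')\<in>?I \<times> ?I. int q dvd n * int a' - n' * int a}"
  define U where "U = (SIGMA aa:{1..A} \<times> {1..A}. ?K (fst aa) (snd aa))"
  have finK: "finite (?K a a')" for a a'
    by (rule finite_subset[of _ "?I \<times> ?I"]) auto
  have finU: "finite U" unfolding U_def by (rule finite_SigmaI) (simp_all only: finK finite_cartesian_product finite_atLeastAtMost)
  have "?E \<subseteq> (\<lambda>((a, a'), (n, n')). ((int a, n), (int a', n'))) ` U"
  proof clarify
    fix a n a' n' assume "a \<in> {1..int A}" "n \<in> ?I" "a' \<in> {1..int A}" "n' \<in> ?I"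
      "int q dvd snd (fst ((a, n), (a', n'))) * fst (snd ((a, n), (a', n'))) - snd (snd ((a, n), (a', n'))) * fst (fst ((a, n), (a', n')))"
    thus "((a, n), (a', n')) \<in> (\<lambda>((a, a'), (n, n')). ((int a, n), (int a', n'))) ` U"
      by (intro image_eqI[of _ _ "((nat a, nat a'), (n, n'))"]) (auto simp: U_def)
  qed
  hence "card ?E \<le> card ((\<lambda>((a, a'), (n, n')). ((int a, n), (int a', n'))) ` U)"
    using finU by (intro card_mono) auto
  also have "\<dots> \<le> card U" by (rule card_image_le[OF finU])
  also have "card U = (\<Sum>aa\<in>{1..A} \<times> {1..A}. card (?K (fst aa) (snd aa)))"
    unfolding U_def by (rule card_SigmaI) (simp_all only: finK finite_cartesian_product finite_atLeastAtMost ball_triv simp_thms)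
  finally have "real (card ?E) \<le> (\<Sum>aa\<in>{1..A} \<times> {1..A}. real (card (?K (fst aa) (snd aa))))"
    by (simp only: of_nat_sum[symmetric] of_nat_le_iff)
  also have "\<dots> = (\<Sum>a\<in>{1..A}. \<Sum>a'\<in>{1..A}. real (card (?K a a')))"
    by (simp add: sum.cartesian_product case_prod_unfold)
  also have "\<dots> \<le> (\<Sum>a\<in>{1..A}. \<Sum>a'\<in>{1..A}. real L * (real (gcd a a') / real a) + 1)"
    by (intro sum_mono card_proportional_pairs[OF _ _ _ _ LA]) auto
  also have "\<dots> = real L * (\<Sum>a\<in>{1..A}. \<Sum>a'\<in>{1..A}. real (gcd a a') / real a) + real A * real A"
    by (simp add: sum.distrib sum_distrib_left)
  also have "\<dots> \<le> real L * (real A * (harm A)\<^sup>2) + real A * real L"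
    using sum_gcd_div_le[OF A(1)] A by (intro add_mono mult_left_mono) auto
  also have "\<dots> = real A * real L * ((harm A)\<^sup>2 + 1)" by (simp add: algebra_simps)
  also have "\<dots> \<le> real A * real L * ((1 + ln (real q))\<^sup>2 + (1 + ln (real q))\<^sup>2)"
  proof (intro mult_left_mono add_mono power_mono)
    have "A < q" using LA A by (metis le_less_trans mult.assoc mult_le_mono1 nat_mult_1 order_trans One_nat_def Suc_leI
          le_numeral_extra(4) mult_2 trans_le_add1 zero_less_one less_le_trans not_less)
    hence "real A \<le> real q" by simp
    hence "ln (real A) \<le> ln (real q)" using A by simp
    thus "harm A \<le> 1 + ln (real q)" using harm_le_ln[OF A(1)] by linarith
    have "ln (real q) \<ge> 0" using q3 by simp
    thus "1 \<le> (1 + ln (real q))\<^sup>2" by simp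
  qed (auto simp: harm_nonneg)
  finally show ?thesis by simp
qed

text \<open>Since \<open>(n + a b)^(-2) = a^(-2) (n / a + b)^(-2)\<close>, averaging over the shifts \<open>n + a b\<close> replaces the sum at \<open>h\<close> by
  sums over \<open>b\<close> at the points \<open>(h / a\<^sup>2, n / a)\<close>. Few triples \<open>(h, a, n)\<close> share a point, so the Hoelder inequality
  and the moment over all points apply.\<close>

lemma large_values:
  fixes s :: int and k A B L :: nat and H :: "int set" and \<tau> :: real
  defines "S \<equiv> \<lambda>h. \<Sum>n\<in>{s..<s + int L}. ee q (h * invsq q n)"
  assumes k: "k \<ge> 1" "k < q" and B: "1 \<le> B" "B < q" "real q \<le> real B ^ k"
    and A: "1 \<le> A" "A \<le> L" "2 * L * A < q" and \<tau>: "4 * real A * real B \<le> \<tau> * real L"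
    and H: "H \<subseteq> {0..<int q}" "\<And>h. h \<in> H \<Longrightarrow> \<tau> * real L \<le> norm (S h)"
  shows "real (card H) * (real A * real L) * (\<tau> / 2) ^ (2 * k) \<le>
    2 * (1 + ln (real q))\<^sup>2 * real q * (real k ^ k + 6 * real k)"
proof (cases "H = {}")
  case True
  thus ?thesis using q3 by (simp add: mult_nonneg_nonneg)
next
  case False
  let ?I = "{s..<s + int L}"
  let ?A = "{1..int A}" and ?B = "{1..int B}"
  have q0: "q > 0" using q3 by simp
  have finH: "finite H" using H(1) finite_subset by blast
  define c where "c = real (card H)"
  have c: "c > 0" using False finH by (simp add: c_def card_gt_0_iff)
  have LA0: "real A > 0" "real L > 0" using A by auto
  have \<tau>0: "\<tau> > 0"
  proof -
    have "0 < \<tau> * real L" using \<tau> A B by (intro less_le_trans[OF _ \<tau>]) auto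
    thus ?thesis using LA0 by (simp add: zero_less_mult_iff)
  qed
  define \<Phi> where "\<Phi> = (\<lambda>z. norm (\<Sum>b\<in>?B. ee q (fst z * invsq q (snd z + b))))"
  \<comment> \<open>The point (h / a^2, n / a), both coordinates reduced modulo q.\<close>
  define \<pi> where "\<pi> = (\<lambda>(h, a, n). ((h * invsq q a) mod int q, (a ^ (q - 2) * n) mod int q))"
  define P where "P = H \<times> (?A \<times> ?I)"
  define R where "R = {0..<int q} \<times> {0..<int q}"
  have finP: "finite P" using finH by (simp add: P_def)
  have cardP: "real (card P) = c * real A * real L"
    by (simp add: P_def card_cartesian_product c_def)
  have A_nd: "\<not> int q dvd a" if "a \<in> ?A" for a
  proof -
    have "A < q" using A by (metis le_less_trans le_trans mult.commute mult_le_mono2 mult_numeral_1_right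
          nat_mult_1_right numeral_One one_le_numeral mult_le_mono)
    thus ?thesis using that by (auto dest: zdvd_imp_le)
  qed
  have shifted: "norm (\<Sum>b\<in>?B. ee q (h * invsq q (n + a * b))) = \<Phi> (\<pi> (h, a, n))" if a: "a \<in> ?A" for h a n
  proof -
    have "ee q (h * invsq q (n + a * b)) =
        ee q ((h * invsq q a) mod int q * invsq q ((a ^ (q - 2) * n) mod int q + b))" for b
    proof (rule ee_cong)
      have "[a * (a ^ (q - 2) * n + b) = 1 * n + a * b] (mod int q)"
        using cong_mult[OF inverse_cong[OF q q3 A_nd[OF a]] cong_refl[of n]]
        by (simp only: distrib_left mult.assoc) (intro cong_add cong_refl, simp add: mult.assoc)
      hence "[n + a * b = a * (a ^ (q - 2) * n + b)] (mod int q)" by (simp add: cong_sym)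
      hence "[h * invsq q (n + a * b) = h * invsq q (a * (a ^ (q - 2) * n + b))] (mod int q)"
        by (intro cong_mult cong_refl invsq_cong[OF q q3])
      also have "h * invsq q (a * (a ^ (q - 2) * n + b)) = (h * invsq q a) * invsq q (a ^ (q - 2) * n + b)"
        by (simp add: invsq_mult[OF q q3])
      also have "[\<dots> = (h * invsq q a) mod int q * invsq q ((a ^ (q - 2) * n) mod int q + b)] (mod int q)"
        by (intro cong_mult invsq_cong[OF q q3] cong_add cong_refl) (simp_all add: unique_euclidean_semiring_class.cong_def)
      finally show "[h * invsq q (n + a * b) =
          (h * invsq q a) mod int q * invsq q ((a ^ (q - 2) * n) mod int q + b)] (mod int q)" .
    qed
    thus ?thesis by (simp add: \<Phi>_def \<pi>_def)
  qed
  \<comment> \<open>Each shift by a b costs at most 2 A B, and 4 A B \<le> \<tau> L keeps at least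
    half of the assumed size \<tau> L after averaging over all a and b.\<close>
  have lower: "real A * real B * (\<tau> * real L / 2) \<le> (\<Sum>(a, n)\<in>?A \<times> ?I. \<Phi> (\<pi> (h, a, n)))" if h: "h \<in> H" for h
  proof -
    define Z where "Z = (\<Sum>(a, b)\<in>?A \<times> ?B. \<Sum>n\<in>?I. ee q (h * invsq q (n + a * b)))"
    have "norm ((\<Sum>(a, b)\<in>?A \<times> ?B. S h) - Z) \<le> (\<Sum>(a, b)\<in>?A \<times> ?B. 2 * (real A * real B))"
      unfolding Z_def case_prod_unfold sum_subtractf[symmetric]
    proof (intro order_trans[OF norm_sum] sum_mono)
      fix ab assume "ab \<in> ?A \<times> ?B"
      then obtain a b where ab: "ab = (a, b)" "a \<in> ?A" "b \<in> ?B" by auto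
      have "norm ((\<Sum>n\<in>?I. ee q (h * invsq q (n + int (nat (a * b))))) - S h) \<le> 2 * real (nat (a * b))"
        unfolding S_def by (rule norm_sum_shift_diff) simp
      also have "int (nat (a * b)) = a * b" using ab by simp
      also have "real (nat (a * b)) \<le> real A * real B"
      proof -
        have "a * b \<le> int A * int B" using ab by (intro mult_mono) auto
        hence "nat (a * b) \<le> A * B" by (simp add: nat_le_iff)
        thus ?thesis by (metis of_nat_le_iff of_nat_mult)
      qed
      finally show "norm (S h - (\<Sum>n\<in>?I. ee q (h * invsq q (n + fst ab * snd ab)))) \<le> 2 * (real A * real B)"
        using ab by (simp add: norm_minus_commute)
    qed
    hence "norm (of_nat (A * B) * S h - Z) \<le> real A * real B * (2 * (real A * real B))"
      by (simp add: case_prod_unfold)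
    hence "real A * real B * norm (S h) \<le> norm Z + real A * real B * (2 * (real A * real B))"
      using norm_triangle_sub[of "of_nat (A * B) * S h" Z] by (simp add: norm_mult)
    moreover have "norm Z \<le> (\<Sum>(a, n)\<in>?A \<times> ?I. \<Phi> (\<pi> (h, a, n)))"
    proof -
      have "Z = (\<Sum>a\<in>?A. \<Sum>b\<in>?B. \<Sum>n\<in>?I. ee q (h * invsq q (n + a * b)))"
        unfolding Z_def by (rule sum.cartesian_product[symmetric])
      also have "\<dots> = (\<Sum>a\<in>?A. \<Sum>n\<in>?I. \<Sum>b\<in>?B. ee q (h * invsq q (n + a * b)))"
        by (intro sum.cong refl sum.swap)
      finally have "norm Z \<le> (\<Sum>a\<in>?A. \<Sum>n\<in>?I. norm (\<Sum>b\<in>?B. ee q (h * invsq q (n + a * b))))"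
        by (simp only:) (intro order_trans[OF norm_sum] sum_mono order_refl)
      also have "\<dots> = (\<Sum>a\<in>?A. \<Sum>n\<in>?I. \<Phi> (\<pi> (h, a, n)))"
        by (intro sum.cong refl shifted)
      finally show ?thesis unfolding sum.cartesian_product .
    qed
    moreover have "real A * real B * (\<tau> * real L) \<le> real A * real B * norm (S h)"
      using H(2)[OF h] by (intro mult_left_mono) auto
    moreover have "real A * real B * (2 * (real A * real B)) \<le> real A * real B * (\<tau> * real L / 2)"
      using \<tau> by (intro mult_left_mono) auto
    moreover have "real A * real B * (\<tau> * real L) = real A * real B * (\<tau> * real L / 2) + real A * real B * (\<tau> * real L / 2)"
      by simp
    ultimately show ?thesis by linarith
  qed
  define V where "V = c * real A * real B * \<tau> * real L / 2"
  have V0: "V \<ge> 0" using c \<tau>0 by (simp add: V_def)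
  have "V = (\<Sum>h\<in>H. real A * real B * (\<tau> * real L / 2))" by (simp add: V_def c_def)
  also have "\<dots> \<le> (\<Sum>h\<in>H. \<Sum>(a, n)\<in>?A \<times> ?I. \<Phi> (\<pi> (h, a, n)))" by (intro sum_mono lower)
  also have "\<dots> = (\<Sum>x\<in>P. \<Phi> (\<pi> x))" by (simp add: P_def sum.cartesian_product case_prod_unfold)
  finally have "V ^ k \<le> (\<Sum>x\<in>P. \<Phi> (\<pi> x)) ^ k" using V0 by (intro power_mono)
  also have "\<dots> \<le> real (card P) ^ (k - 1) * (\<Sum>x\<in>P. \<Phi> (\<pi> x) ^ k)"
    by (rule power_sum_le) (use k in \<open>auto simp: \<Phi>_def\<close>)
  finally have V1: "V ^ k \<le> real (card P) ^ (k - 1) * (\<Sum>x\<in>P. \<Phi> (\<pi> x) ^ k)" .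
  \<comment> \<open>The number of triples above a point. Hoelder moves the k-th power inside and
    Cauchy-Schwarz then separates the multiplicities from the 2 k-th moment.\<close>
  define \<nu> where "\<nu> = (\<lambda>z. real (card {x\<in>P. \<pi> x = z}))"
  have \<pi>R: "\<pi> ` P \<subseteq> R" using q0 by (auto simp: \<pi>_def R_def)
  have grp: "(\<Sum>x\<in>P. g (\<pi> x)) = (\<Sum>z\<in>R. \<nu> z * g z)" for g :: "int \<times> int \<Rightarrow> real"
  proof -
    have "(\<Sum>z\<in>R. \<nu> z * g z) = (\<Sum>z\<in>R. \<Sum>x\<in>{x\<in>P. \<pi> x = z}. g (\<pi> x))" by (simp add: \<nu>_def)
    also have "\<dots> = (\<Sum>x\<in>P. g (\<pi> x))" using finP \<pi>R by (intro sum.group) (auto simp: R_def)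
    finally show ?thesis ..
  qed
  have CS: "(\<Sum>x\<in>P. \<Phi> (\<pi> x) ^ k)\<^sup>2 \<le> (\<Sum>z\<in>R. (\<nu> z)\<^sup>2) * (\<Sum>z\<in>R. (\<Phi> z ^ k)\<^sup>2)"
    unfolding grp[of "\<lambda>z. \<Phi> z ^ k"] by (rule Cauchy_Schwarz_ineq_sum)
  have \<nu>2: "(\<Sum>z\<in>R. (\<nu> z)\<^sup>2) \<le> c * (2 * real A * real L * (1 + ln (real q))\<^sup>2)"
  proof -
    define E where "E = {w\<in>(?A \<times> ?I) \<times> (?A \<times> ?I). int q dvd snd (fst w) * fst (snd w) - snd (snd w) * fst (fst w)}"
    define W where "W = (SIGMA x:P. {y\<in>P. \<pi> y = \<pi> x})"
    have finE: "finite E" by (rule finite_subset[of _ "(?A \<times> ?I) \<times> (?A \<times> ?I)"]) (auto simp: E_def)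
    have "(\<Sum>z\<in>R. (\<nu> z)\<^sup>2) = (\<Sum>x\<in>P. \<nu> (\<pi> x))" unfolding grp by (simp add: power2_eq_square)
    also have "\<dots> = real (card W)"
      unfolding W_def \<nu>_def using finP by (subst card_SigmaI) auto
    finally have e: "(\<Sum>z\<in>R. (\<nu> z)\<^sup>2) = real (card W)" .
    have "card W \<le> card (H \<times> E)"
    proof (rule card_inj_on_le)
      \<comment> \<open>The map forgets h'. Nothing is lost: equality of the points gives h' = h
        a'^2 / a^2 modulo q, and h' lies in 0..q - 1.\<close>
      let ?f = "\<lambda>((h, a, n), (h', a', n')). (h :: int, ((a :: int, n :: int), (a' :: int, n' :: int)))"
      have key: "int q dvd n * a' - n' * a \<and> [h' = h * invsq q a * a'\<^sup>2] (mod int q)"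
        if "a \<in> ?A" "a' \<in> ?A" "\<pi> (h', a', n') = \<pi> (h, a, n)" for h a n h' a' n'
      proof
        have e: "[h' * invsq q a' = h * invsq q a] (mod int q)" "[a' ^ (q - 2) * n' = a ^ (q - 2) * n] (mod int q)"
          using that(3) by (simp_all add: \<pi>_def unique_euclidean_semiring_class.cong_def)
        have ia: "[a * a ^ (q - 2) = 1] (mod int q)" "[a' * a' ^ (q - 2) = 1] (mod int q)"
          using that A_nd by (auto intro: inverse_cong[OF q q3])
        have "[(a' * a' ^ (q - 2)) * (n' * a) = 1 * (n' * a)] (mod int q)" by (intro cong_mult ia cong_refl)
        moreover have "[(a * a ^ (q - 2)) * (n * a') = 1 * (n * a')] (mod int q)" by (intro cong_mult ia cong_refl)
        moreover have "[(a' ^ (q - 2) * n') * (a * a') = (a ^ (q - 2) * n) * (a * a')] (mod int q)"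
          by (intro cong_mult e cong_refl)
        moreover have "(a' * a' ^ (q - 2)) * (n' * a) = (a' ^ (q - 2) * n') * (a * a')"
          "(a * a ^ (q - 2)) * (n * a') = (a ^ (q - 2) * n) * (a * a')" by (simp_all only: mult_ac)
        ultimately have "[n' * a = n * a'] (mod int q)" by (metis cong_sym cong_trans mult_1)
        thus "int q dvd n * a' - n' * a" by (simp add: cong_iff_dvd_diff dvd_diff_commute)
        have "[h' * (a'\<^sup>2 * invsq q a') = h' * 1] (mod int q)"
          using that A_nd by (intro cong_mult cong_refl invsq_cong_1[OF q q3]) auto
        moreover have "[h' * invsq q a' * a'\<^sup>2 = h * invsq q a * a'\<^sup>2] (mod int q)" by (intro cong_mult e cong_refl)
        moreover have "h' * (a'\<^sup>2 * invsq q a') = h' * invsq q a' * a'\<^sup>2" by (simp only: mult_ac)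
        ultimately show "[h' = h * invsq q a * a'\<^sup>2] (mod int q)" by (metis cong_sym cong_trans mult_1_right)
      qed
      show "inj_on ?f W"
      proof (rule inj_onI)
        fix w w' assume w: "w \<in> W" "w' \<in> W" "?f w = ?f w'"
        obtain h a n h' a' n' where w1: "w = ((h, a, n), (h', a', n'))" by (metis prod_cases3 surj_pair)
        obtain g b m g' b' m' where w2: "w' = ((g, b, m), (g', b', m'))" by (metis prod_cases3 surj_pair)
        have eq: "g = h" "b = a" "m = n" "b' = a'" "m' = n'" using w(3) by (auto simp: w1 w2)
        have mem: "a \<in> ?A" "a' \<in> ?A" "h' \<in> H" "g' \<in> H" "\<pi> (h', a', n') = \<pi> (h, a, n)" "\<pi> (g', a', n') = \<pi> (h, a, n)"
          using w(1,2) by (auto simp: w1 w2 W_def P_def eq)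
        have "[h' = g'] (mod int q)"
          using key[OF mem(1,2,5)] key[OF mem(1,2,6)] by (metis cong_sym cong_trans)
        hence "h' = g'" using mem(3,4) H(1) by (intro cong_less_imp_eq_int[of h' "int q" g']) auto
        thus "w = w'" by (simp add: w1 w2 eq)
      qed
      show "?f ` W \<subseteq> H \<times> E"
      proof
        fix v assume "v \<in> ?f ` W"
        then obtain h a n h' a' n' where w: "((h, a, n), (h', a', n')) \<in> W" "v = (h, ((a, n), (a', n')))" by auto
        have mem: "h \<in> H" "a \<in> ?A" "n \<in> ?I" "a' \<in> ?A" "n' \<in> ?I" "\<pi> (h', a', n') = \<pi> (h, a, n)"
          using w(1) by (auto simp: W_def P_def)
        thus "v \<in> H \<times> E" using key[OF mem(2,4,6)] by (simp add: w(2) E_def)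
      qed
      show "finite (H \<times> E)" using finH finE by (rule finite_cartesian_product)
    qed
    hence "real (card W) \<le> c * real (card E)"
      unfolding card_cartesian_product c_def by (metis of_nat_le_iff of_nat_mult)
    hence "(\<Sum>z\<in>R. (\<nu> z)\<^sup>2) \<le> c * real (card E)" by (simp only: e)
    also have "\<dots> \<le> c * (2 * real A * real L * (1 + ln (real q))\<^sup>2)"
      using c unfolding E_def by (intro mult_left_mono card_proportional A) auto
    finally show ?thesis .
  qed
  have M: "(\<Sum>z\<in>R. (\<Phi> z ^ k)\<^sup>2) \<le> real q * ((real k ^ k + 6 * real k) * real B ^ (2 * k))"
  proof -
    have "(\<Sum>z\<in>R. (\<Phi> z ^ k)\<^sup>2) = (\<Sum>t\<in>{0..<int q}. \<Sum>\<xi>\<in>{0..<int q}. norm (\<Sum>b\<in>?B. ee q (t * invsq q (\<xi> + b))) ^ (2 * k))"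
      by (simp add: R_def sum.cartesian_product case_prod_unfold \<Phi>_def power_mult[symmetric] mult.commute[of k])
    also have "\<dots> \<le> real q * (real q * real k ^ k * real B ^ k + 6 * real k * real B ^ (2 * k))"
      by (rule moment_bound[OF q q3 B(2) k(2)])
    also have "\<dots> \<le> real q * (real B ^ k * real k ^ k * real B ^ k + 6 * real k * real B ^ (2 * k))"
      using B(3) by (intro mult_left_mono add_mono mult_right_mono) auto
    also have "\<dots> = real q * ((real k ^ k + 6 * real k) * real B ^ (2 * k))"
    proof -
      have "real B ^ (2 * k) = real B ^ k * real B ^ k" by (simp add: mult_2 power_add)
      thus ?thesis by (simp only:) (simp add: algebra_simps)
    qed
    finally show ?thesis .
  qed
  define T where "T = c * real A * real L"
  have T0: "T > 0" using c LA0 by (simp add: T_def)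
  define K where "K = real k ^ k + 6 * real k"
  define l where "l = (1 + ln (real q))\<^sup>2"
  have "(V ^ k)\<^sup>2 \<le> (T ^ (k - 1) * (\<Sum>x\<in>P. \<Phi> (\<pi> x) ^ k))\<^sup>2"
    using V1 V0 unfolding cardP T_def by (intro power_mono) auto
  also have "\<dots> = (T ^ (k - 1))\<^sup>2 * (\<Sum>x\<in>P. \<Phi> (\<pi> x) ^ k)\<^sup>2" by (rule power_mult_distrib)
  also have "\<dots> \<le> (T ^ (k - 1))\<^sup>2 * ((\<Sum>z\<in>R. (\<nu> z)\<^sup>2) * (\<Sum>z\<in>R. (\<Phi> z ^ k)\<^sup>2))"
    by (intro mult_left_mono CS) auto
  also have "\<dots> \<le> (T ^ (k - 1))\<^sup>2 * ((c * (2 * real A * real L * l)) * (real q * (K * real B ^ (2 * k))))"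
    using \<nu>2 M c unfolding K_def l_def
    by (intro mult_left_mono mult_mono) (auto intro!: sum_nonneg mult_nonneg_nonneg)
  also have "\<dots> = ((T ^ (k - 1))\<^sup>2 * T) * (2 * l * real q * K) * real B ^ (2 * k)" by (simp add: T_def mult_ac)
  also have "(T ^ (k - 1))\<^sup>2 * T = T ^ (2 * k - 1)"
  proof -
    have "2 * k - 1 = (k - 1) * 2 + 1" using k by simp
    thus ?thesis by (simp add: power_mult power_add)
  qed
  \<comment> \<open>\<open>V\<close> is T B \<tau> / 2, so T^(2 k - 1) and B^(2 k) cancel against
    the left-hand side and exactly one factor \<open>T\<close>, hence one factor
    \<open>card H\<close>, remains.\<close>
  finally have fin: "(V ^ k)\<^sup>2 \<le> T ^ (2 * k - 1) * (2 * l * real q * K) * real B ^ (2 * k)" .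
  have "V = T * (real B * (\<tau> / 2))" by (simp add: V_def T_def)
  hence "(V ^ k)\<^sup>2 = T ^ (2 * k) * (real B ^ (2 * k) * (\<tau> / 2) ^ (2 * k))"
    by (simp only: power_mult_distrib[symmetric] power_mult[symmetric] mult.commute[of k 2])
  also have "T ^ (2 * k) = T ^ (2 * k - 1) * T" using k by (simp add: power_eq_if)
  finally have "(T ^ (2 * k - 1) * real B ^ (2 * k)) * (T * (\<tau> / 2) ^ (2 * k)) \<le>
      (T ^ (2 * k - 1) * real B ^ (2 * k)) * (2 * l * real q * K)"
    using fin by (simp add: mult_ac)
  moreover have "T ^ (2 * k - 1) * real B ^ (2 * k) > 0" using T0 B by simp
  ultimately have "T * (\<tau> / 2) ^ (2 * k) \<le> 2 * l * real q * K" by (rule mult_left_le_imp_le)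
  thus ?thesis by (simp add: T_def c_def l_def K_def mult_ac)
qed

end

section \<open>Bilinear sums\<close>

lemma ln_le_powr:
  fixes x e :: real
  assumes "x \<ge> 1" "e > 0"
  shows "1 + ln x \<le> (1 + 1 / e) * x powr e"
proof -
  have "ln x \<le> x powr e / e" by (rule ln_powr_bound) (use assms in auto)
  moreover have "1 \<le> x powr e" using assms by (simp add: ge_one_powr_ge_zero)
  ultimately show ?thesis by (simp add: algebra_simps)
qed

text \<open>Orthogonality, after which the phases e(- h Y / q) are dropped by the triangle
  inequality; this makes the bound uniform in Y.\<close>

lemma solutions_le_moment:
  fixes g :: "'a \<Rightarrow> int"
  assumes V: "finite V" and q: "q > 0"
  shows "real q * real (card {z\<in>tuples j V \<times> tuples j V. int q dvd (\<Sum>i<j. g (fst z i) - g (snd z i)) - Y})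
    \<le> (\<Sum>h\<in>{0..<int q}. norm (\<Sum>v\<in>V. ee q (h * g v)) ^ (2 * j))"
proof -
  define T where "T = tuples j V \<times> tuples j V"
  define G where "G = (\<lambda>z. \<Sum>i<j. g (fst z i) - g (snd z i))"
  have finT: "finite T" using V by (auto simp: T_def)
  have mom: "complex_of_real (norm (\<Sum>v\<in>V. ee q (h * g v)) ^ (2 * j)) = (\<Sum>z\<in>T. ee q (h * G z))" for h
    using norm_exp_sum_power[OF V, of "\<lambda>_. 1" q h g j] by (simp add: T_def G_def case_prod_unfold)
  have "complex_of_real (real q * real (card {z\<in>T. int q dvd G z - Y})) =
      (\<Sum>z\<in>T. if int q dvd G z - Y then of_nat q else 0)"
    using finT by (simp add: sum.If_cases Int_def)
  also have "\<dots> = (\<Sum>z\<in>T. \<Sum>h\<in>{0..<int q}. ee q ((G z - Y) * h))" by (simp only: sum_ee[OF q])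
  also have "\<dots> = (\<Sum>h\<in>{0..<int q}. \<Sum>z\<in>T. ee q ((G z - Y) * h))" by (rule sum.swap)
  also have "\<dots> = (\<Sum>h\<in>{0..<int q}. ee q (- (h * Y)) * of_real (norm (\<Sum>v\<in>V. ee q (h * g v)) ^ (2 * j)))"
    unfolding mom sum_distrib_left
    by (intro sum.cong refl, subst ee_add[symmetric]) (simp add: algebra_simps)
  finally have e: "complex_of_real (real q * real (card {z\<in>T. int q dvd G z - Y})) =
    (\<Sum>h\<in>{0..<int q}. ee q (- (h * Y)) * of_real (norm (\<Sum>v\<in>V. ee q (h * g v)) ^ (2 * j)))" .
  have "norm (complex_of_real (real q * real (card {z\<in>T. int q dvd G z - Y}))) \<le>
      (\<Sum>h\<in>{0..<int q}. norm (ee q (- (h * Y)) * of_real (norm (\<Sum>v\<in>V. ee q (h * g v)) ^ (2 * j))))"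
    unfolding e by (rule norm_sum)
  thus ?thesis unfolding T_def G_def norm_mult norm_of_real by simp
qed

text \<open>Hoelder in m removes \<alpha>. Expanding the 2 j-th power of the sum over n moves
  \<beta> outside the sum over m, so that only coefficient-free sums over m remain, at the
  frequencies h times the sum of differences of g.\<close>

lemma bilinear_power:
  fixes f :: "'b \<Rightarrow> int" and g :: "'a \<Rightarrow> int" and \<alpha> :: "'b \<Rightarrow> complex" and \<beta> :: "'a \<Rightarrow> complex"
  assumes V: "finite V" and j: "j \<ge> 1"
    and \<alpha>: "\<And>m. norm (\<alpha> m) \<le> 1" and \<beta>: "\<And>n. norm (\<beta> n) \<le> 1"
  shows "norm (\<Sum>m\<in>I. \<Sum>n\<in>V. \<alpha> m * \<beta> n * ee q (h * (f m * g n))) ^ (2 * j) \<le>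
    real (card I) ^ (2 * j - 1) * (\<Sum>z\<in>tuples j V \<times> tuples j V.
      norm (\<Sum>m\<in>I. ee q (h * (\<Sum>i<j. g (fst z i) - g (snd z i)) * f m)))"
proof -
  define T where "T = tuples j V \<times> tuples j V"
  define G where "G = (\<lambda>z. \<Sum>i<j. g (fst z i) - g (snd z i))"
  define c where "c = (\<lambda>z. \<Prod>i<j. \<beta> (fst z i) * cnj (\<beta> (snd z i)))"
  define x where "x = (\<lambda>m. norm (\<Sum>n\<in>V. \<beta> n * ee q ((h * f m) * g n)))"
  have c1: "norm (c z) \<le> 1" for z
  proof -
    have "norm (\<beta> (fst z i)) * norm (\<beta> (snd z i)) \<le> 1" for i
      using mult_mono[OF \<beta>[of "fst z i"] \<beta>[of "snd z i"]] by simp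
    thus ?thesis unfolding c_def prod_norm[symmetric] by (intro prod_le_1) (simp add: norm_mult)
  qed
  have "norm (\<Sum>m\<in>I. \<Sum>n\<in>V. \<alpha> m * \<beta> n * ee q (h * (f m * g n))) \<le> (\<Sum>m\<in>I. x m)"
  proof (rule order_trans[OF norm_sum], rule sum_mono)
    fix m
    have "(\<Sum>n\<in>V. \<alpha> m * \<beta> n * ee q (h * (f m * g n))) = \<alpha> m * (\<Sum>n\<in>V. \<beta> n * ee q ((h * f m) * g n))"
      by (simp add: sum_distrib_left mult_ac)
    hence "norm (\<Sum>n\<in>V. \<alpha> m * \<beta> n * ee q (h * (f m * g n))) = norm (\<alpha> m) * x m"
      by (simp only: norm_mult x_def)
    also have "\<dots> \<le> 1 * x m" using \<alpha> by (intro mult_right_mono) (auto simp: x_def)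
    finally show "norm (\<Sum>n\<in>V. \<alpha> m * \<beta> n * ee q (h * (f m * g n))) \<le> x m" by simp
  qed
  hence "norm (\<Sum>m\<in>I. \<Sum>n\<in>V. \<alpha> m * \<beta> n * ee q (h * (f m * g n))) ^ (2 * j) \<le> (\<Sum>m\<in>I. x m) ^ (2 * j)"
    by (intro power_mono) auto
  also have "\<dots> \<le> real (card I) ^ (2 * j - 1) * (\<Sum>m\<in>I. x m ^ (2 * j))"
    by (rule power_sum_le) (use j in \<open>auto simp: x_def\<close>)
  also have "(\<Sum>m\<in>I. x m ^ (2 * j)) \<le> (\<Sum>z\<in>T. norm (\<Sum>m\<in>I. ee q (h * G z * f m)))"
  proof -
    have "complex_of_real (\<Sum>m\<in>I. x m ^ (2 * j)) = (\<Sum>m\<in>I. \<Sum>z\<in>T. c z * ee q (h * f m * G z))"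
      unfolding of_real_sum x_def using norm_exp_sum_power[OF V, of \<beta> q _ g j]
      by (intro sum.cong refl) (simp add: T_def G_def c_def case_prod_unfold)
    also have "\<dots> = (\<Sum>z\<in>T. c z * (\<Sum>m\<in>I. ee q (h * G z * f m)))"
      by (subst sum.swap) (simp add: sum_distrib_left mult_ac)
    finally have e: "complex_of_real (\<Sum>m\<in>I. x m ^ (2 * j)) = (\<Sum>z\<in>T. c z * (\<Sum>m\<in>I. ee q (h * G z * f m)))" .
    have "norm (complex_of_real (\<Sum>m\<in>I. x m ^ (2 * j))) \<le> (\<Sum>z\<in>T. norm (\<Sum>m\<in>I. ee q (h * G z * f m)))"
      unfolding e
    proof (intro order_trans[OF norm_sum] sum_mono)
      fix z show "norm (c z * (\<Sum>m\<in>I. ee q (h * G z * f m))) \<le> norm (\<Sum>m\<in>I. ee q (h * G z * f m))"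
        unfolding norm_mult using mult_right_mono[OF c1, of "norm (\<Sum>m\<in>I. ee q (h * G z * f m))" z] by simp
    qed
    thus ?thesis unfolding norm_of_real by linarith
  qed
  finally show ?thesis by (simp add: T_def G_def mult_left_mono)
qed

text \<open>The tuples are split according to whether the sum over m at their frequency exceeds the
  fraction \<tau> of its length. Each large frequency is hit by at most \<open>J\<close> tuples; at
  the others the saving is \<tau>.\<close>

lemma bilinear_large_values:
  fixes f :: "'b \<Rightarrow> int" and g :: "'a \<Rightarrow> int" and \<alpha> :: "'b \<Rightarrow> complex" and \<beta> :: "'a \<Rightarrow> complex"
  assumes q: "prime q" and h: "\<not> int q dvd h" and V: "finite V" and j: "j \<ge> 1"
    and \<alpha>: "\<And>m. norm (\<alpha> m) \<le> 1" and \<beta>: "\<And>n. norm (\<beta> n) \<le> 1" and \<tau>: "\<tau> \<ge> 0"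
    and J: "\<And>Y. real (card {z\<in>tuples j V \<times> tuples j V. int q dvd (\<Sum>i<j. g (fst z i) - g (snd z i)) - Y}) \<le> J"
  shows "norm (\<Sum>m\<in>I. \<Sum>n\<in>V. \<alpha> m * \<beta> n * ee q (h * (f m * g n))) ^ (2 * j) \<le>
    real (card I) ^ (2 * j) * (real (card {t\<in>{0..<int q}. \<tau> * real (card I) \<le> norm (\<Sum>m\<in>I. ee q (t * f m))}) * J
      + \<tau> * real (card V) ^ (2 * j))"
proof -
  define T where "T = tuples j V \<times> tuples j V"
  define G where "G = (\<lambda>z. \<Sum>i<j. g (fst z i) - g (snd z i))"
  define S where "S = (\<lambda>t. \<Sum>m\<in>I. ee q (t * f m))"
  define H where "H = {t\<in>{0..<int q}. \<tau> * real (card I) \<le> norm (S t)}"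
  have q0: "q > 0" using q prime_gt_0_nat by blast
  have finT: "finite T" using V by (auto simp: T_def)
  have finH: "finite H" by (rule finite_subset[of _ "{0..<int q}"]) (auto simp: H_def)
  define W where "W = {z\<in>T. (h * G z) mod int q \<in> H}"
  have Smod: "S (t mod int q) = S t" for t
    unfolding S_def by (intro sum.cong refl ee_cong) (simp add: unique_euclidean_semiring_class.cong_def mod_mult_left_eq)
  have S1: "norm (S t) \<le> real (card I)" for t
    unfolding S_def by (rule order_trans[OF norm_sum]) simp
  have "(\<Sum>z\<in>T. norm (S (h * G z))) \<le> (\<Sum>z\<in>T. (if z \<in> W then real (card I) else 0) + \<tau> * real (card I))"
  proof (intro sum_mono)
    fix z assume z: "z \<in> T"
    show "norm (S (h * G z)) \<le> (if z \<in> W then real (card I) else 0) + \<tau> * real (card I)"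
    proof (cases "z \<in> W")
      case True
      have "0 \<le> \<tau> * real (card I)" using \<tau> by simp
      thus ?thesis using True S1[of "h * G z"] by simp
    next
      case False
      thus ?thesis using z q0 by (auto simp: W_def H_def Smod)
    qed
  qed
  also have "\<dots> = real (card I) * real (card W) + \<tau> * real (card I) * real (card T)"
  proof -
    have "(\<Sum>z\<in>T. if z \<in> W then real (card I) else 0) = (\<Sum>z\<in>W. real (card I))"
      using finT by (intro sum.mono_neutral_cong_right) (auto simp: W_def)
    thus ?thesis by (simp add: sum.distrib mult_ac)
  qed
  also have "real (card W) \<le> real (card H) * J"
  proof -
    have "W \<subseteq> (\<Union>t\<in>H. {z\<in>T. (h * G z) mod int q = t})" by (auto simp: W_def)
    hence "card W \<le> card (\<Union>t\<in>H. {z\<in>T. (h * G z) mod int q = t})"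
      using finH finT by (intro card_mono) auto
    also have "\<dots> \<le> (\<Sum>t\<in>H. card {z\<in>T. (h * G z) mod int q = t})" by (rule card_UN_le[OF finH])
    finally have "real (card W) \<le> (\<Sum>t\<in>H. real (card {z\<in>T. (h * G z) mod int q = t}))"
      by (simp only: of_nat_sum[symmetric] of_nat_le_iff)
    also have "\<dots> \<le> (\<Sum>t\<in>H. J)"
    proof (intro sum_mono)
      fix t
      show "real (card {z\<in>T. (h * G z) mod int q = t}) \<le> J"
      proof (cases "\<exists>z0\<in>T. (h * G z0) mod int q = t")
        case True
        then obtain z0 where z0: "(h * G z0) mod int q = t" by blast
        have "{z\<in>T. (h * G z) mod int q = t} \<subseteq> {z\<in>T. int q dvd G z - G z0}"
        proof
          fix z assume z: "z \<in> {z\<in>T. (h * G z) mod int q = t}"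
          hence "(h * G z) mod int q = (h * G z0) mod int q" using z0 by simp
          hence "int q dvd h * (G z - G z0)" by (metis mod_eq_dvd_iff right_diff_distrib)
          hence "int q dvd G z - G z0" using h q by (simp add: prime_dvd_mult_iff)
          thus "z \<in> {z\<in>T. int q dvd G z - G z0}" using z by simp
        qed
        hence "card {z\<in>T. (h * G z) mod int q = t} \<le> card {z\<in>T. int q dvd G z - G z0}"
          using finT by (intro card_mono) auto
        thus ?thesis using J[of "G z0"] by (simp add: T_def G_def)
      next
        case False
        hence "{z\<in>T. (h * G z) mod int q = t} = {}" by blast
        moreover have "0 \<le> J" using J[of 0] by (meson of_nat_0_le_iff order_trans)
        ultimately show ?thesis by (simp only: card.empty of_nat_0)
      qed
    qed
    finally show ?thesis by simp
  qed
  also have "real (card T) = real (card V) ^ (2 * j)"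
    by (simp add: T_def card_cartesian_product card_tuples power_add mult_2)
  finally have b: "(\<Sum>z\<in>T. norm (S (h * G z))) \<le> real (card I) * (real (card H) * J) + \<tau> * real (card I) * real (card V) ^ (2 * j)"
    by (simp add: mult_left_mono)
  have "norm (\<Sum>m\<in>I. \<Sum>n\<in>V. \<alpha> m * \<beta> n * ee q (h * (f m * g n))) ^ (2 * j) \<le>
      real (card I) ^ (2 * j - 1) * (\<Sum>z\<in>T. norm (S (h * G z)))"
    unfolding T_def S_def G_def by (rule bilinear_power[OF V j \<alpha> \<beta>])
  also have "\<dots> \<le> real (card I) ^ (2 * j - 1) * (real (card I) * (real (card H) * J) + \<tau> * real (card I) * real (card V) ^ (2 * j))"
    by (intro mult_left_mono b) auto
  also have "\<dots> = (real (card I) ^ (2 * j - 1) * real (card I)) * (real (card H) * J + \<tau> * real (card V) ^ (2 * j))"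
    by (simp add: algebra_simps)
  also have "real (card I) ^ (2 * j - 1) * real (card I) = real (card I) ^ (2 * j)"
    using j by (simp add: power_eq_if)
  finally show ?thesis by (simp add: H_def S_def)
qed

text \<open>The parameters of \<open>large_values\<close> are fixed here: B is about q^(1/k), the
  least size with q \<le> B^k, and A is as large as 4 A B \<le> \<tau> L permits. The lower bound on
  L guarantees A \<ge> 1.\<close>

lemma card_large_values:
  fixes k :: nat
  assumes k: "k \<ge> 2"
  shows "\<exists>C>0. \<forall>q (s::int) L. prime q \<longrightarrow> q \<ge> 3 \<longrightarrow> 16 * real q powr (2 / k) \<le> real L \<longrightarrow> real L \<le> sqrt (real q) \<longrightarrow>
    real (card {h\<in>{0..<int q}. real q powr (- (1 / (real k * (2 * real k + 1)))) * real L \<le>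
      norm (\<Sum>n\<in>{s..<s + int L}. ee q (h * invsq q n))}) \<le> C * real q powr (1 + 3 / k) / (real L)\<^sup>2"
proof -
  define K where "K = real k ^ k + 6 * real k"
  define C where "C = max (real k + 5) (32 * K * 4 ^ k * (1 + 2 * real k)\<^sup>2)"
  have C0: "C > 0" by (simp add: C_def less_max_iff_disj)
  have K0: "K \<ge> 0" by (simp add: K_def)
  show ?thesis
  proof (intro exI[of _ C] conjI C0 allI impI)
    fix q L :: nat and s :: int
    assume q: "prime q" and q3: "q \<ge> 3" and L1: "16 * real q powr (2 / k) \<le> real L" and L2: "real L \<le> sqrt (real q)"
    define Q where "Q = real q"
    \<comment> \<open>Chosen so that \<tau>^(2 k + 1) = q^(-1/k): the lower bound for A contains one
      factor \<tau> besides the 2 k factors of \<open>large_values\<close>.\<close>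
    define \<sigma> where "\<sigma> = 1 / (real k * (2 * real k + 1))"
    define \<tau> where "\<tau> = Q powr - \<sigma>"
    define H where "H = {h\<in>{0..<int q}. \<tau> * real L \<le> norm (\<Sum>n\<in>{s..<s + int L}. ee q (h * invsq q n))}"
    have Q: "Q \<ge> 3" using q3 by (simp add: Q_def)
    have "16 \<le> 16 * Q powr (2 / k)" using Q by (simp add: ge_one_powr_ge_zero)
    hence L16: "real L \<ge> 16" using L1 by (simp add: Q_def)
    have "(real L)\<^sup>2 \<le> (sqrt (real q))\<^sup>2" using L2 by (intro power_mono) auto
    hence LQ: "(real L)\<^sup>2 \<le> Q" by (simp add: Q_def)
    have k0: "real k \<ge> 2" using k by simp
    have "real (card H) \<le> C * Q powr (1 + 3 / k) / (real L)\<^sup>2"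
    \<comment> \<open>Small q are covered by the term k + 5 in \<open>C\<close> and the trivial
      bound q; afterwards k < q and B < q are available.\<close>
    proof (cases "q \<le> k + 4")
      case True
      have "card H \<le> card {0..<int q}" unfolding H_def by (intro card_mono) auto
      hence "real (card H) \<le> Q" by (simp add: Q_def)
      also have "Q \<le> C" using True by (simp add: C_def Q_def le_max_iff_disj)
      also have "C * 1 \<le> C * (Q powr (1 + 3 / k) / (real L)\<^sup>2)"
      proof (intro mult_left_mono)
        have "(real L)\<^sup>2 \<le> Q powr 1" using LQ Q by simp
        also have "\<dots> \<le> Q powr (1 + 3 / k)" using Q by (intro powr_mono) auto
        finally show "1 \<le> Q powr (1 + 3 / k) / (real L)\<^sup>2" using L16 by (simp add: le_divide_eq)
      qed (use C0 in auto)
      finally show ?thesis by simp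
    next
      case False
      define B where "B = nat \<lceil>Q powr (1 / k)\<rceil>"
      define A where "A = nat \<lfloor>\<tau> * real L / (4 * real B)\<rfloor>"
      have one: "1 \<le> Q powr (1 / k)" using Q by (simp add: ge_one_powr_ge_zero)
      have B1: "Q powr (1 / k) \<le> real B" unfolding B_def by linarith
      have B2: "real B \<le> 2 * Q powr (1 / k)" using one unfolding B_def by linarith
      have Bk: "Q \<le> real B ^ k"
      proof -
        have "Q = (Q powr (1 / k)) ^ k" using Q k0 by (simp add: powr_realpow[symmetric] powr_powr)
        also have "\<dots> \<le> real B ^ k" by (intro power_mono B1) auto
        finally show ?thesis .
      qed
      have "Q powr (1 / k) \<le> Q powr (1 / 2)" using Q k0 by (intro powr_mono) (auto simp: field_simps)
      hence "real B \<le> 2 * sqrt Q" using B2 Q by (simp add: powr_half_sqrt)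
      also have "2 * sqrt Q < sqrt Q * sqrt Q"
      proof -
        have "sqrt Q > sqrt 4" using False k by (intro real_sqrt_less_mono) (simp add: Q_def)
        hence "sqrt Q > 2" by simp
        thus ?thesis using Q by (intro mult_strict_right_mono) auto
      qed
      finally have Bq: "B < q" using Q by (simp add: Q_def)
      have \<sigma>0: "0 < \<sigma>" using k0 by (simp add: \<sigma>_def)
      have \<sigma>k: "\<sigma> \<le> 1 / k" unfolding \<sigma>_def using k0 by (intro divide_left_mono) auto
      have \<tau>1: "\<tau> \<le> 1" using powr_mono[of "- \<sigma>" 0 Q] Q \<sigma>0 by (simp add: \<tau>_def)
      have \<tau>0: "\<tau> > 0" using Q by (simp add: \<tau>_def)
      have \<tau>k: "Q powr - (1 / k) \<le> \<tau>" unfolding \<tau>_def using Q \<sigma>k by (intro powr_mono) auto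
      have "Q powr - (1 / k) * (16 * Q powr (2 / k)) \<le> \<tau> * real L"
        using L1 \<tau>k \<tau>0 by (intro mult_mono) (auto simp: Q_def)
      also have "Q powr - (1 / k) * (16 * Q powr (2 / k)) = 16 * Q powr (1 / k)"
        using Q by (simp add: powr_add[symmetric] field_simps)
      finally have \<tau>L: "16 * Q powr (1 / k) \<le> \<tau> * real L" .
      have B0: "real B > 0" using B1 one by linarith
      have x2: "\<tau> * real L / (4 * real B) \<ge> \<tau> * real L / (8 * Q powr (1 / k))"
        using B2 B0 \<tau>0 one Q by (intro divide_left_mono) auto
      have x3: "\<tau> * real L / (8 * Q powr (1 / k)) \<ge> 2" using \<tau>L one Q by (simp add: le_divide_eq)
      have A1: "real A \<ge> \<tau> * real L / (16 * Q powr (1 / k))"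
      proof -
        have "real A \<ge> \<tau> * real L / (8 * Q powr (1 / k)) - 1" using x2 unfolding A_def by linarith
        thus ?thesis using x3 by simp
      qed
      have A2: "4 * real A * real B \<le> \<tau> * real L"
      proof -
        have "real A \<le> \<tau> * real L / (4 * real B)" using x2 x3 unfolding A_def by linarith
        thus ?thesis using B0 by (simp add: le_divide_eq mult_ac)
      qed
      have A3: "1 \<le> A" using x2 x3 unfolding A_def by linarith
      have A4: "4 * real A \<le> real L"
      proof -
        have "4 * real A * 1 \<le> 4 * real A * real B" using B1 one by (intro mult_left_mono) auto
        also have "\<dots> \<le> \<tau> * real L" by (rule A2)
        also have "\<dots> \<le> 1 * real L" using \<tau>1 by (intro mult_right_mono) auto
        finally show ?thesis by simp
      qed
      have A5: "2 * L * A < q"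
      proof -
        have "real L * (4 * real A) \<le> real L * real L" using A4 by (intro mult_left_mono) auto
        hence "2 * real L * real A * 2 \<le> Q" using LQ by (simp add: power2_eq_square)
        moreover have "0 < real L * real A" using L16 A3 by simp
        ultimately have "2 * real L * real A < Q" by linarith
        thus ?thesis unfolding Q_def by (simp only: of_nat_less_iff[symmetric, where 'a = real] of_nat_mult of_nat_numeral)
      qed
      have main: "real (card H) * (real A * real L) * (\<tau> / 2) ^ (2 * k) \<le> 2 * (1 + ln (real q))\<^sup>2 * real q * K"
        unfolding K_def
      proof (rule large_values[OF q q3])
        show "1 \<le> k" "k < q" "1 \<le> B" "B < q" "real q \<le> real B ^ k" "1 \<le> A" "A \<le> L" "2 * L * A < q"
          "4 * real A * real B \<le> \<tau> * real L"
          using k False B0 Bq Bk A3 A4 A5 A2 by (auto simp: Q_def)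
      qed (auto simp: H_def)
      have "real (card H) * ((real L)\<^sup>2 * \<tau> ^ (2 * k + 1)) =
          (16 * Q powr (1 / k) * 4 ^ k) * (real (card H) * (\<tau> * real L / (16 * Q powr (1 / k)) * real L) * (\<tau> / 2) ^ (2 * k))"
        using one Q by (simp add: power_divide power_mult power2_eq_square)
      also have "\<dots> \<le> (16 * Q powr (1 / k) * 4 ^ k) * (real (card H) * (real A * real L) * (\<tau> / 2) ^ (2 * k))"
        using A1 \<tau>0 by (intro mult_left_mono mult_right_mono) auto
      also have "\<dots> \<le> (16 * Q powr (1 / k) * 4 ^ k) * (2 * (1 + ln Q)\<^sup>2 * Q * K)"
        using main by (intro mult_left_mono) (auto simp: Q_def)
      \<comment> \<open>The squared logarithm costs a factor q^(1/k), as does B; undoing \<tau>^(2 k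
        + 1) costs a third. This is the origin of the exponent 1 + 3 / k.\<close>
      also have "\<dots> \<le> (16 * Q powr (1 / k) * 4 ^ k) * (2 * ((1 + 2 * real k) * Q powr (1 / (2 * k)))\<^sup>2 * Q * K)"
        using ln_le_powr[of Q "1 / (2 * k)"] Q k0 K0 by (intro mult_left_mono mult_right_mono power_mono) auto
      also have "\<dots> = (32 * K * 4 ^ k * (1 + 2 * real k)\<^sup>2) * (Q powr (1 / k) * (Q powr (1 / (2 * k)))\<^sup>2 * Q powr 1)"
        using Q by (simp add: power_mult_distrib)
      also have "Q powr (1 / k) * (Q powr (1 / (2 * k)))\<^sup>2 * Q powr 1 = Q powr (1 + 2 / k)"
        unfolding power2_eq_square powr_add[symmetric] by (rule arg_cong[where f = "\<lambda>x. Q powr x"]) (use k0 in \<open>simp add: field_simps\<close>)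
      also have "(32 * K * 4 ^ k * (1 + 2 * real k)\<^sup>2) * Q powr (1 + 2 / k) \<le> C * Q powr (1 + 2 / k)"
        by (intro mult_right_mono) (auto simp: C_def)
      also have "\<tau> ^ (2 * k + 1) = Q powr (- (1 / k))"
      proof -
        have "\<tau> ^ (2 * k + 1) = \<tau> powr real (2 * k + 1)" using \<tau>0 by (rule powr_realpow[symmetric])
        also have "\<dots> = Q powr (- \<sigma> * real (2 * k + 1))" by (simp add: \<tau>_def powr_powr)
        also have "- \<sigma> * real (2 * k + 1) = - (1 / k)"
        proof -
          have "2 * real k + 1 \<noteq> 0" using k0 by linarith
          thus ?thesis by (simp add: \<sigma>_def add.commute)
        qed
        finally show ?thesis .
      qed
      finally have "real (card H) * ((real L)\<^sup>2 * Q powr (- (1 / k))) \<le> C * Q powr (1 + 2 / k)" .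
      hence "real (card H) * ((real L)\<^sup>2 * Q powr (- (1 / k))) * Q powr (1 / k) \<le> C * Q powr (1 + 2 / k) * Q powr (1 / k)"
        by (rule mult_right_mono) auto
      moreover have "Q powr (- (1 / k)) * Q powr (1 / k) = 1" using Q by (simp add: powr_minus)
      moreover have "Q powr (1 + 2 / k) * Q powr (1 / k) = Q powr (1 + 3 / k)"
        unfolding powr_add[symmetric] by (rule arg_cong[where f = "\<lambda>x. Q powr x"]) (use k0 in \<open>simp add: field_simps\<close>)
      ultimately have "real (card H) * (real L)\<^sup>2 \<le> C * Q powr (1 + 3 / k)" by (simp add: mult.assoc)
      thus ?thesis using L16 by (simp add: le_divide_eq)
    qed
    thus "real (card {h\<in>{0..<int q}. real q powr (- (1 / (real k * (2 * real k + 1)))) * real L \<le>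
      norm (\<Sum>n\<in>{s..<s + int L}. ee q (h * invsq q n))}) \<le> C * real q powr (1 + 3 / k) / (real L)\<^sup>2"
      by (simp only: H_def \<tau>_def \<sigma>_def Q_def)
  qed
qed

text \<open>There are about q^(1 + 3/k) / L1^2 large frequencies, each hit by about q^(3/k) L2^(2 j
  - 2) tuples. Relative to all L2^(2 j) tuples this is q^(1 + 6/k) / (L1 L2)^2, which is small
  because L1 L2 \<ge> q^(1/2 + \<theta>). The large value estimate is used twice, for m and for
  n.\<close>

lemma bilinear_saving:
  fixes \<theta> :: real
  assumes \<theta>: "0 < \<theta>" "\<theta> \<le> 1"
  shows "\<exists>\<gamma>>0. \<exists>C>0. \<forall>q (h::int) (s1::int) L1 (s2::int) L2 (\<alpha>::int \<Rightarrow> complex) (\<beta>::int \<Rightarrow> complex).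
    prime q \<longrightarrow> q \<ge> 3 \<longrightarrow> \<not> int q dvd h \<longrightarrow> real L1 \<le> sqrt (real q) \<longrightarrow> real L2 \<le> sqrt (real q) \<longrightarrow>
    real q powr (1 / 2 + \<theta>) \<le> real L1 * real L2 \<longrightarrow> (\<forall>m. norm (\<alpha> m) \<le> 1) \<longrightarrow> (\<forall>n. norm (\<beta> n) \<le> 1) \<longrightarrow>
    norm (\<Sum>m\<in>{s1..<s1 + int L1}. \<Sum>n\<in>{s2..<s2 + int L2}. \<alpha> m * \<beta> n * ee q (h * (invsq q m * invsq q n)))
      \<le> C * (real L1 * real L2) * real q powr - \<gamma>"
proof -
  define k where "k = nat \<lceil>8 / \<theta>\<rceil>"
  have "8 / \<theta> \<ge> 8" using \<theta> by (simp add: le_divide_eq)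
  hence k8: "real k \<ge> 8" and k\<theta>: "8 / \<theta> \<le> real k" unfolding k_def by linarith+
  have k1: "1 / real k \<le> \<theta> / 8" using k\<theta> \<theta> k8 by (simp add: field_simps)
  have k2: "k \<ge> 2" using k8 by linarith
  obtain C1 where C1: "C1 > 0" and LV: "\<And>q (s::int) L. prime q \<Longrightarrow> q \<ge> 3 \<Longrightarrow> 16 * real q powr (2 / k) \<le> real L \<Longrightarrow> real L \<le> sqrt (real q) \<Longrightarrow>
    real (card {h\<in>{0..<int q}. real q powr (- (1 / (real k * (2 * real k + 1)))) * real L \<le>
      norm (\<Sum>n\<in>{s..<s + int L}. ee q (h * invsq q n))}) \<le> C1 * real q powr (1 + 3 / k) / (real L)\<^sup>2"
    using card_large_values[OF k2] by blast
  define \<sigma> where "\<sigma> = 1 / (real k * (2 * real k + 1))"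
  \<comment> \<open>With this j, \<tau>^(2 j) = q^(-2), so the frequencies that are not large
    contribute next to nothing to the 2 j-th moment over n. The final saving is the 2 j-th root of
    \<tau>.\<close>
  define j where "j = k * (2 * k + 1)"
  define \<gamma> where "\<gamma> = \<sigma> / real (2 * j)"
  define C where "C = C1 * (C1 + 1) + 16"
  have j1: "j \<ge> 1" using k2 by (simp add: j_def)
  have \<sigma>0: "\<sigma> > 0" using k8 by (simp add: \<sigma>_def)
  have \<sigma>1: "\<sigma> \<le> \<theta> / 8"
  proof -
    have "\<sigma> \<le> 1 / real k" unfolding \<sigma>_def using k8 by (intro divide_left_mono) auto
    thus ?thesis using k1 by linarith
  qed
  have j\<sigma>: "\<sigma> * real (2 * j) = 2" using k8 by (simp add: \<sigma>_def j_def divide_simps) (simp add: algebra_simps)?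
  have \<gamma>0: "\<gamma> > 0" using \<sigma>0 j1 by (simp add: \<gamma>_def)
  have \<gamma>1: "\<gamma> \<le> \<sigma>"
  proof -
    have "\<sigma> / real (2 * j) \<le> \<sigma> / 1" using \<sigma>0 j1 by (intro divide_left_mono) auto
    thus ?thesis by (simp add: \<gamma>_def)
  qed
  have C0: "C > 0" using C1 by (simp add: C_def add_pos_pos)
  show ?thesis
  proof (rule exI[of _ \<gamma>], rule conjI[OF \<gamma>0], rule exI[of _ C], rule conjI[OF C0], intro allI impI)
    fix q :: nat and h s1 s2 :: int and L1 L2 :: nat and \<alpha> \<beta> :: "int \<Rightarrow> complex"
    assume q: "prime q" and q3: "q \<ge> 3" and h: "\<not> int q dvd h" and L1: "real L1 \<le> sqrt (real q)"
      and L2: "real L2 \<le> sqrt (real q)" and L12: "real q powr (1 / 2 + \<theta>) \<le> real L1 * real L2"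
      and \<alpha>: "\<forall>m. norm (\<alpha> m) \<le> 1" and \<beta>: "\<forall>n. norm (\<beta> n) \<le> 1"
    define Q where "Q = real q"
    have Q: "Q \<ge> 3" using q3 by (simp add: Q_def)
    define T where "T = (\<Sum>m\<in>{s1..<s1 + int L1}. \<Sum>n\<in>{s2..<s2 + int L2}. \<alpha> m * \<beta> n * ee q (h * (invsq q m * invsq q n)))"
    have trivial: "norm T \<le> real L1 * real L2"
    proof -
      have "norm (\<alpha> m * \<beta> n * ee q (h * (invsq q m * invsq q n))) \<le> 1" for m n
        using mult_mono[OF spec[OF \<alpha>, of m] spec[OF \<beta>, of n]] by (simp add: norm_mult)
      hence "norm T \<le> (\<Sum>m\<in>{s1..<s1 + int L1}. \<Sum>n\<in>{s2..<s2 + int L2}. 1)"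
        unfolding T_def by (intro order_trans[OF norm_sum] sum_mono) auto
      thus ?thesis by simp
    qed
    have "norm T \<le> C * (real L1 * real L2) * Q powr - \<gamma>"
    \<comment> \<open>If this fails, q^\<gamma> is at most 16 and the constant 16 in
      \<open>C\<close> lets the trivial bound suffice.\<close>
    proof (cases "16 * Q powr (2 / k) \<le> Q powr \<theta>")
      case False
      have "Q powr \<gamma> * Q powr (2 / k) \<le> Q powr \<theta>"
        unfolding powr_add[symmetric] using Q \<gamma>1 \<sigma>1 k1 \<theta> by (intro powr_mono) auto
      hence "Q powr \<gamma> * Q powr (2 / k) \<le> 16 * Q powr (2 / k)" using False by linarith
      hence "Q powr \<gamma> \<le> 16" using Q by (simp add: mult_le_cancel_right)
      hence "1 \<le> 16 * Q powr - \<gamma>" using Q by (simp add: powr_minus field_simps)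
      also have "\<dots> \<le> C * Q powr - \<gamma>" using C1 by (intro mult_right_mono) (auto simp: C_def)
      finally have "(real L1 * real L2) * 1 \<le> (real L1 * real L2) * (C * Q powr - \<gamma>)"
        by (intro mult_left_mono) auto
      thus ?thesis using trivial by (simp add: mult_ac)
    next
      case True
      have sqrtQ': "sqrt Q = Q powr (1 / 2)" using Q by (simp add: powr_half_sqrt)
      have split: "Q powr (1 / 2 + \<theta>) = Q powr \<theta> * Q powr (1 / 2)" by (simp add: powr_add mult.commute)
      \<comment> \<open>Each length is at least q^\<theta>, since the other one is at most
        q^(1/2).\<close>
      have Lbig: "16 * Q powr (2 / k) \<le> real L1" "16 * Q powr (2 / k) \<le> real L2"
      proof -
        have "Q powr \<theta> * Q powr (1 / 2) \<le> real L1 * Q powr (1 / 2)"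
          using order_trans[OF L12 mult_left_mono[OF L2 of_nat_0_le_iff]]
          unfolding Q_def[symmetric] sqrtQ' split .
        thus "16 * Q powr (2 / k) \<le> real L1" using True Q by (simp add: mult_le_cancel_right)
        have "Q powr \<theta> * Q powr (1 / 2) \<le> Q powr (1 / 2) * real L2"
          using order_trans[OF L12 mult_right_mono[OF L1 of_nat_0_le_iff]]
          unfolding Q_def[symmetric] sqrtQ' split .
        thus "16 * Q powr (2 / k) \<le> real L2" using True Q by (simp add: mult.commute mult_le_cancel_right)
      qed
      have Qk: "Q powr (2 / k) \<ge> 1" using Q by (simp add: ge_one_powr_ge_zero)
      have Lpos: "real L1 > 0" "real L2 > 0" using Lbig Qk by linarith+
      have L2Q: "(real L2)\<^sup>2 \<le> Q"
      proof -
        have "(real L2)\<^sup>2 \<le> (sqrt (real q))\<^sup>2" using L2 by (intro power_mono) auto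
        thus ?thesis by (simp add: Q_def)
      qed
      define \<tau> where "\<tau> = Q powr - \<sigma>"
      have \<tau>0: "\<tau> > 0" using Q by (simp add: \<tau>_def)
      define V where "V = {s2..<s2 + int L2}"
      define S where "S = (\<lambda>s L t. norm (\<Sum>n\<in>{s..<s + int L}. ee q (t * invsq q n)))"
      define H where "H = (\<lambda>s L. {t\<in>{0..<int q}. \<tau> * real L \<le> S s L t})"
      have cardH: "real (card (H s L)) \<le> C1 * Q powr (1 + 3 / k) / (real L)\<^sup>2"
        if "16 * Q powr (2 / k) \<le> real L" "real L \<le> sqrt (real q)" for s L
        unfolding H_def S_def \<tau>_def Q_def \<sigma>_def by (rule LV[OF q q3]) (use that in \<open>auto simp: Q_def\<close>)
      define P where "P = real L2 ^ (2 * j) / (real L2)\<^sup>2"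
      have P0: "P \<ge> 0" by (simp add: P_def)
      have PL: "real L2 ^ (2 * j) = P * (real L2)\<^sup>2" using Lpos by (simp add: P_def)
      define J where "J = (C1 + 1) * Q powr (3 / k) * P"
      have J: "real (card {z\<in>tuples j V \<times> tuples j V. int q dvd (\<Sum>i<j. invsq q (fst z i) - invsq q (snd z i)) - Y}) \<le> J"
        (is "real (card ?Z) \<le> _") for Y
      proof -
        have "Q * real (card ?Z) \<le> (\<Sum>t\<in>{0..<int q}. S s2 L2 t ^ (2 * j))"
          unfolding Q_def S_def V_def[symmetric] by (rule solutions_le_moment) (use q3 in \<open>auto simp: V_def\<close>)
        also have "\<dots> \<le> (\<Sum>t\<in>{0..<int q}. (if t \<in> H s2 L2 then real L2 ^ (2 * j) else 0) + (\<tau> * real L2) ^ (2 * j))"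
        proof (intro sum_mono)
          fix t assume t: "t \<in> {0..<int q}"
          show "S s2 L2 t ^ (2 * j) \<le> (if t \<in> H s2 L2 then real L2 ^ (2 * j) else 0) + (\<tau> * real L2) ^ (2 * j)"
          proof (cases "t \<in> H s2 L2")
            case True
            have "S s2 L2 t \<le> real L2" unfolding S_def by (rule order_trans[OF norm_sum]) simp
            hence "S s2 L2 t ^ (2 * j) \<le> real L2 ^ (2 * j)" by (intro power_mono) (auto simp: S_def)
            moreover have "0 \<le> (\<tau> * real L2) ^ (2 * j)" using \<tau>0 by (intro zero_le_power) auto
            ultimately show ?thesis using True by (simp only: if_True)
          next
            case False
            hence "S s2 L2 t \<le> \<tau> * real L2" using t by (simp add: H_def)
            hence "S s2 L2 t ^ (2 * j) \<le> (\<tau> * real L2) ^ (2 * j)" by (intro power_mono) (auto simp: S_def)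
            thus ?thesis using False by simp
          qed
        qed
        also have "\<dots> = real (card (H s2 L2)) * real L2 ^ (2 * j) + Q * (\<tau> * real L2) ^ (2 * j)"
        proof -
          have "(\<Sum>t\<in>{0..<int q}. if t \<in> H s2 L2 then real L2 ^ (2 * j) else 0) = (\<Sum>t\<in>H s2 L2. real L2 ^ (2 * j))"
            by (intro sum.mono_neutral_cong_right) (auto simp: H_def)
          thus ?thesis by (simp add: sum.distrib Q_def)
        qed
        also have "\<dots> \<le> C1 * Q powr (1 + 3 / k) / (real L2)\<^sup>2 * real L2 ^ (2 * j) + Q powr (1 + 3 / k) * P"
        proof (intro add_mono mult_right_mono cardH Lbig L2)
          have "\<tau> ^ (2 * j) = \<tau> powr real (2 * j)" using \<tau>0 by (rule powr_realpow[symmetric])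
          also have "\<dots> = Q powr (- \<sigma> * real (2 * j))" by (simp add: \<tau>_def powr_powr)
          also have "- \<sigma> * real (2 * j) = - 2" using j\<sigma> by linarith
          finally have t: "\<tau> ^ (2 * j) = Q powr - 2" .
          have "Q * (\<tau> * real L2) ^ (2 * j) = (Q * Q powr - 2) * (P * (real L2)\<^sup>2)"
            by (simp add: power_mult_distrib t PL)
          also have "Q * Q powr - 2 = Q powr (- 1)"
            using Q powr_add[of Q 1 "- 2"] by simp
          also have "Q powr (- 1) * (P * (real L2)\<^sup>2) \<le> 1 * (P * Q)"
          proof (intro mult_mono L2Q order_refl)
            show "Q powr (- 1) \<le> 1" using powr_mono[of "- 1" 0 Q] Q by simp
          qed (use P0 Q in auto)
          also have "\<dots> = Q powr 1 * P" using Q by simp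
          also have "\<dots> \<le> Q powr (1 + 3 / k) * P" using Q P0 by (intro mult_right_mono powr_mono) auto
          finally show "Q * (\<tau> * real L2) ^ (2 * j) \<le> Q powr (1 + 3 / k) * P" .
        qed auto
        also have "\<dots> = Q * J" using Q by (simp add: J_def P_def powr_add algebra_simps)
        finally show ?thesis using Q by simp
      qed
      have "norm T ^ (2 * j) \<le> real (card {s1..<s1 + int L1}) ^ (2 * j) * (real (card {t\<in>{0..<int q}. \<tau> * real (card {s1..<s1 + int L1}) \<le>
          norm (\<Sum>m\<in>{s1..<s1 + int L1}. ee q (t * invsq q m))}) * J + \<tau> * real (card V) ^ (2 * j))"
        unfolding T_def V_def[symmetric]
        by (rule bilinear_large_values[OF q h _ j1 _ _ _ J]) (use \<alpha> \<beta> \<tau>0 in \<open>auto simp: V_def\<close>)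
      also have "\<dots> = real L1 ^ (2 * j) * (real (card (H s1 L1)) * J + \<tau> * real L2 ^ (2 * j))"
        by (simp add: H_def S_def V_def)
      also have "\<dots> \<le> real L1 ^ (2 * j) * (C1 * Q powr (1 + 3 / k) / (real L1)\<^sup>2 * J + \<tau> * real L2 ^ (2 * j))"
        using cardH[OF Lbig(1) L1] C1 P0 by (intro mult_left_mono add_mono mult_right_mono) (auto simp: J_def)
      also have "C1 * Q powr (1 + 3 / k) / (real L1)\<^sup>2 * J =
          C1 * (C1 + 1) * (Q powr (1 + 6 / k) / (real L1 * real L2)\<^sup>2) * real L2 ^ (2 * j)"
      proof -
        have "Q powr (1 + 6 / k) = Q powr (1 + 3 / k) * Q powr (3 / k)" unfolding powr_add[symmetric] by (rule arg_cong[where f = "\<lambda>x. Q powr x"]) simp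
        thus ?thesis by (simp add: J_def P_def power_mult_distrib)
      qed
      also have "\<dots> \<le> C1 * (C1 + 1) * \<tau> * real L2 ^ (2 * j)"
      proof (intro mult_right_mono mult_left_mono)
        have "(Q powr (1 / 2 + \<theta>))\<^sup>2 \<le> (real L1 * real L2)\<^sup>2" using L12 by (intro power_mono) (auto simp: Q_def)
        hence "\<tau> * (Q powr (1 / 2 + \<theta>))\<^sup>2 \<le> \<tau> * (real L1 * real L2)\<^sup>2" using \<tau>0 by (intro mult_left_mono) auto
        moreover have "Q powr (1 + 6 / k) \<le> \<tau> * (Q powr (1 / 2 + \<theta>))\<^sup>2"
          unfolding \<tau>_def power2_eq_square powr_add[symmetric]
          using Q k1 \<sigma>1 \<theta> by (intro powr_mono) auto
        ultimately have "Q powr (1 + 6 / k) \<le> \<tau> * (real L1 * real L2)\<^sup>2" by linarith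
        thus "Q powr (1 + 6 / k) / (real L1 * real L2)\<^sup>2 \<le> \<tau>" using Lpos by (simp add: divide_le_eq)
      qed (use C1 in auto)
      finally have "norm T ^ (2 * j) \<le> real L1 ^ (2 * j) * (C1 * (C1 + 1) * \<tau> * real L2 ^ (2 * j) + \<tau> * real L2 ^ (2 * j))"
        by (simp add: mult_left_mono)
      also have "\<dots> = (C1 * (C1 + 1) + 1) * (\<tau> * (real L1 * real L2) ^ (2 * j))"
        by (simp add: power_mult_distrib algebra_simps)
      also have "\<dots> \<le> C ^ (2 * j) * (\<tau> * (real L1 * real L2) ^ (2 * j))"
      proof (rule mult_right_mono)
        have "C1 * (C1 + 1) + 1 \<le> C ^ 1" by (simp add: C_def)
        also have "C ^ 1 \<le> C ^ (2 * j)" using j1 C1 by (intro power_increasing) (auto simp: C_def)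
        finally show "C1 * (C1 + 1) + 1 \<le> C ^ (2 * j)" .
      qed (use \<tau>0 in auto)
      also have "\<tau> = (Q powr - \<gamma>) ^ (2 * j)"
      proof -
        have "(Q powr - \<gamma>) ^ (2 * j) = (Q powr - \<gamma>) powr real (2 * j)" using Q by (intro powr_realpow[symmetric]) simp
        also have "\<dots> = Q powr (- \<gamma> * real (2 * j))" by (simp add: powr_powr)
        also have "- \<gamma> * real (2 * j) = - \<sigma>" using j1 by (simp add: \<gamma>_def)
        finally show ?thesis by (simp add: \<tau>_def)
      qed
      finally have "norm T ^ (2 * j) \<le> (C * (real L1 * real L2) * Q powr - \<gamma>) ^ (2 * j)"
        by (simp add: power_mult_distrib mult_ac)
      thus ?thesis using C0 j1 by (subst (asm) power_mono_iff) auto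
    qed
    thus "norm (\<Sum>m\<in>{s1..<s1 + int L1}. \<Sum>n\<in>{s2..<s2 + int L2}. \<alpha> m * \<beta> n * ee q (h * (invsq q m * invsq q n)))
      \<le> C * (real L1 * real L2) * real q powr - \<gamma>"
      by (simp only: T_def Q_def)
  qed
qed

section \<open>Divisors and the Moebius function\<close>

lemma card_divisors_prime_power_mult:
  fixes p m a :: nat
  assumes p: "prime p" and m: "m > 0"
  shows "card {d. d dvd p ^ a * m} \<le> (a + 1) * card {d. d dvd m}"
proof -
  have "{d. d dvd p ^ a * m} \<subseteq> (\<lambda>(i, d). p ^ i * d) ` ({..a} \<times> {d. d dvd m})"
  proof
    fix d assume "d \<in> {d. d dvd p ^ a * m}"
    then obtain b c where bc: "d = b * c" "b dvd p ^ a" "c dvd m" by (auto elim: dvd_productE)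
    obtain i where "i \<le> a" "b = p ^ i" using bc(2) p by (auto simp: divides_primepow_nat)
    thus "d \<in> (\<lambda>(i, d). p ^ i * d) ` ({..a} \<times> {d. d dvd m})" using bc by auto
  qed
  hence "card {d. d dvd p ^ a * m} \<le> card ((\<lambda>(i, d). p ^ i * d) ` ({..a} \<times> {d. d dvd m}))"
    using m by (intro card_mono finite_imageI finite_cartesian_product) auto
  also have "\<dots> \<le> card ({..a} \<times> {d. d dvd m})"
    using m by (intro card_image_le finite_cartesian_product) auto
  finally show ?thesis by (simp add: card_cartesian_product)
qed

lemma Suc_le_powr:
  fixes \<epsilon> :: real and p :: nat
  assumes \<epsilon>: "\<epsilon> > 0" and p: "p \<ge> 2"
  shows "real a + 1 \<le> (1 + 1 / (\<epsilon> * ln 2)) * real (p ^ a) powr \<epsilon>"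
proof -
  have e: "real (p ^ a) powr \<epsilon> = exp (real a * \<epsilon> * ln (real p))"
    using p by (simp add: powr_def ln_realpow mult_ac)
  have "1 + real a * \<epsilon> * ln 2 \<le> exp (real a * \<epsilon> * ln 2)" by (rule exp_ge_add_one_self)
  also have "\<dots> \<le> exp (real a * \<epsilon> * ln (real p))" using p \<epsilon> by (intro iffD2[OF exp_le_cancel_iff] mult_left_mono) auto
  finally have "(1 + 1 / (\<epsilon> * ln 2)) * (1 + real a * \<epsilon> * ln 2) \<le> (1 + 1 / (\<epsilon> * ln 2)) * real (p ^ a) powr \<epsilon>"
    unfolding e using \<epsilon> by (intro mult_left_mono) auto
  moreover have "(1 + 1 / (\<epsilon> * ln 2)) * (1 + real a * \<epsilon> * ln 2) = 1 + real a + real a * \<epsilon> * ln 2 + 1 / (\<epsilon> * ln 2)"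
    using \<epsilon> by (simp add: algebra_simps)
  moreover have "real a * \<epsilon> * ln 2 \<ge> 0" "1 / (\<epsilon> * ln 2) \<ge> 0" using \<epsilon> by auto
  ultimately show ?thesis by linarith
qed

text \<open>Prime powers are split off one at a time. A prime p \<ge> 2^(1/\<epsilon>) costs no
  constant, because a + 1 \<le> 2^a \<le> p^(\<epsilon> a); each of the boundedly many smaller
  primes costs the factor \<open>K\<close> from \<open>Suc_le_powr\<close>.\<close>

lemma divisor_bound:
  fixes \<epsilon> :: real
  assumes \<epsilon>: "\<epsilon> > 0"
  shows "\<exists>C>0. \<forall>n>0. real (card {d. d dvd (n::nat)}) \<le> C * real n powr \<epsilon>"
proof -
  define K where "K = 1 + 1 / (\<epsilon> * ln 2)"
  define P where "P = nat \<lceil>2 powr (1 / \<epsilon>)\<rceil>"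
  define g where "g = (\<lambda>p. if p < P then K else 1)"
  have K1: "K \<ge> 1" using \<epsilon> by (simp add: K_def)
  have main: "real (card {d. d dvd n}) \<le> (\<Prod>p\<in>prime_factors n. g p) * real n powr \<epsilon>" if "n > 0" for n :: nat
    using that
  proof (induction n rule: less_induct)
    case (less n)
    show ?case
    proof (cases "n = 1")
      case True
      thus ?thesis by simp
    next
      case False
      then obtain p where p: "prime p" "p dvd n" using prime_factor_nat by blast
      have p2: "p \<ge> 2" using p(1) prime_ge_2_nat by blast
      obtain m where m: "n = p ^ multiplicity p n * m" "\<not> p dvd m"
        using multiplicity_decompose'[of n p] less.prems p by (metis not_prime_unit not_gr0)
      define a where "a = multiplicity p n"
      have a0: "a > 0" using p less.prems by (simp add: a_def prime_multiplicity_gt_zero_iff)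
      have m0: "m > 0" using m less.prems by (cases m) auto
      have n: "n = p ^ a * m" using m by (simp add: a_def)
      have mn: "m < n"
      proof -
        have "1 < p ^ a" using p2 a0 by (intro one_less_power) auto
        thus ?thesis using m0 n by simp
      qed
      have pf: "prime_factors n = insert p (prime_factors m)"
      proof -
        have "prime_factors (p ^ a) = {p}"
          using prime_factorization_prime_power[OF p(1), of a] a0 by simp
        moreover have "p ^ a \<noteq> 0" using p2 by simp
        ultimately show ?thesis unfolding n using m0 prime_factors_product[of "p ^ a" m] by simp
      qed
      have pm: "p \<notin> prime_factors m" using m(2) by auto
      have step: "real a + 1 \<le> g p * real (p ^ a) powr \<epsilon>"
      proof (cases "p < P")
        case True
        thus ?thesis using Suc_le_powr[OF \<epsilon> p2, of a] by (simp add: g_def K_def)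
      next
        case False
        hence "2 powr (1 / \<epsilon>) \<le> real p" unfolding P_def by linarith
        hence "(2 powr (1 / \<epsilon>)) powr \<epsilon> \<le> real p powr \<epsilon>" using \<epsilon> by (intro powr_mono2) auto
        hence p\<epsilon>: "2 \<le> real p powr \<epsilon>" using \<epsilon> by (simp add: powr_powr)
        have "a + 1 \<le> 2 ^ a" by (induction a) auto
        hence "real (a + 1) \<le> real (2 ^ a)" by (rule of_nat_mono)
        hence "real a + 1 \<le> 2 ^ a" by simp
        also have "\<dots> \<le> (real p powr \<epsilon>) ^ a" using p\<epsilon> by (intro power_mono) auto
        also have "\<dots> = real (p ^ a) powr \<epsilon>"
          using p2 by (simp add: powr_realpow[symmetric] powr_powr mult.commute)
        finally show ?thesis using False by (simp add: g_def)
      qed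
      have "real (card {d. d dvd n}) \<le> real ((a + 1) * card {d. d dvd m})"
        unfolding n of_nat_le_iff by (rule card_divisors_prime_power_mult[OF p(1) m0])
      also have "\<dots> = (real a + 1) * real (card {d. d dvd m})" by (simp add: algebra_simps)
      also have "\<dots> \<le> (g p * real (p ^ a) powr \<epsilon>) * ((\<Prod>p\<in>prime_factors m. g p) * real m powr \<epsilon>)"
        using K1 by (intro mult_mono step less.IH mn m0) (auto simp: g_def)
      also have "\<dots> = (\<Prod>p\<in>prime_factors n. g p) * (real (p ^ a) powr \<epsilon> * real m powr \<epsilon>)"
        unfolding pf using pm by simp
      also have "real (p ^ a) powr \<epsilon> * real m powr \<epsilon> = real n powr \<epsilon>"
        unfolding n by (simp add: powr_mult)
      finally show ?thesis .
    qed
  qed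
  show ?thesis
  proof (intro exI[of _ "K ^ P"] conjI allI impI)
    show "K ^ P > 0" using K1 by simp
    fix n :: nat assume n: "n > 0"
    have "(\<Prod>p\<in>prime_factors n. g p) \<le> (\<Prod>p\<in>{..<P} \<union> prime_factors n. g p)"
      using K1 by (intro prod_mono2) (auto simp: g_def)
    also have "\<dots> = (\<Prod>p\<in>{..<P}. g p)"
      by (rule prod.mono_neutral_right) (auto simp: g_def)
    also have "\<dots> = K ^ P" by (simp add: g_def)
    finally have "(\<Prod>p\<in>prime_factors n. g p) * real n powr \<epsilon> \<le> K ^ P * real n powr \<epsilon>"
      by (intro mult_right_mono) auto
    thus "real (card {d. d dvd n}) \<le> K ^ P * real n powr \<epsilon>" using main[OF n] by linarith
  qed
qed

section \<open>Moebius inversion and Vaughan's identity\<close>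

lemma moebius_1 [simp]: "moebius (Suc 0) = 1"
  by (simp add: Defs.moebius_def)

lemma abs_moebius_le: "\<bar>moebius n\<bar> \<le> 1"
  by (simp add: Defs.moebius_def)

lemma moebius_prime_mult:
  fixes p d :: nat
  assumes p: "prime p" and d: "\<not> p dvd d"
  shows "moebius (p * d) = - moebius d"
proof -
  have d0: "d > 0" using d by (cases d) auto
  have cop: "coprime p d" using p d by (simp add: prime_imp_coprime)
  have "squarefree (p * d) \<longleftrightarrow> squarefree d"
    using squarefree_mult_coprime[OF cop squarefree_prime[OF p]] squarefree_multD(2)[of p d] by blast
  moreover have "prime_factors (p * d) = insert p (prime_factors d)"
    using p d0 prime_factors_product[of p d] prime_prime_factors[OF p] by (auto simp: prime_gt_0_nat)
  moreover have "p \<notin> prime_factors d" using d by auto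
  ultimately show ?thesis by (simp add: Defs.moebius_def)
qed

lemma moebius_prime_square:
  assumes "prime p" "p dvd d"
  shows "moebius (p * d) = 0"
proof -
  have "p\<^sup>2 dvd p * d" using assms by (simp add: power2_eq_square)
  hence "\<not> squarefree (p * d)" using assms(1) unfolding squarefree_def by (metis not_prime_unit)
  thus ?thesis by (simp add: Defs.moebius_def)
qed

text \<open>For a prime p dividing n, the divisors d prime to p cancel against p d, and all
  remaining divisors are divisible by p^2.\<close>

lemma sum_moebius_divisors:
  assumes n: "n > 0"
  shows "(\<Sum>d | d dvd n. moebius d) = (if n = 1 then 1 else 0)"
proof (cases "n = 1")
  case True
  thus ?thesis by simp
next
  case False
  then obtain p where p: "prime p" "p dvd n" using prime_factor_nat by blast
  have p0: "p > 0" using p(1) prime_gt_0_nat by blast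
  have fin: "finite {d. d dvd n}" using n by simp
  define D where "D = {d. d dvd n \<and> \<not> p dvd d}"
  have finD: "finite D" by (rule finite_subset[OF _ fin]) (auto simp: D_def)
  have "(\<Sum>d | d dvd n. moebius d) = (\<Sum>d\<in>D \<union> (*) p ` D. moebius d)"
  proof (rule sum.mono_neutral_right[OF fin])
    show "D \<union> (*) p ` D \<subseteq> {d. d dvd n}"
    proof
      fix d assume "d \<in> D \<union> (*) p ` D"
      then consider "d \<in> D" | e where "e \<in> D" "d = p * e" by auto
      thus "d \<in> {d. d dvd n}"
      proof cases
        case 2
        have "coprime p e" using 2 p by (auto simp: D_def prime_imp_coprime)
        thus ?thesis using 2 p by (auto simp: D_def divides_mult)
      qed (auto simp: D_def)
    qed
    show "\<forall>d\<in>{d. d dvd n} - (D \<union> (*) p ` D). moebius d = 0"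
    proof
      fix d assume d: "d \<in> {d. d dvd n} - (D \<union> (*) p ` D)"
      hence "p dvd d" by (auto simp: D_def)
      then obtain e where e: "d = p * e" by auto
      have "p dvd e"
      proof (rule ccontr)
        assume "\<not> p dvd e"
        moreover have "e dvd n" using d e by (metis DiffD1 dvd_mult_right mem_Collect_eq)
        ultimately show False using d e by (auto simp: D_def)
      qed
      thus "moebius d = 0" unfolding e by (rule moebius_prime_square[OF p(1)])
    qed
  qed
  also have "\<dots> = (\<Sum>d\<in>D. moebius d) + (\<Sum>d\<in>(*) p ` D. moebius d)"
    using finD by (intro sum.union_disjoint) (auto simp: D_def)
  also have "(\<Sum>d\<in>(*) p ` D. moebius d) = (\<Sum>d\<in>D. moebius (p * d))"
    using p0 by (subst sum.reindex) (auto simp: inj_on_def)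
  also have "\<dots> = (\<Sum>d\<in>D. - moebius d)"
    by (intro sum.cong refl moebius_prime_mult p) (auto simp: D_def)
  finally show ?thesis using False by (simp add: sum_negf)
qed

text \<open>The d with d^2 dividing n are the divisors of the square part of n.\<close>

lemma moebius_square_sum:
  assumes n: "n > 0"
  shows "(moebius n)\<^sup>2 = (\<Sum>d | d\<^sup>2 dvd n. moebius d)"
proof -
  define s where "s = square_part n"
  have s0: "s > 0" using n by (metis neq0_conv s_def square_part_0_iff)
  have "d\<^sup>2 dvd n \<longleftrightarrow> d dvd s" for d
    using n unfolding s_def by (simp add: dvd_square_part_iff)
  hence "(\<Sum>d | d\<^sup>2 dvd n. moebius d) = (if s = 1 then 1 else 0)"
    using sum_moebius_divisors[OF s0] by simp
  moreover have "s = 1 \<longleftrightarrow> squarefree n"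
  proof
    assume s1: "s = 1"
    hence "n = squarefree_part n" using squarefree_decompose[of n] by (simp add: s_def)
    thus "squarefree n" by (metis squarefree_squarefree_part)
  next
    assume "squarefree n"
    thus "s = 1" using square_part_square_dvd[of n] unfolding s_def squarefree_def by (metis nat_dvd_1_iff_1)
  qed
  ultimately show ?thesis by (simp add: moebius_square)
qed

lemma sum_divisor_pairs:
  fixes g :: "nat \<Rightarrow> complex"
  assumes "M \<le> N"
  shows "(\<Sum>c\<in>{1..N}. \<Sum>d\<in>{1..M div c}. g c * F (c * d)) = (\<Sum>n\<in>{1..M}. (\<Sum>c | c dvd n. g c) * F n)"
proof -
  have "(\<Sum>n\<in>{1..M}. (\<Sum>c | c dvd n. g c) * F n) = (\<Sum>n\<in>{1..M}. \<Sum>c\<in>{c\<in>{1..N}. c dvd n}. g c * F n)"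
    unfolding sum_distrib_right
  proof (intro sum.cong refl)
    fix n assume "n \<in> {1..M}"
    hence n: "n > 0" "n \<le> N" using assms by auto
    have "1 \<le> c \<and> c \<le> N" if "c dvd n" for c
      using dvd_imp_le[OF that n(1)] dvd_pos_nat[OF n(1) that] n(2) by linarith
    thus "{c. c dvd n} = {c\<in>{1..N}. c dvd n}" by auto
  qed
  also have "\<dots> = (\<Sum>c\<in>{1..N}. \<Sum>n\<in>{n\<in>{1..M}. c dvd n}. g c * F n)"
    by (rule sum.swap_restrict) auto
  also have "\<dots> = (\<Sum>c\<in>{1..N}. \<Sum>d\<in>{1..M div c}. g c * F (c * d))"
  proof (rule sum.cong[OF refl])
    fix c assume c: "c \<in> {1..N}"
    show "(\<Sum>n\<in>{n\<in>{1..M}. c dvd n}. g c * F n) = (\<Sum>d\<in>{1..M div c}. g c * F (c * d))"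
    proof (rule sum.reindex_bij_witness[of _ "\<lambda>d. c * d" "\<lambda>n. n div c"])
      fix n assume n: "n \<in> {n\<in>{1..M}. c dvd n}"
      show "c * (n div c) = n" using n by simp
      have "c \<le> n" using n by (auto dest: dvd_imp_le)
      thus "n div c \<in> {1..M div c}" using n c by (auto simp: div_le_mono Suc_le_eq div_greater_zero_iff)
      show "g c * F (c * (n div c)) = g c * F n" using n by simp
    next
      fix d assume d: "d \<in> {1..M div c}"
      show "c * d div c = d" using c by simp
      have "c * d \<le> M" using c d by (simp add: less_eq_div_iff_mult_less_eq mult.commute)
      thus "c * d \<in> {n\<in>{1..M}. c dvd n}" using c d by auto
    qed
  qed
  finally show ?thesis ..
qed

text \<open>If b or c ranges over all of 1..N, the sum of the Moebius function over divisors
  collapses the triple sum over b c d to a single sum. Cutting both b and c at \<open>z\<close> and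
  using the symmetry gives twice the small part, minus small-small, plus large-large.\<close>

lemma vaughan_identity:
  fixes F :: "nat \<Rightarrow> complex"
  defines "\<mu> \<equiv> \<lambda>n. complex_of_int (moebius n)"
  assumes z: "z \<le> N"
  shows "(\<Sum>n\<in>{1..N}. \<mu> n * F n) = 2 * (\<Sum>n\<in>{1..z}. \<mu> n * F n)
    - (\<Sum>b\<in>{1..z}. \<Sum>c\<in>{1..z}. \<mu> b * \<mu> c * (\<Sum>d\<in>{1..N div b div c}. F (b * (c * d))))
    + (\<Sum>b\<in>{z<..N}. \<Sum>n\<in>{1..N div b}. \<mu> b * (\<Sum>c | c dvd n \<and> z < c. \<mu> c) * F (b * n))"
proof -
  define G where "G = (\<lambda>A B. \<Sum>b\<in>A. \<Sum>c\<in>B. \<mu> b * \<mu> c * (\<Sum>d\<in>{1..N div b div c}. F (b * (c * d))))"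
  have G_Un1: "G {1..N} B = G {1..z} B + G {z<..N} B" for B
  proof -
    have "{1..N} = {1..z} \<union> {z<..N}" using z by auto
    thus ?thesis unfolding G_def by (simp only:) (rule sum.union_disjoint, auto)
  qed
  have G_sym: "G A B = G B A" for A B
    unfolding G_def by (subst sum.swap) (simp add: mult_ac div_mult2_eq[symmetric])
  have fiber: "(\<Sum>c\<in>{1..N}. g c * (\<Sum>d\<in>{1..N div b div c}. F (b * (c * d)))) =
      (\<Sum>n\<in>{1..N div b}. (\<Sum>c | c dvd n. g c) * F (b * n))" for g :: "nat \<Rightarrow> complex" and b
    using sum_divisor_pairs[of "N div b" N g "\<lambda>n. F (b * n)"] by (simp add: sum_distrib_left)
  have G_all: "G A {1..N} = (\<Sum>b\<in>A. \<mu> b * F b)" if A: "A \<subseteq> {1..N}" for A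
    unfolding G_def
  proof (intro sum.cong refl)
    fix b assume b: "b \<in> A"
    hence bN: "1 \<le> N div b" using A by (auto simp: Suc_le_eq div_greater_zero_iff)
    have "(\<Sum>c\<in>{1..N}. \<mu> b * \<mu> c * (\<Sum>d\<in>{1..N div b div c}. F (b * (c * d)))) =
        \<mu> b * (\<Sum>n\<in>{1..N div b}. (\<Sum>c | c dvd n. \<mu> c) * F (b * n))"
      unfolding fiber[symmetric] sum_distrib_left by (simp add: mult.assoc)
    also have "(\<Sum>n\<in>{1..N div b}. (\<Sum>c | c dvd n. \<mu> c) * F (b * n)) = (\<Sum>n\<in>{1..N div b}. if n = 1 then F b else 0)"
    proof (intro sum.cong refl)
      fix n assume n: "n \<in> {1..N div b}"
      have "(\<Sum>c | c dvd n. \<mu> c) = complex_of_int (\<Sum>c | c dvd n. moebius c)" by (simp add: \<mu>_def)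
      thus "(\<Sum>c | c dvd n. \<mu> c) * F (b * n) = (if n = 1 then F b else 0)"
        using n by (subst (asm) sum_moebius_divisors) auto
    qed
    also have "\<dots> = F b" using bN by (simp add: sum.delta)
    finally show "(\<Sum>c\<in>{1..N}. \<mu> b * \<mu> c * (\<Sum>d\<in>{1..N div b div c}. F (b * (c * d)))) = \<mu> b * F b" .
  qed
  have LL: "G {z<..N} {z<..N} = (\<Sum>b\<in>{z<..N}. \<Sum>n\<in>{1..N div b}. \<mu> b * (\<Sum>c | c dvd n \<and> z < c. \<mu> c) * F (b * n))"
    unfolding G_def
  proof (rule sum.cong[OF refl])
    fix b
    let ?h = "\<lambda>c. if z < c then \<mu> c else 0"
    have "(\<Sum>c\<in>{z<..N}. \<mu> b * \<mu> c * (\<Sum>d\<in>{1..N div b div c}. F (b * (c * d)))) =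
        \<mu> b * (\<Sum>c\<in>{1..N}. ?h c * (\<Sum>d\<in>{1..N div b div c}. F (b * (c * d))))"
      unfolding sum_distrib_left by (intro sum.mono_neutral_cong_left) auto
    also have "\<dots> = (\<Sum>n\<in>{1..N div b}. \<mu> b * (\<Sum>c | c dvd n. ?h c) * F (b * n))"
      unfolding fiber sum_distrib_left[of "\<mu> b" "\<lambda>n. (\<Sum>c | c dvd n. ?h c) * F (b * n)"] by (simp only: mult.assoc)
    also have "\<dots> = (\<Sum>n\<in>{1..N div b}. \<mu> b * (\<Sum>c | c dvd n \<and> z < c. \<mu> c) * F (b * n))"
    proof (rule sum.cong[OF refl])
      fix n assume "n \<in> {1..N div b}"
      hence "finite {c. c dvd n}" by simp
      hence "(\<Sum>c | c dvd n. ?h c) = (\<Sum>c | c dvd n \<and> z < c. \<mu> c)"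
        by (intro sum.mono_neutral_cong_right) auto
      thus "\<mu> b * (\<Sum>c | c dvd n. ?h c) * F (b * n) = \<mu> b * (\<Sum>c | c dvd n \<and> z < c. \<mu> c) * F (b * n)"
        by (simp only:)
    qed
    finally show "(\<Sum>c\<in>{z<..N}. \<mu> b * \<mu> c * (\<Sum>d\<in>{1..N div b div c}. F (b * (c * d)))) =
      (\<Sum>n\<in>{1..N div b}. \<mu> b * (\<Sum>c | c dvd n \<and> z < c. \<mu> c) * F (b * n))" .
  qed
  have "G {1..z} {1..N} = G {1..z} {1..z} + G {1..z} {z<..N}"
    unfolding G_sym[of "{1..z}" "{1..N}"] G_sym[of "{1..z}" "{z<..N}"] by (rule G_Un1)
  moreover have "G {1..N} {1..N} = G {1..z} {1..N} + G {z<..N} {1..N}" by (rule G_Un1)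
  moreover have "G {z<..N} {1..N} = G {1..z} {z<..N} + G {z<..N} {z<..N}"
    unfolding G_sym[of "{z<..N}" "{1..N}"] by (rule G_Un1)
  ultimately have split: "G {1..N} {1..N} = 2 * G {1..z} {1..N} - G {1..z} {1..z} + G {z<..N} {z<..N}"
    by (simp add: algebra_simps)
  have A: "G {1..N} {1..N} = (\<Sum>n\<in>{1..N}. \<mu> n * F n)" by (rule G_all) auto
  have B: "G {1..z} {1..N} = (\<Sum>n\<in>{1..z}. \<mu> n * F n)" by (rule G_all) (use z in auto)
  show ?thesis unfolding A[symmetric] B[symmetric] LL[symmetric] using split by (simp only: G_def)
qed

section \<open>Bilinear sums under a hyperbola\<close>

lemma sum_blocks:
  fixes F :: "int \<Rightarrow> 'a::comm_monoid_add"
  shows "(\<Sum>r<R. \<Sum>m\<in>{s + int (r * L)..<s + int (r * L) + int L}. F m) = (\<Sum>m\<in>{s..<s + int (R * L)}. F m)"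
proof (induction R)
  case (Suc R)
  have "{s..<s + int (Suc R * L)} = {s..<s + int (R * L)} \<union> {s + int (R * L)..<s + int (R * L) + int L}"
  proof -
    define y where "y = int (R * L)"
    have y: "y \<ge> 0" "int (Suc R * L) = y + int L" by (simp_all add: y_def)
    show ?thesis unfolding y(2) y_def[symmetric] using y(1) by auto
  qed
  hence "(\<Sum>m\<in>{s..<s + int (Suc R * L)}. F m) =
      (\<Sum>m\<in>{s..<s + int (R * L)}. F m) + (\<Sum>m\<in>{s + int (R * L)..<s + int (R * L) + int L}. F m)"
    by (simp only:) (rule sum.union_disjoint, auto)
  thus ?case using Suc.IH by simp
qed auto

lemma div_add_one_times_ge: "L \<ge> 1 \<Longrightarrow> n \<le> (n div L + 1) * (L::nat)"
  by (metis Suc_eq_plus1 add.commute div_mult_mod_eq less_imp_le_nat mod_less_divisor mult_Suc nat_add_left_cancel_le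
      not_less_zero order_le_less zero_less_one_class.zero_less_one gr0I)

text \<open>The range of n depends on m, so rectangle bounds do not apply directly. Within a block
  of L1 values of m the upper limit is frozen; this alters at most N L1 / M^2 + 1 terms for each
  m.\<close>

lemma bilinear_hyperbola_blocks:
  fixes \<alpha> \<beta> :: "int \<Rightarrow> complex" and M N L1 L2 :: nat and E b :: real and e :: "int \<Rightarrow> int \<Rightarrow> complex"
  assumes L1: "1 \<le> L1" "L1 \<le> M" and L2: "1 \<le> L2" "L2 * M \<le> N"
    and e: "\<And>m n. norm (e m n) = 1"
    and \<alpha>: "\<And>m. norm (\<alpha> m) \<le> 1" and b: "b > 0" and \<beta>: "\<And>n. norm (\<beta> n) \<le> b"
    and rect: "\<And>s1 s2 \<alpha>' \<beta>'. (\<forall>m. norm (\<alpha>' m) \<le> 1) \<Longrightarrow> (\<forall>n. norm (\<beta>' n) \<le> 1) \<Longrightarrow>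
      norm (\<Sum>m\<in>{s1..<s1 + int L1}. \<Sum>n\<in>{s2..<s2 + int L2}. \<alpha>' m * \<beta>' n * e m n) \<le> E"
  shows "norm (\<Sum>m\<in>{int M<..2 * int M}. \<Sum>n\<in>{1..int N div m}. \<alpha> m * \<beta> n * e m n) \<le>
    b * (4 * (real N / (real L1 * real L2)) * E + real N * real L1 / real M + real M)"
proof -
  define R where "R = M div L1 + 1"
  define R' where "R' = (N div M) div L2 + 1"
  define s where "s = int M + 1"
  define blk where "blk = (\<lambda>r. {s + int (r * L1)..<s + int (r * L1) + int L1})"
  define blk' where "blk' = (\<lambda>t. {1 + int (t * L2)..<1 + int (t * L2) + int L2})"
  define K where "K = (\<lambda>r. int N div (s + int (r * L1)))"
  \<comment> \<open>The R blocks overshoot 2 M; extending \<alpha> by 0 makes the excess harmless.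
    The coefficients \<beta> are treated likewise and also divided by b.\<close>
  define a where "a = (\<lambda>m. if m \<in> {int M<..2 * int M} then \<alpha> m else 0)"
  define err where "err = (real N * real L1 / (real M)\<^sup>2 + 1)"
  have M0: "M > 0" using L1 by simp
  have E0: "E \<ge> 0" using rect[of "\<lambda>_. 0" "\<lambda>_. 0"] by simp
  have a1: "norm (a m) \<le> 1" for m using \<alpha> by (simp add: a_def)
  have RM: "M \<le> R * L1" unfolding R_def by (rule div_add_one_times_ge[OF L1(1)])
  have RN: "N div M \<le> R' * L2" unfolding R'_def by (rule div_add_one_times_ge[OF L2(1)])
  have R: "real R \<le> 2 * (real M / real L1)"
  proof -
    have "real (M div L1) \<le> real M / real L1" by (rule of_nat_div_le_of_nat)
    moreover have "1 \<le> real M / real L1" using L1 by (simp add: le_divide_eq)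
    ultimately show ?thesis by (simp add: R_def)
  qed
  have R': "real R' \<le> 2 * (real N / (real M * real L2))"
  proof -
    have "real ((N div M) div L2) \<le> real N / (real M * real L2)"
      unfolding div_mult2_eq[symmetric] using of_nat_div_le_of_nat[of N "M * L2"] by simp
    moreover have "1 \<le> real N / (real M * real L2)"
    proof -
      have "real L2 * real M \<le> real N" using L2(2) by (metis of_nat_le_iff of_nat_mult)
      thus ?thesis using L2 M0 by (simp add: le_divide_eq mult.commute)
    qed
    ultimately have "real R' \<le> real N / (real M * real L2) + real N / (real M * real L2)"
      unfolding R'_def of_nat_add of_nat_1 by linarith
    thus ?thesis by (simp only: mult_2)
  qed
  define G where "G = (\<lambda>m. \<Sum>n\<in>{1..int N div m}. \<beta> n * e m n)"
  define G' where "G' = (\<lambda>r m. \<Sum>n\<in>{1..K r}. \<beta> n * e m n)"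
  have "(\<Sum>m\<in>{int M<..2 * int M}. \<Sum>n\<in>{1..int N div m}. \<alpha> m * \<beta> n * e m n) =
      (\<Sum>m\<in>{int M<..2 * int M}. a m * G m)"
    by (intro sum.cong refl) (simp add: a_def G_def sum_distrib_left mult.assoc)
  also have "\<dots> = (\<Sum>m\<in>{s..<s + int (R * L1)}. a m * G m)"
  proof (rule sum.mono_neutral_left)
    have "int M \<le> int (R * L1)" using RM by (simp only: of_nat_le_iff)
    thus "{int M<..2 * int M} \<subseteq> {s..<s + int (R * L1)}" by (auto simp: s_def)
  qed (auto simp: a_def)
  also have "\<dots> = (\<Sum>r<R. \<Sum>m\<in>blk r. a m * G m)" unfolding blk_def by (rule sum_blocks[symmetric])
  finally have decomp: "(\<Sum>m\<in>{int M<..2 * int M}. \<Sum>n\<in>{1..int N div m}. \<alpha> m * \<beta> n * e m n) =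
    (\<Sum>r<R. \<Sum>m\<in>blk r. a m * G m)" .
  have main: "norm (\<Sum>m\<in>blk r. a m * G' r m) \<le> real R' * (b * E)" for r
  proof -
    define \<beta>' where "\<beta>' = (\<lambda>n. if n \<in> {1..K r} then \<beta> n / of_real b else 0)"
    have \<beta>1: "\<forall>n. norm (\<beta>' n) \<le> 1" using \<beta> b by (simp add: \<beta>'_def norm_divide)
    have KN: "K r \<le> int (R' * L2)"
    proof -
      have "K r \<le> int N div int M" unfolding K_def using M0 by (intro zdiv_mono2) (auto simp: s_def)
      also have "\<dots> = int (N div M)" by (simp add: zdiv_int)
      finally show ?thesis using RN by (simp only: of_nat_le_iff[symmetric, where 'a = int])
    qed
    have G': "G' r m = of_real b * (\<Sum>t<R'. \<Sum>n\<in>blk' t. \<beta>' n * e m n)" for m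
    proof -
      have "G' r m = (\<Sum>n\<in>{1..<1 + int (R' * L2)}. of_real b * (\<beta>' n * e m n))"
        unfolding G'_def using KN b by (intro sum.mono_neutral_cong_left) (auto simp: \<beta>'_def)
      thus ?thesis unfolding sum_blocks[symmetric] blk'_def sum_distrib_left .
    qed
    have "(\<Sum>m\<in>blk r. a m * G' r m) = of_real b * (\<Sum>t<R'. \<Sum>m\<in>blk r. \<Sum>n\<in>blk' t. a m * \<beta>' n * e m n)"
      unfolding G' by (subst sum.swap) (simp add: sum_distrib_left mult_ac)
    hence "norm (\<Sum>m\<in>blk r. a m * G' r m) = b * norm (\<Sum>t<R'. \<Sum>m\<in>blk r. \<Sum>n\<in>blk' t. a m * \<beta>' n * e m n)"
      using b by (simp add: norm_mult)
    also have "\<dots> \<le> b * (\<Sum>t<R'. E)"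
    proof (intro mult_left_mono)
      show "norm (\<Sum>t<R'. \<Sum>m\<in>blk r. \<Sum>n\<in>blk' t. a m * \<beta>' n * e m n) \<le> (\<Sum>t<R'. E)"
      proof (rule order_trans[OF norm_sum], rule sum_mono)
        fix t show "norm (\<Sum>m\<in>blk r. \<Sum>n\<in>blk' t. a m * \<beta>' n * e m n) \<le> E"
          unfolding blk_def blk'_def using a1 \<beta>1 by (intro rect) auto
      qed
    qed (use b in auto)
    finally show ?thesis by (simp add: mult_ac)
  qed
  have error: "norm (a m * G m - a m * G' r m) \<le> (if m \<in> {int M<..2 * int M} then b * err else 0)" if m: "m \<in> blk r" for r m
  proof (cases "m \<in> {int M<..2 * int M}")
    case False
    thus ?thesis by (auto simp: a_def)
  next
    case True
    define m0 where "m0 = s + int (r * L1)"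
    have m0: "m0 > int M" "m0 \<le> m" "m \<le> m0 + int L1"
    proof -
      have "0 \<le> int (r * L1)" by (rule of_nat_0_le_iff)
      thus "m0 > int M" unfolding m0_def s_def by linarith
    qed (use m in \<open>auto simp: m0_def blk_def\<close>)
    have Km: "int N div m \<le> K r" unfolding K_def m0_def[symmetric] using m0 M0 by (intro zdiv_mono2) auto
    have "G' r m = G m + (\<Sum>n\<in>{int N div m<..K r}. \<beta> n * e m n)"
    proof -
      have nn: "int N div m \<ge> 0" using m0 M0 by (simp add: pos_imp_zdiv_nonneg_iff)
      have "{1..K r} = {1..int N div m} \<union> {int N div m<..K r}" using Km nn by auto
      thus ?thesis unfolding G'_def G_def by (simp only:) (rule sum.union_disjoint, auto)
    qed
    hence "norm (a m * G m - a m * G' r m) = norm (a m) * norm (\<Sum>n\<in>{int N div m<..K r}. \<beta> n * e m n)"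
      by (simp add: algebra_simps norm_mult[symmetric] del: norm_mult)
    also have "\<dots> \<le> 1 * (\<Sum>n\<in>{int N div m<..K r}. b)"
      by (intro mult_mono a1 order_trans[OF norm_sum] sum_mono) (auto simp: norm_mult e \<beta>)
    also have "\<dots> = b * real_of_int (K r - int N div m)" using Km by (simp add: mult.commute)
    also have "real_of_int (K r - int N div m) \<le> err"
    proof -
      have x: "real_of_int (K r) \<le> real N / real_of_int m0"
        unfolding K_def m0_def[symmetric] using real_of_int_div4[of "int N" m0] by simp
      have y: "real N / real_of_int m - 1 \<le> real_of_int (int N div m)"
        using real_of_int_div3[of "int N" m] by simp
      have mm: "real_of_int m0 \<ge> real M" "real_of_int m \<ge> real M" "real_of_int m - real_of_int m0 \<le> real L1"
        using m0 by linarith+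
      have "real N / real_of_int m0 - real N / real_of_int m = real N * (real_of_int m - real_of_int m0) / (real_of_int m0 * real_of_int m)"
        using mm M0 by (simp add: field_simps)
      also have "\<dots> \<le> real N * real L1 / (real M * real M)"
        using mm M0 m0 by (intro frac_le mult_left_mono mult_mono mult_nonneg_nonneg) auto
      finally show ?thesis using x y by (simp add: err_def power2_eq_square)
    qed
    finally show ?thesis using True b by (simp add: mult_left_mono)
  qed
  have "norm (\<Sum>r<R. \<Sum>m\<in>blk r. a m * G m) \<le> (\<Sum>r<R. norm (\<Sum>m\<in>blk r. a m * G' r m) +
      (\<Sum>m\<in>blk r. if m \<in> {int M<..2 * int M} then b * err else 0))"
  proof (rule order_trans[OF norm_sum], rule sum_mono)
    fix r
    have "(\<Sum>m\<in>blk r. a m * G m) = (\<Sum>m\<in>blk r. a m * G' r m) + (\<Sum>m\<in>blk r. a m * G m - a m * G' r m)"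
      by (simp add: sum.distrib[symmetric])
    hence "norm (\<Sum>m\<in>blk r. a m * G m) \<le> norm (\<Sum>m\<in>blk r. a m * G' r m) + norm (\<Sum>m\<in>blk r. a m * G m - a m * G' r m)"
      by (simp only: norm_triangle_ineq)
    moreover have "norm (\<Sum>m\<in>blk r. a m * G m - a m * G' r m) \<le> (\<Sum>m\<in>blk r. if m \<in> {int M<..2 * int M} then b * err else 0)"
      by (rule order_trans[OF norm_sum], rule sum_mono, rule error)
    ultimately show "norm (\<Sum>m\<in>blk r. a m * G m) \<le> norm (\<Sum>m\<in>blk r. a m * G' r m) +
      (\<Sum>m\<in>blk r. if m \<in> {int M<..2 * int M} then b * err else 0)" by linarith
  qed
  also have "\<dots> = (\<Sum>r<R. norm (\<Sum>m\<in>blk r. a m * G' r m)) +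
      (\<Sum>m\<in>{s..<s + int (R * L1)}. if m \<in> {int M<..2 * int M} then b * err else 0)"
    unfolding sum.distrib blk_def sum_blocks ..
  also have "(\<Sum>m\<in>{s..<s + int (R * L1)}. if m \<in> {int M<..2 * int M} then b * err else 0) \<le> real M * (b * err)"
  proof -
    have "(\<Sum>m\<in>{s..<s + int (R * L1)}. if m \<in> {int M<..2 * int M} then b * err else 0) \<le>
        (\<Sum>m\<in>{s..<s + int (R * L1)} \<union> {int M<..2 * int M}. if m \<in> {int M<..2 * int M} then b * err else 0)"
      using b by (intro sum_mono2) (auto simp: err_def)
    also have "\<dots> = (\<Sum>m\<in>{int M<..2 * int M}. b * err)"
      by (intro sum.mono_neutral_cong_right) auto
    finally show ?thesis by simp
  qed
  also have "(\<Sum>r<R. norm (\<Sum>m\<in>blk r. a m * G' r m)) \<le> real R * (real R' * (b * E))"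
    using sum_mono[of "{..<R}", OF main] by simp
  also have "real R * (real R' * (b * E)) \<le> (2 * (real M / real L1)) * ((2 * (real N / (real M * real L2))) * (b * E))"
    using R R' E0 b by (intro mult_mono) auto
  also have "\<dots> + real M * (b * err) = b * (4 * (real N / (real L1 * real L2)) * E + real N * real L1 / real M + real M)"
  proof -
    have h1: "real M * (b * err) = b * (real N * real L1 / real M + real M)"
    proof -
      have "real M * err = real N * real L1 / real M + real M"
        using M0 by (simp add: err_def power2_eq_square distrib_left)
      thus ?thesis by (metis mult.left_commute)
    qed
    have h2: "(2 * (real M / real L1)) * ((2 * (real N / (real M * real L2))) * (b * E)) = b * (4 * (real N / (real L1 * real L2)) * E)"
      using M0 by simp
    show ?thesis unfolding h1 h2 by (simp only: distrib_left add.assoc)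
  qed
  finally show ?thesis unfolding decomp by simp
qed

text \<open>The block lengths must stay below q^(1/2), must be shorter than M and N / M by q^\<rho>
  so that freezing the hyperbola costs little, and must still have a product above q^(1/2 + \<rho>).
  The assumptions on M and N make this possible.\<close>

lemma bilinear_dyadic:
  fixes \<kappa> \<epsilon> :: real
  assumes \<kappa>: "0 < \<kappa>" "\<kappa> \<le> 1 / 2" and \<epsilon>: "0 < \<epsilon>" "\<epsilon> \<le> 1 / 2"
  shows "\<exists>\<gamma>>0. \<exists>C>0. \<forall>q (h::int) N M (\<alpha>::int \<Rightarrow> complex) (\<beta>::int \<Rightarrow> complex) b.
    prime q \<longrightarrow> q \<ge> 3 \<longrightarrow> \<not> int q dvd h \<longrightarrow> real q powr (1 / 2 + \<kappa>) \<le> real N \<longrightarrow>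
    real q powr \<epsilon> \<le> real M \<longrightarrow> real M * real q powr \<epsilon> \<le> real N \<longrightarrow>
    (\<forall>m. norm (\<alpha> m) \<le> 1) \<longrightarrow> (\<forall>n. norm (\<beta> n) \<le> b) \<longrightarrow> b > 0 \<longrightarrow>
    norm (\<Sum>m\<in>{int M<..2 * int M}. \<Sum>n\<in>{1..int N div m}. \<alpha> m * \<beta> n * ee q (h * (invsq q m * invsq q n)))
      \<le> C * b * real N * real q powr - \<gamma>"
proof -
  define \<rho> where "\<rho> = min \<kappa> \<epsilon> / 4"
  have \<rho>: "0 < \<rho>" "\<rho> \<le> 1 / 8" "4 * \<rho> \<le> \<kappa>" "4 * \<rho> \<le> \<epsilon>" using \<kappa> \<epsilon> by (auto simp: \<rho>_def)
  obtain \<gamma>0 C0 where \<gamma>0: "\<gamma>0 > 0" and C0: "C0 > 0" and BS: "\<And>q h s1 L1 s2 L2 \<alpha> \<beta>.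
    prime q \<Longrightarrow> q \<ge> 3 \<Longrightarrow> \<not> int q dvd h \<Longrightarrow> real L1 \<le> sqrt (real q) \<Longrightarrow> real L2 \<le> sqrt (real q) \<Longrightarrow>
    real q powr (1 / 2 + \<rho>) \<le> real L1 * real L2 \<Longrightarrow> (\<forall>m. norm (\<alpha> m) \<le> 1) \<Longrightarrow> (\<forall>n. norm (\<beta> n) \<le> 1) \<Longrightarrow>
    norm (\<Sum>m\<in>{s1..<s1 + int L1}. \<Sum>n\<in>{s2..<s2 + int L2}. \<alpha> m * \<beta> n * ee q (h * (invsq q m * invsq q n)))
      \<le> C0 * (real L1 * real L2) * real q powr - \<gamma>0"
    using bilinear_saving[of \<rho>] \<rho> by force
  define \<gamma> where "\<gamma> = min \<gamma>0 \<rho>"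
  define C where "C = 4 * C0 + 4"
  have \<gamma>: "\<gamma> > 0" "\<gamma> \<le> \<gamma>0" "\<gamma> \<le> \<rho>" using \<gamma>0 \<rho> by (auto simp: \<gamma>_def)
  have C: "C > 0" using C0 by (simp add: C_def)
  show ?thesis
  proof (rule exI[of _ \<gamma>], rule conjI[OF \<gamma>(1)], rule exI[of _ C], rule conjI[OF C], intro allI impI)
    fix q N M :: nat and h :: int and \<alpha> \<beta> :: "int \<Rightarrow> complex" and b :: real
    assume q: "prime q" and q3: "q \<ge> 3" and h: "\<not> int q dvd h" and N: "real q powr (1 / 2 + \<kappa>) \<le> real N"
      and M: "real q powr \<epsilon> \<le> real M" "real M * real q powr \<epsilon> \<le> real N"
      and \<alpha>: "\<forall>m. norm (\<alpha> m) \<le> 1" and \<beta>: "\<forall>n. norm (\<beta> n) \<le> b" and b: "b > 0"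
    define Q where "Q = real q"
    have Q: "Q \<ge> 3" using q3 by (simp add: Q_def)
    have Q1: "1 \<le> Q powr x" if "x \<ge> 0" for x using Q that by (simp add: ge_one_powr_ge_zero)
    have Qm: "Q powr x \<le> Q powr y" if "x \<le> y" for x y using Q that by (intro powr_mono) auto
    have M1: "real M \<ge> 1" using M(1) Q1[of \<epsilon>] \<epsilon> by (simp add: Q_def)
    let ?e = "\<lambda>m n. ee q (h * (invsq q m * invsq q n))"
    let ?T = "\<Sum>m\<in>{int M<..2 * int M}. \<Sum>n\<in>{1..int N div m}. \<alpha> m * \<beta> n * ?e m n"
    have "norm ?T \<le> C * b * real N * Q powr - \<gamma>"
    \<comment> \<open>For q^\<rho> < 4 the trivial bound suffices; otherwise the factor 4 lost by
      rounding down both lengths is at most q^\<rho>.\<close>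
    proof (cases "Q powr \<rho> \<ge> 4")
      case False
      have "norm ?T \<le> (\<Sum>m\<in>{int M<..2 * int M}. b * (real N / real M))"
      proof (rule order_trans[OF norm_sum], rule sum_mono)
        fix m assume m: "m \<in> {int M<..2 * int M}"
        have "norm (\<alpha> m * \<beta> n * ?e m n) \<le> b" for n
          using mult_mono[OF spec[OF \<alpha>, of m] spec[OF \<beta>, of n]] by (simp add: norm_mult)
        hence "norm (\<Sum>n\<in>{1..int N div m}. \<alpha> m * \<beta> n * ?e m n) \<le> (\<Sum>n\<in>{1..int N div m}. b)"
          by (intro order_trans[OF norm_sum] sum_mono) auto
        also have "\<dots> = b * real_of_int (int N div m)"
          using m by (simp add: pos_imp_zdiv_nonneg_iff)
        also have "\<dots> \<le> b * (real N / real M)"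
        proof (rule mult_left_mono)
          have "real_of_int (int N div m) \<le> real N / real_of_int m" using real_of_int_div4[of "int N" m] by simp
          also have "\<dots> \<le> real N / real M" using m M1 by (intro divide_left_mono) auto
          finally show "real_of_int (int N div m) \<le> real N / real M" .
        qed (use b in auto)
        finally show "norm (\<Sum>n\<in>{1..int N div m}. \<alpha> m * \<beta> n * ?e m n) \<le> b * (real N / real M)" .
      qed
      also have "\<dots> = b * real N * 1" using M1 by simp
      also have "\<dots> \<le> b * real N * (C * Q powr - \<gamma>)"
      proof (rule mult_left_mono)
        have "Q powr \<gamma> \<le> 4" using Qm[OF \<gamma>(3)] False by linarith
        hence "Q powr \<gamma> * Q powr - \<gamma> \<le> C * Q powr - \<gamma>" using C0 by (intro mult_right_mono) (auto simp: C_def)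
        thus "1 \<le> C * Q powr - \<gamma>" using Q by (simp add: powr_add[symmetric])
      qed (use b in auto)
      finally show ?thesis by (simp add: mult_ac)
    next
      case True
      define X1 where "X1 = min (Q powr (1 / 2)) (real M * Q powr - \<rho>)"
      define X2 where "X2 = min (Q powr (1 / 2)) (real N / real M * Q powr - \<rho>)"
      define L1 where "L1 = nat \<lfloor>X1\<rfloor>"
      define L2 where "L2 = nat \<lfloor>X2\<rfloor>"
      have sqrtQ: "sqrt (real q) = Q powr (1 / 2)" using Q by (simp add: Q_def powr_half_sqrt)
      have MQ: "Q powr \<epsilon> \<le> real M" "Q powr \<epsilon> \<le> real N / real M" using M M1 by (auto simp: Q_def le_divide_eq mult.commute)
      have MQ': "Q powr (3 * \<rho>) \<le> x * Q powr - \<rho>" if "Q powr \<epsilon> \<le> x" for x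
      proof -
        have "Q powr (3 * \<rho>) \<le> Q powr (\<epsilon> + - \<rho>)" using \<rho> by (intro Qm) auto
        also have "\<dots> = Q powr \<epsilon> * Q powr - \<rho>" by (rule powr_add)
        also have "\<dots> \<le> x * Q powr - \<rho>" using that by (intro mult_right_mono) auto
        finally show ?thesis .
      qed
      have X: "X1 \<ge> 1" "X2 \<ge> 1"
        using MQ'[OF MQ(1)] MQ'[OF MQ(2)] Q1[of "1 / 2"] Q1[of "3 * \<rho>"] \<rho> unfolding X1_def X2_def by auto
      have LX: "real L1 \<le> X1" "real L2 \<le> X2" "X1 \<le> 2 * real L1" "X2 \<le> 2 * real L2" "L1 \<ge> 1" "L2 \<ge> 1"
      proof -
        have "real L1 = real_of_int \<lfloor>X1\<rfloor>" "real L2 = real_of_int \<lfloor>X2\<rfloor>"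
          using X by (simp_all add: L1_def L2_def)
        moreover have "1 \<le> \<lfloor>X1\<rfloor>" "1 \<le> \<lfloor>X2\<rfloor>" using X by (simp_all add: le_floor_iff)
        ultimately show "real L1 \<le> X1" "real L2 \<le> X2" "X1 \<le> 2 * real L1" "X2 \<le> 2 * real L2" "L1 \<ge> 1" "L2 \<ge> 1"
          by linarith+
      qed
      \<comment> \<open>One inequality for each way the two minima can fall: both q^(1/2), one of
        each kind, or both short, where N \<ge> q^(1/2 + \<kappa>) is needed.\<close>
      have low: "Q powr (1 / 2 + 2 * \<rho>) \<le> X1 * X2"
      proof -
        have half: "Q powr (1 / 2 + 3 * \<rho>) = Q powr (1 / 2) * Q powr (3 * \<rho>)" by (rule powr_add)
        have c1: "Q powr (1 / 2 + 2 * \<rho>) \<le> Q powr (1 / 2) * Q powr (1 / 2)"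
          unfolding powr_add[symmetric] using \<rho> by (intro Qm) auto
        have c2: "Q powr (1 / 2 + 2 * \<rho>) \<le> Q powr (1 / 2) * (x * Q powr - \<rho>)" if "Q powr \<epsilon> \<le> x" for x
        proof -
          have "Q powr (1 / 2 + 2 * \<rho>) \<le> Q powr (1 / 2 + 3 * \<rho>)" using \<rho> by (intro Qm) auto
          also have "\<dots> \<le> Q powr (1 / 2) * (x * Q powr - \<rho>)"
            unfolding half by (intro mult_left_mono MQ' that) auto
          finally show ?thesis .
        qed
        have c3: "Q powr (1 / 2 + 2 * \<rho>) \<le> (real M * Q powr - \<rho>) * (real N / real M * Q powr - \<rho>)"
        proof -
          have "Q powr (1 / 2 + 2 * \<rho>) \<le> Q powr ((1 / 2 + \<kappa>) + (- \<rho> + - \<rho>))" using \<rho> by (intro Qm) auto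
          also have "\<dots> = Q powr (1 / 2 + \<kappa>) * (Q powr - \<rho> * Q powr - \<rho>)" by (simp only: powr_add)
          also have "\<dots> \<le> real N * (Q powr - \<rho> * Q powr - \<rho>)" using N by (intro mult_right_mono) (auto simp: Q_def)
          also have "\<dots> = (real M * Q powr - \<rho>) * (real N / real M * Q powr - \<rho>)" using M1 by simp
          finally show ?thesis .
        qed
        have c4: "Q powr (1 / 2 + 2 * \<rho>) \<le> (real M * Q powr - \<rho>) * Q powr (1 / 2)"
          using c2[OF MQ(1)] by (simp only: mult.commute)
        show ?thesis unfolding X1_def X2_def min_def
          by (cases "Q powr (1 / 2) \<le> real M * Q powr - \<rho>"; cases "Q powr (1 / 2) \<le> real N / real M * Q powr - \<rho>")
            (simp_all only: if_True if_False c1 c2[OF MQ(2)] c3 c4)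
      qed
      have L12: "Q powr (1 / 2 + \<rho>) \<le> real L1 * real L2"
      proof -
        have "4 * Q powr (1 / 2 + \<rho>) \<le> Q powr \<rho> * Q powr (1 / 2 + \<rho>)" using True by (intro mult_right_mono) auto
        also have "\<dots> = Q powr (1 / 2 + 2 * \<rho>)" unfolding powr_add[symmetric] by (rule arg_cong[where f = "\<lambda>x. Q powr x"]) simp
        also have "\<dots> \<le> X1 * X2" by (rule low)
        also have "\<dots> \<le> (2 * real L1) * (2 * real L2)" using LX X by (intro mult_mono) auto
        finally show ?thesis by simp
      qed
      define E where "E = C0 * (real L1 * real L2) * Q powr - \<gamma>0"
      have \<rho>1: "Q powr - \<rho> \<le> 1" using Qm[of "- \<rho>" 0] \<rho> Q by simp
      have L1M: "real L1 \<le> real M * Q powr - \<rho>" using LX(1) by (simp add: X1_def)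
      have "norm ?T \<le> b * (4 * (real N / (real L1 * real L2)) * E + real N * real L1 / real M + real M)"
      proof (rule bilinear_hyperbola_blocks)
        have "real M * Q powr - \<rho> \<le> real M * 1" using \<rho>1 by (intro mult_left_mono) auto
        thus "L1 \<le> M" using L1M by simp
        have "real N / real M * Q powr - \<rho> \<le> real N / real M * 1" using \<rho>1 by (intro mult_left_mono) auto
        hence "real L2 \<le> real N / real M" using LX(2) by (simp add: X2_def)
        hence "real L2 * real M \<le> real N" using M1 by (simp add: le_divide_eq)
        thus "L2 * M \<le> N" by (metis of_nat_le_iff of_nat_mult)
        show "1 \<le> L1" "1 \<le> L2" by (rule LX)+
        fix s1 s2 :: int and \<alpha>' \<beta>' :: "int \<Rightarrow> complex"
        assume "\<forall>m. norm (\<alpha>' m) \<le> 1" "\<forall>n. norm (\<beta>' n) \<le> 1"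
        thus "norm (\<Sum>m\<in>{s1..<s1 + int L1}. \<Sum>n\<in>{s2..<s2 + int L2}. \<alpha>' m * \<beta>' n * ?e m n) \<le> E"
          unfolding E_def Q_def using LX L12 unfolding X1_def X2_def
          by (intro BS q q3 h) (auto simp: sqrtQ Q_def)
      qed (use \<alpha> \<beta> b in auto)
      also have "\<dots> \<le> b * (4 * C0 * real N * Q powr - \<gamma> + real N * Q powr - \<gamma> + real N * Q powr - \<gamma>)"
      proof (intro mult_left_mono add_mono)
        have "4 * (real N / (real L1 * real L2)) * E = 4 * C0 * real N * Q powr - \<gamma>0"
          using LX(5,6) by (simp add: E_def)
        also have "\<dots> \<le> 4 * C0 * real N * Q powr - \<gamma>" using C0 \<gamma> by (intro mult_left_mono Qm) auto
        finally show "4 * (real N / (real L1 * real L2)) * E \<le> 4 * C0 * real N * Q powr - \<gamma>" .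
        have \<rho>\<gamma>: "Q powr - \<rho> \<le> Q powr - \<gamma>" using \<gamma> by (intro Qm) auto
        have "real N * real L1 / real M = real N * (real L1 / real M)" by simp
        also have "\<dots> \<le> real N * Q powr - \<rho>" using L1M M1 by (intro mult_left_mono) (auto simp: divide_le_eq mult.commute)
        also have "\<dots> \<le> real N * Q powr - \<gamma>" using \<rho>\<gamma> by (intro mult_left_mono) auto
        finally show "real N * real L1 / real M \<le> real N * Q powr - \<gamma>" .
        have "real M = real M * Q powr \<epsilon> * Q powr - \<epsilon>" using Q by (simp add: powr_minus)
        also have "\<dots> \<le> real N * Q powr - \<epsilon>" using M(2) by (intro mult_right_mono) (auto simp: Q_def)
        also have "\<dots> \<le> real N * Q powr - \<gamma>" using \<gamma> \<rho> by (intro mult_left_mono Qm) auto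
        finally show "real M \<le> real N * Q powr - \<gamma>" .
      qed (use b in auto)
      also have "\<dots> = b * real N * Q powr - \<gamma> * (4 * C0 + 2)" by (simp add: algebra_simps)
      also have "\<dots> \<le> b * real N * Q powr - \<gamma> * C" using b by (intro mult_left_mono) (auto simp: C_def)
      finally show ?thesis by (simp add: mult_ac)
    qed
    thus "norm ?T \<le> C * b * real N * real q powr - \<gamma>" by (simp only: Q_def)
  qed
qed

section \<open>Moebius sums twisted by inverse squares\<close>

lemma sum_nat_to_int: "(\<Sum>d\<in>{k<..n}. G (int d)) = (\<Sum>d\<in>{int k<..int n}. G d)"
  by (rule sum.reindex_bij_witness[of _ nat int]) auto

lemma sum_nat_to_int1: "(\<Sum>d\<in>{1..n}. G (int d)) = (\<Sum>d\<in>{1..int n}. G d)"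
  by (rule sum.reindex_bij_witness[of _ nat int]) auto

lemma sum_dyadic:
  fixes T :: "int \<Rightarrow> 'a::comm_monoid_add"
  shows "(\<Sum>m\<in>{int z<..int (z * 2 ^ I)}. T m) = (\<Sum>i<I. \<Sum>m\<in>{int (z * 2 ^ i)<..2 * int (z * 2 ^ i)}. T m)"
proof (induction I)
  case (Suc I)
  have "z * 1 \<le> z * 2 ^ I" by (intro mult_left_mono) auto
  hence "int z \<le> int (z * 2 ^ I)" by (simp only: of_nat_le_iff mult_1_right)
  hence "{int z<..int (z * 2 ^ Suc I)} = {int z<..int (z * 2 ^ I)} \<union> {int (z * 2 ^ I)<..2 * int (z * 2 ^ I)}"
    by auto
  hence "(\<Sum>m\<in>{int z<..int (z * 2 ^ Suc I)}. T m) =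
      (\<Sum>m\<in>{int z<..int (z * 2 ^ I)}. T m) + (\<Sum>m\<in>{int (z * 2 ^ I)<..2 * int (z * 2 ^ I)}. T m)"
    by (simp only:) (rule sum.union_disjoint, auto)
  thus ?case using Suc.IH by simp
qed auto

text \<open>The innermost variable has no weight. As z < q, both b and c are invertible, so the
  frequency h / (b c)^2 is nonzero modulo q and completion applies.\<close>

lemma sum_two_block_bound:
  assumes q: "prime q" and q3: "q \<ge> 3" and h: "\<not> int q dvd h" and z: "z < q"
  shows "norm (\<Sum>b\<in>{1..z}. \<Sum>c\<in>{1..z}. complex_of_int (moebius b) * complex_of_int (moebius c) *
      (\<Sum>d\<in>{1..N div b div c}. ee q (h * invsq q (int (b * (c * d)))))) \<le>
    real z * (real z * (8 * sqrt (real q) * (1 + ln (real q) + real N / real q)))" (is "_ \<le> real z * (real z * ?B)")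
proof -
  have B0: "0 \<le> ?B" using q3 by simp
  have block: "norm (complex_of_int (moebius b) * complex_of_int (moebius c) *
      (\<Sum>d\<in>{1..N div b div c}. ee q (h * invsq q (int (b * (c * d)))))) \<le> ?B"
    if b: "b \<in> {1..z}" and c: "c \<in> {1..z}" for b c
  proof -
    define n where "n = N div b div c"
    have "\<not> int q dvd int b" "\<not> int q dvd int c" using b c z by (auto dest!: dvd_imp_le)
    hence "\<not> int q dvd (h * invsq q (int b) * invsq q (int c))"
      using h q by (simp add: prime_dvd_mult_iff dvd_invsq_iff[OF q q3])
    hence "norm (\<Sum>d\<in>{1..<1 + int n}. ee q ((h * invsq q (int b) * invsq q (int c)) * invsq q d))
        \<le> 8 * sqrt (real q) * (1 + ln (real q) + real n / real q)"
      by (rule incomplete_sum_bound[OF q q3])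
    also have "{1..<1 + int n} = {1..int n}" by auto
    also have "(\<Sum>d\<in>{1..int n}. ee q ((h * invsq q (int b) * invsq q (int c)) * invsq q d)) =
        (\<Sum>d\<in>{1..n}. ee q (h * invsq q (int (b * (c * d)))))"
      unfolding sum_nat_to_int1[symmetric] by (simp add: invsq_mult[OF q q3] mult.assoc)
    also have "8 * sqrt (real q) * (1 + ln (real q) + real n / real q) \<le> ?B"
      using q3 by (intro mult_left_mono add_left_mono divide_right_mono) (auto simp: n_def intro: order_trans[OF div_le_dividend])
    finally have s: "norm (\<Sum>d\<in>{1..n}. ee q (h * invsq q (int (b * (c * d))))) \<le> ?B" .
    have m: "norm (complex_of_int (moebius b) * complex_of_int (moebius c)) \<le> 1 * 1"
      unfolding norm_mult norm_of_int using abs_moebius_le[of b] abs_moebius_le[of c]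
      by (intro mult_mono) (simp_all only: of_int_le_1_iff of_int_abs[symmetric] abs_ge_zero zero_le_one)
    show ?thesis unfolding norm_mult[of "complex_of_int (moebius b) * complex_of_int (moebius c)"] n_def[symmetric]
      using mult_mono[OF m s] by simp
  qed
  have "norm (\<Sum>b\<in>{1..z}. \<Sum>c\<in>{1..z}. complex_of_int (moebius b) * complex_of_int (moebius c) *
      (\<Sum>d\<in>{1..N div b div c}. ee q (h * invsq q (int (b * (c * d)))))) \<le> (\<Sum>b\<in>{1..z}. \<Sum>c\<in>{1..z}. ?B)"
    by (intro order_trans[OF norm_sum] sum_mono block)
  thus ?thesis by simp
qed

text \<open>Vaughan's identity with z about q^(\<kappa>/8): the short sum is trivial, the part with
  b, c \<le> z is completed, and the rest is split dyadically. The upper bound q^K on N ensures that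
  divisor counts and logarithms of N cost only small powers of q.\<close>

lemma moebius_exp_sum:
  fixes \<kappa> K :: real
  assumes \<kappa>: "0 < \<kappa>" "\<kappa> \<le> 1 / 2" and K: "K \<ge> 1"
  shows "\<exists>\<gamma>>0. \<exists>C>0. \<forall>q (h::int) N. prime q \<longrightarrow> q \<ge> 3 \<longrightarrow> \<not> int q dvd h \<longrightarrow>
    real q powr (1 / 2 + \<kappa>) \<le> real N \<longrightarrow> real N \<le> real q powr K \<longrightarrow>
    norm (\<Sum>d\<in>{d\<in>{1..int N}. \<not> int q dvd d}. complex_of_int (moebius (nat d)) * ee q (h * invsq q d))
      \<le> C * real N * real q powr - \<gamma>"
proof -
  \<comment> \<open>The completed part costs about z^2 q^(1/2) log q \<le> q^(1/2 + 3 \<epsilon>),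
    up to a constant, which stays below N q^(-\<gamma>) for this \<epsilon>.\<close>
  define \<epsilon> where "\<epsilon> = \<kappa> / 8"
  have \<epsilon>: "0 < \<epsilon>" "\<epsilon> \<le> 1 / 2" using \<kappa> by (auto simp: \<epsilon>_def)
  obtain \<gamma>2 C2 where \<gamma>2: "\<gamma>2 > 0" and C2: "C2 > 0" and BD: "\<And>q h N M \<alpha> \<beta> b.
    prime q \<Longrightarrow> q \<ge> 3 \<Longrightarrow> \<not> int q dvd h \<Longrightarrow> real q powr (1 / 2 + \<kappa>) \<le> real N \<Longrightarrow>
    real q powr \<epsilon> \<le> real M \<Longrightarrow> real M * real q powr \<epsilon> \<le> real N \<Longrightarrow>
    (\<forall>m. norm (\<alpha> m) \<le> 1) \<Longrightarrow> (\<forall>n. norm (\<beta> n) \<le> b) \<Longrightarrow> b > 0 \<Longrightarrow>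
    norm (\<Sum>m\<in>{int M<..2 * int M}. \<Sum>n\<in>{1..int N div m}. \<alpha> m * \<beta> n * ee q (h * (invsq q m * invsq q n)))
      \<le> C2 * b * real N * real q powr - \<gamma>2"
    using bilinear_dyadic[OF \<kappa> \<epsilon>] by force
  \<comment> \<open>This exponent turns N \<le> q^K into a loss of q^(\<gamma>2/4). The number of
    dyadic blocks loses as much again, so half of \<gamma>2 remains.\<close>
  obtain Cd where Cd: "Cd > 0" and DB: "\<And>n. n > 0 \<Longrightarrow> real (card {d. d dvd (n::nat)}) \<le> Cd * real n powr (\<gamma>2 / (4 * K))"
    using divisor_bound[of "\<gamma>2 / (4 * K)"] \<gamma>2 K by auto
  define \<gamma> where "\<gamma> = min (\<gamma>2 / 2) (\<kappa> / 2)"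
  define C3 where "C3 = 2 * K * (1 + 4 / \<gamma>2) * C2 * Cd"
  define C where "C = 4 + 4 + 32 * (1 + 1 / \<epsilon>) + 32 + C3 + 1"
  have \<gamma>: "\<gamma> > 0" "\<gamma> \<le> \<gamma>2 / 2" "\<gamma> \<le> \<kappa> / 2" using \<gamma>2 \<kappa> by (auto simp: \<gamma>_def)
  have C3: "C3 > 0" using K \<gamma>2 C2 Cd by (simp add: C3_def add_pos_pos)
  have C4: "C \<ge> 4" using C3 \<epsilon> by (simp add: C_def)
  hence C: "C > 0" by linarith
  show ?thesis
  proof (rule exI[of _ \<gamma>], rule conjI[OF \<gamma>(1)], rule exI[of _ C], rule conjI[OF C], intro allI impI)
    fix q N :: nat and h :: int
    assume q: "prime q" and q3: "q \<ge> 3" and h: "\<not> int q dvd h" and N1: "real q powr (1 / 2 + \<kappa>) \<le> real N"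
      and N2: "real N \<le> real q powr K"
    define Q where "Q = real q"
    have Q: "Q \<ge> 3" using q3 by (simp add: Q_def)
    have Q1: "1 \<le> Q powr x" if "x \<ge> 0" for x using Q that by (simp add: ge_one_powr_ge_zero)
    have Qm: "Q powr x \<le> Q powr y" if "x \<le> y" for x y using Q that by (intro powr_mono) auto
    have NQ: "Q powr (1 / 2 + \<kappa>) \<le> real N" "real N \<le> Q powr K" using N1 N2 by (auto simp: Q_def)
    have N0: "real N \<ge> 1" using NQ(1) Q1[of "1 / 2 + \<kappa>"] \<kappa> by linarith
    have NQs: "Q powr x \<le> real N * Q powr - \<gamma>" if "x \<le> 1 / 2 + \<kappa> - \<gamma>" for x
    proof -
      have "Q powr x \<le> Q powr (1 / 2 + \<kappa> + - \<gamma>)" using that by (intro Qm) auto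
      also have "\<dots> = Q powr (1 / 2 + \<kappa>) * Q powr - \<gamma>" by (rule powr_add)
      also have "\<dots> \<le> real N * Q powr - \<gamma>" using NQ by (intro mult_right_mono) auto
      finally show ?thesis .
    qed
    define \<mu> where "\<mu> = (\<lambda>n. complex_of_int (moebius n))"
    have \<mu>1: "norm (\<mu> n) \<le> 1" for n
      unfolding \<mu>_def norm_of_int using abs_moebius_le[of n] by (simp only: of_int_le_1_iff of_int_abs[symmetric])
    define F where "F = (\<lambda>d. ee q (h * invsq q (int d)))"
    let ?S = "\<Sum>d\<in>{d\<in>{1..int N}. \<not> int q dvd d}. complex_of_int (moebius (nat d)) * ee q (h * invsq q d)"
    have term1: "norm (complex_of_int (moebius (nat d)) * ee q (h * invsq q d)) \<le> 1" for d
      using \<mu>1[of "nat d"] by (simp add: norm_mult \<mu>_def)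
    have "norm ?S \<le> C * real N * Q powr - \<gamma>"
    proof (cases "q < 5")
      case True
      have "norm ?S \<le> (\<Sum>d\<in>{d\<in>{1..int N}. \<not> int q dvd d}. 1)"
        by (rule order_trans[OF norm_sum], rule sum_mono, rule term1)
      also have "\<dots> \<le> (\<Sum>d\<in>{1..int N}. 1)" by (intro sum_mono2) auto
      also have "\<dots> = real N * 1" by simp
      also have "\<dots> \<le> real N * (C * Q powr - \<gamma>)"
      proof (rule mult_left_mono)
        have "Q powr \<gamma> \<le> Q powr 1" using \<gamma> \<kappa> by (intro Qm) auto
        also have "\<dots> \<le> C" using True C4 Q by (simp add: Q_def)
        finally have "Q powr \<gamma> * Q powr - \<gamma> \<le> C * Q powr - \<gamma>" by (intro mult_right_mono) auto
        thus "1 \<le> C * Q powr - \<gamma>" using Q by (simp add: powr_add[symmetric])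
      qed auto
      finally show ?thesis by (simp add: mult_ac)
    next
      case False
      hence Q5: "Q \<ge> 5" by (simp add: Q_def)
      define z where "z = nat \<lceil>Q powr \<epsilon>\<rceil>"
      have z1: "Q powr \<epsilon> \<le> real z" unfolding z_def by linarith
      have z2: "real z \<le> 2 * Q powr \<epsilon>" using Q1[of \<epsilon>] \<epsilon> unfolding z_def by linarith
      have zpos: "z \<ge> 1" using z1 Q1[of \<epsilon>] \<epsilon> by linarith
      have half: "2 \<le> Q powr (1 / 2)"
      proof -
        have "sqrt 4 \<le> sqrt Q" using Q5 by (intro real_sqrt_le_mono) auto
        thus ?thesis using Q by (simp add: powr_half_sqrt)
      qed
      have z3: "real z \<le> Q powr (1 / 2 + \<epsilon>)"
        unfolding powr_add using half z2 mult_right_mono[OF half, of "Q powr \<epsilon>"] by simp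
      have "Q powr (1 / 2 + \<epsilon>) \<le> Q powr (1 / 2 + \<kappa>)" using \<kappa> by (intro Qm) (auto simp: \<epsilon>_def)
      hence zN: "z \<le> N" using z3 NQ(1) by linarith
      have "Q powr (1 / 2 + \<epsilon>) < Q powr 1" using \<kappa> Q by (intro powr_less_mono) (auto simp: \<epsilon>_def)
      hence zq: "z < q" using z3 Q by (simp add: Q_def)
      define V1 where "V1 = (\<Sum>n\<in>{1..z}. \<mu> n * F n)"
      define V2 where "V2 = (\<Sum>b\<in>{1..z}. \<Sum>c\<in>{1..z}. \<mu> b * \<mu> c * (\<Sum>d\<in>{1..N div b div c}. F (b * (c * d))))"
      define V3 where "V3 = (\<Sum>b\<in>{z<..N}. \<Sum>n\<in>{1..N div b}. \<mu> b * (\<Sum>c | c dvd n \<and> z < c. \<mu> c) * F (b * n))"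
      have vaughan: "(\<Sum>n\<in>{1..N}. \<mu> n * F n) = 2 * V1 - V2 + V3"
        unfolding V1_def V2_def V3_def \<mu>_def by (rule vaughan_identity[OF zN])
      have "norm V1 \<le> (\<Sum>n\<in>{1..z}. 1)"
        unfolding V1_def by (rule order_trans[OF norm_sum], rule sum_mono) (simp add: norm_mult \<mu>1 F_def)
      also have "\<dots> = real z" by simp
      also have "\<dots> \<le> 2 * Q powr \<epsilon>" by (rule z2)
      also have "\<dots> \<le> 2 * (real N * Q powr - \<gamma>)" using \<gamma> \<kappa> by (intro mult_left_mono NQs) (auto simp: \<epsilon>_def)
      finally have V1: "norm V1 \<le> 2 * (real N * Q powr - \<gamma>)" .
      have V2: "norm V2 \<le> (32 * (1 + 1 / \<epsilon>) + 32) * (real N * Q powr - \<gamma>)"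
      proof -
        have "norm V2 \<le> real z * (real z * (8 * sqrt (real q) * (1 + ln (real q) + real N / real q)))"
          unfolding V2_def F_def \<mu>_def by (rule sum_two_block_bound[OF q q3 h zq])
        also have "\<dots> \<le> (2 * Q powr \<epsilon>) * ((2 * Q powr \<epsilon>) * (8 * Q powr (1 / 2) * ((1 + 1 / \<epsilon>) * Q powr \<epsilon> + real N / Q)))"
        proof -
          define W where "W = 8 * sqrt (real q) * (1 + ln (real q) + real N / real q)"
          have W: "0 \<le> W" using q3 by (simp add: W_def)
          have "W \<le> 8 * Q powr (1 / 2) * ((1 + 1 / \<epsilon>) * Q powr \<epsilon> + real N / Q)"
            using ln_le_powr[of Q \<epsilon>] \<epsilon> Q by (simp add: W_def Q_def powr_half_sqrt)
          thus ?thesis unfolding W_def[symmetric] using z2 W by (intro mult_mono) auto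
        qed
        also have "\<dots> = 32 * (1 + 1 / \<epsilon>) * (Q powr \<epsilon> * Q powr \<epsilon> * Q powr (1 / 2) * Q powr \<epsilon>) +
            32 * (real N * (Q powr \<epsilon> * Q powr \<epsilon> * Q powr (1 / 2) * Q powr (- 1)))"
        proof -
          have alg: "(2 * e) * ((2 * e) * (8 * s * (c * e + n * i))) = 32 * c * (e * e * s * e) + 32 * (n * (e * e * s * i))"
            for c e s n i :: real by (simp add: algebra_simps)
          have "real N / Q = real N * Q powr (- 1)" using Q by (simp add: powr_minus divide_inverse)
          thus ?thesis by (simp only: alg)
        qed
        also have "\<dots> \<le> 32 * (1 + 1 / \<epsilon>) * (real N * Q powr - \<gamma>) + 32 * (real N * Q powr - \<gamma>)"
          unfolding powr_add[symmetric] using \<epsilon> \<gamma> \<kappa>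
          by (intro add_mono mult_left_mono NQs Qm) (auto simp: \<epsilon>_def)
        finally show ?thesis by (simp add: algebra_simps)
      qed
      have V3: "norm V3 \<le> C3 * (real N * Q powr - \<gamma>)"
      proof -
        define b where "b = Cd * Q powr (\<gamma>2 / 4)"
        define \<alpha> where "\<alpha> = (\<lambda>m. \<mu> (nat m))"
        \<comment> \<open>Cut off at N because the bilinear estimate asks for one bound valid at all
          n, while the divisor sum itself is unbounded.\<close>
        define \<beta> where "\<beta> = (\<lambda>n. if n \<in> {1..int N} then (\<Sum>c | c dvd nat n \<and> z < c. \<mu> c) else 0)"
        define T where "T = (\<lambda>m. \<Sum>n\<in>{1..int N div m}. \<alpha> m * \<beta> n * ee q (h * (invsq q m * invsq q n)))"
        have b0: "b > 0" using Cd Q by (simp add: b_def)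
        have \<beta>b: "norm (\<beta> n) \<le> b" for n
        proof (cases "n \<in> {1..int N}")
          case False
          hence "\<beta> n = 0" by (simp only: \<beta>_def if_False)
          thus ?thesis using b0 by simp
        next
          case True
          have fin: "finite {c. c dvd nat n}" using True by simp
          have "norm (\<Sum>c | c dvd nat n \<and> z < c. \<mu> c) \<le> (\<Sum>c | c dvd nat n \<and> z < c. 1)"
            by (rule order_trans[OF norm_sum], rule sum_mono, rule \<mu>1)
          also have "\<dots> \<le> (\<Sum>c | c dvd nat n. 1)" using fin by (intro sum_mono2) auto
          also have "\<dots> = real (card {c. c dvd nat n})" by simp
          also have "\<dots> \<le> Cd * real (nat n) powr (\<gamma>2 / (4 * K))" using True by (intro DB) auto
          also have "\<dots> \<le> Cd * (Q powr K) powr (\<gamma>2 / (4 * K))"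
            using True Cd NQ(2) \<gamma>2 K by (intro mult_left_mono powr_mono2) auto
          also have "\<dots> = b" using K by (simp add: b_def powr_powr)
          finally show ?thesis using True by (simp add: \<beta>_def)
        qed
        \<comment> \<open>No divisor of n \<le> z exceeds z. Hence blocks with N < z M vanish, which
          confines the remaining ones to the range of M where the bilinear estimate applies.\<close>
        have \<beta>0: "\<beta> n = 0" if "n \<le> int z" for n
        proof (cases "n \<ge> 1")
          case True
          have "{c. c dvd nat n \<and> z < c} = {}"
          proof -
            have "c \<le> z" if "c dvd nat n" for c
              using dvd_imp_le[OF that] True \<open>n \<le> int z\<close> by linarith
            thus ?thesis by force
          qed
          thus ?thesis unfolding \<beta>_def by (simp only: sum.empty if_cancel)
        qed (simp add: \<beta>_def)
        define I where "I = nat \<lceil>log 2 (real N)\<rceil>"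
        have I1: "N \<le> 2 ^ I"
        proof -
          have "real N = 2 powr log 2 (real N)" using N0 by simp
          also have "\<dots> \<le> 2 powr real I" unfolding I_def by (rule powr_mono) linarith+
          also have "\<dots> = real (2 ^ I)" by (simp add: powr_realpow)
          finally show ?thesis by (simp only: of_nat_le_iff)
        qed
        have I2: "real I \<le> 2 * K * (1 + 4 / \<gamma>2) * Q powr (\<gamma>2 / 4)"
        proof -
          have l2: "ln 2 \<ge> (1 / 2 :: real)" using ln2_ge_two_thirds by linarith
          have lnN: "0 \<le> ln (real N)" using N0 by simp
          have "log 2 (real N) = ln (real N) / ln 2" by (simp add: log_def)
          also have "\<dots> \<le> ln (real N) / (1 / 2)" using l2 lnN by (intro divide_left_mono) auto
          finally have "log 2 (real N) \<le> 2 * ln (real N)" by simp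
          moreover have "ln (real N) \<le> ln (Q powr K)" using NQ(2) N0 Q by (subst ln_le_cancel_iff) auto
          hence "ln (real N) \<le> K * ln Q" using Q by (simp add: ln_powr)
          moreover have "real I \<le> log 2 (real N) + 1"
            using lnN unfolding I_def log_def by (simp add: zero_le_divide_iff)
          ultimately have "real I \<le> 2 * (K * ln Q) + 1" by linarith
          also have "\<dots> \<le> 2 * K * (1 + ln Q)" using K by (simp add: algebra_simps)
          also have "\<dots> \<le> 2 * K * ((1 + 1 / (\<gamma>2 / 4)) * Q powr (\<gamma>2 / 4))"
            using K \<gamma>2 Q by (intro mult_left_mono ln_le_powr) auto
          finally show ?thesis by simp
        qed
        have "V3 = (\<Sum>m\<in>{z<..N}. T (int m))"
          unfolding V3_def
        proof (rule sum.cong[OF refl])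
          fix m assume m: "m \<in> {z<..N}"
          have "(\<Sum>n\<in>{1..N div m}. \<mu> m * (\<Sum>c | c dvd n \<and> z < c. \<mu> c) * F (m * n)) =
              (\<Sum>n\<in>{1..N div m}. \<alpha> (int m) * \<beta> (int n) * ee q (h * (invsq q (int m) * invsq q (int n))))"
          proof (rule sum.cong[OF refl])
            fix n assume "n \<in> {1..N div m}"
            hence "1 \<le> n" "n \<le> N div m" by auto
            hence "1 \<le> n" "n \<le> N" using div_le_dividend[of N m] by linarith+
            thus "\<mu> m * (\<Sum>c | c dvd n \<and> z < c. \<mu> c) * F (m * n) =
                \<alpha> (int m) * \<beta> (int n) * ee q (h * (invsq q (int m) * invsq q (int n)))"
              by (simp add: \<alpha>_def \<beta>_def F_def invsq_mult[OF q q3])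
          qed
          also have "\<dots> = T (int m)" unfolding T_def sum_nat_to_int1[of "\<lambda>n. \<alpha> (int m) * \<beta> n * ee q (h * (invsq q (int m) * invsq q n))"]
            by (simp add: zdiv_int)
          finally show "(\<Sum>n\<in>{1..N div m}. \<mu> m * (\<Sum>c | c dvd n \<and> z < c. \<mu> c) * F (m * n)) = T (int m)" .
        qed
        also have "\<dots> = (\<Sum>m\<in>{int z<..int N}. T m)" by (rule sum_nat_to_int)
        also have "\<dots> = (\<Sum>m\<in>{int z<..int (z * 2 ^ I)}. T m)"
        proof (rule sum.mono_neutral_left)
          have "1 * 2 ^ I \<le> z * 2 ^ I" using zpos by (intro mult_right_mono) auto
          hence "int N \<le> int (z * 2 ^ I)" using I1 by (simp only: of_nat_le_iff)
          thus "{int z<..int N} \<subseteq> {int z<..int (z * 2 ^ I)}" by auto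
          show "\<forall>m\<in>{int z<..int (z * 2 ^ I)} - {int z<..int N}. T m = 0"
            by (auto simp: T_def)
        qed auto
        also have "\<dots> = (\<Sum>i<I. \<Sum>m\<in>{int (z * 2 ^ i)<..2 * int (z * 2 ^ i)}. T m)" by (rule sum_dyadic)
        finally have "norm V3 \<le> (\<Sum>i<I. norm (\<Sum>m\<in>{int (z * 2 ^ i)<..2 * int (z * 2 ^ i)}. T m))"
          by (simp only: norm_sum)
        also have "\<dots> \<le> (\<Sum>i<I. C2 * b * real N * Q powr - \<gamma>2)"
        proof (rule sum_mono)
          fix i
          define M where "M = z * 2 ^ i"
          have zM: "real z \<le> real M"
          proof -
            have "z * 1 \<le> z * 2 ^ i" by (intro mult_left_mono) auto
            thus ?thesis by (simp only: M_def of_nat_le_iff mult_1_right)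
          qed
          show "norm (\<Sum>m\<in>{int (z * 2 ^ i)<..2 * int (z * 2 ^ i)}. T m) \<le> C2 * b * real N * Q powr - \<gamma>2"
          proof (cases "real M * Q powr \<epsilon> \<le> real N")
            case True
            show ?thesis unfolding M_def[symmetric] T_def Q_def
              by (rule BD[OF q q3 h N1]) (use True z1 zM b0 \<beta>b \<mu>1 in \<open>auto simp: Q_def \<alpha>_def\<close>)
          next
            case False
            have "T m = 0" if m: "m \<in> {int M<..2 * int M}" for m
            proof -
              have "int N div m \<le> int z"
              proof -
                have "real N < real z * real M"
                  using False mult_left_mono[OF z1, of "real M"] by (simp add: mult.commute)
                hence "real_of_int (int N) < real_of_int (int z * int M)" by simp
                hence "int N < int z * int M" by (simp only: of_int_less_iff)
                also have "\<dots> \<le> int z * m" using m by (intro mult_left_mono) auto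
                finally have "int N div m \<le> (int z * m) div m" using m by (intro zdiv_mono1) auto
                thus ?thesis using m by simp
              qed
              thus ?thesis unfolding T_def by (intro sum.neutral) (auto simp: \<beta>0)
            qed
            hence "(\<Sum>m\<in>{int M<..2 * int M}. T m) = 0" by (intro sum.neutral) auto
            thus ?thesis unfolding M_def[symmetric] using C2 b0 by simp
          qed
        qed
        also have "\<dots> = real I * (C2 * b * real N * Q powr - \<gamma>2)" by simp
        also have "\<dots> \<le> (2 * K * (1 + 4 / \<gamma>2) * Q powr (\<gamma>2 / 4)) * (C2 * b * real N * Q powr - \<gamma>2)"
          using C2 b0 by (intro mult_right_mono I2) auto
        also have "\<dots> = C3 * (real N * (Q powr (\<gamma>2 / 4) * Q powr (\<gamma>2 / 4) * Q powr - \<gamma>2))"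
          by (simp add: C3_def b_def)
        also have "\<dots> \<le> C3 * (real N * Q powr - \<gamma>)"
          unfolding powr_add[symmetric] using C3 \<gamma> by (intro mult_left_mono Qm) auto
        finally show ?thesis .
      qed
      have full: "norm (\<Sum>d\<in>{1..int N}. complex_of_int (moebius (nat d)) * ee q (h * invsq q d)) \<le>
          (4 + 32 * (1 + 1 / \<epsilon>) + 32 + C3) * (real N * Q powr - \<gamma>)"
      proof -
        have "(\<Sum>d\<in>{1..int N}. complex_of_int (moebius (nat d)) * ee q (h * invsq q d)) = 2 * V1 - V2 + V3"
          unfolding vaughan[symmetric] sum_nat_to_int1[symmetric] by (simp add: \<mu>_def F_def)
        moreover have "norm (2 * V1 - V2 + V3) \<le> 2 * norm V1 + norm V2 + norm V3"
          using norm_triangle_ineq[of "2 * V1 - V2" V3] norm_triangle_ineq4[of "2 * V1" V2] by (simp add: norm_mult)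
        ultimately show ?thesis using V1 V2 V3 by (simp add: distrib_right)
      qed
      \<comment> \<open>Vaughan's identity runs over all d; the multiples of q, absent from the sum
        in question, are removed trivially.\<close>
      have mult_q: "norm (\<Sum>d\<in>{d\<in>{1..int N}. int q dvd d}. complex_of_int (moebius (nat d)) * ee q (h * invsq q d)) \<le> 2 * (real N * Q powr - \<gamma>)"
      proof -
        have "norm (\<Sum>d\<in>{d\<in>{1..int N}. int q dvd d}. complex_of_int (moebius (nat d)) * ee q (h * invsq q d)) \<le>
            (\<Sum>d\<in>{d\<in>{1..int N}. int q dvd d}. 1)"
          by (rule order_trans[OF norm_sum], rule sum_mono, rule term1)
        also have "\<dots> = real (card {d\<in>{1..int N}. int q dvd d})" by simp
        also have "\<dots> \<le> real N / real q + 1"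
          by (rule card_residue_class_interval[of _ 1]) (use q3 in auto)
        also have "\<dots> \<le> real N * Q powr - \<gamma> + real N * Q powr - \<gamma>"
        proof (rule add_mono)
          have "real N / real q = real N * Q powr - 1" using Q by (simp add: Q_def powr_minus divide_inverse)
          also have "\<dots> \<le> real N * Q powr - \<gamma>" using \<gamma> \<kappa> by (intro mult_left_mono Qm) auto
          finally show "real N / real q \<le> real N * Q powr - \<gamma>" .
          show "1 \<le> real N * Q powr - \<gamma>" using NQs[of 0] \<gamma> \<kappa> Q by simp
        qed
        finally show ?thesis by simp
      qed
      have "{1..int N} = {d\<in>{1..int N}. \<not> int q dvd d} \<union> {d\<in>{1..int N}. int q dvd d}" by auto
      hence "(\<Sum>d\<in>{1..int N}. complex_of_int (moebius (nat d)) * ee q (h * invsq q d)) = ?S +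
          (\<Sum>d\<in>{d\<in>{1..int N}. int q dvd d}. complex_of_int (moebius (nat d)) * ee q (h * invsq q d))"
        using sum.union_disjoint[of "{d\<in>{1..int N}. \<not> int q dvd d}" "{d\<in>{1..int N}. int q dvd d}"
            "\<lambda>d. complex_of_int (moebius (nat d)) * ee q (h * invsq q d)"]
        by (metis (no_types, lifting) Int_emptyI finite_Un finite_atLeastAtMost_int mem_Collect_eq)
      hence "?S = (\<Sum>d\<in>{1..int N}. complex_of_int (moebius (nat d)) * ee q (h * invsq q d)) -
          (\<Sum>d\<in>{d\<in>{1..int N}. int q dvd d}. complex_of_int (moebius (nat d)) * ee q (h * invsq q d))"
        by (simp only: add_diff_cancel_right')
      hence "norm ?S \<le> norm (\<Sum>d\<in>{1..int N}. complex_of_int (moebius (nat d)) * ee q (h * invsq q d)) +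
          norm (\<Sum>d\<in>{d\<in>{1..int N}. int q dvd d}. complex_of_int (moebius (nat d)) * ee q (h * invsq q d))"
        by (simp only: norm_triangle_ineq4)
      also have "\<dots> \<le> (4 + 32 * (1 + 1 / \<epsilon>) + 32 + C3) * (real N * Q powr - \<gamma>) + 2 * (real N * Q powr - \<gamma>)"
        by (intro add_mono full mult_q)
      also have "\<dots> = (4 + 32 * (1 + 1 / \<epsilon>) + 32 + C3 + 2) * (real N * Q powr - \<gamma>)" by (simp add: algebra_simps)
      also have "\<dots> \<le> C * (real N * Q powr - \<gamma>)" by (intro mult_right_mono) (auto simp: C_def)
      finally show ?thesis by (simp add: mult.assoc)
    qed
    thus "norm ?S \<le> C * real N * real q powr - \<gamma>" by (simp only: Q_def)
  qed
qed

section \<open>Squarefree numbers in residue classes\<close>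

lemma finite_int_interval_Collect [simp]:
  fixes k l :: int
  shows "finite {x. k \<le> x \<and> x < l \<and> P x}" "finite {x. k < x \<and> x \<le> l \<and> P x}"
  by (rule finite_subset[of _ "{k..l}"], auto)+

definition residue_disc :: "nat \<Rightarrow> int \<Rightarrow> nat \<Rightarrow> real" where
  "residue_disc q c Y = real (card {m\<in>{1..<1 + int Y}. [m = c] (mod int q)}) - real Y / real q"

lemma residue_disc_0 [simp]: "residue_disc q c 0 = 0"
  by (simp add: residue_disc_def)

lemma residue_disc_le:
  assumes q: "q > 0"
  shows "\<bar>residue_disc q c Y\<bar> \<le> 1"
proof -
  let ?S = "{m\<in>{1..<1 + int Y}. [m = c] (mod int q)}"
  have fin: "finite ?S" by simp
  have upper: "real (card ?S) \<le> real Y / real q + 1"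
  proof (rule card_residue_class_interval)
    show "?S \<subseteq> {1..<1 + int Y}" by auto
    fix x y assume "x \<in> ?S" "y \<in> ?S"
    hence "[x = y] (mod int q)" by (auto intro: cong_trans cong_sym)
    thus "int q dvd x - y" by (simp add: cong_iff_dvd_diff)
  qed (use q in auto)
  \<comment> \<open>The representative of c in 1..q, not in 0..q - 1: the interval counted starts at
    1, so c' + q t with t < \<open>Y div q\<close> stays inside it.\<close>
  define c' where "c' = (c - 1) mod int q + 1"
  have "(c - 1) mod int q < int q" "0 \<le> (c - 1) mod int q" using q by simp_all
  hence c': "1 \<le> c'" "c' \<le> int q" unfolding c'_def by linarith+
  have cc: "[c' = c] (mod int q)"
    unfolding unique_euclidean_semiring_class.cong_def c'_def by (simp add: mod_add_left_eq)
  have "(\<lambda>t. c' + int q * int t) ` {..<Y div q} \<subseteq> ?S"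
  proof
    fix m assume "m \<in> (\<lambda>t. c' + int q * int t) ` {..<Y div q}"
    then obtain t where t: "t < Y div q" "m = c' + int q * int t" by auto
    have "q * (t + 1) \<le> q * (Y div q)" using t(1) by (intro mult_left_mono) auto
    also have "\<dots> \<le> Y" by simp
    finally have "int q * (int t + 1) \<le> int Y" by (metis of_nat_1 of_nat_add of_nat_le_iff of_nat_mult)
    hence "m \<le> int Y" using c'(2) t(2) by (simp add: distrib_left)
    moreover have "1 \<le> m" using c'(1) t(2) by (simp add: add_increasing2)
    moreover have "[m = c] (mod int q)"
      using cc unfolding t(2) unique_euclidean_semiring_class.cong_def by simp
    ultimately show "m \<in> ?S" by simp
  qed
  hence "card ((\<lambda>t. c' + int q * int t) ` {..<Y div q}) \<le> card ?S" by (intro card_mono fin)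
  moreover have "card ((\<lambda>t. c' + int q * int t) ` {..<Y div q}) = Y div q"
    using q by (subst card_image) (auto simp: inj_on_def)
  ultimately have "real (Y div q) \<le> real (card ?S)" by simp
  moreover have "real Y / real q - 1 \<le> real (Y div q)"
    using real_of_int_div3[of "int Y" "int q"] by (simp add: zdiv_int[symmetric])
  ultimately show ?thesis using upper by (simp add: residue_disc_def abs_le_iff)
qed

lemma sum_moebius_square:
  fixes P :: "nat \<Rightarrow> bool"
  assumes R: "\<And>d. d\<^sup>2 \<le> N \<Longrightarrow> d \<le> R"
  shows "(\<Sum>n\<in>{n\<in>{1..N}. P n}. real_of_int ((moebius n)\<^sup>2)) =
    (\<Sum>d\<in>{1..R}. real_of_int (moebius d) * real (card {m\<in>{1..N div d\<^sup>2}. P (d\<^sup>2 * m)}))"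
proof -
  let ?N = "{n\<in>{1..N}. P n}"
  have "(\<Sum>n\<in>?N. real_of_int ((moebius n)\<^sup>2)) = (\<Sum>n\<in>?N. \<Sum>d\<in>{d\<in>{1..R}. d\<^sup>2 dvd n}. real_of_int (moebius d))"
  proof (rule sum.cong[OF refl])
    fix n assume n: "n \<in> ?N"
    hence n0: "n > 0" by auto
    have "{d. d\<^sup>2 dvd n} = {d\<in>{1..R}. d\<^sup>2 dvd n}"
    proof -
      have "1 \<le> d \<and> d \<le> R" if d: "d\<^sup>2 dvd n" for d
      proof
        show "1 \<le> d" using d n0 by (cases d) auto
        have "d\<^sup>2 \<le> n" using d n0 by (rule dvd_imp_le)
        thus "d \<le> R" using n by (intro R) auto
      qed
      thus ?thesis by auto
    qed
    thus "real_of_int ((moebius n)\<^sup>2) = (\<Sum>d\<in>{d\<in>{1..R}. d\<^sup>2 dvd n}. real_of_int (moebius d))"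
      using moebius_square_sum[OF n0] by simp
  qed
  also have "\<dots> = (\<Sum>d\<in>{1..R}. \<Sum>n\<in>{n\<in>?N. d\<^sup>2 dvd n}. real_of_int (moebius d))"
    by (rule sum.swap_restrict) auto
  also have "\<dots> = (\<Sum>d\<in>{1..R}. real_of_int (moebius d) * real (card {m\<in>{1..N div d\<^sup>2}. P (d\<^sup>2 * m)}))"
  proof (rule sum.cong[OF refl])
    fix d assume "d \<in> {1..R}"
    hence d: "d\<^sup>2 > 0" by auto
    have "{n\<in>?N. d\<^sup>2 dvd n} = (\<lambda>m. d\<^sup>2 * m) ` {m\<in>{1..N div d\<^sup>2}. P (d\<^sup>2 * m)}" (is "?A = ?B")
    proof
      show "?A \<subseteq> ?B"
      proof
        fix n assume n: "n \<in> ?A"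
        then obtain m where m: "n = d\<^sup>2 * m" by auto
        have "m \<ge> 1" using n m by (cases m) auto
        moreover have "m \<le> N div d\<^sup>2" using n m d by (auto simp: less_eq_div_iff_mult_less_eq mult.commute)
        ultimately show "n \<in> ?B" using n m by auto
      qed
      show "?B \<subseteq> ?A"
      proof
        fix n assume "n \<in> ?B"
        then obtain m where m: "n = d\<^sup>2 * m" "1 \<le> m" "m \<le> N div d\<^sup>2" "P (d\<^sup>2 * m)" by auto
        have "d\<^sup>2 * m \<le> N" using m(3) d by (simp add: less_eq_div_iff_mult_less_eq mult.commute)
        moreover have "d\<^sup>2 * m \<ge> 1" using m(2) d by (simp add: Suc_le_eq)
        ultimately show "n \<in> ?A" using m by simp
      qed
    qed
    moreover have "inj_on (\<lambda>m. d\<^sup>2 * m) {m\<in>{1..N div d\<^sup>2}. P (d\<^sup>2 * m)}" using d by (auto simp: inj_on_def)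
    ultimately have "card {n\<in>?N. d\<^sup>2 dvd n} = card {m\<in>{1..N div d\<^sup>2}. P (d\<^sup>2 * m)}" by (simp only: card_image)
    thus "(\<Sum>n\<in>{n\<in>?N. d\<^sup>2 dvd n}. real_of_int (moebius d)) =
        real_of_int (moebius d) * real (card {m\<in>{1..N div d\<^sup>2}. P (d\<^sup>2 * m)})"
      by (simp only: sum_constant mult.commute)
  qed
  finally show ?thesis .
qed

context
  fixes q :: nat and a :: int
  assumes q: "prime q" and q3: "q \<ge> 3" and a: "\<not> int q dvd a"
begin

text \<open>The d divisible by q contribute to neither sum of E. For any other d, dividing by d^2
  turns the congruence into m = a / d^2, and the mean over the reduced classes differs from Y / q by
  at most 2 / q.\<close>

lemma squarefree_error_eq_disc:
  fixes x :: real
  defines "N \<equiv> nat \<lfloor>x\<rfloor>"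
  assumes x: "x > 1" and R: "\<And>d. d\<^sup>2 \<le> N \<Longrightarrow> d \<le> R"
  shows "\<bar>squarefree_error x q a - (\<Sum>d\<in>{d\<in>{1..int R}. \<not> int q dvd d}.
      real_of_int (moebius (nat d)) * residue_disc q (a * invsq q d) (N div (nat d)\<^sup>2))\<bar> \<le> 2 * real R / real q"
proof -
  have q0: "q > 0" using q3 by simp
  have tot: "totient q = q - 1" using q by (simp add: totient_prime)
  have rq: "real (q - 1) = real q - 1" using q3 by simp
  have setN: "{n. n > 0 \<and> real n \<le> x \<and> P n} = {n\<in>{1..N}. P n}" for P
    using x by (auto simp: N_def le_nat_iff le_floor_iff)
  let ?\<mu> = "\<lambda>d. real_of_int (moebius d)"
  let ?Y = "\<lambda>d. N div d\<^sup>2"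
  let ?cA = "\<lambda>d. real (card {m\<in>{1..?Y d}. [int (d\<^sup>2 * m) = a] (mod int q)})"
  let ?cB = "\<lambda>d. real (card {m\<in>{1..?Y d}. coprime (d\<^sup>2 * m) q})"
  let ?I = "{d\<in>{1..R}. \<not> q dvd d}"
  have "squarefree_error x q a = (\<Sum>d\<in>{1..R}. ?\<mu> d * ?cA d) - 1 / (real q - 1) * (\<Sum>d\<in>{1..R}. ?\<mu> d * ?cB d)"
    unfolding squarefree_error_def setN tot rq by (subst (1 2) sum_moebius_square[OF R]) simp_all
  also have "\<dots> = (\<Sum>d\<in>{1..R}. ?\<mu> d * (?cA d - ?cB d / (real q - 1)))"
    by (simp add: sum_distrib_left sum_subtractf[symmetric] right_diff_distrib)
  also have "\<dots> = (\<Sum>d\<in>?I. ?\<mu> d * (?cA d - ?cB d / (real q - 1)))"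
  proof (rule sum.mono_neutral_right)
    show "\<forall>d\<in>{1..R} - ?I. ?\<mu> d * (?cA d - ?cB d / (real q - 1)) = 0"
    proof
      fix d assume d: "d \<in> {1..R} - ?I"
      hence qd: "q dvd d" by auto
      have dvd: "q dvd d\<^sup>2 * m" for m using qd by (simp add: power2_eq_square)
      have "\<not> [int (d\<^sup>2 * m) = a] (mod int q)" for m
        using dvd[of m] a cong_dvd_iff[of "int (d\<^sup>2 * m)" a "int q"] by (metis of_nat_dvd_iff)
      moreover have "\<not> coprime (d\<^sup>2 * m) q" for m
        using coprime_common_divisor[OF _ dvd[of m] dvd_refl] not_prime_unit q by blast
      ultimately have "{m\<in>{1..?Y d}. [int (d\<^sup>2 * m) = a] (mod int q)} = {}" "{m\<in>{1..?Y d}. coprime (d\<^sup>2 * m) q} = {}"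
        by blast+
      thus "?\<mu> d * (?cA d - ?cB d / (real q - 1)) = 0" by (simp only: card.empty) simp
    qed
  qed auto
  finally have E: "squarefree_error x q a = (\<Sum>d\<in>?I. ?\<mu> d * (?cA d - ?cB d / (real q - 1)))" .
  have "(\<Sum>d\<in>{d\<in>{1..int R}. \<not> int q dvd d}. real_of_int (moebius (nat d)) * residue_disc q (a * invsq q d) (N div (nat d)\<^sup>2)) =
      (\<Sum>d\<in>?I. ?\<mu> d * residue_disc q (a * invsq q (int d)) (?Y d))"
  proof (rule sum.reindex_bij_witness[of _ int nat])
    have "q dvd nat d \<longleftrightarrow> int q dvd d" if "1 \<le> d" for d
      using that of_nat_dvd_iff[of q "nat d", where 'a = int] by simp
    thus "nat d \<in> ?I" if "d \<in> {d\<in>{1..int R}. \<not> int q dvd d}" for d using that by auto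
  qed auto
  hence "squarefree_error x q a - (\<Sum>d\<in>{d\<in>{1..int R}. \<not> int q dvd d}. real_of_int (moebius (nat d)) * residue_disc q (a * invsq q d) (N div (nat d)\<^sup>2)) =
      (\<Sum>d\<in>?I. ?\<mu> d * (?cA d - ?cB d / (real q - 1) - residue_disc q (a * invsq q (int d)) (?Y d)))"
    unfolding E by (simp add: sum_subtractf[symmetric] right_diff_distrib)
  moreover have "\<bar>\<Sum>d\<in>?I. ?\<mu> d * (?cA d - ?cB d / (real q - 1) - residue_disc q (a * invsq q (int d)) (?Y d))\<bar> \<le> (\<Sum>d\<in>?I. 2 / real q)"
  proof (rule order_trans[OF sum_abs], rule sum_mono)
    fix d assume d: "d \<in> ?I"
    have nd: "\<not> int q dvd int d" using d by simp
    define Y where "Y = ?Y d"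
    define P where "P = (\<lambda>m. [int (d\<^sup>2 * m) = a] (mod int q))"
    have "card {m\<in>{1..Y}. P m} = card {m\<in>{1..<1 + int Y}. [m = a * invsq q (int d)] (mod int q)}"
    proof (rule bij_betw_same_card[of int], rule bij_betwI[of _ _ _ nat])
      have iff: "P m \<longleftrightarrow> [int m = a * invsq q (int d)] (mod int q)" for m
        unfolding P_def
      proof
        assume "[int (d\<^sup>2 * m) = a] (mod int q)"
        hence "[(int d)\<^sup>2 * int m * invsq q (int d) = a * invsq q (int d)] (mod int q)"
          by (intro cong_mult cong_refl) simp
        moreover have "[((int d)\<^sup>2 * invsq q (int d)) * int m = 1 * int m] (mod int q)"
          by (intro cong_mult cong_refl invsq_cong_1[OF q q3 nd])
        hence "[int m = (int d)\<^sup>2 * int m * invsq q (int d)] (mod int q)"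
          by (simp add: cong_sym_eq mult_ac)
        ultimately show "[int m = a * invsq q (int d)] (mod int q)" using cong_trans by blast
      next
        assume "[int m = a * invsq q (int d)] (mod int q)"
        hence "[(int d)\<^sup>2 * int m = (int d)\<^sup>2 * (a * invsq q (int d))] (mod int q)" by (intro cong_mult cong_refl)
        moreover have "[a * ((int d)\<^sup>2 * invsq q (int d)) = a * 1] (mod int q)"
          by (intro cong_mult cong_refl invsq_cong_1[OF q q3 nd])
        hence "[(int d)\<^sup>2 * (a * invsq q (int d)) = a] (mod int q)" by (simp add: mult_ac)
        ultimately have "[(int d)\<^sup>2 * int m = a] (mod int q)" using cong_trans by blast
        thus "[int (d\<^sup>2 * m) = a] (mod int q)" by simp
      qed
      show "int \<in> {m\<in>{1..Y}. P m} \<rightarrow> {m \<in> {1..<1 + int Y}. [m = a * invsq q (int d)] (mod int q)}"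
        by (auto simp: iff)
      show "nat \<in> {m \<in> {1..<1 + int Y}. [m = a * invsq q (int d)] (mod int q)} \<rightarrow> {m\<in>{1..Y}. P m}"
        by (auto simp: iff)
    qed auto
    hence A: "?cA d - residue_disc q (a * invsq q (int d)) Y = real Y / real q"
      by (simp add: residue_disc_def Y_def P_def)
    have cop: "coprime (d\<^sup>2 * m) q \<longleftrightarrow> \<not> q dvd m" for m
    proof -
      have "coprime (d\<^sup>2 * m) q \<longleftrightarrow> \<not> q dvd d\<^sup>2 * m"
      proof
        assume "coprime (d\<^sup>2 * m) q"
        thus "\<not> q dvd d\<^sup>2 * m" using coprime_common_divisor[of "d\<^sup>2 * m" q q] not_prime_unit q by auto
      next
        assume "\<not> q dvd d\<^sup>2 * m"
        thus "coprime (d\<^sup>2 * m) q" using prime_imp_coprime[OF q, of "d\<^sup>2 * m"] coprime_commute by blast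
      qed
      thus ?thesis using d q by (simp add: prime_dvd_mult_iff prime_dvd_power_iff)
    qed
    have "{m\<in>{1..Y}. q dvd m} = (\<lambda>k. q * k) ` {1..Y div q}"
    proof -
      have le: "q * k \<le> Y \<longleftrightarrow> k \<le> Y div q" for k
        using q0 less_eq_div_iff_mult_less_eq[of q k Y] by (simp add: mult.commute)
      have ge: "1 \<le> q * k \<longleftrightarrow> 1 \<le> k" for k using q0 by (cases k) auto
      show ?thesis unfolding dvd_def using le ge by (auto simp del: One_nat_def)
    qed
    hence "card {m\<in>{1..Y}. q dvd m} = card ((\<lambda>k. q * k) ` {1..Y div q})" by (simp only:)
    also have "\<dots> = Y div q" using q0 by (subst card_image) (auto simp: inj_on_def)
    finally have mult: "card {m\<in>{1..Y}. q dvd m} = Y div q" .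
    have "card ({m\<in>{1..Y}. \<not> q dvd m} \<union> {m\<in>{1..Y}. q dvd m}) = card {m\<in>{1..Y}. \<not> q dvd m} + card {m\<in>{1..Y}. q dvd m}"
      by (rule card_Un_disjoint) auto
    moreover have "{m\<in>{1..Y}. \<not> q dvd m} \<union> {m\<in>{1..Y}. q dvd m} = {1..Y}" by auto
    ultimately have "Y = card {m\<in>{1..Y}. \<not> q dvd m} + Y div q" by (simp only: mult) simp
    hence B: "?cB d = real Y - real (Y div q)"
      unfolding cop Y_def[symmetric] by linarith
    have qr: "real q - 1 > 0" "real q > 0" using q3 by simp_all
    define r where "r = real (Y mod q)"
    have r: "0 \<le> r" "r \<le> real q" using q0 by (simp_all add: r_def less_imp_le)
    have Yq: "real Y = real q * real (Y div q) + r"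
      unfolding r_def by (metis mult_div_mod_eq of_nat_add of_nat_mult)
    \<comment> \<open>With Y = q k + r, exactly Y - k of the integers up to Y are prime to q, and
      the two means differ only through r.\<close>
    have "real Y / real q - ?cB d / (real q - 1) = - (r / (real q * (real q - 1)))"
    proof -
      have "(p * k + s) / p - (p * k + s - k) / (p - 1) = - (s / (p * (p - 1)))" if "p > 1" for p k s :: real
      proof -
        have "(p * k + s) / p = k + s / p" using that by (simp add: add_divide_distrib)
        moreover have "(p * k + s - k) / (p - 1) = k + s / (p - 1)"
        proof -
          have e: "p * k + s - k = k * (p - 1) + s" by (simp add: algebra_simps)
          show ?thesis unfolding e using that by (simp add: add_divide_distrib)
        qed
        moreover have "s / p - s / (p - 1) = - (s / (p * (p - 1)))"
          using that by (simp add: diff_frac_eq algebra_simps minus_divide_left[symmetric])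
        ultimately show ?thesis by linarith
      qed
      from this[of "real q" "real (Y div q)" r] show ?thesis unfolding B using qr by (simp only: Yq)
    qed
    moreover have "r / (real q * (real q - 1)) \<le> 2 / real q"
    proof -
      have "r / (real q * (real q - 1)) \<le> real q / (real q * (real q - 1))" using r qr by (intro divide_right_mono) auto
      also have "\<dots> = 1 / (real q - 1)" using qr by simp
      also have "\<dots> \<le> 2 / real q" using q3 by (simp add: field_simps)
      finally show ?thesis .
    qed
    moreover have "0 \<le> r / (real q * (real q - 1))" using r qr by simp
    ultimately have "\<bar>?cA d - ?cB d / (real q - 1) - residue_disc q (a * invsq q (int d)) (?Y d)\<bar> \<le> 2 / real q"
      using A unfolding Y_def[symmetric] by linarith
    moreover have "\<bar>?\<mu> d\<bar> \<le> 1" using abs_moebius_le[of d] by (simp only: of_int_le_1_iff of_int_abs[symmetric])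
    ultimately show "\<bar>?\<mu> d * (?cA d - ?cB d / (real q - 1) - residue_disc q (a * invsq q (int d)) (?Y d))\<bar> \<le> 2 / real q"
      unfolding abs_mult using mult_mono[of "\<bar>?\<mu> d\<bar>" 1] by fastforce
  qed
  moreover have "(\<Sum>d\<in>?I. 2 / real q) = real (card ?I) * (2 / real q)" by simp
  moreover have "real (card ?I) * (2 / real q) \<le> real R * (2 / real q)"
  proof (intro mult_right_mono)
    have "card ?I \<le> card {1..R}" by (intro card_mono) auto
    thus "real (card ?I) \<le> real R" by simp
  qed auto
  ultimately show ?thesis by (simp only: mult.commute[of "real R"] times_divide_eq_left)
qed

text \<open>The limit N / d^2 is replaced by its value at the left end, so one fixed window serves
  all d and the Moebius sums enter through \<open>window_discrepancy\<close>. The replacement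
  concerns only m in a window of length \<open>Z\<close>, where the Moebius function is dropped and
  solutions are counted.\<close>

lemma disc_interval_bound:
  fixes u G N :: nat
  defines "D \<equiv> {d\<in>{int u + 1..<int u + 1 + int G}. \<not> int q dvd d}"
    and "Z \<equiv> N div u\<^sup>2 - N div (u + G)\<^sup>2"
  assumes u: "u \<ge> 1" and B: "\<And>h. \<not> int q dvd h \<Longrightarrow>
      norm (\<Sum>d\<in>D. complex_of_int (moebius (nat d)) * ee q (h * invsq q d)) \<le> B"
  shows "\<bar>\<Sum>d\<in>D. real_of_int (moebius (nat d)) * residue_disc q (a * invsq q d) (N div (nat d)\<^sup>2)\<bar> \<le>
    2 * (1 + ln (real q)) * B + 2 * (real G * real Z / real q) + 16 * (1 + ln (real q))\<^sup>2 * (sqrt (real q) + real G / sqrt (real q))"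
proof -
  let ?\<mu> = "\<lambda>d. real_of_int (moebius (nat d))"
  define Yu where "Yu = N div u\<^sup>2"
  define Yv where "Yv = N div (u + G)\<^sup>2"
  define b where "b = 1 + int Yv"
  define Y where "Y = (\<lambda>d. N div (nat d)\<^sup>2)"
  have finD: "finite D" by (simp add: D_def)
  have YvYu: "Yv \<le> Yu" using u by (auto simp: Yv_def Yu_def intro!: div_le_mono2 power_mono)
  have Z: "Z = Yu - Yv" by (simp add: Z_def Yu_def Yv_def)
  let ?C = "\<lambda>d. card {m\<in>{b..<b + int Z}. [m = a * invsq q d] (mod int q)}"
  have Yd: "Yv \<le> Y d" "Y d \<le> Yu" if d: "d \<in> D" for d
  proof -
    have "u \<le> nat d" "nat d \<le> u + G" using d by (auto simp: D_def)
    thus "Yv \<le> Y d" "Y d \<le> Yu" using u by (auto simp: Yv_def Yu_def Y_def intro!: div_le_mono2 power_mono)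
  qed
  have main: "\<bar>\<Sum>d\<in>D. ?\<mu> d * residue_disc q (a * invsq q d) Yu\<bar> \<le> 2 * (1 + ln (real q)) * B"
  proof -
    have "complex_of_real (\<Sum>d\<in>D. ?\<mu> d * residue_disc q (a * invsq q d) Yu) =
        (\<Sum>d\<in>D. complex_of_int (moebius (nat d)) * of_nat (card {m\<in>{1..<1 + int Yu}. [m = a * invsq q d] (mod int q)}))
        - of_real (real Yu / real q) * (\<Sum>d\<in>D. complex_of_int (moebius (nat d)))"
      by (simp add: residue_disc_def right_diff_distrib sum_subtractf sum_distrib_left mult.commute)
    also have "norm \<dots> \<le> 2 * (1 + ln (real q)) * B" by (rule window_discrepancy[OF q q3 finD a B])
    finally show ?thesis by (simp only: norm_of_real)
  qed
  have diff: "\<bar>?\<mu> d * residue_disc q (a * invsq q d) (Y d) - ?\<mu> d * residue_disc q (a * invsq q d) Yu\<bar> \<le>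
      real (?C d) + real Z / real q" if d: "d \<in> D" for d
  proof -
    let ?P = "\<lambda>m. [m = a * invsq q d] (mod int q)"
    have split: "{m\<in>{1..<1 + int Yu}. ?P m} = {m\<in>{1..<1 + int (Y d)}. ?P m} \<union> {m\<in>{1 + int (Y d)..<1 + int Yu}. ?P m}"
      using Yd[OF d] by auto
    have "card {m\<in>{1..<1 + int Yu}. ?P m} = card {m\<in>{1..<1 + int (Y d)}. ?P m} + card {m\<in>{1 + int (Y d)..<1 + int Yu}. ?P m}"
      unfolding split by (rule card_Un_disjoint) auto
    moreover have "card {m\<in>{1 + int (Y d)..<1 + int Yu}. ?P m} \<le> ?C d"
      using Yd[OF d] YvYu by (intro card_mono) (auto simp: b_def Z)
    moreover have "real Yu / real q - real (Y d) / real q \<le> real Z / real q" "real (Y d) / real q \<le> real Yu / real q"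
      using Yd[OF d] YvYu unfolding diff_divide_distrib[symmetric] by (auto simp: Z of_nat_diff intro!: divide_right_mono)
    ultimately have "\<bar>residue_disc q (a * invsq q d) (Y d) - residue_disc q (a * invsq q d) Yu\<bar> \<le> real (?C d) + real Z / real q"
      by (simp add: residue_disc_def abs_le_iff)
    moreover have "\<bar>?\<mu> d\<bar> \<le> 1" using abs_moebius_le[of "nat d"] by (simp only: of_int_le_1_iff of_int_abs[symmetric])
    ultimately show ?thesis
      unfolding right_diff_distrib[symmetric] abs_mult using mult_mono[of "\<bar>?\<mu> d\<bar>" 1] by fastforce
  qed
  have "(\<Sum>d\<in>D. real (?C d) + real Z / real q) \<le> (\<Sum>d\<in>{int u + 1..<int u + 1 + int G}. real (?C d) + real Z / real q)"
    unfolding D_def by (intro sum_mono2) auto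
  also have "\<dots> = real (\<Sum>d\<in>{int u + 1..<int u + 1 + int G}. ?C d) + real G * real Z / real q"
    by (simp add: sum.distrib)
  also have "\<dots> \<le> (real G * real Z / real q + 16 * (1 + ln (real q))\<^sup>2 * (sqrt (real q) + real G / sqrt (real q))) + real G * real Z / real q"
    by (intro add_right_mono count_bound[OF q q3 a])
  finally have err: "(\<Sum>d\<in>D. real (?C d) + real Z / real q) \<le>
      2 * (real G * real Z / real q) + 16 * (1 + ln (real q))\<^sup>2 * (sqrt (real q) + real G / sqrt (real q))" by simp
  have "\<bar>(\<Sum>d\<in>D. ?\<mu> d * residue_disc q (a * invsq q d) (Y d)) - (\<Sum>d\<in>D. ?\<mu> d * residue_disc q (a * invsq q d) Yu)\<bar> \<le>
      (\<Sum>d\<in>D. real (?C d) + real Z / real q)"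
    unfolding sum_subtractf[symmetric] by (rule order_trans[OF sum_abs], rule sum_mono, rule diff)
  thus ?thesis using main err unfolding Y_def by linarith
qed

text \<open>For given m all solutions d are congruent to d0 or - d0, where d0 is any one of
  them.\<close>

lemma card_square_roots_interval:
  "real (card {d\<in>{int T<..2 * int T}. \<not> int q dvd d \<and> [m = a * invsq q d] (mod int q)}) \<le> 2 * (real T / real q + 1)"
proof (cases "{d\<in>{int T<..2 * int T}. \<not> int q dvd d \<and> [m = a * invsq q d] (mod int q)} = {}")
  case True
  show ?thesis unfolding True by simp
next
  case False
  then obtain d0 where d0: "\<not> int q dvd d0" "[m = a * invsq q d0] (mod int q)" by blast
  let ?S = "{d\<in>{int T<..2 * int T}. \<not> int q dvd d \<and> [m = a * invsq q d] (mod int q)}"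
  let ?A = "\<lambda>\<sigma>. {d\<in>{int T<..2 * int T}. int q dvd d - \<sigma> * d0}"
  have cardA: "real (card (?A \<sigma>)) \<le> real T / real q + 1" for \<sigma>
  proof (rule card_residue_class_interval)
    show "?A \<sigma> \<subseteq> {int T + 1..<int T + 1 + int T}" by auto
    fix x y assume "x \<in> ?A \<sigma>" "y \<in> ?A \<sigma>"
    hence "int q dvd x - \<sigma> * d0" "int q dvd y - \<sigma> * d0" by auto
    hence "int q dvd (x - \<sigma> * d0) - (y - \<sigma> * d0)" by (rule dvd_diff)
    thus "int q dvd x - y" by simp
  qed (use q3 in auto)
  have "?S \<subseteq> ?A 1 \<union> ?A (- 1)"
  proof
    fix d assume d: "d \<in> ?S"
    have "[a * invsq q d = a * invsq q d0] (mod int q)" using d d0 by (auto intro: cong_trans cong_sym)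
    hence "int q dvd a * (invsq q d - invsq q d0)" by (simp add: cong_iff_dvd_diff right_diff_distrib)
    hence "[invsq q d = invsq q d0] (mod int q)" using q a by (simp add: prime_dvd_mult_iff cong_iff_dvd_diff)
    hence "[d\<^sup>2 * d0\<^sup>2 * invsq q d = d\<^sup>2 * d0\<^sup>2 * invsq q d0] (mod int q)" by (intro cong_mult cong_refl)
    moreover have "[d0\<^sup>2 * (d\<^sup>2 * invsq q d) = d0\<^sup>2 * 1] (mod int q)"
      using d by (intro cong_mult cong_refl invsq_cong_1[OF q q3]) auto
    moreover have "[d\<^sup>2 * (d0\<^sup>2 * invsq q d0) = d\<^sup>2 * 1] (mod int q)"
      using d0 by (intro cong_mult cong_refl invsq_cong_1[OF q q3]) auto
    moreover have "d\<^sup>2 * d0\<^sup>2 * invsq q d = d0\<^sup>2 * (d\<^sup>2 * invsq q d)" "d\<^sup>2 * d0\<^sup>2 * invsq q d0 = d\<^sup>2 * (d0\<^sup>2 * invsq q d0)"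
      by simp_all
    ultimately have "[d\<^sup>2 = d0\<^sup>2] (mod int q)" by (metis cong_sym cong_trans mult_1_right)
    hence "int q dvd (d - d0) * (d + d0)" by (simp add: cong_iff_dvd_diff power2_eq_square algebra_simps)
    hence "int q dvd d - d0 \<or> int q dvd d + d0" using q by (simp add: prime_dvd_mult_iff)
    thus "d \<in> ?A 1 \<union> ?A (- 1)" using d by auto
  qed
  hence "card ?S \<le> card (?A 1 \<union> ?A (- 1))" by (intro card_mono) auto
  also have "\<dots> \<le> card (?A 1) + card (?A (- 1))" by (rule card_Un_le)
  finally have "real (card ?S) \<le> real (card (?A 1)) + real (card (?A (- 1)))" by (simp only: of_nat_add[symmetric] of_nat_le_iff)
  also have "\<dots> \<le> (real T / real q + 1) + (real T / real q + 1)" by (intro add_mono cardA)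
  finally show ?thesis by (simp only: mult_2)
qed

text \<open>Both bounds drop the Moebius function. The first counts pairs (d, m) by completion in d
  and fails once T / q^(1/2) is large; the second counts at most two classes of d for each m, which
  then wins because \<open>Z\<close> is small.\<close>

lemma disc_dyadic_bound:
  fixes T N :: nat
  defines "D \<equiv> {d\<in>{int T<..2 * int T}. \<not> int q dvd d}" and "Z \<equiv> N div T\<^sup>2"
  assumes T: "T \<ge> 1"
  shows "\<bar>\<Sum>d\<in>D. real_of_int (moebius (nat d)) * residue_disc q (a * invsq q d) (N div (nat d)\<^sup>2)\<bar> \<le>
      2 * (real T * real Z / real q) + 16 * (1 + ln (real q))\<^sup>2 * (sqrt (real q) + real T / sqrt (real q))" (is "?S \<le> ?b1")
    and "\<bar>\<Sum>d\<in>D. real_of_int (moebius (nat d)) * residue_disc q (a * invsq q d) (N div (nat d)\<^sup>2)\<bar> \<le>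
      3 * (real T * real Z / real q) + 2 * real Z"
proof -
  let ?C = "\<lambda>d. card {m\<in>{1..<1 + int Z}. [m = a * invsq q d] (mod int q)}"
  have Ieq: "{int T<..2 * int T} = {int T + 1..<int T + 1 + int T}" by auto
  have finD: "finite D" by (simp add: D_def)
  have cardD: "real (card D) \<le> real T"
  proof -
    have "card D \<le> card {int T<..2 * int T}" unfolding D_def by (intro card_mono) auto
    thus ?thesis by simp
  qed
  have "?S \<le> (\<Sum>d\<in>D. real (?C d) + real Z / real q)"
  proof (rule order_trans[OF sum_abs], rule sum_mono)
    fix d assume d: "d \<in> D"
    define Y where "Y = N div (nat d)\<^sup>2"
    have YZ: "Y \<le> Z" using d T unfolding Y_def Z_def D_def by (intro div_le_mono2 power_mono) auto
    have "card {m\<in>{1..<1 + int Y}. [m = a * invsq q d] (mod int q)} \<le> ?C d" using YZ by (intro card_mono) auto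
    moreover have "real Y / real q \<le> real Z / real q" using YZ by (intro divide_right_mono) auto
    moreover have "0 \<le> real Y / real q" by simp
    ultimately have "\<bar>residue_disc q (a * invsq q d) Y\<bar> \<le> real (?C d) + real Z / real q"
      unfolding residue_disc_def by linarith
    moreover have "\<bar>real_of_int (moebius (nat d))\<bar> \<le> 1"
      using abs_moebius_le[of "nat d"] by (simp only: of_int_le_1_iff of_int_abs[symmetric])
    ultimately show "\<bar>real_of_int (moebius (nat d)) * residue_disc q (a * invsq q d) (N div (nat d)\<^sup>2)\<bar> \<le> real (?C d) + real Z / real q"
      unfolding abs_mult Y_def[symmetric] using mult_mono[of "\<bar>real_of_int (moebius (nat d))\<bar>" 1] by fastforce
  qed
  also have "\<dots> = real (\<Sum>d\<in>D. ?C d) + real (card D) * (real Z / real q)" by (simp add: sum.distrib)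
  also have "\<dots> \<le> real (\<Sum>d\<in>D. ?C d) + real T * (real Z / real q)"
    by (intro add_left_mono mult_right_mono cardD) auto
  finally have S: "?S \<le> real (\<Sum>d\<in>D. ?C d) + real T * real Z / real q" by simp
  have "real (\<Sum>d\<in>D. ?C d) \<le> real (\<Sum>d\<in>{int T + 1..<int T + 1 + int T}. ?C d)"
    unfolding D_def Ieq of_nat_le_iff by (intro sum_mono2) auto
  also have "\<dots> \<le> real T * real Z / real q + 16 * (1 + ln (real q))\<^sup>2 * (sqrt (real q) + real T / sqrt (real q))"
    by (rule count_bound[OF q q3 a])
  finally show "?S \<le> ?b1" using S by simp
  have "(\<Sum>d\<in>D. ?C d) = (\<Sum>d\<in>D. \<Sum>m\<in>{m\<in>{1..<1 + int Z}. [m = a * invsq q d] (mod int q)}. 1)" by simp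
  also have "\<dots> = (\<Sum>m\<in>{1..<1 + int Z}. \<Sum>d\<in>{d\<in>D. [m = a * invsq q d] (mod int q)}. 1)"
    by (rule sum.swap_restrict) (use finD in auto)
  finally have "real (\<Sum>d\<in>D. ?C d) = (\<Sum>m\<in>{1..<1 + int Z}. real (card {d\<in>D. [m = a * invsq q d] (mod int q)}))" by simp
  also have "\<dots> \<le> (\<Sum>m\<in>{1..<1 + int Z}. 2 * (real T / real q + 1))"
  proof (rule sum_mono)
    fix m
    have "{d\<in>D. [m = a * invsq q d] (mod int q)} = {d\<in>{int T<..2 * int T}. \<not> int q dvd d \<and> [m = a * invsq q d] (mod int q)}"
      by (auto simp: D_def)
    thus "real (card {d\<in>D. [m = a * invsq q d] (mod int q)}) \<le> 2 * (real T / real q + 1)"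
      using card_square_roots_interval[of T m] by (simp only:)
  qed
  also have "\<dots> = 2 * (real T * real Z / real q) + 2 * real Z" by (simp add: algebra_simps)
  finally show "?S \<le> 3 * (real T * real Z / real q) + 2 * real Z" using S by simp
qed

end

section \<open>Assembly of the ranges of d\<close>

lemma real_div_minus_1_le: "real n / real m - 1 \<le> real (n div m)"
  using real_of_int_div3[of "int n" "int m"] by (simp add: zdiv_int[symmetric])

lemma squarefree_error_trivial:
  assumes X: "X > 1"
  shows "\<bar>squarefree_error X q a\<bar> \<le> X"
proof -
  have fin: "finite {n. n > 0 \<and> real n \<le> X \<and> P n}" and le: "real (card {n. n > 0 \<and> real n \<le> X \<and> P n}) \<le> X" for P
  proof -
    have sub: "{n. n > 0 \<and> real n \<le> X \<and> P n} \<subseteq> {1..nat \<lfloor>X\<rfloor>}" by (auto simp: le_nat_iff le_floor_iff)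
    show "finite {n. n > 0 \<and> real n \<le> X \<and> P n}" by (rule finite_subset[OF sub]) simp
    have "card {n. n > 0 \<and> real n \<le> X \<and> P n} \<le> card {1..nat \<lfloor>X\<rfloor>}" by (rule card_mono[OF _ sub]) simp
    thus "real (card {n. n > 0 \<and> real n \<le> X \<and> P n}) \<le> X" using X by simp linarith
  qed
  have bound: "0 \<le> (\<Sum>n | n > 0 \<and> real n \<le> X \<and> P n. real_of_int ((moebius n)\<^sup>2)) \<and>
      (\<Sum>n | n > 0 \<and> real n \<le> X \<and> P n. real_of_int ((moebius n)\<^sup>2)) \<le> X" for P
  proof
    show "0 \<le> (\<Sum>n | n > 0 \<and> real n \<le> X \<and> P n. real_of_int ((moebius n)\<^sup>2))" by (intro sum_nonneg) simp
    have "(\<Sum>n | n > 0 \<and> real n \<le> X \<and> P n. real_of_int ((moebius n)\<^sup>2)) \<le> (\<Sum>n | n > 0 \<and> real n \<le> X \<and> P n. 1)"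
      by (intro sum_mono) (simp add: moebius_square)
    thus "(\<Sum>n | n > 0 \<and> real n \<le> X \<and> P n. real_of_int ((moebius n)\<^sup>2)) \<le> X" using le[of P] by simp
  qed
  define A where "A = (\<Sum>n | n > 0 \<and> real n \<le> X \<and> [int n = a] (mod int q). real_of_int ((moebius n)\<^sup>2))"
  define B where "B = (\<Sum>n | n > 0 \<and> real n \<le> X \<and> coprime n q. real_of_int ((moebius n)\<^sup>2))"
  have "0 \<le> A" "A \<le> X" "0 \<le> B" "B \<le> X" using bound[of "\<lambda>n. [int n = a] (mod int q)"] bound[of "\<lambda>n. coprime n q"] by (simp_all add: A_def B_def)
  moreover have "1 / real (totient q) * B \<le> 1 * B" using \<open>0 \<le> B\<close> by (intro mult_right_mono) (auto simp: divide_le_eq Suc_le_eq)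
  moreover have "0 \<le> 1 / real (totient q) * B" using \<open>0 \<le> B\<close> by simp
  ultimately show ?thesis unfolding squarefree_error_def A_def[symmetric] B_def[symmetric] by linarith
qed

text \<open>The d below D q^(-\<gamma>) are trivial, those up to about D q^\<gamma> fall into short
  intervals on which the Moebius sums save, and those beyond into dyadic blocks. The hypothesis q^(2
  + 4 \<eta>) \<le> X is D \<ge> q^(1/2 + 2 \<eta>) squared and multiplied by q.\<close>

lemma squarefree_error_saving:
  fixes \<eta> :: real
  assumes \<eta>: "0 < \<eta>" "\<eta> < 1 / 4"
  shows "\<exists>\<gamma>>0. \<exists>C>0. \<exists>q0. \<forall>(X::real) (q::nat) (a::int).
    X > 1 \<longrightarrow> prime q \<longrightarrow> q0 \<le> real q \<longrightarrow> X powr \<eta> \<le> real q \<longrightarrow> real q powr (2 + 4 * \<eta>) \<le> X \<longrightarrow> coprime a (int q) \<longrightarrow>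
    \<bar>squarefree_error X q a\<bar> \<le> C * sqrt (X / real q) * real q powr - \<gamma>"
proof -
  \<comment> \<open>X^\<eta> \<le> q gives D \<le> q^(1/(2 \<eta>)); the summand 1 covers the factor
    4 q^\<gamma> by which the largest d in the middle range exceeds D.\<close>
  define K where "K = 1 / (2 * \<eta>) + 1"
  have K1: "K \<ge> 1" using \<eta> by (simp add: K_def)
  obtain \<gamma>1 C1 where \<gamma>1: "\<gamma>1 > 0" and C1: "C1 > 0" and MS: "\<And>q h N. prime q \<Longrightarrow> q \<ge> 3 \<Longrightarrow> \<not> int q dvd h \<Longrightarrow>
    real q powr (1 / 2 + \<eta>) \<le> real N \<Longrightarrow> real N \<le> real q powr K \<Longrightarrow>
    norm (\<Sum>d\<in>{d\<in>{1..int N}. \<not> int q dvd d}. complex_of_int (moebius (nat d)) * ee q (h * invsq q d))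
      \<le> C1 * real N * real q powr - \<gamma>1"
    using moebius_exp_sum[of \<eta> K] \<eta> K1 by auto
  \<comment> \<open>In the middle range about q^(7 \<gamma>) intervals, a logarithm and the length D
    q^\<gamma> cost q^(9 \<gamma>) against the saving q^(-\<gamma>1), hence 10 \<gamma> \<le>
    \<gamma>1. The completion term q^(1/2 + 8 \<gamma>) must stay below D q^(-\<gamma>), for which 5
    \<gamma> \<le> \<eta> is enough.\<close>
  define \<gamma> where "\<gamma> = min (\<gamma>1 / 10) (\<eta> / 5)"
  have \<gamma>: "\<gamma> > 0" "10 * \<gamma> \<le> \<gamma>1" "5 * \<gamma> \<le> \<eta>" using \<gamma>1 \<eta> by (auto simp: \<gamma>_def)
  have \<gamma>20: "\<gamma> \<le> 1 / 20" using \<gamma> \<eta> by linarith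
  define cl where "cl = 1 + 2 / \<gamma>"
  have cl: "cl \<ge> 1" using \<gamma> by (simp add: cl_def)
  define C where "C = 2 + 1 + (32 * cl * C1 + 264 + 96 * cl\<^sup>2) + (5 + 32 * cl\<^sup>2) * (cl / \<eta>)"
  have C: "C > 0"
  proof -
    have "0 \<le> 32 * cl * C1" "0 \<le> (5 + 32 * cl\<^sup>2) * (cl / \<eta>)" using cl C1 \<eta> by auto
    moreover have "0 \<le> 96 * cl\<^sup>2" by simp
    ultimately show ?thesis unfolding C_def by linarith
  qed
  have \<gamma>2: "\<gamma> / 2 > 0" using \<gamma> by simp
  show ?thesis
  proof (rule exI[of _ "\<gamma> / 2"], rule conjI[OF \<gamma>2], rule exI[of _ C], rule conjI[OF C], rule exI[of _ "4 powr (1 / \<gamma>)"], intro allI impI)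
    fix X :: real and q :: nat and a :: int
    assume X: "X > 1" and q: "prime q" and big: "4 powr (1 / \<gamma>) \<le> real q" and X\<eta>: "X powr \<eta> \<le> real q"
      and Xlow: "real q powr (2 + 4 * \<eta>) \<le> X" and cop: "coprime a (int q)"
    define Q where "Q = real q"
    define P where "P = (\<lambda>x. Q powr x)"
    have P4: "P \<gamma> \<ge> 4"
    proof -
      have "(4 powr (1 / \<gamma>)) powr \<gamma> \<le> Q powr \<gamma>" using big \<gamma> by (intro powr_mono2) (auto simp: Q_def)
      thus ?thesis using \<gamma> by (simp add: P_def powr_powr)
    qed
    have q3: "q \<ge> 3"
    proof -
      have "4 powr 1 \<le> 4 powr (1 / \<gamma>)" using \<gamma> \<gamma>20 by (intro powr_mono) (auto simp: le_divide_eq)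
      thus ?thesis using big by simp
    qed
    have Q: "Q \<ge> 3" using q3 by (simp add: Q_def)
    have a: "\<not> int q dvd a"
    proof
      assume "int q dvd a"
      hence "int q dvd 1" using cop by (meson coprime_common_divisor dvd_refl)
      thus False using q3 by simp
    qed
    have Padd: "P (x + y) = P x * P y" for x y unfolding P_def by (rule powr_add)
    have Pm: "P x \<le> P y" if "x \<le> y" for x y unfolding P_def using Q that by (intro powr_mono) auto
    have Ppos [simp]: "P x > 0" for x unfolding P_def using Q by simp
    have Pne [simp]: "P x \<noteq> 0" for x using Ppos[of x] by linarith
    have Pnn [simp]: "P x \<ge> 0" for x by (rule less_imp_le[OF Ppos])
    have P0: "P 0 = 1" using Q by (simp add: P_def)
    have P1: "P 1 = Q" using Q by (simp add: P_def)
    have Pge1: "1 \<le> P x" if "x \<ge> 0" for x using Pm[OF that] P0 by simp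
    have Phalf: "sqrt Q = P (1 / 2)" using Q by (simp add: P_def powr_half_sqrt)
    define D where "D = sqrt (X / Q)"
    have D2: "D\<^sup>2 = X / Q" using X Q by (simp add: D_def)
    have XD: "X = D\<^sup>2 * Q" using Q by (simp add: D2)
    have Dlow: "P (1 / 2 + 2 * \<eta>) \<le> D"
      unfolding D_def
    proof (rule real_le_rsqrt)
      have "(P (1 / 2 + 2 * \<eta>))\<^sup>2 * Q = P ((1 / 2 + 2 * \<eta>) + (1 / 2 + 2 * \<eta>) + 1)"
        unfolding power2_eq_square Padd P1 ..
      also have "\<dots> = P (2 + 4 * \<eta>)" by (rule arg_cong[where f = P]) simp
      also have "\<dots> \<le> X" using Xlow by (simp add: P_def Q_def)
      finally show "(P (1 / 2 + 2 * \<eta>))\<^sup>2 \<le> X / Q" using Q by (simp add: le_divide_eq)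
    qed
    have D0: "D > 0" using Dlow Ppos[of "1 / 2 + 2 * \<eta>"] by linarith
    have Xup: "X \<le> P (1 / \<eta>)"
    proof -
      have "X = (X powr \<eta>) powr (1 / \<eta>)" using X \<eta> by (simp add: powr_powr)
      also have "\<dots> \<le> Q powr (1 / \<eta>)" using X\<eta> \<eta> X by (intro powr_mono2) (auto simp: Q_def)
      finally show ?thesis by (simp add: P_def)
    qed
    have Dup: "D \<le> P (1 / (2 * \<eta>))"
      unfolding D_def
    proof (rule real_le_lsqrt)
      have "X / Q \<le> X / 1" using X Q by (intro divide_left_mono) auto
      also have "\<dots> \<le> P (1 / \<eta>)" using Xup by simp
      also have "\<dots> = (P (1 / (2 * \<eta>)))\<^sup>2" unfolding power2_eq_square Padd[symmetric] by simp
      finally show "X / Q \<le> (P (1 / (2 * \<eta>)))\<^sup>2" .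
    qed simp
    have DP: "P x \<le> D * P y" if "x \<le> 1 / 2 + 2 * \<eta> + y" for x y
    proof -
      have "P x \<le> P (1 / 2 + 2 * \<eta>) * P y" unfolding Padd[symmetric] by (rule Pm[OF that])
      also have "\<dots> \<le> D * P y" using Dlow by (intro mult_right_mono) auto
      finally show ?thesis .
    qed
    define l where "l = 1 + ln Q"
    have l1: "l \<le> cl * P (\<gamma> / 2)"
      using ln_le_powr[of Q "\<gamma> / 2"] Q \<gamma> by (simp add: l_def cl_def P_def)
    have l0: "l \<ge> 0" using Q by (simp add: l_def)
    have l2: "l\<^sup>2 \<le> cl\<^sup>2 * P \<gamma>"
    proof -
      have "l\<^sup>2 \<le> (cl * P (\<gamma> / 2))\<^sup>2" using l1 l0 by (rule power_mono)
      also have "\<dots> = cl\<^sup>2 * P (\<gamma> / 2 + \<gamma> / 2)" unfolding Padd by (simp add: power2_eq_square)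
      finally show ?thesis by simp
    qed
    define N where "N = nat \<lfloor>X\<rfloor>"
    define R where "R = nat \<lfloor>sqrt X\<rfloor>"
    have NX: "real N \<le> X" using X by (simp add: N_def)
    have RX: "real R \<le> sqrt X" using X by (simp add: R_def)
    have R: "d \<le> R" if "d\<^sup>2 \<le> N" for d
    proof -
      have "real (d\<^sup>2) \<le> real N" using that by (simp only: of_nat_le_iff)
      hence "(real d)\<^sup>2 \<le> X" unfolding of_nat_power using NX by linarith
      hence "real d \<le> sqrt X" by (rule real_le_rsqrt)
      thus ?thesis unfolding R_def by (rule le_nat_floor)
    qed
    have R1: "R \<ge> 1" unfolding R_def using X by (intro le_nat_floor) simp
    define g where "g = (\<lambda>d. real_of_int (moebius (nat d)) * residue_disc q (a * invsq q d) (N div (nat d)\<^sup>2))"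
    define f where "f = (\<lambda>d. if \<not> int q dvd d then g d else 0)"
    have fg: "(\<Sum>d\<in>{d\<in>A. \<not> int q dvd d}. g d) = (\<Sum>d\<in>A. f d)" if "finite A" for A
      unfolding f_def by (rule sum.inter_filter[OF that])
    have f1: "\<bar>f d\<bar> \<le> 1" for d
    proof -
      have "\<bar>real_of_int (moebius (nat d))\<bar> \<le> 1"
        using abs_moebius_le[of "nat d"] by (simp only: of_int_le_1_iff of_int_abs[symmetric])
      moreover have "\<bar>residue_disc q (a * invsq q d) (N div (nat d)\<^sup>2)\<bar> \<le> 1"
        using q3 by (intro residue_disc_le) auto
      ultimately have "\<bar>g d\<bar> \<le> 1 * 1" unfolding g_def abs_mult by (intro mult_mono) auto
      thus ?thesis by (simp add: f_def)
    qed
    \<comment> \<open>Beyond R the range of m is empty, so the sum may be extended to the end of the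
      last dyadic block.\<close>
    have f0: "f d = 0" if "d > int R" for d
    proof -
      have "N < (nat d)\<^sup>2" using R[of "nat d"] that by (meson leD leI nat_less_iff zless_nat_eq_int_zless)
      thus ?thesis by (simp add: f_def g_def)
    qed
    have red: "\<bar>squarefree_error X q a - (\<Sum>d\<in>{1..int R}. f d)\<bar> \<le> 2 * (D * P (- (\<gamma> / 2)))"
    proof -
      have "\<bar>squarefree_error X q a - (\<Sum>d\<in>{d\<in>{1..int R}. \<not> int q dvd d}. g d)\<bar> \<le> 2 * real R / real q"
        unfolding g_def N_def by (rule squarefree_error_eq_disc[OF q q3 a X R[unfolded N_def]])
      also have "\<dots> \<le> 2 * (sqrt X / Q)" using RX Q by (simp add: Q_def divide_right_mono)
      also have "sqrt X / Q = D * P (- (1 / 2))"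
      proof -
        have "sqrt X = D * P (1 / 2)" unfolding XD real_sqrt_mult Phalf using D0 by simp
        moreover have "P (1 / 2) / Q = P (- (1 / 2))"
        proof -
          have "P (- (1 / 2)) * P 1 = P (1 / 2)" unfolding Padd[symmetric] by simp
          thus ?thesis using Q by (simp add: P1 field_simps)
        qed
        ultimately show ?thesis by (metis times_divide_eq_right)
      qed
      also have "2 * (D * P (- (1 / 2))) \<le> 2 * (D * P (- (\<gamma> / 2)))"
        using D0 \<gamma>20 by (intro mult_left_mono Pm) auto
      finally show ?thesis unfolding fg[OF finite_atLeastAtMost_int] .
    qed
    define U0 where "U0 = nat \<lfloor>D * P (- \<gamma>)\<rfloor>"
    \<comment> \<open>Each interval replaces the moving limit at a cost of about G^2 / D = D q^(-12
      \<gamma>), times q^(3 \<gamma>) because u may be as small as D q^(-\<gamma>) / 2. The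
      resulting D q^(-9 \<gamma>) survives the number of intervals, about q^(7 \<gamma>).\<close>
    define G where "G = nat \<lceil>D * P (- 6 * \<gamma>)\<rceil>"
    define W where "W = nat \<lceil>D * P \<gamma> / real G\<rceil>"
    define U where "U = U0 + W * G"
    have DP1: "1 \<le> D * P (- \<gamma>)" "1 \<le> D * P (- 6 * \<gamma>)"
      using DP[of 0 "- \<gamma>"] DP[of 0 "- 6 * \<gamma>"] P0 \<gamma> \<eta> by auto
    have U0: "real U0 \<le> D * P (- \<gamma>)" "D * P (- \<gamma>) / 2 \<le> real U0" "U0 \<ge> 1"
    proof -
      have "real U0 = real_of_int \<lfloor>D * P (- \<gamma>)\<rfloor>" using DP1 by (simp add: U0_def)
      moreover have "1 \<le> \<lfloor>D * P (- \<gamma>)\<rfloor>" using DP1 by (simp add: le_floor_iff)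
      ultimately show "real U0 \<le> D * P (- \<gamma>)" "D * P (- \<gamma>) / 2 \<le> real U0" "U0 \<ge> 1" by linarith+
    qed
    have G: "D * P (- 6 * \<gamma>) \<le> real G" "real G \<le> 2 * (D * P (- 6 * \<gamma>))"
      using DP1 unfolding G_def by linarith+
    have G0: "real G > 0" using G DP1 by linarith
    have D\<gamma>: "0 < D * P \<gamma>" using D0 by simp
    have W1: "D * P \<gamma> / real G \<le> real W" "real W \<le> D * P \<gamma> / real G + 1"
      using D\<gamma> G0 divide_pos_pos[OF D\<gamma> G0] unfolding W_def by linarith+
    have W2: "real W \<le> 2 * P (7 * \<gamma>)"
    proof -
      have "D * P \<gamma> / real G \<le> D * P \<gamma> / (D * P (- 6 * \<gamma>))" using G D\<gamma> D0 G0 by (intro divide_left_mono) auto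
      also have "\<dots> = P (7 * \<gamma>)"
      proof -
        have "P \<gamma> = P (7 * \<gamma>) * P (- 6 * \<gamma>)" unfolding Padd[symmetric] by simp
        thus ?thesis using D0 by simp
      qed
      finally have "D * P \<gamma> / real G \<le> P (7 * \<gamma>)" .
      moreover have "1 \<le> P (7 * \<gamma>)" using \<gamma> by (intro Pge1) simp
      ultimately show ?thesis using W1(2) by linarith
    qed
    have WG: "D * P \<gamma> \<le> real W * real G" "real W * real G \<le> D * P \<gamma> + real G"
      using W1 G0 by (simp_all add: divide_le_eq field_simps)
    have U1: "D * P \<gamma> \<le> real U" "real U \<le> 4 * (D * P \<gamma>)"
    proof -
      show "D * P \<gamma> \<le> real U" using WG by (simp add: U_def)
      have "D * P (- \<gamma>) \<le> D * P \<gamma>" "D * P (- 6 * \<gamma>) \<le> D * P \<gamma>" using D0 \<gamma> by (auto intro!: mult_left_mono Pm)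
      thus "real U \<le> 4 * (D * P \<gamma>)" using WG(2) U0(1) G(2) unfolding U_def of_nat_add of_nat_mult by linarith
    qed
    have Uge1: "U \<ge> 1" using U0(3) by (simp add: U_def)
    define I where "I = nat \<lceil>log 2 (real R)\<rceil>"
    have I1: "R \<le> 2 ^ I"
    proof -
      have "real R = 2 powr log 2 (real R)" using R1 by simp
      also have "\<dots> \<le> 2 powr real I" unfolding I_def by (rule powr_mono) linarith+
      also have "\<dots> = real (2 ^ I)" by (simp add: powr_realpow)
      finally show ?thesis by (simp only: of_nat_le_iff)
    qed
    have I2: "real I \<le> (cl / \<eta>) * P (\<gamma> / 2)"
    proof -
      have l2: "ln 2 \<ge> (1 / 2 :: real)" using ln2_ge_two_thirds by linarith
      have lnR: "0 \<le> ln (real R)" using R1 by simp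
      have "log 2 (real R) = ln (real R) / ln 2" by (simp add: log_def)
      also have "\<dots> \<le> ln (real R) / (1 / 2)" using l2 lnR by (intro divide_left_mono) auto
      finally have "log 2 (real R) \<le> 2 * ln (real R)" by simp
      moreover have "ln (real R) \<le> ln (sqrt X)" using RX R1 X by (subst ln_le_cancel_iff) auto
      hence "2 * ln (real R) \<le> ln X" using X by (simp add: ln_sqrt)
      moreover have "ln X \<le> ln (P (1 / \<eta>))" using Xup X by (subst ln_le_cancel_iff) auto
      hence "ln X \<le> 1 / \<eta> * ln Q" using Q by (simp add: P_def ln_powr)
      moreover have "real I \<le> log 2 (real R) + 1"
        using lnR unfolding I_def log_def by (simp add: zero_le_divide_iff)
      ultimately have "real I \<le> 1 / \<eta> * ln Q + 1" by linarith
      also have "\<dots> \<le> 1 / \<eta> * l" using \<eta> by (simp add: l_def distrib_left)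
      also have "\<dots> \<le> 1 / \<eta> * (cl * P (\<gamma> / 2))" using \<eta> l1 by (intro mult_left_mono) auto
      finally show ?thesis by simp
    qed
    have decomp: "(\<Sum>d\<in>{1..int R}. f d) = (\<Sum>d\<in>{1..int U0}. f d) +
        (\<Sum>r<W. \<Sum>d\<in>{int U0 + 1 + int (r * G)..<int U0 + 1 + int (r * G) + int G}. f d) +
        (\<Sum>i<I. \<Sum>d\<in>{int (U * 2 ^ i)<..2 * int (U * 2 ^ i)}. f d)"
    proof -
      have UI: "int U \<le> int (U * 2 ^ I)" "int R \<le> int (U * 2 ^ I)"
      proof -
        have "U * 1 \<le> U * 2 ^ I" by (intro mult_left_mono) auto
        thus "int U \<le> int (U * 2 ^ I)" by (simp only: of_nat_le_iff mult_1_right)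
        have "1 * 2 ^ I \<le> U * 2 ^ I" using Uge1 by (intro mult_right_mono) auto
        thus "int R \<le> int (U * 2 ^ I)" using I1 by (simp only: of_nat_le_iff)
      qed
      define V where "V = int (U * 2 ^ I)"
      have Uint: "int U = int U0 + int (W * G)" by (simp only: U_def of_nat_add)
      define M where "M = int (W * G)"
      have M: "M \<ge> 0" unfolding M_def by (rule of_nat_0_le_iff)
      have "(\<Sum>d\<in>{1..int R}. f d) = (\<Sum>d\<in>{1..V}. f d)"
        using UI(2) f0 by (intro sum.mono_neutral_left) (auto simp: V_def)
      also have "{1..V} = {1..int U0} \<union> {int U0 + 1..<int U0 + 1 + M} \<union> {int U<..V}"
        using UI(1) M unfolding Uint V_def[symmetric] M_def[symmetric] by auto
      also have "(\<Sum>d\<in>{1..int U0} \<union> {int U0 + 1..<int U0 + 1 + M} \<union> {int U<..V}. f d) =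
          (\<Sum>d\<in>{1..int U0} \<union> {int U0 + 1..<int U0 + 1 + M}. f d) + (\<Sum>d\<in>{int U<..V}. f d)"
        using M unfolding Uint M_def[symmetric] by (intro sum.union_disjoint) auto
      also have "(\<Sum>d\<in>{1..int U0} \<union> {int U0 + 1..<int U0 + 1 + M}. f d) =
          (\<Sum>d\<in>{1..int U0}. f d) + (\<Sum>d\<in>{int U0 + 1..<int U0 + 1 + M}. f d)"
        by (intro sum.union_disjoint) auto
      finally show ?thesis unfolding V_def M_def sum_dyadic sum_blocks[symmetric] .
    qed
    have part1: "\<bar>\<Sum>d\<in>{1..int U0}. f d\<bar> \<le> D * P (- \<gamma>)"
    proof -
      have "\<bar>\<Sum>d\<in>{1..int U0}. f d\<bar> \<le> (\<Sum>d\<in>{1..int U0}. 1)"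
        by (rule order_trans[OF sum_abs], rule sum_mono, rule f1)
      thus ?thesis using U0(1) by simp
    qed
    have part2: "\<bar>\<Sum>r<W. \<Sum>d\<in>{int U0 + 1 + int (r * G)..<int U0 + 1 + int (r * G) + int G}. f d\<bar> \<le>
        (32 * cl * C1 + 264 + 96 * cl\<^sup>2) * (D * P (- \<gamma>))"
    proof -
      define B where "B = 8 * C1 * (D * P (\<gamma> - \<gamma>1))"
      define E2 where "E2 = 2 * (cl * P \<gamma>) * B + 2 * (64 * (D * P (- 9 * \<gamma>)) + 2 * (D * P (- 6 * \<gamma> - 1))) +
          16 * (cl\<^sup>2 * P \<gamma>) * (P (1 / 2) + 2 * (D * P (- 6 * \<gamma> - 1 / 2)))"
      have each: "\<bar>\<Sum>d\<in>{int U0 + 1 + int (r * G)..<int U0 + 1 + int (r * G) + int G}. f d\<bar> \<le> E2" if r: "r < W" for r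
      proof -
        define u where "u = U0 + r * G"
        have u: "u \<ge> 1" "U0 \<le> u" using U0(3) by (auto simp: u_def)
        have uU: "u + G \<le> U"
        proof -
          have "(r + 1) * G \<le> W * G" using r by (intro mult_right_mono) auto
          thus ?thesis by (simp add: u_def U_def)
        qed
        have iu: "int U0 + 1 + int (r * G) = int u + 1" by (simp add: u_def)
        have u2: "D * P (- \<gamma>) / 2 \<le> real u" using U0(2) u(2) by linarith
        have Bh: "norm (\<Sum>d\<in>{d\<in>{int u + 1..<int u + 1 + int G}. \<not> int q dvd d}. complex_of_int (moebius (nat d)) * ee q (h * invsq q d)) \<le> B"
          if h: "\<not> int q dvd h" for h
        proof -
          let ?t = "\<lambda>d. complex_of_int (moebius (nat d)) * ee q (h * invsq q d)"
          have S: "norm (\<Sum>d\<in>{d\<in>{1..int n}. \<not> int q dvd d}. ?t d) \<le> C1 * (4 * (D * P \<gamma>)) * P (- \<gamma>1)"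
            if n: "u \<le> n" "n \<le> u + G" for n
          \<comment> \<open>The Moebius sum over an interval is a difference of two initial sums,
            each long enough for \<open>MS\<close>: q^\<gamma> \<ge> 4 yields D q^(-\<gamma>) / 2
            \<ge> q^(1/2 + \<eta>).\<close>
          proof -
            have "P (1 / 2 + \<eta>) * 4 \<le> P (1 / 2 + \<eta>) * P \<gamma>" using P4 by (intro mult_left_mono) auto
            also have "\<dots> \<le> D * P (- \<gamma>)" unfolding Padd[symmetric] using \<gamma> by (intro DP) auto
            finally have "P (1 / 2 + \<eta>) \<le> D * P (- \<gamma>) / 2" using Ppos[of "1 / 2 + \<eta>"] by linarith
            hence low: "real q powr (1 / 2 + \<eta>) \<le> real n" using u2 n(1) unfolding P_def Q_def by linarith
            have nU: "real n \<le> 4 * (D * P \<gamma>)" using n(2) uU U1(2) by linarith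
            also have "\<dots> \<le> P \<gamma> * (P (1 / (2 * \<eta>)) * P \<gamma>)" using P4 Dup D0 by (intro mult_mono) auto
            also have "\<dots> \<le> P K" unfolding Padd[symmetric] using \<gamma>20 by (intro Pm) (auto simp: K_def)
            finally have up: "real n \<le> real q powr K" by (simp add: P_def Q_def)
            have "norm (\<Sum>d\<in>{d\<in>{1..int n}. \<not> int q dvd d}. ?t d) \<le> C1 * real n * real q powr - \<gamma>1"
              by (rule MS[OF q q3 h low up])
            also have "\<dots> \<le> C1 * (4 * (D * P \<gamma>)) * P (- \<gamma>1)"
              using C1 nU by (intro mult_mono) (auto simp: P_def Q_def)
            finally show ?thesis .
          qed
          have "(\<Sum>d\<in>{d\<in>{1..int (u + G)}. \<not> int q dvd d}. ?t d) = (\<Sum>d\<in>{d\<in>{1..int u}. \<not> int q dvd d} \<union> {d\<in>{int u + 1..<int u + 1 + int G}. \<not> int q dvd d}. ?t d)"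
            by (rule arg_cong2[where f = sum]) auto
          also have "\<dots> = (\<Sum>d\<in>{d\<in>{1..int u}. \<not> int q dvd d}. ?t d) + (\<Sum>d\<in>{d\<in>{int u + 1..<int u + 1 + int G}. \<not> int q dvd d}. ?t d)"
            by (rule sum.union_disjoint) (auto intro: finite_subset[of _ "{1..int u}"])
          finally have "(\<Sum>d\<in>{d\<in>{int u + 1..<int u + 1 + int G}. \<not> int q dvd d}. ?t d) =
              (\<Sum>d\<in>{d\<in>{1..int (u + G)}. \<not> int q dvd d}. ?t d) - (\<Sum>d\<in>{d\<in>{1..int u}. \<not> int q dvd d}. ?t d)"
            by (simp only: add_diff_cancel_left')
          hence "norm (\<Sum>d\<in>{d\<in>{int u + 1..<int u + 1 + int G}. \<not> int q dvd d}. ?t d) \<le>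
              norm (\<Sum>d\<in>{d\<in>{1..int (u + G)}. \<not> int q dvd d}. ?t d) + norm (\<Sum>d\<in>{d\<in>{1..int u}. \<not> int q dvd d}. ?t d)"
            by (simp only: norm_triangle_ineq4)
          also have "\<dots> \<le> C1 * (4 * (D * P \<gamma>)) * P (- \<gamma>1) + C1 * (4 * (D * P \<gamma>)) * P (- \<gamma>1)"
            by (intro add_mono S) auto
          also have "\<dots> = B" unfolding B_def diff_conv_add_uminus Padd by simp
          finally show ?thesis .
        qed
        define Z where "Z = N div u\<^sup>2 - N div (u + G)\<^sup>2"
        have GZ: "real G * real Z / Q \<le> 64 * (D * P (- 9 * \<gamma>)) + 2 * (D * P (- 6 * \<gamma> - 1))"
        proof -
          have u0: "real u > 0" using u by simp
          have "N div (u + G)\<^sup>2 \<le> N div u\<^sup>2" using u by (intro div_le_mono2 power_mono) auto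
          hence "real Z = real (N div u\<^sup>2) - real (N div (u + G)\<^sup>2)" by (simp add: Z_def of_nat_diff)
          moreover have "real (N div u\<^sup>2) \<le> real N / (real u)\<^sup>2"
            using of_nat_div_le_of_nat[of N "u\<^sup>2", where 'a = real] by simp
          moreover have "real N / (real u + real G)\<^sup>2 - 1 \<le> real (N div (u + G)\<^sup>2)"
            using real_div_minus_1_le[of N "(u + G)\<^sup>2"] by simp
          ultimately have "real Z \<le> real N / (real u)\<^sup>2 - real N / (real u + real G)\<^sup>2 + 1" by linarith
          also have "real N / (real u)\<^sup>2 - real N / (real u + real G)\<^sup>2 \<le> 2 * X * real G / real u ^ 3"
          proof -
            define x y z where "x = real u" and "y = real G" and "z = real u + real G"
            have xy: "x > 0" "y > 0" "z > 0" "z = x + y" "x \<le> z" using u0 G0 by (auto simp: x_def y_def z_def)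
            have "1 / x\<^sup>2 - 1 / z\<^sup>2 = (z\<^sup>2 - x\<^sup>2) / (x\<^sup>2 * z\<^sup>2)"
              using xy(1,3) by (simp add: diff_frac_eq)
            also have "z\<^sup>2 - x\<^sup>2 = y * (z + x)" unfolding xy(4) by (simp add: power2_eq_square algebra_simps)
            also have "y * (z + x) / (x\<^sup>2 * z\<^sup>2) \<le> y * (2 * z) / (x\<^sup>2 * z\<^sup>2)"
              using xy by (intro divide_right_mono mult_left_mono) auto
            also have "\<dots> = 2 * y / (x\<^sup>2 * z)" using xy(3) by (simp add: power2_eq_square mult_ac)
            also have "\<dots> \<le> 2 * y / (x\<^sup>2 * x)"
              using xy by (intro divide_left_mono mult_left_mono) auto
            finally have le: "1 / x\<^sup>2 - 1 / z\<^sup>2 \<le> 2 * y / (x\<^sup>2 * x)" .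
            have "real N / x\<^sup>2 - real N / z\<^sup>2 = real N * (1 / x\<^sup>2 - 1 / z\<^sup>2)" by (simp add: right_diff_distrib)
            also have "\<dots> \<le> real N * (2 * y / (x\<^sup>2 * x))" using le by (intro mult_left_mono) auto
            also have "\<dots> \<le> X * (2 * y / (x\<^sup>2 * x))" using NX xy by (intro mult_right_mono) auto
            also have "\<dots> = 2 * X * y / x ^ 3" by (simp add: power3_eq_cube power2_eq_square)
            finally show ?thesis by (simp only: x_def y_def z_def)
          qed
          finally have Zb: "real Z \<le> 2 * X * real G / real u ^ 3 + 1" by simp
          have "real G * real Z / Q \<le> real G * (2 * X * real G / real u ^ 3 + 1) / Q"
            using Zb Q by (intro divide_right_mono mult_left_mono) auto
          also have "\<dots> = 2 * D\<^sup>2 * (real G)\<^sup>2 / real u ^ 3 + real G / Q"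
            unfolding XD using Q by (simp add: add_divide_distrib distrib_left power2_eq_square)
          also have "\<dots> \<le> 2 * D\<^sup>2 * (2 * (D * P (- 6 * \<gamma>)))\<^sup>2 / (D * P (- \<gamma>) / 2) ^ 3 + 2 * (D * P (- 6 * \<gamma>)) / Q"
            using u2 G G0 D0 Q by (intro add_mono frac_le mult_left_mono power_mono divide_right_mono) auto
          also have "2 * D\<^sup>2 * (2 * (D * P (- 6 * \<gamma>)))\<^sup>2 / (D * P (- \<gamma>) / 2) ^ 3 = 64 * (D * P (- 9 * \<gamma>))"
          proof -
            have p: "P (- 6 * \<gamma>) * P (- 6 * \<gamma>) = P (- 9 * \<gamma>) * (P (- \<gamma>) * P (- \<gamma>) * P (- \<gamma>))"
              unfolding Padd[symmetric] by simp
            have "2 * D\<^sup>2 * (2 * (D * P (- 6 * \<gamma>)))\<^sup>2 = 8 * D ^ 4 * (P (- 6 * \<gamma>) * P (- 6 * \<gamma>))"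
              by (simp add: power2_eq_square power4_eq_xxxx)
            also have "\<dots> = 64 * (D * P (- 9 * \<gamma>)) * (D * P (- \<gamma>) / 2) ^ 3"
              unfolding p by (simp add: power3_eq_cube power4_eq_xxxx)
            finally show ?thesis using D0 by simp
          qed
          also have "2 * (D * P (- 6 * \<gamma>)) / Q = 2 * (D * P (- 6 * \<gamma> - 1))"
          proof -
            have "P (- 6 * \<gamma>) = P (- 6 * \<gamma> - 1) * Q" unfolding P1[symmetric] Padd[symmetric] by simp
            thus ?thesis using Q by simp
          qed
          finally show ?thesis .
        qed
        have GQ: "real G / sqrt Q \<le> 2 * (D * P (- 6 * \<gamma> - 1 / 2))"
        proof -
          have "P (- 6 * \<gamma>) = P (- 6 * \<gamma> - 1 / 2) * P (1 / 2)" unfolding Padd[symmetric] by simp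
          hence "real G \<le> 2 * (D * P (- 6 * \<gamma> - 1 / 2)) * P (1 / 2)" using G(2) by simp
          thus ?thesis unfolding Phalf by (simp add: divide_le_eq)
        qed
        have B0: "B \<ge> 0" using C1 D0 by (simp add: B_def)
        have l\<gamma>: "l \<le> cl * P \<gamma>"
        proof -
          have "cl * P (\<gamma> / 2) \<le> cl * P \<gamma>" using cl \<gamma> by (intro mult_left_mono Pm) auto
          thus ?thesis using l1 by linarith
        qed
        have "\<bar>\<Sum>d\<in>{d\<in>{int u + 1..<int u + 1 + int G}. \<not> int q dvd d}. g d\<bar> \<le>
            2 * (1 + ln (real q)) * B + 2 * (real G * real Z / real q) + 16 * (1 + ln (real q))\<^sup>2 * (sqrt (real q) + real G / sqrt (real q))"
          unfolding g_def Z_def by (rule disc_interval_bound[OF q q3 a u(1) Bh])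
        also have "\<dots> = 2 * l * B + 2 * (real G * real Z / Q) + 16 * l\<^sup>2 * (sqrt Q + real G / sqrt Q)"
          by (simp only: l_def Q_def)
        also have "\<dots> \<le> E2"
          unfolding E2_def
        proof (intro add_mono)
          show "2 * l * B \<le> 2 * (cl * P \<gamma>) * B" using l\<gamma> B0 by (intro mult_right_mono mult_left_mono) auto
          show "2 * (real G * real Z / Q) \<le> 2 * (64 * (D * P (- 9 * \<gamma>)) + 2 * (D * P (- 6 * \<gamma> - 1)))"
            using GZ by (intro mult_left_mono) auto
          show "16 * l\<^sup>2 * (sqrt Q + real G / sqrt Q) \<le> 16 * (cl\<^sup>2 * P \<gamma>) * (P (1 / 2) + 2 * (D * P (- 6 * \<gamma> - 1 / 2)))"
            using l2 GQ Q by (intro mult_mono mult_left_mono add_mono) (auto simp: Phalf)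
        qed
        finally show ?thesis unfolding iu fg[OF finite_atLeastLessThan_int] .
      qed
      have E20: "E2 \<ge> 0" using cl C1 D0 unfolding E2_def B_def by (intro add_nonneg_nonneg mult_nonneg_nonneg) auto
      have "\<bar>\<Sum>r<W. \<Sum>d\<in>{int U0 + 1 + int (r * G)..<int U0 + 1 + int (r * G) + int G}. f d\<bar> \<le> (\<Sum>r<W. E2)"
        by (rule order_trans[OF sum_abs], rule sum_mono, rule each) simp
      also have "\<dots> = real W * E2" by simp
      also have "\<dots> \<le> 2 * P (7 * \<gamma>) * E2" using W2 E20 by (intro mult_right_mono) auto
      also have "\<dots> = 32 * cl * C1 * (D * (P (7 * \<gamma>) * P \<gamma> * P (\<gamma> - \<gamma>1))) +
          256 * (D * (P (7 * \<gamma>) * P (- 9 * \<gamma>))) + 8 * (D * (P (7 * \<gamma>) * P (- 6 * \<gamma> - 1))) +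
          32 * cl\<^sup>2 * (P (7 * \<gamma>) * P \<gamma> * P (1 / 2)) + 64 * cl\<^sup>2 * (D * (P (7 * \<gamma>) * P \<gamma> * P (- 6 * \<gamma> - 1 / 2)))"
        unfolding E2_def B_def by (simp add: algebra_simps)
      also have "\<dots> \<le> 32 * cl * C1 * (D * P (- \<gamma>)) + 256 * (D * P (- \<gamma>)) + 8 * (D * P (- \<gamma>)) +
          32 * cl\<^sup>2 * (D * P (- \<gamma>)) + 64 * cl\<^sup>2 * (D * P (- \<gamma>))"
      proof -
        have h1: "D * (P (7 * \<gamma>) * P \<gamma> * P (\<gamma> - \<gamma>1)) \<le> D * P (- \<gamma>)"
          unfolding Padd[symmetric] using D0 \<gamma> by (intro mult_left_mono Pm) auto
        have h2: "D * (P (7 * \<gamma>) * P (- 9 * \<gamma>)) \<le> D * P (- \<gamma>)"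
          unfolding Padd[symmetric] using D0 \<gamma> by (intro mult_left_mono Pm) auto
        have h3: "D * (P (7 * \<gamma>) * P (- 6 * \<gamma> - 1)) \<le> D * P (- \<gamma>)"
          unfolding Padd[symmetric] using D0 \<gamma>20 by (intro mult_left_mono Pm) auto
        have h4: "P (7 * \<gamma>) * P \<gamma> * P (1 / 2) \<le> D * P (- \<gamma>)"
          unfolding Padd[symmetric] using \<gamma> by (intro DP) auto
        have h5: "D * (P (7 * \<gamma>) * P \<gamma> * P (- 6 * \<gamma> - 1 / 2)) \<le> D * P (- \<gamma>)"
          unfolding Padd[symmetric] using D0 \<gamma>20 by (intro mult_left_mono Pm) auto
        show ?thesis
          by (intro add_mono mult_left_mono h1 h2 h3 h4 h5) (use cl C1 in auto)
      qed
      also have "\<dots> = (32 * cl * C1 + 264 + 96 * cl\<^sup>2) * (D * P (- \<gamma>))" by (simp add: algebra_simps)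
      finally show ?thesis .
    qed
    have part3: "\<bar>\<Sum>i<I. \<Sum>d\<in>{int (U * 2 ^ i)<..2 * int (U * 2 ^ i)}. f d\<bar> \<le>
        (5 + 32 * cl\<^sup>2) * (cl / \<eta>) * (D * P (- (\<gamma> / 2)))"
    proof -
      have each: "\<bar>\<Sum>d\<in>{int (U * 2 ^ i)<..2 * int (U * 2 ^ i)}. f d\<bar> \<le> (5 + 32 * cl\<^sup>2) * (D * P (- \<gamma>))" for i
      proof -
        define T where "T = U * 2 ^ i"
        have "U * 1 \<le> T" unfolding T_def by (intro mult_left_mono) auto
        hence UT: "U \<le> T" by simp
        hence T1: "T \<ge> 1" using Uge1 by simp
        have TD: "D * P \<gamma> \<le> real T" using U1(1) UT by linarith
        define Z where "Z = N div T\<^sup>2"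
        have Zle: "real Z \<le> D\<^sup>2 * Q / (real T)\<^sup>2"
        proof -
          have "real Z \<le> real N / (real T)\<^sup>2"
            unfolding Z_def using of_nat_div_le_of_nat[of N "T\<^sup>2", where 'a = real] by simp
          also have "\<dots> \<le> X / (real T)\<^sup>2" using NX by (intro divide_right_mono) auto
          finally show ?thesis unfolding XD .
        qed
        have TZ: "real T * real Z / Q \<le> D * P (- \<gamma>)"
        proof -
          have "real T * real Z / Q \<le> real T * (D\<^sup>2 * Q / (real T)\<^sup>2) / Q"
            using Zle Q by (intro divide_right_mono mult_left_mono) auto
          also have "\<dots> = D\<^sup>2 / real T" using T1 Q by (simp add: power2_eq_square)
          also have "\<dots> \<le> D\<^sup>2 / (D * P \<gamma>)" using TD D\<gamma> T1 by (intro divide_left_mono) auto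
          also have "\<dots> = D * P (- \<gamma>)"
          proof -
            have "P (- \<gamma>) * P \<gamma> = 1" unfolding Padd[symmetric] using P0 by simp
            hence "D\<^sup>2 = D * P (- \<gamma>) * (D * P \<gamma>)" by (simp add: power2_eq_square)
            thus ?thesis using D\<gamma> by (simp add: field_simps)
          qed
          finally show ?thesis .
        qed
        have "\<bar>\<Sum>d\<in>{d\<in>{int T<..2 * int T}. \<not> int q dvd d}. g d\<bar> \<le> (5 + 32 * cl\<^sup>2) * (D * P (- \<gamma>))"
        \<comment> \<open>The threshold balances the two dyadic bounds: below it T / q^(1/2) \<le>
          D^(1/2) q^\<gamma>, a power of q below D because D \<ge> q^(1/2); above it Z \<le> D^2 q /
          T^2 \<le> D q^(-2 \<gamma>).\<close>
        proof (cases "real T \<le> P (1 / 2) * sqrt D * P \<gamma>")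
          case True
          have "\<bar>\<Sum>d\<in>{d\<in>{int T<..2 * int T}. \<not> int q dvd d}. g d\<bar> \<le>
              2 * (real T * real Z / real q) + 16 * (1 + ln (real q))\<^sup>2 * (sqrt (real q) + real T / sqrt (real q))"
            unfolding g_def Z_def by (rule disc_dyadic_bound(1)[OF q q3 a T1])
          also have "\<dots> = 2 * (real T * real Z / Q) + 16 * l\<^sup>2 * (P (1 / 2) + real T / P (1 / 2))"
            by (simp only: l_def Q_def[symmetric] Phalf)
          also have "\<dots> \<le> 2 * (D * P (- \<gamma>)) + 16 * (cl\<^sup>2 * P \<gamma>) * (P (1 / 2) + D * P (\<gamma> - 1 / 4))"
          proof (intro add_mono mult_mono mult_left_mono TZ l2)
            have "real T / P (1 / 2) \<le> sqrt D * P \<gamma>" using True by (simp add: divide_le_eq mult_ac)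
            also have "\<dots> \<le> (D * P (- (1 / 4))) * P \<gamma>"
            proof (rule mult_right_mono)
              have "P (1 / 4) \<le> sqrt D"
              proof (rule real_le_rsqrt)
                have "(P (1 / 4))\<^sup>2 = P (1 / 2)" unfolding power2_eq_square Padd[symmetric] by simp
                also have "\<dots> \<le> P (1 / 2 + 2 * \<eta>)" using \<eta> by (intro Pm) auto
                finally show "(P (1 / 4))\<^sup>2 \<le> D" using Dlow by linarith
              qed
              hence "P (1 / 4) * sqrt D \<le> sqrt D * sqrt D" using D0 by (intro mult_right_mono) auto
              hence "P (- (1 / 4)) * (P (1 / 4) * sqrt D) \<le> P (- (1 / 4)) * D" using D0 by (intro mult_left_mono) auto
              moreover have "P (- (1 / 4)) * P (1 / 4) = 1" unfolding Padd[symmetric] using P0 by simp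
              hence "P (- (1 / 4)) * (P (1 / 4) * sqrt D) = sqrt D" unfolding mult.assoc[symmetric] by simp
              ultimately show "sqrt D \<le> D * P (- (1 / 4))" using D0 by (simp only: mult.commute[of _ D])
            qed simp
            also have "\<dots> = D * P (\<gamma> - 1 / 4)" unfolding diff_conv_add_uminus Padd by simp
            finally show "real T / P (1 / 2) \<le> D * P (\<gamma> - 1 / 4)" .
          qed (use D0 Q in auto)
          also have "\<dots> = 2 * (D * P (- \<gamma>)) + 16 * cl\<^sup>2 * (P \<gamma> * P (1 / 2)) + 16 * cl\<^sup>2 * (D * (P \<gamma> * P (\<gamma> - 1 / 4)))"
            by (simp add: algebra_simps)
          also have "\<dots> \<le> 2 * (D * P (- \<gamma>)) + 16 * cl\<^sup>2 * (D * P (- \<gamma>)) + 16 * cl\<^sup>2 * (D * P (- \<gamma>))"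
          proof -
            have h1: "P \<gamma> * P (1 / 2) \<le> D * P (- \<gamma>)"
              unfolding Padd[symmetric] using \<gamma> by (intro DP) auto
            have h2: "D * (P \<gamma> * P (\<gamma> - 1 / 4)) \<le> D * P (- \<gamma>)"
              unfolding Padd[symmetric] using D0 \<gamma>20 by (intro mult_left_mono Pm) auto
            show ?thesis by (intro add_mono mult_left_mono h1 h2 order_refl) auto
          qed
          also have "\<dots> = (2 + 32 * cl\<^sup>2) * (D * P (- \<gamma>))" by (simp add: algebra_simps)
          also have "\<dots> \<le> (5 + 32 * cl\<^sup>2) * (D * P (- \<gamma>))" using D0 by (intro mult_right_mono) auto
          finally show ?thesis .
        next
          case False
          have "\<bar>\<Sum>d\<in>{d\<in>{int T<..2 * int T}. \<not> int q dvd d}. g d\<bar> \<le> 3 * (real T * real Z / real q) + 2 * real Z"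
            unfolding g_def Z_def by (rule disc_dyadic_bound(2)[OF q q3 a T1])
          also have "\<dots> = 3 * (real T * real Z / Q) + 2 * real Z" by (simp only: Q_def)
          also have "\<dots> \<le> 3 * (D * P (- \<gamma>)) + 2 * (D * P (- \<gamma>))"
          proof (intro add_mono mult_left_mono TZ)
            have "(P (1 / 2) * sqrt D * P \<gamma>)\<^sup>2 \<le> (real T)\<^sup>2" using False D0 by (intro power_mono) auto
            moreover have "(P (1 / 2) * sqrt D * P \<gamma>)\<^sup>2 = Q * D * P (2 * \<gamma>)"
            proof -
              have "P (1 / 2) * P (1 / 2) = Q" "P \<gamma> * P \<gamma> = P (2 * \<gamma>)" unfolding Padd[symmetric] using P1 by simp_all
              thus ?thesis using D0 by (simp add: power_mult_distrib power2_eq_square[of "P _"])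
            qed
            ultimately have T2: "Q * D * P (2 * \<gamma>) \<le> (real T)\<^sup>2" by simp
            have "real Z \<le> D\<^sup>2 * Q / (real T)\<^sup>2" by (rule Zle)
            also have "\<dots> \<le> D\<^sup>2 * Q / (Q * D * P (2 * \<gamma>))" using T2 Q D0 T1 by (intro divide_left_mono) auto
            also have "\<dots> = D * P (- 2 * \<gamma>)"
            proof -
              have "P (- 2 * \<gamma>) * P (2 * \<gamma>) = 1" unfolding Padd[symmetric] using P0 by simp
              hence "D\<^sup>2 * Q = D * P (- 2 * \<gamma>) * (Q * D * P (2 * \<gamma>))" by (simp add: power2_eq_square)
              thus ?thesis using Q D0 by simp
            qed
            also have "\<dots> \<le> D * P (- \<gamma>)" using D0 \<gamma> by (intro mult_left_mono Pm) auto
            finally show "real Z \<le> D * P (- \<gamma>)" .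
          qed auto
          also have "\<dots> = 5 * (D * P (- \<gamma>))" by simp
          also have "\<dots> \<le> (5 + 32 * cl\<^sup>2) * (D * P (- \<gamma>))" using D0 by (intro mult_right_mono) auto
          finally show ?thesis .
        qed
        thus ?thesis unfolding T_def[symmetric] fg[OF finite_greaterThanAtMost_int] .
      qed
      have "\<bar>\<Sum>i<I. \<Sum>d\<in>{int (U * 2 ^ i)<..2 * int (U * 2 ^ i)}. f d\<bar> \<le> (\<Sum>i<I. (5 + 32 * cl\<^sup>2) * (D * P (- \<gamma>)))"
        by (rule order_trans[OF sum_abs], rule sum_mono, rule each)
      also have "\<dots> = real I * ((5 + 32 * cl\<^sup>2) * (D * P (- \<gamma>)))" by simp
      also have "\<dots> \<le> ((cl / \<eta>) * P (\<gamma> / 2)) * ((5 + 32 * cl\<^sup>2) * (D * P (- \<gamma>)))"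
        using D0 by (intro mult_right_mono I2) auto
      also have "\<dots> = (5 + 32 * cl\<^sup>2) * (cl / \<eta>) * (D * (P (\<gamma> / 2) * P (- \<gamma>)))" by simp
      also have "P (\<gamma> / 2) * P (- \<gamma>) = P (- (\<gamma> / 2))" unfolding Padd[symmetric] by simp
      finally show ?thesis .
    qed
    have P\<gamma>: "D * P (- \<gamma>) \<le> D * P (- (\<gamma> / 2))" using D0 \<gamma> by (intro mult_left_mono Pm) auto
    define Y where "Y = D * P (- (\<gamma> / 2))"
    have c2: "(32 * cl * C1 + 264 + 96 * cl\<^sup>2) * (D * P (- \<gamma>)) \<le> (32 * cl * C1 + 264 + 96 * cl\<^sup>2) * Y"
      unfolding Y_def by (rule mult_left_mono[OF P\<gamma>]) (use cl C1 in auto)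
    have "\<bar>squarefree_error X q a\<bar> \<le> 2 * Y + Y + (32 * cl * C1 + 264 + 96 * cl\<^sup>2) * Y + (5 + 32 * cl\<^sup>2) * (cl / \<eta>) * Y"
      using red part1 part2 part3 c2 P\<gamma> unfolding decomp Y_def[symmetric] by linarith
    also have "\<dots> = C * Y" unfolding C_def by (simp only: distrib_right mult_1_left)
    finally show "\<bar>squarefree_error X q a\<bar> \<le> C * sqrt (X / real q) * real q powr - (\<gamma> / 2)"
      by (simp add: Y_def D_def P_def Q_def mult.assoc)
  qed
qed

theorem theorem3:
  shows "\<forall>\<eta>::real. 0 < \<eta> \<and> \<eta> < 1 / 4 \<longrightarrow>
    (\<exists>\<delta>>0. \<exists>C>0. \<forall>(X::real) (q::nat) (a::int).
       X > 1 \<and> prime q \<and> X powr \<eta> \<le> real q \<and> real q \<le> X powr (1 / 2 - \<eta>) \<and> coprime a (int q) \<longrightarrow>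
       \<bar>squarefree_error X q a\<bar> \<le> C * (X / real q) powr (1 / 2 - \<delta>))"
proof (intro allI impI, elim conjE)
  fix \<eta> :: real assume \<eta>: "0 < \<eta>" "\<eta> < 1 / 4"
  obtain \<gamma> C0 q0 where \<gamma>: "\<gamma> > 0" and C0: "C0 > 0" and main: "\<And>X q a. X > 1 \<Longrightarrow> prime q \<Longrightarrow> q0 \<le> real q \<Longrightarrow>
      X powr \<eta> \<le> real q \<Longrightarrow> real q powr (2 + 4 * \<eta>) \<le> X \<Longrightarrow> coprime a (int q) \<Longrightarrow>
      \<bar>squarefree_error X q a\<bar> \<le> C0 * sqrt (X / real q) * real q powr - \<gamma>"
    using squarefree_error_saving[OF \<eta>] by blast
  \<comment> \<open>From q \<ge> X^\<eta> \<ge> (X/q)^\<eta> a saving q^(-\<gamma>) is at least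
    (X/q)^(-\<eta> \<gamma>). The cap 1 / 2 keeps the final exponent nonnegative, which the case of
    bounded q needs.\<close>
  define \<delta> where "\<delta> = min (\<eta> * \<gamma>) (1 / 2)"
  \<comment> \<open>The second summand bounds X itself when q < q0, because X^\<eta> \<le> q; there
    the trivial bound \<open>X\<close> for E is enough.\<close>
  define C where "C = C0 + \<bar>q0\<bar> powr (1 / \<eta>)"
  have \<delta>: "\<delta> > 0" "\<delta> \<le> \<eta> * \<gamma>" "\<delta> \<le> 1 / 2" using \<eta> \<gamma> by (auto simp: \<delta>_def)
  have C: "C > 0" using C0 by (simp add: C_def add_pos_nonneg)
  show "\<exists>\<delta>>0. \<exists>C>0. \<forall>(X::real) (q::nat) (a::int).
       X > 1 \<and> prime q \<and> X powr \<eta> \<le> real q \<and> real q \<le> X powr (1 / 2 - \<eta>) \<and> coprime a (int q) \<longrightarrow>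
       \<bar>squarefree_error X q a\<bar> \<le> C * (X / real q) powr (1 / 2 - \<delta>)"
  proof (rule exI[of _ \<delta>], rule conjI[OF \<delta>(1)], rule exI[of _ C], rule conjI[OF C], intro allI impI, elim conjE)
    fix X :: real and q :: nat and a :: int
    assume X: "X > 1" and q: "prime q" and low: "X powr \<eta> \<le> real q" and up: "real q \<le> X powr (1 / 2 - \<eta>)"
      and a: "coprime a (int q)"
    have q1: "real q > 1" using q prime_gt_1_nat by simp
    \<comment> \<open>Since (1/2 - \<eta>) (2 + 4 \<eta>) = 1 - 4 \<eta>^2 \<le> 1, the upper bound
      on q implies the form used above.\<close>
    have Xq: "real q powr (2 + 4 * \<eta>) \<le> X"
    proof -
      have "real q powr (2 + 4 * \<eta>) \<le> (X powr (1 / 2 - \<eta>)) powr (2 + 4 * \<eta>)"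
        using up \<eta> q1 by (intro powr_mono2) auto
      also have "\<dots> = X powr ((1 / 2 - \<eta>) * (2 + 4 * \<eta>))" by (rule powr_powr)
      also have "\<dots> \<le> X powr 1"
      proof (rule powr_mono)
        have "(1 / 2 - \<eta>) * (2 + 4 * \<eta>) = 1 - 4 * \<eta>\<^sup>2" by (simp add: algebra_simps power2_eq_square)
        thus "(1 / 2 - \<eta>) * (2 + 4 * \<eta>) \<le> 1" by simp
      qed (use X in auto)
      finally show ?thesis using X by simp
    qed
    have ratio: "1 \<le> X / real q"
    proof -
      have "real q powr 1 \<le> real q powr (2 + 4 * \<eta>)" using q1 \<eta> by (intro powr_mono) auto
      thus ?thesis using Xq q1 by (simp add: le_divide_eq)
    qed
    define r where "r = X / real q"
    have r1: "r \<ge> 1" using ratio by (simp add: r_def)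
    have "\<bar>squarefree_error X q a\<bar> \<le> C * r powr (1 / 2 - \<delta>)"
    proof (cases "q0 \<le> real q")
      case True
      have "r \<le> X / 1" unfolding r_def using X q1 by (intro divide_left_mono) auto
      hence "r powr \<eta> \<le> X powr \<eta>" using r1 \<eta> by (intro powr_mono2) auto
      hence "r powr \<eta> \<le> real q" using low by linarith
      hence "real q powr - \<gamma> \<le> (r powr \<eta>) powr - \<gamma>"
        using r1 \<gamma> by (intro powr_mono2') auto
      also have "\<dots> = r powr (- (\<eta> * \<gamma>))" by (simp add: powr_powr)
      also have "\<dots> \<le> r powr - \<delta>" using r1 \<delta> by (intro powr_mono) auto
      finally have q\<delta>: "real q powr - \<gamma> \<le> r powr - \<delta>" .
      have "\<bar>squarefree_error X q a\<bar> \<le> C0 * sqrt r * real q powr - \<gamma>"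
        unfolding r_def by (rule main[OF X q True low Xq a])
      also have "\<dots> \<le> C0 * sqrt r * r powr - \<delta>" using q\<delta> C0 r1 by (intro mult_left_mono) auto
      also have "\<dots> = C0 * r powr (1 / 2 - \<delta>)"
        using r1 unfolding diff_conv_add_uminus powr_add by (simp add: powr_half_sqrt)
      also have "\<dots> \<le> C * r powr (1 / 2 - \<delta>)" by (intro mult_right_mono) (auto simp: C_def)
      finally show ?thesis .
    next
      case False
      have "X = (X powr \<eta>) powr (1 / \<eta>)" using X \<eta> by (simp add: powr_powr)
      also have "\<dots> \<le> \<bar>q0\<bar> powr (1 / \<eta>)" using low False \<eta> by (intro powr_mono2) auto
      also have "\<dots> \<le> C" using C0 by (simp add: C_def)
      finally have "X \<le> C" .
      have "\<bar>squarefree_error X q a\<bar> \<le> C * 1" using squarefree_error_trivial[OF X, of q a] \<open>X \<le> C\<close> by simp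
      also have "\<dots> \<le> C * r powr (1 / 2 - \<delta>)" using C r1 \<delta> by (intro mult_left_mono ge_one_powr_ge_zero) auto
      finally show ?thesis .
    qed
    thus "\<bar>squarefree_error X q a\<bar> \<le> C * (X / real q) powr (1 / 2 - \<delta>)" by (simp only: r_def)
  qed
qed

end
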